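(* Let $\mathfrak g$ be a simple Lie algebra over $\mathbb C$, let $f\in\mathfrak g$ be nilpotent and let $\{e,h,f\}$ be an $sl_2$-triple containing $f$. Then the classical $W$-algebra associated to the nilpotent orbit of $f$ is independent of the choice of a good grading and of an isotropic subspace: for every good grading $\Gamma$ for $f$ compatible with $\{e,h,f\}$ and every isotropic subspace $\mathfrak l\subset\mathfrak g_{-1}$, the reduced second Poisson bracket $\{.,.\}_2^Q$ on $Q=e+\mathfrak L(\mathfrak g_f)$ constructed from $(\Gamma,\mathfrak l)$ is this classical $W$-algebra. Moreover it can be calculated equally by using (i) the Drinfeld-Sokolov method, (ii) the Poisson tensor procedure, or (iii) the Dirac formula. (The three methods are described in the context.)
   Context: **Algebra.** A good grading for $f$ is a $\mathbb Z$-grading $\mathfrak g=\oplus_{i}\mathfrak g_i$, $[\mathfrak g_i,\mathfrak g_j]\subset\mathfrak g_{i+j}$, with $f\in\mathfrak g_{-2}$ and $\mathrm{ad}\,f:\mathfrak g_j\to\mathfrak g_{j-2}$ injective for $j\ge1$ and surjective for $j\le1$. The $sl_2$-triple satisfies $[h,e]=2e$, $[h,f]=-2f$, $[e,f]=h$; it is compatible with the grading if $h\in\mathfrak g_0$, $e\in\mathfrak g_2$. The Dynkin grading is the grading by eigenvalues of $\mathrm{ad}\,h$. $\langle\cdot|\cdot\rangle$ is the Killing form. On $\mathfrak g_{-1}$ one has the symplectic form $(x,y)=\langle e|[x,y]\rangle$; $\mathfrak l\subset\mathfrak g_{-1}$ is isotropic, $\mathfrak l'$ is its symplectic complement, $\mathfrak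 m=\mathfrak l\oplus\bigoplus_{i\le-2}\mathfrak g_i$, $\mathfrak n=\mathfrak l'\oplus\bigoplus_{i\le-2}\mathfrak g_i$, $\mathfrak b$ is the orthogonal complement of $\mathfrak n$ under the Killing form, $\mathfrak g_f=\ker\mathrm{ad}\,f$. **Loop algebra and reduction.** $\mathfrak L(V)$ is the space of smooth maps from the circle $S^1$ to $V$; $(u|v)=\int_{S^1}\langle u(x)|v(x)\rangle dx$ is used to identify $\mathfrak L(\mathfrak g)$ with its dual. $\{.,.\}_2$ is the Poisson bracket on $\mathfrak L(\mathfrak g)$ with Poisson tensor $P_2(q)(v)=[\partial_x+q,v]=v_x+[q,v]$. Put $S=e+\mathfrak L(\mathfrak b)$, let $D=P_2(\mathfrak L(\mathfrak n))$ and let $E=D\cap\mathfrak L(\mathfrak b)$ be the distribution induced on $S$. Let $\mathcal M$ be the adjoint group of $\mathfrak L(\mathfrak m)$, acting on $S$ by $s+e\mapsto\exp(-\mathrm{ad}\,m)[\partial_x+s+e]-\partial_x$ with $m\in\mathfrak L(\mathfrak m)$, $s\in\mathfrak L(\mathfrak b)$; the leaves of $E$ on $S$ are its orbits. The Slodowy slice $Q=e+\mathfrak L(\mathfrak g_f)\subset S$ is transverse to $E$ and meets every orbit exactly once, so $Q\cong S/\mathcal M$. The reduced second bracket is $\{\phi,\psi\}_2^Q=\{F,G\}_2$ (evaluated on $Q$), where $F,G$ are functionals on $\mathfrak L(\mathfrak g)$ which extend $\phi,\psi$ and are constant along $D$. **The classical $W$-algebra associated to the orbit of $f$** is the bracket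 $\{.,.\}_2^Q$; when $\Gamma$ is the Dynkin grading and $\mathfrak l$ is Lagrangian it is known to be a classical $W$-algebra, i.e. a local Poisson bracket having local coordinates $u^1,\dots,u^m$ in which $u^1$ is a Virasoro density, $\{u^1(x),u^1(y)\}=\epsilon\,\delta'''(x-y)+2u^1(x)\delta'(x-y)+u^1_x\delta(x-y)$, and the $u^i$, $i>1$, are primary fields of conformal weights $\eta_i$, $\{u^1(x),u^i(y)\}=(\eta_i+1)u^i(x)\delta'(x-y)+\eta_i u^i_x\delta(x-y)$. Conjugate nilpotent elements give the same algebra. **Methods** (repeated indices are summed). (i) Drinfeld-Sokolov method: write the coordinates of $Q$ as differential polynomials in the coordinates $s^i(x)$ of $S$ by means of the equation $q(x)+e=\exp(-\mathrm{ad}\,m(x))[\partial_x+s(x)+e]-\partial_x$, where $m\in\mathfrak L(\mathfrak m)$ is the unique element for which the right-hand side lies in $Q$ (the entries of $q(x)$ then generate the ring $R$ of differential polynomials on $S$ invariant under $\mathcal M$), and then apply the Leibniz rule, which for $u,v\in R$ reads $\{u(x),v(y)\}_2=\frac{\partial u(x)}{\partial(\partial^a s^i)}\partial_x^a\Big(\frac{\partial v(y)}{\partial(\partial^b s^j)}\partial_y^b\big(\{s^i(x),s^j(y)\}_2\big)\Big)$. (ii) Poisson tensor procedure: for $z\in Q$ and $w\in T_z^*Q$, find $v\in T^*_z\mathfrak L(\mathfrak g)$ extending $w$ (i.e. $v|_{T_zQ}=w$) with $P_2(z)(v)\in T_zQ$; then the reduced Poisson tensor is $P_2^Q(w)=P_2(v)$.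 (iii) Dirac formula: choose a homogeneous basis $\xi_1,\dots,\xi_n$ of $\mathfrak g$ with $\xi_1,\dots,\xi_m$ a basis of $\mathfrak g_f$, dual basis $\xi^i$ with respect to the Killing form, coordinates $q^i(z)=\langle z-e|\xi^i\rangle$ on $\mathfrak L(\mathfrak g)$, and write $\{q^I(x),q^J(y)\}_2=\mathbb F^{IJ}\delta(x-y)$ with $\mathbb F^{IJ}$ a matrix differential operator. The slice $Q$ is $q^\alpha=0$, $\alpha=m+1,\dots,n$. The Dirac formula is $\{q^i(x),q^j(y)\}_2^Q=(\mathbb F^{ij}-\mathbb F^{i\alpha}\mathbb S_{\alpha\beta}\mathbb F^{\beta j})\delta(x-y)$ for $i,j\le m$, where $\mathbb S_{\alpha\beta}$ is the inverse (a matrix differential operator of finite order) of the minor $\mathbb F^{\alpha\beta}$, $\alpha,\beta>m$, restricted to $Q$.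
   Formalization: In (i), the Leibniz rule in the coordinates of S alone is asserted only for Lagrangian l; for other isotropic l, where it fails (e.g. sl_3, minimal f, l=0), it is applied to differential-polynomial extensions of the invariants that are constant along D, whose existence is also proved. *)

theory Defs
  imports "HOL-Analysis.Analysis"
begin

text \<open>
  A finite-dimensional complex Lie algebra is given by a bracket on \<^typ>\<open>complex^'n\<close>, the
  dimension being \<open>CARD('n)\<close>; complex subspaces and complex linear maps are those of the
  vector space structure \<open>(*s)\<close>.
\<close>

type_synonym 'n vec = "complex ^ 'n"
type_synonym 'n bracket = "'n vec \<Rightarrow> 'n vec \<Rightarrow> 'n vec"
type_synonym 'n grading = "int \<Rightarrow> 'n vec set"
type_synonym 'n loop = "real \<Rightarrow> 'n vec"
type_synonym 'n functional = "'n loop \<Rightarrow> complex"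
type_synonym 'n functional_bracket = "'n functional \<Rightarrow> 'n functional \<Rightarrow> 'n functional"


section \<open>Lie algebras, gradings and the subspaces attached to them\<close>

definition lie_algebra :: "'n::finite bracket \<Rightarrow> bool" where
  "lie_algebra br \<longleftrightarrow>
     (\<forall>x. Vector_Spaces.linear (*s) (*s) (\<lambda>y. br x y)) \<and>
     (\<forall>y. Vector_Spaces.linear (*s) (*s) (\<lambda>x. br x y)) \<and>
     (\<forall>x. br x x = 0) \<and>
     (\<forall>x y z. br x (br y z) + br y (br z x) + br z (br x y) = 0)"

definition lie_ideal :: "'n::finite bracket \<Rightarrow> 'n vec set \<Rightarrow> bool" where
  "lie_ideal br I \<longleftrightarrow> vec.subspace I \<and> (\<forall>x. \<forall>y\<in>I. br x y \<in> I)"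

definition simple_lie_algebra :: "'n::finite bracket \<Rightarrow> bool" where
  "simple_lie_algebra br \<longleftrightarrow>
     lie_algebra br \<and> (\<exists>x y. br x y \<noteq> 0) \<and> (\<forall>I. lie_ideal br I \<longrightarrow> I = {0} \<or> I = UNIV)"

definition killing :: "'n::finite bracket \<Rightarrow> 'n vec \<Rightarrow> 'n vec \<Rightarrow> complex" where
  "killing br x y = trace (matrix (\<lambda>z. br x (br y z)))"

definition ad_nilpotent :: "'n::finite bracket \<Rightarrow> 'n vec \<Rightarrow> bool" where
  "ad_nilpotent br x \<longleftrightarrow> (\<exists>k. \<forall>y. (br x ^^ k) y = 0)"

definition sl2_triple :: "'n::finite bracket \<Rightarrow> 'n vec \<Rightarrow> 'n vec \<Rightarrow> 'n vec \<Rightarrow> bool" where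
  "sl2_triple br e h f \<longleftrightarrow> br h e = 2 *s e \<and> br h f = (- 2) *s f \<and> br e f = h"

definition lie_grading :: "'n::finite bracket \<Rightarrow> 'n grading \<Rightarrow> bool" where
  "lie_grading br \<Gamma> \<longleftrightarrow>
     (\<forall>i. vec.subspace (\<Gamma> i)) \<and>
     (\<forall>x. \<exists>!c. (\<forall>i. c i \<in> \<Gamma> i) \<and> finite {i. c i \<noteq> 0} \<and> x = (\<Sum>i | c i \<noteq> 0. c i)) \<and>
     (\<forall>i j. \<forall>x\<in>\<Gamma> i. \<forall>y\<in>\<Gamma> j. br x y \<in> \<Gamma> (i + j))"

definition good_grading :: "'n::finite bracket \<Rightarrow> 'n vec \<Rightarrow> 'n grading \<Rightarrow> bool" where
  "good_grading br f \<Gamma> \<longleftrightarrow>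
     lie_grading br \<Gamma> \<and> f \<in> \<Gamma> (- 2) \<and>
     (\<forall>j\<ge>1. inj_on (br f) (\<Gamma> j)) \<and>
     (\<forall>j\<le>1. br f ` \<Gamma> j = \<Gamma> (j - 2))"

definition compatible_grading :: "'n::finite vec \<Rightarrow> 'n vec \<Rightarrow> 'n grading \<Rightarrow> bool" where
  "compatible_grading e h \<Gamma> \<longleftrightarrow> h \<in> \<Gamma> 0 \<and> e \<in> \<Gamma> 2"

definition dynkin_grading :: "'n::finite bracket \<Rightarrow> 'n vec \<Rightarrow> 'n grading" where
  "dynkin_grading br h i = {x. br h x = of_int i *s x}"

definition isotropic ::
    "'n::finite bracket \<Rightarrow> 'n vec \<Rightarrow> 'n grading \<Rightarrow> 'n vec set \<Rightarrow> bool" where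
  "isotropic br e \<Gamma> l \<longleftrightarrow>
     vec.subspace l \<and> l \<subseteq> \<Gamma> (- 1) \<and> (\<forall>x\<in>l. \<forall>y\<in>l. killing br e (br x y) = 0)"

definition symplectic_complement ::
    "'n::finite bracket \<Rightarrow> 'n vec \<Rightarrow> 'n grading \<Rightarrow> 'n vec set \<Rightarrow> 'n vec set" where
  "symplectic_complement br e \<Gamma> l = {x \<in> \<Gamma> (- 1). \<forall>y\<in>l. killing br e (br x y) = 0}"

definition lagrangian ::
    "'n::finite bracket \<Rightarrow> 'n vec \<Rightarrow> 'n grading \<Rightarrow> 'n vec set \<Rightarrow> bool" where
  "lagrangian br e \<Gamma> l \<longleftrightarrow> isotropic br e \<Gamma> l \<and> symplectic_complement br e \<Gamma> l = l"

definition m_space :: "'n::finite grading \<Rightarrow> 'n vec set \<Rightarrow> 'n vec set" where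
  "m_space \<Gamma> l = vec.span (l \<union> (\<Union>i\<in>{..- 2}. \<Gamma> i))"

definition n_space ::
    "'n::finite bracket \<Rightarrow> 'n vec \<Rightarrow> 'n grading \<Rightarrow> 'n vec set \<Rightarrow> 'n vec set" where
  "n_space br e \<Gamma> l = vec.span (symplectic_complement br e \<Gamma> l \<union> (\<Union>i\<in>{..- 2}. \<Gamma> i))"

definition b_space ::
    "'n::finite bracket \<Rightarrow> 'n vec \<Rightarrow> 'n grading \<Rightarrow> 'n vec set \<Rightarrow> 'n vec set" where
  "b_space br e \<Gamma> l = {x. \<forall>y\<in>n_space br e \<Gamma> l. killing br x y = 0}"

definition ker_ad :: "'n::finite bracket \<Rightarrow> 'n vec \<Rightarrow> 'n vec set" where
  "ker_ad br f = {x. br f x = 0}"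


section \<open>Loops\<close>

text \<open>The circle is \<open>\<real>/\<int>\<close>: loops are smooth maps on \<open>\<real>\<close> of period 1.\<close>

definition nderiv :: "nat \<Rightarrow> (real \<Rightarrow> 'v::real_normed_vector) \<Rightarrow> real \<Rightarrow> 'v" where
  "nderiv k u = ((\<lambda>w x. vector_derivative w (at x)) ^^ k) u"

definition loops :: "'v::real_normed_vector set \<Rightarrow> (real \<Rightarrow> 'v) set" where
  "loops V = {u. (\<forall>k x. nderiv k u differentiable (at x)) \<and> (\<forall>x. u (x + 1) = u x) \<and> (\<forall>x. u x \<in> V)}"

abbreviation test_functions :: "(real \<Rightarrow> complex) set" where
  "test_functions \<equiv> loops UNIV"

definition affine_loops :: "'n::finite vec \<Rightarrow> 'n vec set \<Rightarrow> 'n loop set" where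
  "affine_loops e V = {\<lambda>x. e + u x | u. u \<in> loops V}"

definition S_space ::
    "'n::finite bracket \<Rightarrow> 'n vec \<Rightarrow> 'n grading \<Rightarrow> 'n vec set \<Rightarrow> 'n loop set" where
  "S_space br e \<Gamma> l = affine_loops e (b_space br e \<Gamma> l)"

definition Q_space :: "'n::finite bracket \<Rightarrow> 'n vec \<Rightarrow> 'n vec \<Rightarrow> 'n loop set" where
  "Q_space br e f = affine_loops e (ker_ad br f)"

definition pairing :: "'n::finite bracket \<Rightarrow> 'n loop \<Rightarrow> 'n loop \<Rightarrow> complex" where
  "pairing br u v = integral {0..1} (\<lambda>x. killing br (u x) (v x))"

definition P2 :: "'n::finite bracket \<Rightarrow> 'n loop \<Rightarrow> 'n loop \<Rightarrow> 'n loop" where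
  "P2 br q v = (\<lambda>x. vector_derivative v (at x) + br (q x) (v x))"


section \<open>Local functionals and the second bracket\<close>

text \<open>
  A jet is a sequence \<open>(q, q', q'', \<dots>)\<close>. Differential polynomials are the polynomial functions of
  finitely many jet coordinates. Densities of local functionals may also depend on the loop
  parameter; thus \<open>\<integral> \<alpha>(x) u(q(x), q'(x), \<dots>) dx\<close> is a local functional for every test function \<open>\<alpha>\<close>
  and every differential polynomial \<open>u\<close>.
\<close>

definition jet :: "'n::finite loop \<Rightarrow> real \<Rightarrow> nat \<Rightarrow> 'n vec" where
  "jet q x = (\<lambda>k. nderiv k q x)"

inductive_set diff_poly :: "((nat \<Rightarrow> 'n::finite vec) \<Rightarrow> complex) set" where
  const: "(\<lambda>_. c) \<in> diff_poly"
| coord: "(\<lambda>j. j k $ i) \<in> diff_poly"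
| add: "p \<in> diff_poly \<Longrightarrow> p' \<in> diff_poly \<Longrightarrow> (\<lambda>j. p j + p' j) \<in> diff_poly"
| mult: "p \<in> diff_poly \<Longrightarrow> p' \<in> diff_poly \<Longrightarrow> (\<lambda>j. p j * p' j) \<in> diff_poly"

inductive_set densities :: "(real \<Rightarrow> (nat \<Rightarrow> 'n::finite vec) \<Rightarrow> complex) set" where
  coeff: "a \<in> test_functions \<Longrightarrow> (\<lambda>x _. a x) \<in> densities"
| coord: "(\<lambda>_ j. j k $ i) \<in> densities"
| add: "p \<in> densities \<Longrightarrow> p' \<in> densities \<Longrightarrow> (\<lambda>x j. p x j + p' x j) \<in> densities"
| mult: "p \<in> densities \<Longrightarrow> p' \<in> densities \<Longrightarrow> (\<lambda>x j. p x j * p' x j) \<in> densities"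

definition local_functionals :: "'n::finite functional set" where
  "local_functionals = {F. \<exists>p\<in>densities. F = (\<lambda>q. integral {0..1} (\<lambda>x. p x (jet q x)))}"

text \<open>
  The differential at \<open>q\<close> along the directions in \<open>loops V\<close>, as a covector represented by a loop
  through the pairing. For \<open>V = UNIV\<close> the representative is the gradient and is unique.
\<close>

definition has_differential ::
    "'n::finite bracket \<Rightarrow> 'n vec set \<Rightarrow> 'n functional \<Rightarrow> 'n loop \<Rightarrow> 'n loop \<Rightarrow> bool" where
  "has_differential br V F q v \<longleftrightarrow>
     v \<in> loops UNIV \<and>
     (\<forall>w\<in>loops V. ((\<lambda>t. F (\<lambda>x. q x + t *\<^sub>R w x)) has_vector_derivative pairing br v w) (at 0))"

definition gradient :: "'n::finite bracket \<Rightarrow> 'n functional \<Rightarrow> 'n loop \<Rightarrow> 'n loop" where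
  "gradient br F q = (THE v. has_differential br UNIV F q v)"

definition bracket2 :: "'n::finite bracket \<Rightarrow> 'n functional_bracket" where
  "bracket2 br F G q = pairing br (gradient br F q) (P2 br q (gradient br G q))"


section \<open>The reduced bracket\<close>

definition local_functionals_on ::
    "'n::finite loop set \<Rightarrow> 'n functional set" where
  "local_functionals_on X = {\<phi>. \<exists>F\<in>local_functionals. \<forall>z\<in>X. \<phi> z = F z}"

text \<open>\<open>D = P2 (loops n)\<close> is a distribution along \<open>S\<close> in the whole loop algebra.\<close>

definition constant_along_D ::
    "'n::finite bracket \<Rightarrow> 'n vec \<Rightarrow> 'n grading \<Rightarrow> 'n vec set \<Rightarrow> 'n functional \<Rightarrow> bool" where
  "constant_along_D br e \<Gamma> l F \<longleftrightarrow>
     (\<forall>s\<in>S_space br e \<Gamma> l. \<forall>v\<in>loops (n_space br e \<Gamma> l).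
        pairing br (gradient br F s) (P2 br s v) = 0)"

definition reduction_extension ::
    "'n::finite bracket \<Rightarrow> 'n vec \<Rightarrow> 'n vec \<Rightarrow> 'n grading \<Rightarrow> 'n vec set
      \<Rightarrow> 'n functional \<Rightarrow> 'n functional \<Rightarrow> bool" where
  "reduction_extension br e f \<Gamma> l \<phi> F \<longleftrightarrow>
     F \<in> local_functionals \<and> (\<forall>z\<in>Q_space br e f. F z = \<phi> z) \<and> constant_along_D br e \<Gamma> l F"

definition reduced_bracket ::
    "'n::finite bracket \<Rightarrow> 'n vec \<Rightarrow> 'n vec \<Rightarrow> 'n grading \<Rightarrow> 'n vec set \<Rightarrow> 'n functional_bracket" where
  "reduced_bracket br e f \<Gamma> l \<phi> \<psi> z =
     (THE c. \<exists>F G. reduction_extension br e f \<Gamma> l \<phi> F \<and> reduction_extension br e f \<Gamma> l \<psi> G \<and>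
        c = bracket2 br F G z)"

definition reduction_well_defined ::
    "'n::finite bracket \<Rightarrow> 'n vec \<Rightarrow> 'n vec \<Rightarrow> 'n grading \<Rightarrow> 'n vec set \<Rightarrow> bool" where
  "reduction_well_defined br e f \<Gamma> l \<longleftrightarrow>
     (\<forall>\<phi>\<in>local_functionals_on (Q_space br e f). \<exists>F. reduction_extension br e f \<Gamma> l \<phi> F) \<and>
     (\<forall>\<phi>\<in>local_functionals_on (Q_space br e f). \<forall>\<psi>\<in>local_functionals_on (Q_space br e f).
        \<forall>F G. reduction_extension br e f \<Gamma> l \<phi> F \<longrightarrow> reduction_extension br e f \<Gamma> l \<psi> G \<longrightarrow>
          (\<forall>z\<in>Q_space br e f. reduced_bracket br e f \<Gamma> l \<phi> \<psi> z = bracket2 br F G z))"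

definition classical_W_bracket ::
    "'n::finite bracket \<Rightarrow> 'n vec \<Rightarrow> 'n vec \<Rightarrow> 'n vec \<Rightarrow> 'n functional_bracket" where
  "classical_W_bracket br e h f =
     reduced_bracket br e f (dynkin_grading br h)
       (SOME l. lagrangian br e (dynkin_grading br h) l)"


section \<open>Brackets of densities\<close>

text \<open>
  A distribution \<open>T(x,y)\<close> on the product of two circles is represented by the bilinear form
  \<open>(\<alpha>,\<beta>) \<mapsto> \<integral>\<integral> \<alpha>(x) \<beta>(y) T(x,y) dx dy\<close> on test functions; multiplication by functions and partial
  derivatives act by duality.
\<close>

type_synonym distribution = "(real \<Rightarrow> complex) \<Rightarrow> (real \<Rightarrow> complex) \<Rightarrow> complex"

definition delta :: distribution where
  "delta \<alpha> \<beta> = integral {0..1} (\<lambda>x. \<alpha> x * \<beta> x)"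

definition mult_x :: "(real \<Rightarrow> complex) \<Rightarrow> distribution \<Rightarrow> distribution" where
  "mult_x c T \<alpha> \<beta> = T (\<lambda>x. c x * \<alpha> x) \<beta>"

definition mult_y :: "(real \<Rightarrow> complex) \<Rightarrow> distribution \<Rightarrow> distribution" where
  "mult_y c T \<alpha> \<beta> = T \<alpha> (\<lambda>y. c y * \<beta> y)"

definition deriv_x :: "distribution \<Rightarrow> distribution" where
  "deriv_x T \<alpha> \<beta> = - T (nderiv 1 \<alpha>) \<beta>"

definition deriv_y :: "distribution \<Rightarrow> distribution" where
  "deriv_y T \<alpha> \<beta> = - T \<alpha> (nderiv 1 \<beta>)"

text \<open>
  The index type \<open>'n\<close> of the ambient space also indexes bases of the Lie algebra; \<open>Iq \<subseteq> UNIV\<close>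
  plays the role of \<open>{1..m}\<close>.
\<close>

definition adapted_basis ::
    "'n::finite bracket \<Rightarrow> 'n vec \<Rightarrow> ('n \<Rightarrow> 'n vec) \<Rightarrow> ('n \<Rightarrow> 'n vec) \<Rightarrow> 'n set \<Rightarrow> bool" where
  "adapted_basis br f \<xi> \<eta> Iq \<longleftrightarrow>
     inj \<xi> \<and> vec.independent (range \<xi>) \<and> vec.span (range \<xi>) = UNIV \<and>
     vec.span (\<xi> ` Iq) = ker_ad br f \<and>
     (\<forall>i j. killing br (\<xi> i) (\<eta> j) = (if i = j then 1 else 0))"

definition coords :: "'n::finite bracket \<Rightarrow> 'n vec \<Rightarrow> ('n \<Rightarrow> 'n vec) \<Rightarrow> 'n loop \<Rightarrow> 'n loop" where
  "coords br e \<eta> z = (\<lambda>x. \<chi> i. killing br (z x - e) (\<eta> i))"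

definition smeared ::
    "'n::finite bracket \<Rightarrow> 'n vec \<Rightarrow> ('n \<Rightarrow> 'n vec) \<Rightarrow> ((nat \<Rightarrow> 'n vec) \<Rightarrow> complex)
      \<Rightarrow> (real \<Rightarrow> complex) \<Rightarrow> 'n functional" where
  "smeared br e \<eta> u \<alpha> z = integral {0..1} (\<lambda>x. \<alpha> x * u (jet (coords br e \<eta> z) x))"

text \<open>The distribution \<open>{u(x), v(y)}\<close> at the point \<open>z\<close>, for differential polynomials in the coordinates.\<close>

definition density_bracket ::
    "'n::finite bracket \<Rightarrow> 'n vec \<Rightarrow> ('n \<Rightarrow> 'n vec) \<Rightarrow> 'n functional_bracket \<Rightarrow> 'n loop
      \<Rightarrow> ((nat \<Rightarrow> 'n vec) \<Rightarrow> complex) \<Rightarrow> ((nat \<Rightarrow> 'n vec) \<Rightarrow> complex) \<Rightarrow> distribution" where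
  "density_bracket br e \<eta> B z u v \<alpha> \<beta> = B (smeared br e \<eta> u \<alpha>) (smeared br e \<eta> v \<beta>) z"

definition coordinate :: "'n::finite \<Rightarrow> (nat \<Rightarrow> 'n vec) \<Rightarrow> complex" where
  "coordinate i j = j 0 $ i"


section \<open>Drinfeld-Sokolov method\<close>

text \<open>
  The adjoint action of a loop \<open>m\<close> on operators \<open>c \<partial>\<^sub>x + q\<close>, written as pairs \<open>(c, q)\<close>, and the
  gauge transformation \<open>exp(- ad m) (\<partial>\<^sub>x + q) - \<partial>\<^sub>x\<close>.
\<close>

definition ad_op ::
    "'n::finite bracket \<Rightarrow> 'n loop \<Rightarrow> complex \<times> 'n loop \<Rightarrow> complex \<times> 'n loop" where
  "ad_op br m = (\<lambda>(c, q). (0, \<lambda>x. br (m x) (q x) - c *s vector_derivative m (at x)))"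

definition gauge_action :: "'n::finite bracket \<Rightarrow> 'n loop \<Rightarrow> 'n loop \<Rightarrow> 'n loop" where
  "gauge_action br m q =
     (\<lambda>x. \<Sum>k. ((- 1) ^ k / fact k) *\<^sub>R snd ((ad_op br m ^^ k) (1, q)) x)"

definition jet_partial ::
    "nat \<Rightarrow> 'n \<Rightarrow> ((nat \<Rightarrow> 'n::finite vec) \<Rightarrow> complex) \<Rightarrow> (nat \<Rightarrow> 'n vec) \<Rightarrow> complex" where
  "jet_partial a i u j = deriv (\<lambda>t. u (j(a := (\<chi> k. if k = i then t else j a $ k)))) (j a $ i)"

definition jet_orders :: "((nat \<Rightarrow> 'n::finite vec) \<Rightarrow> complex) \<Rightarrow> nat set" where
  "jet_orders u = {a. \<exists>i j. jet_partial a i u j \<noteq> 0}"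

definition leibniz_bracket ::
    "'n::finite bracket \<Rightarrow> 'n vec \<Rightarrow> ('n \<Rightarrow> 'n vec) \<Rightarrow> 'n loop
      \<Rightarrow> ((nat \<Rightarrow> 'n vec) \<Rightarrow> complex) \<Rightarrow> ((nat \<Rightarrow> 'n vec) \<Rightarrow> complex) \<Rightarrow> distribution" where
  "leibniz_bracket br e \<eta> z u v \<alpha> \<beta> =
     (\<Sum>a\<in>jet_orders u. \<Sum>i\<in>UNIV. \<Sum>b\<in>jet_orders v. \<Sum>j\<in>UNIV.
        mult_x (\<lambda>x. jet_partial a i u (jet (coords br e \<eta> z) x))
          ((deriv_x ^^ a)
            (mult_y (\<lambda>y. jet_partial b j v (jet (coords br e \<eta> z) y))
              ((deriv_y ^^ b)
                (density_bracket br e \<eta> (bracket2 br) z (coordinate i) (coordinate j))))) \<alpha> \<beta>)"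

definition depends_only_on :: "'n set \<Rightarrow> ((nat \<Rightarrow> 'n::finite vec) \<Rightarrow> complex) \<Rightarrow> bool" where
  "depends_only_on I u \<longleftrightarrow> (\<forall>j j'. (\<forall>k. \<forall>i\<in>I. j k $ i = j' k $ i) \<longrightarrow> u j = u j')"

text \<open>\<open>Ib\<close> indexes the part of the basis spanning \<open>b\<close>, hence the coordinates of \<open>S\<close>.\<close>

definition invariant_ring ::
    "'n::finite bracket \<Rightarrow> 'n vec \<Rightarrow> 'n grading \<Rightarrow> 'n vec set \<Rightarrow> ('n \<Rightarrow> 'n vec) \<Rightarrow> 'n set
      \<Rightarrow> ((nat \<Rightarrow> 'n vec) \<Rightarrow> complex) set" where
  "invariant_ring br e \<Gamma> l \<eta> Ib =
     {u \<in> diff_poly. depends_only_on Ib u \<and>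
        (\<forall>s\<in>S_space br e \<Gamma> l. \<forall>m\<in>loops (m_space \<Gamma> l). \<forall>x.
           u (jet (coords br e \<eta> (gauge_action br m s)) x) = u (jet (coords br e \<eta> s) x))}"

definition density_extension_constant_along_D ::
    "'n::finite bracket \<Rightarrow> 'n vec \<Rightarrow> 'n grading \<Rightarrow> 'n vec set \<Rightarrow> ('n \<Rightarrow> 'n vec)
      \<Rightarrow> ((nat \<Rightarrow> 'n vec) \<Rightarrow> complex) \<Rightarrow> ((nat \<Rightarrow> 'n vec) \<Rightarrow> complex) \<Rightarrow> bool" where
  "density_extension_constant_along_D br e \<Gamma> l \<eta> u v \<longleftrightarrow>
     v \<in> diff_poly \<and>
     (\<forall>s\<in>S_space br e \<Gamma> l. \<forall>x. v (jet (coords br e \<eta> s) x) = u (jet (coords br e \<eta> s) x)) \<and>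
     (\<forall>\<alpha>\<in>test_functions. constant_along_D br e \<Gamma> l (smeared br e \<eta> v \<alpha>))"

text \<open>
  \<open>U i\<close> expresses the coordinate \<open>q\<^sup>i\<close> of the representative in \<open>Q\<close> through the coordinates of
  \<open>S\<close>. If \<open>l\<close> is Lagrangian then \<open>D\<close> is tangent to \<open>S\<close> and the Leibniz rule applies to \<open>U i\<close>
  itself: only the coordinates of \<open>S\<close> contribute. Otherwise \<open>U i\<close>, regarded as a
  function on the whole loop algebra independent of the coordinates outside \<open>Ib\<close>, is in general
  not constant along \<open>D\<close>, and the rule has to be applied, in all coordinates of the loop algebra,
  to an extension which is. (For \<open>sl\<^sub>3\<close>, \<open>f\<close> minimal, \<open>l = 0\<close> and the Dynkin grading, the
  coordinates of degree -1 are themselves invariant, but their naive brackets lack the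
  \<open>\<delta>''\<close> term.)
\<close>

definition drinfeld_sokolov_computes ::
    "'n::finite bracket \<Rightarrow> 'n vec \<Rightarrow> 'n vec \<Rightarrow> 'n grading \<Rightarrow> 'n vec set
      \<Rightarrow> 'n functional_bracket \<Rightarrow> bool" where
  "drinfeld_sokolov_computes br e f \<Gamma> l B \<longleftrightarrow>
     (\<forall>s\<in>S_space br e \<Gamma> l. \<exists>!m. m \<in> loops (m_space \<Gamma> l) \<and> gauge_action br m s \<in> Q_space br e f) \<and>
     (\<forall>\<xi> \<eta> Iq Ib. adapted_basis br f \<xi> \<eta> Iq \<and> Iq \<subseteq> Ib \<and> vec.span (\<xi> ` Ib) = b_space br e \<Gamma> l \<longrightarrow>
       (\<exists>U.
          (\<forall>i\<in>Iq. U i \<in> invariant_ring br e \<Gamma> l \<eta> Ib) \<and>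
          (\<forall>s\<in>S_space br e \<Gamma> l. \<forall>m\<in>loops (m_space \<Gamma> l). gauge_action br m s \<in> Q_space br e f \<longrightarrow>
             (\<forall>i\<in>Iq. \<forall>x. coords br e \<eta> (gauge_action br m s) x $ i = U i (jet (coords br e \<eta> s) x))) \<and>
          (\<forall>u\<in>invariant_ring br e \<Gamma> l \<eta> Ib. \<exists>p\<in>diff_poly. \<forall>s\<in>S_space br e \<Gamma> l. \<forall>x.
             u (jet (coords br e \<eta> s) x) =
             p (jet (\<lambda>y. \<chi> i. if i \<in> Iq then U i (jet (coords br e \<eta> s) y) else 0) x)) \<and>
          (lagrangian br e \<Gamma> l \<longrightarrow>
             (\<forall>i\<in>Iq. \<forall>j\<in>Iq. \<forall>z\<in>Q_space br e f. \<forall>\<alpha>\<in>test_functions. \<forall>\<beta>\<in>test_functions.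
                density_bracket br e \<eta> B z (coordinate i) (coordinate j) \<alpha> \<beta> =
                leibniz_bracket br e \<eta> z (U i) (U j) \<alpha> \<beta>)) \<and>
          (\<forall>i\<in>Iq. \<exists>v. density_extension_constant_along_D br e \<Gamma> l \<eta> (U i) v) \<and>
          (\<forall>i\<in>Iq. \<forall>j\<in>Iq. \<forall>v w.
             density_extension_constant_along_D br e \<Gamma> l \<eta> (U i) v \<longrightarrow>
             density_extension_constant_along_D br e \<Gamma> l \<eta> (U j) w \<longrightarrow>
             (\<forall>z\<in>Q_space br e f. \<forall>\<alpha>\<in>test_functions. \<forall>\<beta>\<in>test_functions.
                density_bracket br e \<eta> B z (coordinate i) (coordinate j) \<alpha> \<beta> =
                leibniz_bracket br e \<eta> z v w \<alpha> \<beta>))))"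


section \<open>Poisson tensor procedure\<close>

text \<open>
  The tangent space of \<open>Q\<close> is \<open>loops (ker_ad br f)\<close>; a covector of \<open>Q\<close> is represented by any
  loop \<open>w\<close> inducing it through the pairing.
\<close>

definition covector_lift ::
    "'n::finite bracket \<Rightarrow> 'n vec \<Rightarrow> 'n loop \<Rightarrow> 'n loop \<Rightarrow> 'n loop \<Rightarrow> bool" where
  "covector_lift br f z w v \<longleftrightarrow>
     v \<in> loops UNIV \<and> (\<forall>t\<in>loops (ker_ad br f). pairing br v t = pairing br w t) \<and>
     P2 br z v \<in> loops (ker_ad br f)"

definition poisson_tensor_procedure_computes ::
    "'n::finite bracket \<Rightarrow> 'n vec \<Rightarrow> 'n vec \<Rightarrow> 'n functional_bracket \<Rightarrow> bool" where
  "poisson_tensor_procedure_computes br e f B \<longleftrightarrow>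
     (\<forall>z\<in>Q_space br e f. \<forall>w\<in>loops UNIV. \<exists>!v. covector_lift br f z w v) \<and>
     (\<forall>\<phi>\<in>local_functionals_on (Q_space br e f). \<forall>z\<in>Q_space br e f.
        \<exists>w. has_differential br (ker_ad br f) \<phi> z w) \<and>
     (\<forall>\<phi>\<in>local_functionals_on (Q_space br e f). \<forall>\<psi>\<in>local_functionals_on (Q_space br e f).
        \<forall>z\<in>Q_space br e f. \<forall>w w' v.
          has_differential br (ker_ad br f) \<phi> z w \<longrightarrow>
          has_differential br (ker_ad br f) \<psi> z w' \<longrightarrow>
          covector_lift br f z w' v \<longrightarrow>
          B \<phi> \<psi> z = pairing br w (P2 br z v))"


section \<open>Dirac formula\<close>

text \<open>
  A differential operator \<open>\<Sum>\<^sub>k A\<^sub>k \<partial>\<^sup>k\<close> whose coefficients are differential polynomials, evaluated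
  along the (coordinate) loop \<open>c\<close> and applied to functions or, in the variable \<open>x\<close>, to distributions.
\<close>

type_synonym 'n diff_op = "nat \<Rightarrow> (nat \<Rightarrow> 'n vec) \<Rightarrow> complex"

definition diff_ops :: "'n::finite diff_op set" where
  "diff_ops = {A. (\<forall>k. A k \<in> diff_poly) \<and> finite {k. A k \<noteq> (\<lambda>_. 0)}}"

definition op_fun :: "'n::finite diff_op \<Rightarrow> 'n loop \<Rightarrow> (real \<Rightarrow> complex) \<Rightarrow> real \<Rightarrow> complex" where
  "op_fun A c w = (\<lambda>x. \<Sum>k | A k \<noteq> (\<lambda>_. 0). A k (jet c x) * nderiv k w x)"

definition op_dist :: "'n::finite diff_op \<Rightarrow> 'n loop \<Rightarrow> distribution \<Rightarrow> distribution" where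
  "op_dist A c T \<alpha> \<beta> =
     (\<Sum>k | A k \<noteq> (\<lambda>_. 0). mult_x (\<lambda>x. A k (jet c x)) ((deriv_x ^^ k) T) \<alpha> \<beta>)"

definition represents_bracket2 ::
    "'n::finite bracket \<Rightarrow> 'n vec \<Rightarrow> ('n \<Rightarrow> 'n vec) \<Rightarrow> ('n \<Rightarrow> 'n \<Rightarrow> 'n diff_op) \<Rightarrow> bool" where
  "represents_bracket2 br e \<eta> FF \<longleftrightarrow>
     (\<forall>I J. FF I J \<in> diff_ops) \<and>
     (\<forall>I J. \<forall>z\<in>loops UNIV. \<forall>\<alpha>\<in>test_functions. \<forall>\<beta>\<in>test_functions.
        density_bracket br e \<eta> (bracket2 br) z (coordinate I) (coordinate J) \<alpha> \<beta> =
        op_dist (FF I J) (coords br e \<eta> z) delta \<alpha> \<beta>)"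

definition inverse_minor ::
    "'n::finite bracket \<Rightarrow> 'n vec \<Rightarrow> 'n vec \<Rightarrow> ('n \<Rightarrow> 'n vec) \<Rightarrow> 'n set
      \<Rightarrow> ('n \<Rightarrow> 'n \<Rightarrow> 'n diff_op) \<Rightarrow> ('n \<Rightarrow> 'n \<Rightarrow> 'n diff_op) \<Rightarrow> bool" where
  "inverse_minor br e f \<eta> Iq FF SS \<longleftrightarrow>
     (\<forall>a\<in>- Iq. \<forall>b\<in>- Iq. SS a b \<in> diff_ops) \<and>
     (\<forall>z\<in>Q_space br e f. \<forall>a\<in>- Iq. \<forall>c\<in>- Iq. \<forall>w\<in>test_functions. \<forall>x.
        (\<Sum>b\<in>- Iq. op_fun (FF a b) (coords br e \<eta> z) (op_fun (SS b c) (coords br e \<eta> z) w) x) =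
          (if a = c then w x else 0) \<and>
        (\<Sum>b\<in>- Iq. op_fun (SS a b) (coords br e \<eta> z) (op_fun (FF b c) (coords br e \<eta> z) w) x) =
          (if a = c then w x else 0))"

definition dirac_formula_computes ::
    "'n::finite bracket \<Rightarrow> 'n vec \<Rightarrow> 'n vec \<Rightarrow> 'n grading \<Rightarrow> 'n functional_bracket \<Rightarrow> bool" where
  "dirac_formula_computes br e f \<Gamma> B \<longleftrightarrow>
     (\<forall>\<xi> \<eta> Iq. adapted_basis br f \<xi> \<eta> Iq \<and> (\<forall>i. \<exists>d. \<xi> i \<in> \<Gamma> d) \<longrightarrow>
        (\<exists>FF. represents_bracket2 br e \<eta> FF) \<and>
        (\<forall>FF. represents_bracket2 br e \<eta> FF \<longrightarrow>
           (\<exists>SS. inverse_minor br e f \<eta> Iq FF SS) \<and>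
           (\<forall>SS. inverse_minor br e f \<eta> Iq FF SS \<longrightarrow>
              (\<forall>i\<in>Iq. \<forall>j\<in>Iq. \<forall>z\<in>Q_space br e f. \<forall>\<alpha>\<in>test_functions. \<forall>\<beta>\<in>test_functions.
                 density_bracket br e \<eta> B z (coordinate i) (coordinate j) \<alpha> \<beta> =
                 op_dist (FF i j) (coords br e \<eta> z) delta \<alpha> \<beta> -
                 (\<Sum>a\<in>- Iq. \<Sum>b\<in>- Iq.
                    op_dist (FF i a) (coords br e \<eta> z)
                      (op_dist (SS a b) (coords br e \<eta> z)
                        (op_dist (FF b j) (coords br e \<eta> z) delta)) \<alpha> \<beta>)))))"

end

theory Submission
  imports Defs "HOL-Computational_Algebra.Fundamental_Theorem_Algebra"
begin

text \<open>
  Let \<open>R\<close> be the linear map with kernel \<open>ker (ad f)\<close> and image \<open>[f, g]\<close> that inverts \<open>ad e\<close> on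
  \<open>[f, g]\<close>; it lowers the degree by 2 in every compatible good grading. For \<open>z\<close> in \<open>Q\<close> and a
  covector \<open>w\<close>, the loop \<open>v\<close> extends \<open>w\<close> with \<open>P2 z v\<close> tangent to \<open>Q\<close> iff \<open>u = v - w\<close> takes values in
  \<open>[f, g]\<close> and \<open>u + N u = - R (P2 z w)\<close>, where \<open>N u = R (u' + [z - e, u])\<close>. As \<open>N\<close> strictly lowers
  the filtration of a good grading, it is nilpotent, so \<open>v\<close> exists, is unique and depends neither on
  the grading nor on \<open>l\<close>.

  If \<open>G\<close> is an extension of \<open>\<psi>\<close> constant along \<open>D\<close>, then \<open>P2 z (grad G)\<close> takes values in \<open>b\<close>, and the
  same geometric series produces a loop \<open>n\<close> in \<open>m\<close> with \<open>v = grad G + n\<close>. Since an extension \<open>F\<close> of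
  \<open>\<phi>\<close> is constant along \<open>P2 z n\<close>, the reduced bracket is \<open>(w\<^sub>\<phi> | P2 z v)\<close>, whatever the data. The
  Dirac formula eliminates the component \<open>v - w\<close> of \<open>v\<close>; the inverse minor is \<open>(1 + N)\<^sup>-\<^sup>1 R\<close>.

  Extensions constant along \<open>D\<close> exist for all \<open>l\<close> at once: the gauge group of degree \<open>\<le> -1\<close> acts on
  \<open>e + g\<^sub>\<le>\<^sub>1\<close>, which contains every \<open>S\<close>, and \<open>Q\<close> is a slice for this action; the gauge parameter
  is the fixed point of a map contracting the filtration, hence a differential polynomial. Composing
  with the projection to \<open>Q\<close> gives the extensions, and also the invariants of the
  Drinfeld-Sokolov method, where the Leibniz rule is the chain rule for gradients.
\<close>

section \<open>Complex linear algebra\<close>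

text \<open>Two choices of data can be compared because \<open>R\<close>, \<open>Q\<close> and
  covector lifts are built from \<open>e\<close> and \<open>f\<close> alone. A grading enters only
  as a filtration \<open>Fil\<close> along which the series terminate, so the axioms of a good
  grading are boiled down to a few properties of \<open>Fil\<close> and \<open>R\<close>. The
  obstacle is the case where \<open>l\<close> is not Lagrangian: the directions in \<open>D\<close>
  then leave \<open>S\<close>, so constancy along \<open>D\<close> constrains normal derivatives of
  an extension and cannot be tested on \<open>S\<close>. It is established on
  \<open>e + Fil 1\<close> instead, to which all directions \<open>P2 s v\<close> with
  \<open>v\<close> in \<open>Fil (- 1)\<close> are tangent. Nondegeneracy of the Killing form turns
  covectors into loops and has to be extracted from simplicity: Engel's theorem yields an
  \<open>x\<close> with \<open>ad x\<close> not nilpotent, which a trace weighted by conjugate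
  eigenvalues excludes if the form vanishes. The nilpotency of \<open>ad e\<close> and the integer
  spectrum of \<open>ad h\<close> are likewise derived from the triple and the nilpotency of
  \<open>ad f\<close>. Functionals are differentiated along curves polynomial in the parameter,
  where all exchanges of limits are finite sums.\<close>

abbreviation clin :: "(complex ^ 'a \<Rightarrow> complex ^ 'b) \<Rightarrow> bool" where
  "clin \<equiv> Vector_Spaces.linear (*s) (*s)"

lemma clin_iff: "clin T \<longleftrightarrow> (\<forall>x y. T (x + y) = T x + T y) \<and> (\<forall>c x. T (c *s x) = c *s T x)"
  by (auto simp: Vector_Spaces.linear_iff vec.vector_space_axioms)

lemma clinI:
  "\<lbrakk>\<And>x y. T (x + y) = T x + T y; \<And>c x. T (c *s x) = c *s T x\<rbrakk> \<Longrightarrow> clin T"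
  by (simp add: clin_iff)

lemma clin_compose: "clin S \<Longrightarrow> clin T \<Longrightarrow> clin (\<lambda>x. S (T x))"
  by (simp add: clin_iff)

lemma clin_plus: "clin S \<Longrightarrow> clin T \<Longrightarrow> clin (\<lambda>x. S x + T x)"
  and clin_minus: "clin S \<Longrightarrow> clin T \<Longrightarrow> clin (\<lambda>x. S x - T x)"
  and clin_smult: "clin T \<Longrightarrow> clin (\<lambda>x. c *s T x)"
  and clin_zero: "clin (\<lambda>x. 0)"
  by (simp_all add: clin_iff vec_eq_iff algebra_simps)

lemma clin_id: "clin (\<lambda>x. x)"
  by (simp add: clin_iff)

lemma clin_funpow:
  fixes T :: "complex ^ 'n \<Rightarrow> complex ^ 'n"
  shows "clin T \<Longrightarrow> clin (T ^^ k)"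
  by (induction k) (auto simp: clin_iff)

lemma clin_sum: "(\<And>i. i \<in> I \<Longrightarrow> clin (T i)) \<Longrightarrow> clin (\<lambda>x. \<Sum>i\<in>I. T i x)"
proof (induction I rule: infinite_finite_induct)
  case (insert i I)
  then show ?case using clin_plus[of "T i" "\<lambda>x. \<Sum>i\<in>I. T i x"] by simp
qed (auto intro: clin_zero)

lemma clin_0: "clin T \<Longrightarrow> T 0 = 0"
  and clin_add: "clin T \<Longrightarrow> T (x + y) = T x + T y"
  and clin_diff: "clin T \<Longrightarrow> T (x - y) = T x - T y"
  and clin_neg: "clin T \<Longrightarrow> T (- x) = - T x"
  and clin_scale: "clin T \<Longrightarrow> T (c *s x) = c *s T x"
  and clin_setsum: "clin T \<Longrightarrow> T (sum g I) = (\<Sum>i\<in>I. T (g i))"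
  by (auto simp: vec.linear_0 vec.linear_add vec.linear_diff vec.linear_neg vec.linear_scale
      vec.linear_sum)

lemma clin_eqI_axis:
  assumes "clin S" "clin T" "\<And>i. S (axis i 1) = T (axis i 1)"
  shows "S x = T x"
proof -
  have "S (\<Sum>i\<in>UNIV. x $ i *s axis i 1) = T (\<Sum>i\<in>UNIV. x $ i *s axis i 1)"
    using assms by (simp add: clin_setsum clin_scale)
  then show ?thesis by (simp add: basis_expansion)
qed

lemma subspace_kernel: "clin T \<Longrightarrow> vec.subspace {x. T x = 0}"
  by (auto simp: vec.subspace_def clin_0 clin_add clin_scale)

lemma subspace_range: "clin T \<Longrightarrow> vec.subspace (range T)"
  using vec.linear_subspace_image vec.subspace_UNIV by blast

lemma clin_projection_exists:
  fixes V :: "(complex ^ 'n::finite) set"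
  assumes V: "vec.subspace V"
  obtains P where "clin P" "\<And>x. P x \<in> V" "\<And>x. x \<in> V \<Longrightarrow> P x = x"
proof -
  have "\<exists>g. g ` UNIV \<subseteq> V \<and> clin g \<and> (\<forall>v\<in>V. g ((\<lambda>x. x) v) = v)"
    by (rule vec.linear_exists_left_inverse_on[OF clin_id V]) simp
  then obtain g where "range g \<subseteq> V" "clin g" "\<forall>v\<in>V. g v = v" by auto
  then show thesis using that[of g] by auto
qed

text \<open>For a projection \<open>P\<close> onto \<open>ker T\<close>, the kernel of
  \<open>P\<close> is a complement on which \<open>T\<close> is injective and still has full image.
  The dimension count in \<open>kernel_E_plus_range_F\<close> rests on this.\<close>

lemma dim_kernel_range:
  fixes T :: "complex ^ 'n::finite \<Rightarrow> complex ^ 'n"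
  assumes T: "clin T"
  shows "vec.dim {x. T x = 0} + vec.dim (range T) = CARD('n)"
proof -
  let ?K = "{x. T x = 0}"
  obtain P where P: "clin P" "\<And>x. P x \<in> ?K" "\<And>x. x \<in> ?K \<Longrightarrow> P x = x"
    using clin_projection_exists[OF subspace_kernel[OF T]] by blast
  let ?C = "{x. P x = 0}"
  have C: "vec.subspace ?C" using subspace_kernel[OF P(1)] .
  have "T ` ?C = range T"
  proof safe
    fix x
    have "T (x - P x) = T x" "P (x - P x) = 0"
      using P T by (auto simp: clin_diff)
    then show "T x \<in> T ` ?C" by (metis (mono_tags, lifting) imageI mem_Collect_eq)
  qed auto
  moreover have "inj_on T ?C"
  proof (rule inj_onI)
    fix x y assume "x \<in> ?C" "y \<in> ?C" "T x = T y"
    then have "x - y \<in> ?K" "x - y \<in> ?C" using T P(1) by (auto simp: clin_diff)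
    then show "x = y" using P(3) by fastforce
  qed
  ultimately have 1: "vec.dim (range T) = vec.dim ?C"
    using vec.dim_image_eq[OF T, of ?C] C by (metis vec.span_eq_iff)
  have "{x + y | x y. x \<in> ?K \<and> y \<in> ?C} = UNIV"
  proof -
    have "\<exists>a b. x = a + b \<and> a \<in> ?K \<and> b \<in> ?C" for x
      using P by (intro exI[of _ "P x"] exI[of _ "x - P x"]) (auto simp: clin_diff)
    then show ?thesis by blast
  qed
  moreover have "?K \<inter> ?C = {0}" using P(1,3) T by (auto simp: clin_0)
  ultimately have "vec.dim ?K + vec.dim ?C = CARD('n)"
    using vec.dim_sums_Int[OF subspace_kernel[OF T] C] card_cart_basis[where 'a = complex and 'i = 'n]
    by (simp only: vec.dim_UNIV vec.dim_singleton) simp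
  with 1 show ?thesis by simp
qed

section \<open>Traces of nilpotent and idempotent operators\<close>

definition lin_trace :: "(complex ^ 'n \<Rightarrow> complex ^ 'n::finite) \<Rightarrow> complex" where
  "lin_trace T = trace (matrix T)"

lemma lin_trace_eq: "lin_trace T = (\<Sum>i\<in>UNIV. T (axis i 1) $ i)"
  by (simp add: lin_trace_def trace_def matrix_def)

lemma lin_trace_add: "lin_trace (\<lambda>x. S x + T x) = lin_trace S + lin_trace T"
  and lin_trace_diff: "lin_trace (\<lambda>x. S x - T x) = lin_trace S - lin_trace T"
  and lin_trace_smult: "lin_trace (\<lambda>x. c *s T x) = c * lin_trace T"
  and lin_trace_0: "lin_trace (\<lambda>x. 0) = 0"
  by (auto simp: lin_trace_eq sum.distrib sum_subtractf sum_distrib_left)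

lemma lin_trace_sum: "lin_trace (\<lambda>x. \<Sum>j\<in>J. T j x) = (\<Sum>j\<in>J. lin_trace (T j))"
  by (simp add: lin_trace_eq) (rule sum.swap)

lemma lin_trace_commute:
  assumes "clin S" "clin T"
  shows "lin_trace (\<lambda>x. S (T x)) = lin_trace (\<lambda>x. T (S x))"
proof -
  have "matrix (\<lambda>x. S (T x)) = matrix S ** matrix T" "matrix (\<lambda>x. T (S x)) = matrix T ** matrix S"
    using matrix_compose_gen[OF assms(2,1)] matrix_compose_gen[OF assms] by (simp_all add: o_def)
  then show ?thesis unfolding lin_trace_def by (simp only: trace_mul_sym[of "matrix S"])
qed

text \<open>Induction on the exponent. With \<open>P\<close> a projection onto \<open>ker T\<close>,
  the operator \<open>T' = (1 - P) T\<close> has the same trace, because \<open>P T\<close> and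
  \<open>T P = 0\<close> have equal traces, and it is nilpotent one step earlier.\<close>

lemma lin_trace_nilpotent:
  assumes "clin T" "\<And>x. (T ^^ k) x = 0"
  shows "lin_trace T = 0"
proof -
  have "lin_trace T = 0" if "clin T" "\<And>x. (T ^^ Suc k) x = 0" for T and k :: nat
    using that
  proof (induction k arbitrary: T)
    case 0
    then have "T = (\<lambda>x. 0)" by auto
    then show ?case using lin_trace_0 by simp
  next
    case (Suc k)
    let ?K = "{x. T x = 0}"
    note T = Suc.prems(1)
    obtain P where P: "clin P" "\<And>x. P x \<in> ?K" "\<And>x. x \<in> ?K \<Longrightarrow> P x = x"
      using clin_projection_exists[OF subspace_kernel[OF T]] by blast
    define T' where "T' = (\<lambda>x. T x - P (T x))"
    have T': "clin T'" unfolding T'_def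
      by (rule clin_minus[OF T clin_compose[OF P(1) T]])
    have TP: "T (P x) = 0" for x using P(2) by auto
    \<comment> \<open>Since \<open>T P = 0\<close>, powers of \<open>T'\<close> are
      \<open>1 - P\<close> applied to powers of \<open>T\<close>.\<close>
    have iter: "T' ((T' ^^ j) x) = T ((T ^^ j) x) - P (T ((T ^^ j) x))" for j x
      by (induction j) (simp_all add: T'_def clin_diff[OF T] TP)
    have "T (T ((T ^^ k) x)) = 0" for x
      using Suc.prems(2)[of x] by simp
    then have nil: "(T' ^^ Suc k) x = 0" for x
      using P(3)[of "T ((T ^^ k) x)"] iter[of k x] by simp
    have "lin_trace T = lin_trace T' + lin_trace (\<lambda>x. P (T x))"
      by (simp add: lin_trace_add[symmetric] T'_def)
    also have "lin_trace (\<lambda>x. P (T x)) = 0"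
      using lin_trace_commute[OF P(1) T] TP lin_trace_0 by simp
    finally show ?case using Suc.IH[OF T' nil] by simp
  qed
  moreover have "(T ^^ Suc k) x = 0" for x
    using assms by (simp add: clin_0)
  ultimately show ?thesis using assms(1) by blast
qed

text \<open>The trace of a projection is its rank. A rank one projection \<open>q\<close> onto a
  fixed vector of \<open>P\<close> is split off, and \<open>P - q\<close> has a smaller range. That
  the value is a natural number, zero only for \<open>P = 0\<close>, is what the sum of squares in
  \<open>killing_not_zero\<close> needs.\<close>

lemma lin_trace_idempotent:
  assumes "clin P" "\<And>x. P (P x) = P x"
  shows "\<exists>n::nat. lin_trace P = of_nat n \<and> (n = 0 \<longrightarrow> (\<forall>x. P x = 0))"
  using assms
proof (induction "vec.dim (range P)" arbitrary: P rule: less_induct)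
  case (less P)
  show ?case
  proof (cases "\<forall>x. P x = 0")
    case True
    then have "P = (\<lambda>x. 0)" by auto
    then show ?thesis using lin_trace_0 by (intro exI[of _ 0]) auto
  next
    case False
    then obtain x where "P x \<noteq> 0" by blast
    then obtain v where "P v = v" "v \<noteq> 0" using less.prems(2) by blast
    then obtain i where v: "P v = v" "v $ i \<noteq> 0" by (auto simp: vec_eq_iff)
    define q where "q = (\<lambda>x. (P x $ i / v $ i) *s v)"
    have q: "clin q" using less.prems(1)
      by (intro clinI) (auto simp: q_def clin_add clin_scale vec.scale_left_distrib add_divide_distrib)
    have Pq: "P (q x) = q x" and qP: "q (P x) = q x" and qq: "q (q x) = q x" for x
      using v less.prems by (auto simp: q_def clin_scale)
    define P' where "P' = (\<lambda>x. P x - q x)"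
    have P': "clin P'" unfolding P'_def using less.prems(1) q by (rule clin_minus)
    have idem: "P' (P' x) = P' x" for x
      by (simp add: P'_def clin_diff[OF less.prems(1)] clin_diff[OF q] Pq qP qq less.prems(2))
    have "P' v = 0" using v by (simp add: P'_def q_def)
    have sub: "range P' \<subseteq> range P"
    proof safe
      fix x
      have "P' x = P (P' x)" by (simp add: P'_def clin_diff[OF less.prems(1)] less.prems(2) Pq)
      then show "P' x \<in> range P" by (rule range_eqI)
    qed
    have "v \<notin> range P'" using \<open>P' v = 0\<close> idem v(2) by auto
    moreover have "v \<in> range P" using v(1) by (rule range_eqI[OF sym])
    ultimately have "range P' \<subset> range P" using sub by blast
    then have "vec.dim (range P') < vec.dim (range P)"
      using vec.dim_psubset[of "range P'" "range P"] subspace_range[OF P'] subspace_range[OF less.prems(1)]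
      by (simp add: vec.span_eq_iff[THEN iffD2])
    from less.hyps[OF this P' idem] obtain n where n: "lin_trace P' = of_nat n" by blast
    have "lin_trace q = 1"
    proof -
      have "lin_trace q = (\<Sum>j\<in>UNIV. P (axis j 1) $ i * (v $ j / v $ i))"
        by (simp add: lin_trace_eq q_def)
      also have "\<dots> = (\<Sum>j\<in>UNIV. v $ j * P (axis j 1) $ i) / v $ i"
        by (simp add: sum_divide_distrib mult.commute)
      also have "\<dots> = P v $ i / v $ i"
        using linear_componentwise[OF less.prems(1), of v i] by simp
      finally show ?thesis using v by simp
    qed
    moreover have "lin_trace P = lin_trace P' + lin_trace q"
      by (simp add: lin_trace_add[symmetric] P'_def)
    ultimately have "lin_trace P = of_nat (Suc n)" using n by simp
    then show ?thesis by blast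
  qed
qed

section \<open>Direct sum decompositions and their projections\<close>

text \<open>The index type is left open: integers serve for gradings, complex numbers for
  generalized eigenspaces.\<close>

locale direct_decomposition =
  fixes \<Gamma> :: "'i \<Rightarrow> (complex ^ 'n::finite) set"
  assumes subspace: "vec.subspace (\<Gamma> i)"
    and decomposition: "\<exists>!c. (\<forall>i. c i \<in> \<Gamma> i) \<and> finite {i. c i \<noteq> 0} \<and> x = (\<Sum>i | c i \<noteq> 0. c i)"

definition component :: "('i \<Rightarrow> (complex ^ 'n::finite) set) \<Rightarrow> 'i \<Rightarrow> complex ^ 'n \<Rightarrow> complex ^ 'n" where
  "component \<Gamma> i x =
     (THE c. (\<forall>i. c i \<in> \<Gamma> i) \<and> finite {i. c i \<noteq> 0} \<and> x = (\<Sum>i | c i \<noteq> 0. c i)) i"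

lemma direct_decompositionI:
  fixes \<Gamma> :: "'i \<Rightarrow> (complex ^ 'n::finite) set"
  assumes sub: "\<And>i. vec.subspace (\<Gamma> i)"
    and span: "vec.span (\<Union>i. \<Gamma> i) = UNIV"
    and indep: "\<And>J v. \<lbrakk>finite J; \<And>j. j \<in> J \<Longrightarrow> v j \<in> \<Gamma> j; sum v J = 0\<rbrakk> \<Longrightarrow> \<forall>j\<in>J. v j = 0"
  shows "direct_decomposition \<Gamma>"
proof
  fix x :: "complex ^ 'n"
  have "x \<in> vec.span (\<Union>i. \<Gamma> i)" using span by simp
  then have "\<exists>J c. finite J \<and> (\<forall>i. c i \<in> \<Gamma> i) \<and> (\<forall>i. i \<notin> J \<longrightarrow> c i = 0) \<and> x = sum c J"
  proof (induction rule: vec.span_induct_alt)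
    case base
    show ?case using sub by (intro exI[of _ "{}"] exI[of _ "\<lambda>_. 0"]) (auto simp: vec.subspace_0)
  next
    case (step a y z)
    then obtain i J c where *: "y \<in> \<Gamma> i" "finite J" "\<forall>i. c i \<in> \<Gamma> i" "\<forall>i. i \<notin> J \<longrightarrow> c i = 0"
      "z = sum c J" by blast
    define c' where "c' = (\<lambda>j. c j + (if j = i then a *s y else 0))"
    have "sum c' (insert i J) = sum c (insert i J) + a *s y"
      using *(2) by (simp add: c'_def sum.distrib)
    also have "sum c (insert i J) = sum c J"
      using * by (intro sum.mono_neutral_right) auto
    finally show ?case
      using * sub by (intro exI[of _ "insert i J"] exI[of _ c'])
        (auto simp: c'_def intro!: vec.subspace_add vec.subspace_scale)
  qed
  then obtain J c where c: "finite J" "\<And>i. c i \<in> \<Gamma> i" "\<And>i. i \<notin> J \<Longrightarrow> c i = 0" "x = sum c J"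
    by blast
  have fin: "finite {i. c i \<noteq> 0}" by (rule finite_subset[OF _ c(1)]) (use c(3) in blast)
  show "\<exists>!c. (\<forall>i. c i \<in> \<Gamma> i) \<and> finite {i. c i \<noteq> 0} \<and> x = (\<Sum>i | c i \<noteq> 0. c i)"
  proof (rule ex1I[of _ c])
    have "sum c J = (\<Sum>i | c i \<noteq> 0. c i)"
      using c by (intro sum.mono_neutral_right) auto
    then show "(\<forall>i. c i \<in> \<Gamma> i) \<and> finite {i. c i \<noteq> 0} \<and> x = (\<Sum>i | c i \<noteq> 0. c i)"
      using c fin by simp
  next
    fix d assume d: "(\<forall>i. d i \<in> \<Gamma> i) \<and> finite {i. d i \<noteq> 0} \<and> x = (\<Sum>i | d i \<noteq> 0. d i)"
    let ?I = "J \<union> {i. d i \<noteq> 0}"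
    have "sum c ?I = sum c J" using c d by (intro sum.mono_neutral_right) auto
    moreover have "sum d ?I = (\<Sum>i | d i \<noteq> 0. d i)" using c d by (intro sum.mono_neutral_right) auto
    ultimately
    have "(\<Sum>i\<in>?I. d i - c i) = 0" using c d by (simp add: sum_subtractf)
    moreover have "d i - c i \<in> \<Gamma> i" for i using sub c d by (simp add: vec.subspace_diff)
    moreover have "finite ?I" using c(1) d by blast
    ultimately have "\<forall>i\<in>?I. d i - c i = 0" using indep[of ?I "\<lambda>i. d i - c i"] by blast
    then have di: "d i = c i" if "i \<in> ?I" for i using that eq_iff_diff_eq_0 by blast
    show "d = c"
    proof
      fix i show "d i = c i" using di[of i] c(3)[of i] by (cases "i \<in> ?I") auto
    qed
  qed
qed (rule sub)

context direct_decomposition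
begin

abbreviation comp where "comp i x \<equiv> component \<Gamma> i x"

lemma component_properties:
  "(\<forall>i. comp i x \<in> \<Gamma> i) \<and> finite {i. comp i x \<noteq> 0} \<and> x = (\<Sum>i | comp i x \<noteq> 0. comp i x)"
  using theI'[OF decomposition[of x]] unfolding component_def .

lemma component_in: "comp i x \<in> \<Gamma> i"
  and finite_support: "finite {i. comp i x \<noteq> 0}"
  using component_properties by blast+

lemma sum_support: "(\<Sum>i | comp i x \<noteq> 0. comp i x) = x"
  using component_properties[of x] by (elim conjE) (rule sym)

lemma component_unique:
  assumes "finite J" "\<And>i. i \<in> J \<Longrightarrow> c i \<in> \<Gamma> i" "x = sum c J"
  shows "comp i x = (if i \<in> J then c i else 0)"
proof -
  let ?c = "\<lambda>i. if i \<in> J then c i else 0"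
  have "sum c J = (\<Sum>i | ?c i \<noteq> 0. ?c i)"
    using assms(1) by (intro sum.mono_neutral_cong_right) auto
  moreover have "\<forall>i. ?c i \<in> \<Gamma> i" using assms(2) subspace by (auto simp: vec.subspace_0)
  moreover have "finite {i. ?c i \<noteq> 0}" using assms(1) by (rule rev_finite_subset) auto
  ultimately have "(\<forall>i. ?c i \<in> \<Gamma> i) \<and> finite {i. ?c i \<noteq> 0} \<and> x = (\<Sum>i | ?c i \<noteq> 0. ?c i)"
    using assms(3) by simp
  then have "(THE c. (\<forall>i. c i \<in> \<Gamma> i) \<and> finite {i. c i \<noteq> 0} \<and> x = (\<Sum>i | c i \<noteq> 0. c i)) = ?c"
    by (rule the1_equality[OF decomposition])
  then show ?thesis by (simp only: component_def)
qed

lemma component_of: "x \<in> \<Gamma> i \<Longrightarrow> comp j x = (if j = i then x else 0)"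
  using component_unique[of "{i}" "\<lambda>_. x" x j] by (simp split: if_splits)

lemma component_linear: "clin (comp i)"
proof (rule clinI)
  fix x y
  let ?J = "{i. comp i x \<noteq> 0} \<union> {i. comp i y \<noteq> 0}"
  have fJ: "finite ?J" using finite_support by auto
  have "sum (\<lambda>i. comp i x) {i. comp i x \<noteq> 0} = sum (\<lambda>i. comp i x) ?J"
      "sum (\<lambda>i. comp i y) {i. comp i y \<noteq> 0} = sum (\<lambda>i. comp i y) ?J"
    by (rule sum.mono_neutral_left[OF fJ]; blast)+
  then have "sum (\<lambda>i. comp i x) ?J = x" "sum (\<lambda>i. comp i y) ?J = y"
    by (simp_all only: sum_support)
  then have "x + y = sum (\<lambda>i. comp i x + comp i y) ?J" by (simp add: sum.distrib)
  from component_unique[OF fJ _ this, of i] show "comp i (x + y) = comp i x + comp i y"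
    using component_in subspace by (auto simp: vec.subspace_add)
next
  fix c x
  let ?J = "{i. comp i x \<noteq> 0}"
  have "c *s x = (\<Sum>i\<in>?J. c *s comp i x)"
    by (simp only: vec.scale_sum_right[symmetric] sum_support)
  from component_unique[OF _ _ this, of i] show "comp i (c *s x) = c *s comp i x"
    using component_in subspace finite_support by (auto simp: vec.subspace_scale)
qed

text \<open>The supports of the finitely many basis vectors together contain every degree that
  occurs.\<close>

lemma finite_degrees: obtains J where "finite J" "\<And>i x. i \<notin> J \<Longrightarrow> comp i x = 0"
proof -
  define J where "J = (\<Union>k::'n. {i. comp i (axis k 1) \<noteq> 0})"
  have "finite J" unfolding J_def by (rule finite_UN_I) (simp_all add: finite_support)
  moreover have "comp i x = 0" if "i \<notin> J" for i x
    using clin_eqI_axis[OF component_linear clin_zero, of i x] that by (auto simp: J_def)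
  ultimately show thesis using that by blast
qed

lemma sum_components:
  assumes "finite J" "\<And>i. i \<notin> J \<Longrightarrow> comp i x = 0"
  shows "(\<Sum>i\<in>J. comp i x) = x"
proof -
  have "(\<Sum>i | comp i x \<noteq> 0. comp i x) = (\<Sum>i\<in>J. comp i x)"
    using assms by (intro sum.mono_neutral_left) auto
  then show ?thesis by (simp only: sum_support)
qed

lemma component_eqI:
  assumes "\<And>i. comp i x = comp i y" shows "x = y"
proof -
  obtain J where J: "finite J" "\<And>i x. i \<notin> J \<Longrightarrow> comp i x = 0" using finite_degrees by blast
  have "x = (\<Sum>i\<in>J. comp i x)" "y = (\<Sum>i\<in>J. comp i y)" using J by (simp_all add: sum_components)
  then show ?thesis using assms by simp
qed

text \<open>A map sending degree \<open>i\<close> to degree \<open>s i\<close> acts blockwise;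
  injectivity of \<open>s\<close> ensures that no two blocks land in the same degree.\<close>

lemma component_commute:
  assumes T: "clin T" and "inj s" and "\<And>i x. x \<in> \<Gamma> i \<Longrightarrow> T x \<in> \<Gamma> (s i)"
  shows "comp (s i) (T x) = T (comp i x)"
proof -
  obtain J where J: "finite J" "\<And>i x. i \<notin> J \<Longrightarrow> comp i x = 0" using finite_degrees by blast
  have "T x = (\<Sum>i\<in>J. T (comp i x))"
    using J sum_components[of J x] clin_setsum[OF T, of "\<lambda>i. comp i x" J] by simp
  also have "\<dots> = (\<Sum>k\<in>s ` J. T (comp (inv s k) x))"
    using assms(2) by (subst sum.reindex) (auto simp: inj_on_def)
  finally have "comp (s i) (T x) = (if s i \<in> s ` J then T (comp (inv s (s i)) x) else 0)"
    using J assms component_in by (intro component_unique) auto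
  then show ?thesis using assms(2) J clin_0[OF T] by (auto simp: inj_image_mem_iff)
qed

lemma lin_trace_components:
  assumes T: "clin T" and J: "finite J" "\<And>i x. i \<notin> J \<Longrightarrow> comp i x = 0"
  shows "lin_trace T = (\<Sum>i\<in>J. lin_trace (\<lambda>x. comp i (T (comp i x))))"
proof -
  have "lin_trace T = lin_trace (\<lambda>x. \<Sum>i\<in>J. comp i (T x))"
    using J by (simp add: sum_components)
  also have "\<dots> = (\<Sum>i\<in>J. lin_trace (\<lambda>x. comp i (T x)))" by (rule lin_trace_sum)
  also have "\<dots> = (\<Sum>i\<in>J. lin_trace (\<lambda>x. comp i (T (comp i x))))"
  proof (rule sum.cong[OF refl])
    fix i
    show "lin_trace (\<lambda>x. comp i (T x)) = lin_trace (\<lambda>x. comp i (T (comp i x)))"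
      using lin_trace_commute[OF component_linear clin_compose[OF component_linear[of i] T], of i]
      by (simp add: component_of[OF component_in])
  qed
  finally show ?thesis .
qed

text \<open>All diagonal blocks vanish. For \<open>T = ad x ad y\<close> this is the orthogonality
  of graded pieces whose degrees do not add up to zero.\<close>

lemma lin_trace_shift:
  assumes T: "clin T" and "\<And>i x. x \<in> \<Gamma> i \<Longrightarrow> T x \<in> \<Gamma> (s i)" "\<And>i. s i \<noteq> i"
  shows "lin_trace T = 0"
proof -
  obtain J where J: "finite J" "\<And>i x. i \<notin> J \<Longrightarrow> comp i x = 0" using finite_degrees by blast
  have "(\<lambda>x. comp i (T (comp i x))) = (\<lambda>x. 0)" for i
    by (rule ext) (simp add: component_of[OF assms(2)[OF component_in]] assms(3)[of i, symmetric])
  then show ?thesis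
    by (subst lin_trace_components[OF T J]) (simp_all add: lin_trace_0)
qed

end

section \<open>Generalized eigenspaces of a complex operator\<close>

definition generalized_eigenspace :: "(complex ^ 'n \<Rightarrow> complex ^ 'n::finite) \<Rightarrow> complex \<Rightarrow> (complex ^ 'n) set"
  where "generalized_eigenspace A c = {y. \<exists>k. ((\<lambda>z. A z - c *s z) ^^ k) y = 0}"

lemma funpow_zero_mono:
  fixes T :: "complex ^ 'n \<Rightarrow> complex ^ 'n"
  assumes "clin T" "(T ^^ k) y = 0" "k \<le> j" shows "(T ^^ j) y = 0"
proof -
  have "(T ^^ j) y = (T ^^ (j - k)) ((T ^^ k) y)"
    using assms(3) by (metis comp_apply funpow_add le_add_diff_inverse2)
  then show ?thesis using assms clin_0[OF clin_funpow[OF assms(1)]] by simp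
qed

lemma clin_shift: "clin A \<Longrightarrow> clin (\<lambda>z. A z - c *s z)"
  by (intro clin_minus clin_smult clin_id)

lemma subspace_generalized_eigenspace:
  assumes "clin A" shows "vec.subspace (generalized_eigenspace A c)"
proof -
  let ?T = "\<lambda>z. A z - c *s z"
  note T = clin_shift[OF assms, of c]
  have "\<exists>k. (?T ^^ k) (x + y) = 0" if "(?T ^^ i) x = 0" "(?T ^^ j) y = 0" for i j x y
    using funpow_zero_mono[OF T that(1), of "max i j"] funpow_zero_mono[OF T that(2), of "max i j"]
    by (intro exI[of _ "max i j"]) (simp add: clin_add[OF clin_funpow[OF T]])
  moreover have "\<exists>k. (?T ^^ k) 0 = 0" by (rule exI[of _ 0]) simp
  ultimately show ?thesis
    unfolding vec.subspace_def generalized_eigenspace_def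
    by (auto simp: clin_scale[OF clin_funpow[OF T]])
qed

lemma generalized_eigenspace_invariant:
  assumes A: "clin A" and "clin B" and "\<And>x. B (A x) = A (B x)" and "y \<in> generalized_eigenspace A c"
  shows "B y \<in> generalized_eigenspace A c"
proof -
  have "((\<lambda>z. A z - c *s z) ^^ k) (B y) = B (((\<lambda>z. A z - c *s z) ^^ k) y)" for k
    by (induction k) (simp_all add: assms(3) clin_diff[OF assms(2)] clin_scale[OF assms(2)])
  moreover obtain k where "((\<lambda>z. A z - c *s z) ^^ k) y = 0"
    using assms(4) by (auto simp: generalized_eigenspace_def)
  ultimately have "((\<lambda>z. A z - c *s z) ^^ k) (B y) = 0" using clin_0[OF assms(2)] by simp
  then show ?thesis unfolding generalized_eigenspace_def by blast
qed

lemma generalized_eigenspaces_injective: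
  assumes "clin A" "y \<in> generalized_eigenspace A b" "A y = c *s y" "b \<noteq> c"
  shows "y = 0"
proof -
  have "((\<lambda>z. A z - b *s z) ^^ k) y = (c - b) ^ k *s y" for k
  proof (induction k)
    case (Suc k)
    have "((\<lambda>z. A z - b *s z) ^^ Suc k) y = A ((c - b) ^ k *s y) - b *s ((c - b) ^ k *s y)"
      by (simp add: Suc)
    also have "\<dots> = (c - b) ^ Suc k *s y"
      by (simp add: clin_scale[OF assms(1)] assms(3) vec_eq_iff algebra_simps)
    finally show ?case .
  qed simp
  then show ?thesis using assms(2,4) by (auto simp: generalized_eigenspace_def)
qed

text \<open>A power of \<open>A - c\<close> kills the summand for \<open>c\<close> and is injective
  on the generalized eigenspaces of the other eigenvalues; so the induction hypothesis applies to
  the images, and their vanishing pulls back.\<close>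

lemma generalized_eigenspaces_independent:
  assumes A: "clin A" and "finite J" "\<And>j. j \<in> J \<Longrightarrow> v j \<in> generalized_eigenspace A j" "sum v J = 0"
  shows "\<forall>j\<in>J. v j = 0"
  using assms(2-)
proof (induction J arbitrary: v rule: finite_induct)
  case (insert c J)
  let ?T = "\<lambda>z. A z - c *s z"
  note T = clin_shift[OF A, of c]
  obtain k where k: "(?T ^^ k) (v c) = 0"
    using insert.prems(1)[of c] by (auto simp: generalized_eigenspace_def)
  have step: "?T y \<in> generalized_eigenspace A j" if "y \<in> generalized_eigenspace A j" for y j
    by (rule generalized_eigenspace_invariant[OF A T _ that]) (simp add: clin_diff[OF A] clin_scale[OF A])
  have mem: "(?T ^^ i) (v j) \<in> generalized_eigenspace A j" if "j \<in> J" for i j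
    by (induction i) (use insert.prems(1)[of j] that step in auto)
  have "(?T ^^ k) (sum v (insert c J)) = 0"
    using insert.prems(2) clin_0[OF clin_funpow[OF T]] by simp
  then have "(\<Sum>j\<in>J. (?T ^^ k) (v j)) = 0"
    using insert.hyps k by (simp add: clin_add[OF clin_funpow[OF T]] clin_setsum[OF clin_funpow[OF T]])
  from insert.IH[OF mem this] have z: "\<forall>j\<in>J. (?T ^^ k) (v j) = 0" .
  have "v j = 0" if "j \<in> J" for j
  proof -
    have "(?T ^^ i) (v j) = 0 \<Longrightarrow> v j = 0" for i
    proof (induction i)
      case (Suc i)
      then have "A ((?T ^^ i) (v j)) = c *s (?T ^^ i) (v j)" by simp
      with mem[OF that, of i] have "(?T ^^ i) (v j) = 0"
        using generalized_eigenspaces_injective[OF A] that insert.hyps by blast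
      then show ?case by (rule Suc.IH)
    qed simp
    then show ?thesis using z that by blast
  qed
  moreover from this have "v c = 0" using insert.prems(2) insert.hyps by simp
  ultimately show ?case by simp
qed simp

definition poly_apply :: "complex poly \<Rightarrow> (complex ^ 'n \<Rightarrow> complex ^ 'n) \<Rightarrow> complex ^ 'n \<Rightarrow> complex ^ 'n::finite"
  where "poly_apply p A y = (\<Sum>i\<le>degree p. coeff p i *s (A ^^ i) y)"

lemma poly_apply_bound: "degree p \<le> n \<Longrightarrow> poly_apply p A y = (\<Sum>i\<le>n. coeff p i *s (A ^^ i) y)"
  unfolding poly_apply_def
  by (rule sum.mono_neutral_left) (auto simp: coeff_eq_0)

lemma poly_apply_linear_factor:
  assumes "clin A"
  shows "poly_apply ([:- c, 1:] * q) A y = poly_apply q A (A y - c *s y)"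
proof -
  let ?n = "degree q"
  have d: "degree ([:- c, 1:] * q) \<le> Suc ?n"
    using degree_mult_le[of "[:- c, 1:]" q] by simp
  have "poly_apply ([:- c, 1:] * q) A y =
      (\<Sum>i\<le>Suc ?n. (coeff (pCons 0 q) i - c * coeff q i) *s (A ^^ i) y)"
    using poly_apply_bound[OF d] by (simp add: algebra_simps)
  also have "\<dots> = (\<Sum>i\<le>Suc ?n. coeff (pCons 0 q) i *s (A ^^ i) y) - (\<Sum>i\<le>Suc ?n. (c * coeff q i) *s (A ^^ i) y)"
    by (simp add: vec.scale_left_diff_distrib sum_subtractf)
  also have "(\<Sum>i\<le>Suc ?n. coeff (pCons 0 q) i *s (A ^^ i) y) = (\<Sum>i\<le>?n. coeff q i *s (A ^^ i) (A y))"
    by (subst sum.atMost_Suc_shift) (simp add: funpow_swap1)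
  also have "(\<Sum>i\<le>Suc ?n. (c * coeff q i) *s (A ^^ i) y) = (\<Sum>i\<le>?n. (c * coeff q i) *s (A ^^ i) y)"
    by (simp add: coeff_eq_0)
  finally show ?thesis
    by (simp add: poly_apply_def clin_diff[OF clin_funpow[OF assms]] clin_scale[OF clin_funpow[OF assms]]
        vec.scale_right_diff_distrib sum_subtractf mult.commute)
qed

text \<open>On this space \<open>A - c\<close> is the nonzero scalar \<open>b - c\<close> plus a
  nilpotent operator. Induction on the nilpotency order of \<open>z\<close>: a solution
  \<open>y\<close> for the right-hand side \<open>(A - b) z\<close> gives the solution
  \<open>(z - y) / (b - c)\<close> for \<open>z\<close>.\<close>

lemma shift_surjective_on_generalized_eigenspace:
  assumes A: "clin A" and "z \<in> generalized_eigenspace A b" "b \<noteq> c"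
  shows "\<exists>y\<in>generalized_eigenspace A b. A y - c *s y = z"
proof -
  let ?N = "\<lambda>z. A z - b *s z"
  note G = subspace_generalized_eigenspace[OF A, of b]
  have NG: "?N y \<in> generalized_eigenspace A b" if "y \<in> generalized_eigenspace A b" for y
    by (rule generalized_eigenspace_invariant[OF A clin_shift[OF A] _ that]) (simp add: clin_diff[OF A] clin_scale[OF A])
  have "\<exists>y\<in>generalized_eigenspace A b. A y - c *s y = z"
    if "(?N ^^ k) z = 0" "z \<in> generalized_eigenspace A b" for k
    using that
  proof (induction k arbitrary: z)
    case 0
    then show ?case using vec.subspace_0[OF G] by (intro bexI[of _ 0]) (auto simp: clin_0[OF A])
  next
    case (Suc k)
    have "(?N ^^ k) (?N z) = 0" using Suc.prems(1) by (simp only: funpow_Suc_right o_apply)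
    from Suc.IH[OF this NG[OF Suc.prems(2)]]
    obtain y where y: "y \<in> generalized_eigenspace A b" "A y - c *s y = ?N z" by blast
    let ?x = "(1 / (b - c)) *s (z - y)"
    have "A ?x - c *s ?x = (1 / (b - c)) *s ((A z - c *s z) - (A y - c *s y))"
      by (simp add: clin_scale[OF A] clin_diff[OF A] vec_eq_iff algebra_simps)
    also have "\<dots> = (1 / (b - c)) *s ((b - c) *s z)"
      by (simp add: y vec_eq_iff algebra_simps)
    also have "\<dots> = z" using assms(3) by (simp only: vec.scale_scale) simp
    finally show ?case using y(1) Suc.prems(2) G
      by (intro bexI[of _ ?x]) (auto intro: vec.subspace_diff vec.subspace_scale)
  qed
  then show ?thesis using assms(2) by (auto simp: generalized_eigenspace_def)
qed

text \<open>Strip a root \<open>c\<close> off \<open>p\<close>: by induction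
  \<open>(A - c) y\<close> lies in the span. Every vector of the span equals some
  \<open>(A - c) w\<close>, with \<open>w\<close> in the span, up to a generalized eigenvector for
  \<open>c\<close>; hence \<open>y - w\<close> is itself such a generalized eigenvector.\<close>

lemma poly_apply_zero_imp_span:
  assumes A: "clin A"
  shows "p \<noteq> 0 \<Longrightarrow> poly_apply p A y = 0 \<Longrightarrow> y \<in> vec.span (\<Union>c. generalized_eigenspace A c)"
proof (induction "degree p" arbitrary: p y)
  case 0
  then have "coeff p 0 \<noteq> 0" using leading_coeff_0_iff[of p] by simp
  moreover have "coeff p 0 *s y = 0" using 0 by (simp add: poly_apply_def)
  ultimately show ?case by (simp add: vec.span_zero)
next
  case (Suc d)
  let ?G = "\<Union>c. generalized_eigenspace A c"
  obtain c where "poly p c = 0"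
    using fundamental_theorem_of_algebra_alt[of p] Suc.hyps(2) by (metis degree_pCons_0 Zero_not_Suc)
  then obtain q where q: "p = [:- c, 1:] * q" by (auto simp: poly_eq_0_iff_dvd)
  have q0: "q \<noteq> 0" using q Suc.prems by auto
  then have "degree q = d" using Suc.hyps(2) unfolding q by (subst (asm) degree_mult_eq) auto
  moreover have "poly_apply q A (A y - c *s y) = 0"
    using Suc.prems(2) unfolding q by (simp only: poly_apply_linear_factor[OF A])
  ultimately have z: "A y - c *s y \<in> vec.span ?G" using Suc.hyps(1)[of q] q0 by auto
  have solve: "\<exists>w\<in>vec.span ?G. z - (A w - c *s w) \<in> generalized_eigenspace A c" if "z \<in> vec.span ?G" for z
    using that
  proof (induction rule: vec.span_induct_alt)
    case base
    show ?case using vec.subspace_0[OF subspace_generalized_eigenspace[OF A]]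
      by (intro bexI[of _ 0]) (auto simp: clin_0[OF A] vec.span_zero)
  next
    case (step a x z)
    then obtain w b where w: "w \<in> vec.span ?G" "z - (A w - c *s w) \<in> generalized_eigenspace A c"
      and b: "x \<in> generalized_eigenspace A b" by blast
    obtain u where u: "u \<in> vec.span ?G" "x - (A u - c *s u) \<in> generalized_eigenspace A c"
    proof (cases "b = c")
      case True
      then show ?thesis using that[of 0] b by (simp add: clin_0[OF A] vec.span_zero)
    next
      case False
      obtain u where "u \<in> generalized_eigenspace A b" "A u - c *s u = x"
        using shift_surjective_on_generalized_eigenspace[OF A b False] by blast
      then show ?thesis using that[of u] vec.subspace_0[OF subspace_generalized_eigenspace[OF A]]
        by (auto intro: vec.span_base)
    qed
    have "(a *s x + z) - (A (a *s u + w) - c *s (a *s u + w))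
        = a *s (x - (A u - c *s u)) + (z - (A w - c *s w))"
      by (simp add: clin_add[OF A] clin_scale[OF A] vec_eq_iff algebra_simps)
    moreover have "a *s (x - (A u - c *s u)) + (z - (A w - c *s w)) \<in> generalized_eigenspace A c"
      using u w subspace_generalized_eigenspace[OF A, of c]
      by (intro vec.subspace_add vec.subspace_scale) auto
    ultimately have "(a *s x + z) - (A (a *s u + w) - c *s (a *s u + w)) \<in> generalized_eigenspace A c"
      by (simp only:)
    moreover have "a *s u + w \<in> vec.span ?G" using u w by (intro vec.span_add vec.span_scale)
    ultimately show ?case by blast
  qed
  from solve[OF z] obtain w where w: "w \<in> vec.span ?G"
    "(A y - c *s y) - (A w - c *s w) \<in> generalized_eigenspace A c" by blast
  have "A (y - w) - c *s (y - w) \<in> generalized_eigenspace A c"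
    using w(2) by (simp add: clin_diff[OF A] vec.scale_right_diff_distrib algebra_simps)
  then obtain k where "((\<lambda>z. A z - c *s z) ^^ k) (A (y - w) - c *s (y - w)) = 0"
    by (auto simp: generalized_eigenspace_def)
  then have "((\<lambda>z. A z - c *s z) ^^ Suc k) (y - w) = 0" by (simp only: funpow_Suc_right o_apply)
  then have "y - w \<in> generalized_eigenspace A c" unfolding generalized_eigenspace_def by blast
  then have "(y - w) + w \<in> vec.span ?G"
    using w(1) by (intro vec.span_add) (auto intro: vec.span_base)
  then show ?case by simp
qed

text \<open>The vector and its first \<open>n\<close> iterates are linearly dependent. Coinciding
  iterates are treated apart: as a set they collapse to fewer vectors, which may well be
  independent.\<close>

lemma annihilating_polynomial_exists:
  fixes y :: "complex ^ 'n::finite"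
  shows "\<exists>p. p \<noteq> 0 \<and> poly_apply p A y = 0"
proof -
  let ?n = "CARD('n)"
  have "\<exists>c. (\<exists>i\<le>?n. c i \<noteq> 0) \<and> (\<Sum>i\<le>?n. c i *s (A ^^ i) y) = 0"
  proof (cases "inj_on (\<lambda>i. (A ^^ i) y) {..?n}")
    case True
    let ?S = "(\<lambda>i. (A ^^ i) y) ` {..?n}"
    have "card ?S = Suc ?n" using True by (simp add: card_image)
    moreover have "vec.dim ?S \<le> ?n" by (rule dim_subset_UNIV_cart_gen)
    ultimately have "vec.dependent ?S"
      using vec.dim_eq_card_independent[of ?S] by (metis Suc_n_not_le_n)
    then obtain u v where u: "v \<in> ?S" "u v \<noteq> 0" "(\<Sum>v\<in>?S. u v *s v) = 0"
      using vec.dependent_finite[of ?S] by auto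
    then show ?thesis using True
      by (intro exI[of _ "\<lambda>i. u ((A ^^ i) y)"]) (auto simp: sum.reindex)
  next
    case False
    then obtain i j where ij: "i \<le> ?n" "j \<le> ?n" "i \<noteq> j" "(A ^^ i) y = (A ^^ j) y"
      by (auto simp: inj_on_def)
    let ?c = "\<lambda>k. if k = i then 1 else if k = j then - 1 else (0::complex)"
    have "(\<Sum>k\<le>?n. ?c k *s (A ^^ k) y) = (\<Sum>k\<le>?n. (if k = i then (A ^^ k) y else 0) - (if k = j then (A ^^ k) y else 0))"
      using ij(3) by (intro sum.cong) auto
    also have "\<dots> = 0" using ij by (simp add: sum_subtractf)
    finally show ?thesis using ij(1) by (intro exI[of _ ?c]) auto
  qed
  then obtain c i where c: "i \<le> ?n" "c i \<noteq> 0" "(\<Sum>i\<le>?n. c i *s (A ^^ i) y) = 0" by blast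
  define p where "p = (\<Sum>i\<le>?n. monom (c i) i)"
  have co: "coeff p k = (if k \<le> ?n then c k else 0)" for k
    by (simp add: p_def coeff_sum)
  then have "degree p \<le> ?n" by (intro degree_le) auto
  then have "poly_apply p A y = 0" using c(3) by (simp add: poly_apply_bound co)
  moreover have "p \<noteq> 0" using c(1,2) co[of i] by auto
  ultimately show ?thesis by blast
qed

lemma generalized_eigenspace_decomposition:
  assumes "clin A" shows "direct_decomposition (generalized_eigenspace A)"
proof (rule direct_decompositionI)
  show "vec.span (\<Union>c. generalized_eigenspace A c) = UNIV"
    using annihilating_polynomial_exists poly_apply_zero_imp_span[OF assms] by blast
qed (use assms subspace_generalized_eigenspace generalized_eigenspaces_independent in blast)+

section \<open>The Killing form of a simple Lie algebra\<close>

locale lie =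
  fixes br :: "complex ^ 'n::finite \<Rightarrow> complex ^ 'n \<Rightarrow> complex ^ 'n"
  assumes lie_algebra: "lie_algebra br"
begin

lemma linear_right: "clin (\<lambda>y. br x y)" and linear_left: "clin (\<lambda>x. br x y)"
  and br_self [simp]: "br x x = 0"
  and jacobi_cyclic: "br x (br y z) + br y (br z x) + br z (br x y) = 0"
  using lie_algebra by (auto simp: lie_algebra_def)

lemmas br_linear [simp] =
  clin_0[OF linear_right] clin_0[OF linear_left]
  clin_neg[OF linear_right] clin_neg[OF linear_left]
  clin_scale[OF linear_right] clin_scale[OF linear_left]

lemmas br_add = clin_add[OF linear_right] clin_add[OF linear_left]
lemmas br_diff = clin_diff[OF linear_right] clin_diff[OF linear_left]
lemmas br_sum_right = clin_setsum[OF linear_right]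
lemmas br_sum_left = clin_setsum[OF linear_left]

lemma br_anticommute: "br x y = - br y x"
proof -
  have "br (x + y) (x + y) = br x y + br y x" by (simp add: br_add add.assoc del: br_self) simp
  then show ?thesis by (simp add: eq_neg_iff_add_eq_0)
qed

lemma jacobi: "br x (br y z) = br (br x y) z + br y (br x z)"
  using jacobi_cyclic[of x y z] br_anticommute[of z "br x y"] br_anticommute[of z x]
  by (simp add: algebra_simps add_eq_0_iff)

lemma jacobi_left: "br (br x y) z = br x (br y z) - br y (br x z)"
  using jacobi[of x y z] by simp

abbreviation K where "K \<equiv> killing br"

lemma killing_trace: "K x y = lin_trace (\<lambda>z. br x (br y z))"
  by (simp add: killing_def lin_trace_def)

lemma killing_sym: "K x y = K y x"
  unfolding killing_trace by (rule lin_trace_commute[OF linear_right linear_right])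

lemma killing_add: "K (x + x') y = K x y + K x' y" "K x (y + y') = K x y + K x y'"
  and killing_diff: "K (x - x') y = K x y - K x' y" "K x (y - y') = K x y - K x y'"
  and killing_scale [simp]: "K (c *s x) y = c * K x y" "K x (c *s y) = c * K x y"
  and killing_0 [simp]: "K 0 y = 0" "K x 0 = 0"
  by (simp_all add: killing_trace br_add br_diff lin_trace_add lin_trace_diff lin_trace_smult lin_trace_0)

lemma killing_neg [simp]: "K (- x) y = - K x y" "K x (- y) = - K x y"
  using killing_diff[of 0 x y] killing_diff(2)[of x 0 y] by simp_all

lemma killing_sum: "K (sum g I) y = (\<Sum>i\<in>I. K (g i) y)" "K x (sum g I) = (\<Sum>i\<in>I. K x (g i))"
  by (induction I rule: infinite_finite_induct) (simp_all add: killing_add)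

lemma killing_invariant: "K (br x y) z = K x (br y z)"
proof -
  have "K (br x y) z = lin_trace (\<lambda>w. br x (br y (br z w))) - lin_trace (\<lambda>w. br y (br x (br z w)))"
    by (simp add: killing_trace jacobi_left lin_trace_diff)
  also have "lin_trace (\<lambda>w. br y (br x (br z w))) = lin_trace (\<lambda>w. br x (br z (br y w)))"
    using lin_trace_commute[OF linear_right clin_compose[OF linear_right linear_right], of y x z] .
  finally show ?thesis by (simp add: killing_trace jacobi_left br_diff lin_trace_diff)
qed

lemma killing_invariant': "K (br x y) z = - K y (br x z)"
  using killing_invariant[of y x z] br_anticommute[of x y] by simp

text \<open>Nondegeneracy is injectivity of the map into the dual space, and equal dimensions make
  it surjective. This supplies the duals of the coordinate functionals and the separating functional
  in \<open>double_complement\<close>.\<close>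

lemma killing_represents:
  assumes nondegenerate: "\<And>x. (\<And>y. K x y = 0) \<Longrightarrow> x = 0"
    and \<phi>: "\<And>x y. \<phi> (x + y) = \<phi> x + \<phi> y" "\<And>c x. \<phi> (c *s x) = c * \<phi> x"
  shows "\<exists>b. \<forall>x. K b x = \<phi> x"
proof -
  define T where "T = (\<lambda>x. \<chi> i. K x (axis i 1))"
  have T: "clin T" by (rule clinI) (auto simp: T_def vec_eq_iff killing_add)
  have expand: "\<psi> x = (\<Sum>i\<in>UNIV. x $ i * \<psi> (axis i 1))"
    if "\<And>x y. \<psi> (x + y) = \<psi> x + \<psi> y" "\<And>c x. \<psi> (c *s x) = c * \<psi> x" for x and \<psi> :: "complex ^ 'n \<Rightarrow> complex"
  proof -
    have "\<psi> (sum g I) = (\<Sum>i\<in>I. \<psi> (g i))" if "finite I" for g and I :: "'n set"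
      using that
    proof (induction I rule: finite_induct)
      case empty
      show ?case using \<open>\<And>c x. \<psi> (c *s x) = c * \<psi> x\<close>[of 0 0] by simp
    qed (simp add: \<open>\<And>x y. \<psi> (x + y) = \<psi> x + \<psi> y\<close>)
    from this[of UNIV "\<lambda>i. x $ i *s axis i 1"] show ?thesis by (simp add: basis_expansion that)
  qed
  have "inj T"
  proof (rule injI)
    fix x y assume "T x = T y"
    then have "K (x - y) (axis i 1) = 0" for i by (simp add: T_def vec_eq_iff killing_diff)
    then have "K (x - y) z = 0" for z using expand[of "K (x - y)" z] by (simp add: killing_add)
    then show "x = y" using nondegenerate by (metis eq_iff_diff_eq_0)
  qed
  then have "surj T" by (rule vec.linear_injective_imp_surjective[OF T _ refl])
  then obtain b where "T b = (\<chi> i. \<phi> (axis i 1))" by (metis surjD)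
  then have "K b (axis i 1) = \<phi> (axis i 1)" for i by (simp add: T_def vec_eq_iff)
  then have "K b x = \<phi> x" for x
    using expand[of "K b" x] expand[of \<phi> x] by (simp add: killing_add \<phi>)
  then show ?thesis by blast
qed

text \<open>By the Leibniz rule, \<open>ad x - (a + b)\<close> applied to a bracket gives two
  brackets, in each of which one factor has lost a step of its nilpotency order; induction on the
  sum of the two orders.\<close>

lemma bracket_generalized_eigenspaces:
  assumes "u \<in> generalized_eigenspace (br x) a" "v \<in> generalized_eigenspace (br x) b"
  shows "br u v \<in> generalized_eigenspace (br x) (a + b)"
proof -
  let ?N = "\<lambda>a z. br x z - a *s z"
  have step: "?N (a + b) (br u v) = br (?N a u) v + br u (?N b v)" for u v
    by (simp add: jacobi[of x u v] br_diff vec_eq_iff algebra_simps)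
  note L = clin_funpow[OF clin_shift[OF linear_right[of x], of "a + b"]]
  have "\<exists>k. (?N (a + b) ^^ k) (br u v) = 0" if "(?N a ^^ i) u = 0" "(?N b ^^ j) v = 0" "i + j \<le> n" for i j n u v
    using that
  proof (induction n arbitrary: i j u v)
    case 0
    then show ?case by (intro exI[of _ 0]) simp
  next
    case (Suc n)
    show ?case
    proof (cases "i = 0 \<or> j = 0")
      case True
      then show ?thesis using Suc.prems by (intro exI[of _ 0]) auto
    next
      case False
      then obtain i' j' where ij: "i = Suc i'" "j = Suc j'" by (metis not0_implies_Suc)
      obtain k where k: "(?N (a + b) ^^ k) (br (?N a u) v) = 0"
        using Suc.IH[of i' "?N a u" j v] Suc.prems ij by (auto simp: funpow_Suc_right simp del: funpow.simps)
      obtain l where l: "(?N (a + b) ^^ l) (br u (?N b v)) = 0"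
        using Suc.IH[of i u j' "?N b v"] Suc.prems ij by (auto simp: funpow_Suc_right simp del: funpow.simps)
      have "(?N (a + b) ^^ (k + l)) (br (?N a u) v) = 0" "(?N (a + b) ^^ (k + l)) (br u (?N b v)) = 0"
        using funpow_zero_mono[OF clin_shift[OF linear_right] k] funpow_zero_mono[OF clin_shift[OF linear_right] l]
        by simp_all
      then have "(?N (a + b) ^^ Suc (k + l)) (br u v) = 0"
        by (simp only: funpow_Suc_right o_apply step clin_add[OF L]) simp
      then show ?thesis by blast
    qed
  qed
  then show ?thesis using assms unfolding generalized_eigenspace_def by blast
qed

text \<open>Engel's theorem for the action of \<open>H\<close> on the quotient of \<open>B\<close>
  by \<open>A\<close>. Keeping the pair \<open>A\<close>, \<open>B\<close> variable lets the
  induction hypothesis be used twice: with a maximal proper subalgebra \<open>U\<close> acting on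
  \<open>H\<close> modulo \<open>U\<close>, which shows that \<open>U\<close> has codimension one,
  and with \<open>U\<close> acting on \<open>B\<close> modulo \<open>A\<close>.\<close>

lemma engel_step:
  assumes nil: "\<And>x. ad_nilpotent br x"
    and H: "vec.subspace H" "\<And>x y. x \<in> H \<Longrightarrow> y \<in> H \<Longrightarrow> br x y \<in> H"
    and AB: "vec.subspace A" "vec.subspace B" "A \<subset> B"
      "\<And>x y. x \<in> H \<Longrightarrow> y \<in> A \<Longrightarrow> br x y \<in> A" "\<And>x y. x \<in> H \<Longrightarrow> y \<in> B \<Longrightarrow> br x y \<in> B"
  shows "\<exists>b\<in>B - A. \<forall>x\<in>H. br x b \<in> A"
  using H AB
proof (induction "vec.dim H" arbitrary: H A B rule: less_induct)
  case less
  show ?case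
  proof (cases "H = {0}")
    case True
    then show ?thesis using less.prems vec.subspace_0[of A] by auto
  next
    case False
    define P where "P = (\<lambda>U. vec.subspace U \<and> U \<subset> H \<and> (\<forall>x\<in>U. \<forall>y\<in>U. br x y \<in> U))"
    have "P {0}" using False less.prems(1) by (auto simp: P_def vec.subspace_0)
    moreover have "\<forall>U. P U \<longrightarrow> vec.dim U < Suc CARD('n)"
      by (simp add: less_Suc_eq_le dim_subset_UNIV_cart_gen)
    ultimately have "\<exists>U. P U \<and> (\<forall>V. P V \<longrightarrow> vec.dim V \<le> vec.dim U)"
      by (rule ex_has_greatest_nat)
    then obtain U where U: "P U" "\<And>V. P V \<Longrightarrow> vec.dim V \<le> vec.dim U" by blast
    have sU: "vec.subspace U" "U \<subset> H" "\<And>x y. x \<in> U \<Longrightarrow> y \<in> U \<Longrightarrow> br x y \<in> U"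
      using U(1) by (auto simp: P_def)
    have dU: "vec.dim U < vec.dim H"
      using vec.dim_psubset[of U H] sU less.prems(1) by (simp add: vec.span_eq_iff[THEN iffD2])
    \<comment> \<open>The vector \<open>x\<close> normalizes \<open>U\<close>, so \<open>U\<close>
      and \<open>x\<close> span a subalgebra, which is \<open>H\<close> by maximality of
      \<open>U\<close>.\<close>
    obtain x where x: "x \<in> H" "x \<notin> U" "\<forall>u\<in>U. br u x \<in> U"
      using less.hyps[OF dU sU(1,3) sU(1) less.prems(1) sU(2)] less.prems(2) sU by blast
    define V where "V = {u + c *s x | u c. u \<in> U}"
    have UV: "U \<subseteq> V" unfolding V_def by (force intro: exI[of _ 0])
    have xV: "x \<in> V" unfolding V_def using vec.subspace_0[OF sU(1)] by (force intro: exI[of _ 1])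
    have subV: "vec.subspace V"
      unfolding vec.subspace_def
    proof (intro conjI ballI allI)
      show "0 \<in> V" using UV vec.subspace_0[OF sU(1)] by blast
    next
      fix a b assume "a \<in> V" "b \<in> V"
      then obtain u c u' c' where "a = u + c *s x" "b = u' + c' *s x" "u \<in> U" "u' \<in> U" by (auto simp: V_def)
      then have "a + b = (u + u') + (c + c') *s x" "u + u' \<in> U"
        using vec.subspace_add[OF sU(1)] by (auto simp: vec.scale_left_distrib algebra_simps)
      then show "a + b \<in> V" unfolding V_def by blast
    next
      fix k a assume "a \<in> V"
      then obtain u c where "a = u + c *s x" "u \<in> U" by (auto simp: V_def)
      then have "k *s a = k *s u + (k * c) *s x" "k *s u \<in> U"
        using vec.subspace_scale[OF sU(1)] by (auto simp: vec.scale_right_distrib)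
      then show "k *s a \<in> V" unfolding V_def by blast
    qed
    have brV: "br a b \<in> V" if ab: "a \<in> V" "b \<in> V" for a b
    proof -
      obtain u c u' c' where *: "a = u + c *s x" "b = u' + c' *s x" "u \<in> U" "u' \<in> U"
        using ab by (auto simp: V_def)
      have "br a b = br u u' + c' *s br u x - c *s br u' x"
        using br_anticommute[of x u'] by (simp add: * br_add)
      moreover have "br u u' + c' *s br u x - c *s br u' x \<in> U"
        using * x(3) sU by (intro vec.subspace_diff vec.subspace_add vec.subspace_scale) auto
      ultimately show ?thesis using UV by auto
    qed
    have VH: "V \<subseteq> H" unfolding V_def using x(1) sU(2) less.prems(1)
      by (auto intro!: vec.subspace_add vec.subspace_scale)
    have "V = H"
    proof (rule ccontr)
      assume "V \<noteq> H"
      then have "P V" using VH subV brV by (auto simp: P_def)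
      then have "vec.dim V \<le> vec.dim U" by (rule U(2))
      moreover have "vec.dim U < vec.dim V"
        using vec.dim_psubset[of U V] UV xV x(2) sU(1) subV by (auto simp: vec.span_eq_iff[THEN iffD2])
      ultimately show False by simp
    qed
    have "\<exists>b\<in>B - A. \<forall>u\<in>U. br u b \<in> A"
      using less.hyps[OF dU sU(1,3) less.prems(3,4,5)] less.prems(6,7) sU(2) by blast
    then obtain b where b: "b \<in> B" "b \<notin> A" "\<forall>u\<in>U. br u b \<in> A" by blast
    have bx: "(br x ^^ j) b \<in> B \<and> (\<forall>u\<in>U. br u ((br x ^^ j) b) \<in> A)" for j
    proof (induction j)
      case (Suc j)
      let ?c = "(br x ^^ j) b"
      have "br u (br x ?c) \<in> A" if "u \<in> U" for u
        unfolding jacobi[of u x ?c]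
        using Suc that x less.prems by (intro vec.subspace_add) auto
      then show ?case using Suc x(1) less.prems(7) by simp
    qed (use b in auto)
    \<comment> \<open>The iterates of \<open>b\<close> under \<open>ad x\<close> keep the property
      that \<open>U\<close> moves them into \<open>A\<close>. By nilpotency they enter
      \<open>A\<close>, and the last one outside \<open>A\<close> is the vector sought.\<close>
    obtain k where "(br x ^^ k) b = 0" using nil[of x] by (auto simp: ad_nilpotent_def)
    then have "\<exists>k. (br x ^^ k) b \<in> A" using vec.subspace_0[OF less.prems(3)] by metis
    define k where "k = (LEAST k. (br x ^^ k) b \<in> A)"
    have k: "(br x ^^ k) b \<in> A" unfolding k_def by (rule LeastI_ex) fact
    have "k \<noteq> 0" using k b(2) by (metis funpow_0)
    then obtain j where j: "k = Suc j" by (metis not0_implies_Suc)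
    let ?c = "(br x ^^ j) b"
    have c: "?c \<notin> A" using not_less_Least[of j "\<lambda>k. (br x ^^ k) b \<in> A"] j k_def by auto
    have "br y ?c \<in> A" if y: "y \<in> H" for y
    proof -
      obtain u t where "y = u + t *s x" "u \<in> U" using y \<open>V = H\<close> by (auto simp: V_def)
      then show ?thesis using bx[of j] k j less.prems(3)
        by (auto simp: br_add intro!: vec.subspace_add vec.subspace_scale)
    qed
    then show ?thesis using c bx[of j] by blast
  qed
qed

end

locale nondegenerate_lie = lie +
  assumes killing_nondegenerate: "(\<And>y. K x y = 0) \<Longrightarrow> x = 0"

locale simple_lie = lie +
  assumes simple: "simple_lie_algebra br"
begin

lemma ideal_cases: "lie_ideal br I \<Longrightarrow> I = {0} \<or> I = UNIV"
  and not_abelian: "\<exists>x y. br x y \<noteq> 0"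
  using simple by (auto simp: simple_lie_algebra_def)

lemma centerless: assumes "\<And>y. br y x = 0" shows "x = 0"
proof -
  let ?Z = "{x. \<forall>y. br y x = 0}"
  have "lie_ideal br ?Z" by (auto simp: lie_ideal_def vec.subspace_def br_add)
  then have "?Z = {0}" using ideal_cases not_abelian by fastforce
  then show ?thesis using assms by blast
qed

text \<open>Otherwise Engel's theorem for the algebra acting on itself produces a nonzero central
  element.\<close>

lemma not_all_nilpotent: "\<exists>x. \<not> ad_nilpotent br x"
proof (rule ccontr)
  assume "\<not> ?thesis"
  then have "\<And>x. ad_nilpotent br x" by blast
  moreover have "{0} \<subset> (UNIV :: (complex ^ 'a) set)" using not_abelian by (metis br_linear(1) UNIV_I psubsetI singletonD subset_UNIV)
  ultimately have "\<exists>b\<in>UNIV - {0}. \<forall>x\<in>UNIV. br x b \<in> {0}"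
    by (intro engel_step) (auto simp: vec.subspace_0)
  then show False using centerless by blast
qed

lemma derived_algebra: "vec.span {br x y | x y. True} = UNIV"
proof -
  let ?D = "vec.span {br x y | x y. True}"
  have "lie_ideal br ?D"
    unfolding lie_ideal_def by (auto intro: vec.span_base)
  moreover have "?D \<noteq> {0}" using not_abelian vec.span_base[of _ "{br x y | x y. True}"] by blast
  ultimately show ?thesis using ideal_cases by blast
qed

text \<open>If the Killing form vanished, then the derivation \<open>s\<close> acting on the generalized eigenspaces
  of \<open>ad x\<close> by the conjugate eigenvalues would satisfy \<open>tr (s \<circ> ad x) = 0\<close> because \<open>x\<close> is a sum of
  brackets; but this trace is the sum of the squared absolute values of the eigenvalues.\<close>

lemma killing_not_zero: "\<exists>x y. K x y \<noteq> 0"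
proof (rule ccontr)
  assume "\<not> ?thesis"
  then have K0: "K x y = 0" for x y by blast
  have "ad_nilpotent br x" for x
  proof -
    interpret G: direct_decomposition "generalized_eigenspace (br x)"
      by (rule generalized_eigenspace_decomposition[OF linear_right])
    obtain J where J: "finite J" "\<And>i y. i \<notin> J \<Longrightarrow> G.comp i y = 0" using G.finite_degrees by blast
    define s where "s = (\<lambda>y. \<Sum>c\<in>J. cnj c *s G.comp c y)"
    have s: "clin s" unfolding s_def by (intro clin_sum clin_smult G.component_linear)
    have s_eig: "s y = cnj c *s y" if "y \<in> generalized_eigenspace (br x) c" for c y
    proof (cases "c \<in> J")
      case True
      then show ?thesis using J(1) by (simp add: s_def G.component_of[OF that] if_distrib cong: if_cong)
    next
      case False
      then have "y = 0" using J(2)[of c y] G.component_of[OF that, of c] by simp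
      then show ?thesis using s by (simp add: clin_0)
    qed
    \<comment> \<open>Generalized eigenvalues add under the bracket and complex conjugation is
      additive, so \<open>s\<close> is a derivation.\<close>
    have sbr: "s (br u v) = br (s u) v + br u (s v)" for u v
    proof -
      have "s (br (G.comp a u) (G.comp b v)) = br (s (G.comp a u)) (G.comp b v) + br (G.comp a u) (s (G.comp b v))" for a b
        using s_eig[OF bracket_generalized_eigenspaces[OF G.component_in G.component_in]]
          s_eig[OF G.component_in] by (simp add: vec.scale_left_distrib)
      then have "s (br (\<Sum>a\<in>J. G.comp a u) (\<Sum>b\<in>J. G.comp b v)) =
          br (s (\<Sum>a\<in>J. G.comp a u)) (\<Sum>b\<in>J. G.comp b v) + br (\<Sum>a\<in>J. G.comp a u) (s (\<Sum>b\<in>J. G.comp b v))"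
        by (simp only: br_sum_left br_sum_right clin_setsum[OF s] sum.distrib)
      then show ?thesis using G.sum_components[OF J(1)] J(2) by simp
    qed
    \<comment> \<open>For \<open>y = [u, v]\<close>, cyclicity of the trace and the derivation
      property identify the trace with \<open>K (s u) v\<close>.\<close>
    have tr0: "lin_trace (\<lambda>z. s (br y z)) = 0" if "y \<in> vec.span {br u v | u v. True}" for y
      using that
    proof (induction rule: vec.span_induct_alt)
      case base
      then show ?case using s by (simp add: clin_0 lin_trace_0)
    next
      case (step c y z)
      then obtain u v where y: "y = br u v" by blast
      have "lin_trace (\<lambda>z. s (br y z)) = lin_trace (\<lambda>z. s (br u (br v z))) - lin_trace (\<lambda>z. s (br v (br u z)))"
        by (simp add: y jacobi_left clin_diff[OF s] lin_trace_diff)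
      also have "lin_trace (\<lambda>z. s (br v (br u z))) = lin_trace (\<lambda>z. br u (s (br v z)))"
        by (rule lin_trace_commute[OF clin_compose[OF s linear_right] linear_right])
      also have "lin_trace (\<lambda>z. s (br u (br v z))) - lin_trace (\<lambda>z. br u (s (br v z))) = K (s u) v"
        by (simp add: killing_trace lin_trace_diff[symmetric] sbr)
      finally have "lin_trace (\<lambda>z. s (br y z)) = 0" using K0 by simp
      then show ?case using step.IH
        by (simp add: br_add clin_add[OF s] clin_scale[OF s] lin_trace_add lin_trace_smult)
    qed
    have comp_br: "G.comp c (br x (G.comp c z)) = br x (G.comp c z)" for c z
    proof -
      have "br x (G.comp c z) \<in> generalized_eigenspace (br x) c"
        by (rule generalized_eigenspace_invariant[OF linear_right linear_right _ G.component_in]) simp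
      then show ?thesis by (simp add: G.component_of)
    qed
    \<comment> \<open>On the block of \<open>c\<close>, \<open>ad x\<close> is \<open>c\<close> plus
      a nilpotent operator, and \<open>s\<close> is the scalar \<open>cnj c\<close>.\<close>
    have part: "lin_trace (\<lambda>z. G.comp c (s (br x (G.comp c z)))) = cnj c * c * lin_trace (G.comp c)" for c
    proof -
      let ?N = "\<lambda>z. br x z - c *s z"
      have N: "?N y \<in> generalized_eigenspace (br x) c" if "y \<in> generalized_eigenspace (br x) c" for y
        by (rule generalized_eigenspace_invariant[OF linear_right clin_shift[OF linear_right] _ that]) (simp add: br_diff)
      have Nin: "(?N ^^ k) (G.comp c z) \<in> generalized_eigenspace (br x) c" for k z
        by (induction k) (use G.component_in N in auto)
      have *: "clin (\<lambda>z. ?N (G.comp c z))"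
        by (rule clin_compose[OF clin_shift[OF linear_right] G.component_linear])
      have pow: "((\<lambda>z. ?N (G.comp c z)) ^^ k) (G.comp c z) = (?N ^^ k) (G.comp c z)" for k z
        by (induction k) (simp_all add: G.component_of[OF Nin])
      have "\<exists>k. \<forall>z. ((\<lambda>z. ?N (G.comp c z)) ^^ k) z = 0"
      proof -
        have "\<exists>k. (?N ^^ k) (G.comp c (axis i 1)) = 0" for i
          using G.component_in[of c "axis i 1"] by (auto simp: generalized_eigenspace_def)
        then obtain k where k: "\<And>i. (?N ^^ k i) (G.comp c (axis i 1)) = 0" by metis
        define m where "m = Max (range k)"
        have "(?N ^^ m) (G.comp c (axis i 1)) = 0" for i
          by (rule funpow_zero_mono[OF clin_shift[OF linear_right] k]) (simp add: m_def)
        then have "(?N ^^ m) (G.comp c z) = 0" for z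
          using clin_eqI_axis[OF clin_compose[OF clin_funpow[OF clin_shift[OF linear_right]] G.component_linear] clin_zero]
          by blast
        note nil = this
        \<comment> \<open>One application more than on the block itself: the first one projects an
          arbitrary \<open>z\<close> into the block.\<close>
        have "((\<lambda>z. ?N (G.comp c z)) ^^ Suc m) z = 0" for z
        proof -
          have "((\<lambda>z. ?N (G.comp c z)) ^^ Suc m) z = ((\<lambda>z. ?N (G.comp c z)) ^^ Suc m) (G.comp c z)"
            by (simp only: funpow_Suc_right o_apply G.component_of[OF G.component_in] if_True refl)
          also have "\<dots> = (?N ^^ Suc m) (G.comp c z)" by (rule pow)
          also have "\<dots> = 0" using nil[of z] by simp
          finally show ?thesis .
        qed
        then show ?thesis by blast
      qed
      then have "lin_trace (\<lambda>z. ?N (G.comp c z)) = 0" using lin_trace_nilpotent[OF *] by blast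
      then have "lin_trace (\<lambda>z. br x (G.comp c z)) = c * lin_trace (G.comp c)"
        by (simp add: lin_trace_diff lin_trace_smult)
      moreover have "G.comp c (s (br x (G.comp c z))) = cnj c *s br x (G.comp c z)" for z
        using s_eig[of "br x (G.comp c z)" c] comp_br[of c z] G.component_in[of c "br x (G.comp c z)"]
        by (simp add: clin_scale[OF G.component_linear])
      ultimately show ?thesis by (simp add: lin_trace_smult)
    qed
    have "0 = lin_trace (\<lambda>z. s (br x z))" using tr0[of x] derived_algebra by simp
    also have "\<dots> = (\<Sum>c\<in>J. cnj c * c * lin_trace (G.comp c))"
      using G.lin_trace_components[OF clin_compose[OF s linear_right] J] part by simp
    finally have sum0: "(\<Sum>c\<in>J. cnj c * c * lin_trace (G.comp c)) = 0" by simp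
    have "\<exists>n::nat. lin_trace (G.comp c) = of_nat n \<and> (n = 0 \<longrightarrow> (\<forall>z. G.comp c z = 0))" for c
      by (rule lin_trace_idempotent[OF G.component_linear]) (simp add: G.component_of[OF G.component_in])
    then obtain n where n: "\<And>c. lin_trace (G.comp c) = of_nat (n c)" "\<And>c z. n c = 0 \<Longrightarrow> G.comp c z = 0"
      by metis
    \<comment> \<open>The multiplicities \<open>n c\<close> are natural numbers, so the vanishing
      trace is a sum of nonnegative reals and leaves only the eigenvalue zero: \<open>ad x\<close>
      is nilpotent for every \<open>x\<close>, against Engel.\<close>
    have "(\<Sum>c\<in>J. (cmod c)\<^sup>2 * real (n c)) = 0"
    proof -
      have "complex_of_real (\<Sum>c\<in>J. (cmod c)\<^sup>2 * real (n c)) = (\<Sum>c\<in>J. cnj c * c * lin_trace (G.comp c))"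
        by (simp add: n complex_norm_square[symmetric] mult.commute)
      then show ?thesis using sum0 by (metis of_real_eq_0_iff)
    qed
    then have "\<forall>c\<in>J. (cmod c)\<^sup>2 * real (n c) = 0"
      using J(1) by (subst (asm) sum_nonneg_eq_0_iff) auto
    then have z: "G.comp c z = 0" if "c \<noteq> 0" for c z
      using that n(2)[of c z] J(2)[of c z] by (cases "c \<in> J") auto
    have "z \<in> generalized_eigenspace (br x) 0" for z
    proof -
      have "z = G.comp 0 z"
        by (rule G.component_eqI) (use z in \<open>auto simp: G.component_of[OF G.component_in]\<close>)
      then show ?thesis using G.component_in[of 0 z] by simp
    qed
    then have "\<exists>k. (br x ^^ k) (axis i 1) = 0" for i by (simp add: generalized_eigenspace_def)
    then obtain k where k: "\<And>i. (br x ^^ k i) (axis i 1) = 0" by metis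
    define m where "m = Max (range k)"
    have "(br x ^^ m) (axis i 1) = 0" for i
      by (rule funpow_zero_mono[OF linear_right k]) (simp add: m_def)
    then have "(br x ^^ m) z = 0" for z
      using clin_eqI_axis[OF clin_funpow[OF linear_right] clin_zero] by blast
    then show ?thesis by (auto simp: ad_nilpotent_def)
  qed
  then show False using not_all_nilpotent by blast
qed

lemma killing_radical: assumes "\<And>y. K x y = 0" shows "x = 0"
proof -
  let ?R = "{x. \<forall>y. K x y = 0}"
  have "lie_ideal br ?R"
    by (auto simp: lie_ideal_def vec.subspace_def killing_add killing_invariant')
  then have "?R = {0}" using ideal_cases killing_not_zero by fastforce
  then show ?thesis using assms by blast
qed

sublocale nondegenerate_lie
  by unfold_locales (rule killing_radical)

end

section \<open>Nilpotent representations of sl2\<close>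

text \<open>Abstract operators in place of the adjoint ones, so that every fact about
  \<open>E\<close> and \<open>F\<close> has its mirror image through
  \<open>opposite\<close>.\<close>

locale sl2_operators =
  fixes E H F :: "complex ^ 'n::finite \<Rightarrow> complex ^ 'n"
  assumes E: "clin E" and H: "clin H" and F: "clin F"
    and HE: "H (E x) = E (H x) + 2 *s E x"
    and HF: "H (F x) = F (H x) - 2 *s F x"
    and EF: "E (F x) = F (E x) + H x"
    and E_nilpotent: "\<exists>k. \<forall>x. (E ^^ k) x = 0"
    and F_nilpotent: "\<exists>k. \<forall>x. (F ^^ k) x = 0"
begin

lemma opposite: "sl2_operators F (\<lambda>x. - H x) E"
  using E H F E_nilpotent F_nilpotent
  by unfold_locales
    (auto simp: HE HF EF clin_iff clin_neg vec_eq_iff)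

lemmas lin = clin_add[OF E] clin_add[OF H] clin_add[OF F] clin_diff[OF E] clin_diff[OF H] clin_diff[OF F]
  clin_scale[OF E] clin_scale[OF H] clin_scale[OF F] clin_0[OF E] clin_0[OF H] clin_0[OF F]

text \<open>The falling factorial \<open>H (H - 1) ... (H - k + 1)\<close> applied to
  \<open>x\<close>. Its vanishing restricts the weights to \<open>0, ..., k - 1\<close>.\<close>

fun falling :: "nat \<Rightarrow> complex ^ 'n \<Rightarrow> complex ^ 'n" where
  "falling 0 x = x"
| "falling (Suc k) x = falling k (H x - of_nat k *s x)"

lemma E_F_power:
  assumes "E x = 0" shows "E ((F ^^ Suc k) x) = of_nat (Suc k) *s (F ^^ k) (H x - of_nat k *s x)"
proof -
  note L = clin_funpow[OF F]
  have HFk: "H ((F ^^ k) x) = (F ^^ k) (H x) - (2 * of_nat k) *s (F ^^ k) x" for k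
  proof (induction k)
    case (Suc k)
    then show ?case by (simp add: HF lin)
  qed simp
  show ?thesis
  proof (induction k)
    case 0
    then show ?case using assms by (simp add: EF lin)
  next
    case (Suc k)
    have "E ((F ^^ Suc (Suc k)) x) = F (E ((F ^^ Suc k) x)) + H ((F ^^ Suc k) x)"
      by (simp add: EF)
    also have "\<dots> = of_nat (Suc k) *s (F ^^ Suc k) (H x - of_nat k *s x)
        + ((F ^^ Suc k) (H x) - (2 * of_nat (Suc k)) *s (F ^^ Suc k) x)"
      unfolding Suc HFk by (simp add: lin)
    also have "\<dots> = of_nat (Suc (Suc k)) *s (F ^^ Suc k) (H x - of_nat (Suc k) *s x)"
      by (simp only: clin_diff[OF L] clin_scale[OF L]) (simp add: vec_eq_iff algebra_simps)
    finally show ?case .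
  qed
qed

lemma kernel_E_invariant: "E x = 0 \<Longrightarrow> E (H x - c *s x) = 0"
proof -
  assume "E x = 0"
  then have "E (H x) = 0" using HE[of x] by (simp add: lin)
  then show ?thesis using \<open>E x = 0\<close> by (simp add: lin)
qed

lemma E_power_F_power: "E x = 0 \<Longrightarrow> (E ^^ k) ((F ^^ k) x) = fact k *s falling k x"
proof (induction k arbitrary: x)
  case (Suc k)
  have "(E ^^ Suc k) ((F ^^ Suc k) x) = (E ^^ k) (E ((F ^^ Suc k) x))"
    by (simp only: funpow_Suc_right o_apply)
  also have "\<dots> = of_nat (Suc k) *s (E ^^ k) ((F ^^ k) (H x - of_nat k *s x))"
    by (simp only: E_F_power[OF Suc.prems] clin_scale[OF clin_funpow[OF E]])
  also have "\<dots> = fact (Suc k) *s falling (Suc k) x"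
    using Suc.IH[OF kernel_E_invariant[OF Suc.prems]] by simp
  finally show ?case .
qed simp

text \<open>Choose \<open>N\<close> with \<open>F ^^ N = 0\<close> in
  \<open>E_power_F_power\<close>. Thus highest weight vectors have weights among
  \<open>0, ..., N - 1\<close>.\<close>

lemma falling_kernel: obtains N where "\<And>x. E x = 0 \<Longrightarrow> falling N x = 0"
proof -
  obtain N where "\<And>x. (F ^^ N) x = 0" using F_nilpotent by blast
  then have "falling N x = 0" if "E x = 0" for x
    using E_power_F_power[OF that, of N] clin_0[OF clin_funpow[OF E]] by simp
  then show thesis using that by blast
qed

lemma falling_eigenvector: "H x = c *s x \<Longrightarrow> falling k x = (\<Prod>j<k. c - of_nat j) *s x"
proof (induction k arbitrary: x)
  case (Suc k)
  have "H (H x - of_nat k *s x) = c *s (H x - of_nat k *s x)"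
    using Suc.prems by (simp add: lin)
  then have "falling (Suc k) x = (\<Prod>j<k. c - of_nat j) *s (H x - of_nat k *s x)" using Suc.IH by simp
  also have "H x - of_nat k *s x = (c - of_nat k) *s x"
    using Suc.prems by (simp add: vec.scale_left_diff_distrib)
  finally show ?case by (simp only: vec.scale_scale prod.lessThan_Suc)
qed simp

lemma F_E_power:
  assumes "E (F y) = 0"
  shows "F ((E ^^ Suc k) y) = - (of_nat (Suc k) *s (E ^^ k) (H y + of_nat k *s y))"
proof -
  note L = clin_funpow[OF E]
  have HEk: "H ((E ^^ k) y) = (E ^^ k) (H y) + (2 * of_nat k) *s (E ^^ k) y" for k
  proof (induction k)
    case (Suc k)
    then show ?case by (simp add: HE lin)
  qed simp
  show ?thesis
  proof (induction k)
    case 0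
    show ?case using EF[of y] assms by (simp add: eq_neg_iff_add_eq_0)
  next
    case (Suc k)
    have "F ((E ^^ Suc (Suc k)) y) = E (F ((E ^^ Suc k) y)) - H ((E ^^ Suc k) y)"
      using EF[of "(E ^^ Suc k) y"] by simp
    also have "\<dots> = - (of_nat (Suc k) *s (E ^^ Suc k) (H y + of_nat k *s y))
        - ((E ^^ Suc k) (H y) + (2 * of_nat (Suc k)) *s (E ^^ Suc k) y)"
      unfolding Suc HEk by (simp add: clin_neg[OF E] lin)
    also have "\<dots> = - (of_nat (Suc (Suc k)) *s (E ^^ Suc k) (H y + of_nat (Suc k) *s y))"
      by (simp only: clin_add[OF L] clin_scale[OF L]) (simp add: vec_eq_iff algebra_simps)
    finally show ?case .
  qed
qed

text \<open>Induction on the order \<open>k\<close> with which \<open>E\<close> kills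
  \<open>y\<close>. By \<open>F_E_power\<close> the vector \<open>H y + k y\<close> is killed one
  step earlier, and the induction hypothesis for it says that \<open>F y\<close> has weight
  \<open>- (k + 2)\<close>. This is negative, whereas \<open>ker E\<close> has only nonnegative
  weights.\<close>

lemma kernel_E_Int_range_F:
  assumes "E (F y) = 0" shows "F y = 0"
proof -
  obtain N where N: "\<And>x. E x = 0 \<Longrightarrow> falling N x = 0" using falling_kernel by blast
  have "E (F y) = 0 \<Longrightarrow> (E ^^ k) y = 0 \<Longrightarrow> F y = 0" for k y
  proof (induction k arbitrary: y)
    case 0
    then show ?case by (simp add: lin)
  next
    case (Suc k)
    let ?y = "H y + of_nat k *s y"
    have F': "F ?y = H (F y) + of_nat (k + 2) *s F y"
      by (simp add: lin HF vec_eq_iff algebra_simps)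
    have "E (H (F y)) = 0" using kernel_E_invariant[of "F y" 0] Suc.prems(1) by (simp add: lin)
    then have "E (F ?y) = 0" using Suc.prems(1) unfolding F' by (simp add: lin)
    moreover have "(E ^^ k) ?y = 0"
    proof -
      have "of_nat (Suc k) *s (E ^^ k) ?y = 0"
        using F_E_power[OF Suc.prems(1), of k] Suc.prems(2)
        by (simp only: lin(9) neg_equal_0_iff_equal neg_0_equal_iff_equal clin_0[OF F])
      then show ?thesis by (metis of_nat_eq_0_iff nat.distinct(1) vec.scale_eq_0_iff)
    qed
    ultimately have "F ?y = 0" by (rule Suc.IH)
    then have "H (F y) = (- of_nat (k + 2)) *s F y"
      by (simp only: F' add_eq_0_iff2 vec.scale_minus_left)
    then have "(\<Prod>j<N. - of_nat (k + 2) - of_nat j) *s F y = 0"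
      using falling_eigenvector N[OF Suc.prems(1)] by metis
    moreover have "(\<Prod>j<N. - of_nat (k + 2) - of_nat j) \<noteq> (0::complex)"
    proof -
      have "- of_nat (k + 2) - of_nat j = - (of_nat (k + 2 + j) :: complex)" for j by simp
      then show ?thesis by (simp only: prod_zero_iff finite_lessThan neg_equal_0_iff_equal of_nat_eq_0_iff) simp
    qed
    ultimately show ?case by simp
  qed
  moreover obtain k where "(E ^^ k) y = 0" using E_nilpotent by blast
  ultimately show ?thesis using assms by blast
qed

end

context sl2_operators begin

interpretation opp: sl2_operators F "\<lambda>x. - H x" E by (rule opposite)

lemma kernel_F_Int_range_E: "F (E y) = 0 \<Longrightarrow> E y = 0"
  by (rule opp.kernel_E_Int_range_F)

text \<open>\<open>ker E\<close> meets \<open>range F\<close> trivially, and so do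
  \<open>ker F\<close> and \<open>range E\<close>. Hence each of the two sums of dimensions is at
  most the full dimension, while by rank and nullity together they make up twice that dimension;
  both are equalities.\<close>

lemma kernel_E_plus_range_F: "\<exists>a b. x = a + F b \<and> E a = 0"
proof -
  let ?S = "\<lambda>E F. {x + y | x y. x \<in> {x. E x = 0} \<and> y \<in> range F}"
  have "{x. E x = 0} \<inter> range F = {0}" "{x. F x = 0} \<inter> range E = {0}"
    using kernel_E_Int_range_F kernel_F_Int_range_E clin_0[OF E] clin_0[OF F]
    by (auto intro: range_eqI[of 0 _ 0])
  then have s: "vec.dim (?S E F) = vec.dim {x. E x = 0} + vec.dim (range F)"
    "vec.dim (?S F E) = vec.dim {x. F x = 0} + vec.dim (range E)"
    using vec.dim_sums_Int[OF subspace_kernel[OF E] subspace_range[OF F]]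
      vec.dim_sums_Int[OF subspace_kernel[OF F] subspace_range[OF E]]
    by simp_all
  have "vec.dim (?S E F) \<le> CARD('n)" "vec.dim (?S F E) \<le> CARD('n)"
    by (rule dim_subset_UNIV_cart_gen)+
  then have "vec.dim (?S E F) = CARD('n)"
    using s dim_kernel_range[OF E] dim_kernel_range[OF F] by linarith
  then have "vec.span (?S E F) = UNIV"
    using vec.dim_eq_full[of "?S E F"] by (simp only: vec.dimension_def card_cart_basis simp_thms)
  moreover have "vec.subspace (?S E F)"
    by (rule vec.subspace_sums[OF subspace_kernel[OF E] subspace_range[OF F]])
  ultimately have "x \<in> ?S E F" by (simp add: vec.span_eq_iff[THEN iffD2])
  then show ?thesis by blast
qed

definition eigenspaces_span :: "(complex ^ 'n) set" where
  "eigenspaces_span = vec.span {x. \<exists>i::int. H x = of_int i *s x}"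

text \<open>Lagrange interpolation one root at a time: \<open>falling k x\<close> is an eigenvector
  for \<open>k\<close>, and subtracting its multiple by the inverse of \<open>?c\<close>, the value
  of the falling factorial at \<open>k\<close>, leaves a vector annihilated by the shorter
  product.\<close>

lemma falling_zero_imp_span: "falling k x = 0 \<Longrightarrow> x \<in> eigenspaces_span"
proof (induction k arbitrary: x)
  case 0
  then show ?case by (simp add: eigenspaces_span_def vec.span_zero)
next
  case (Suc k)
  have comm: "H (falling k x) = falling k (H x)" for k x
    by (induction k arbitrary: x) (simp_all add: lin)
  have falin: "clin (falling k)" for k
  proof (rule clinI)
    show "falling k (x + y) = falling k x + falling k y" for x y
    proof (induction k arbitrary: x y)
      case (Suc k)
      have "H (x + y) - of_nat k *s (x + y) = (H x - of_nat k *s x) + (H y - of_nat k *s y)"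
        by (simp add: lin)
      then show ?case using Suc by (simp only: falling.simps)
    qed simp
    show "falling k (c *s x) = c *s falling k x" for c x
    proof (induction k arbitrary: x)
      case (Suc k)
      have "H (c *s x) - of_nat k *s (c *s x) = c *s (H x - of_nat k *s x)"
        by (simp add: lin)
      then show ?case using Suc by (simp only: falling.simps)
    qed simp
  qed
  let ?y = "falling k x"
  have "H ?y = of_nat k *s ?y"
    using Suc.prems by (simp add: comm clin_diff[OF falin] clin_scale[OF falin])
  then have y: "H ?y = of_int (int k) *s ?y" by simp
  let ?c = "\<Prod>j<k. of_nat k - of_nat j :: complex"
  have c: "?c \<noteq> 0" by (auto simp: prod_zero_iff)
  have "falling k ?y = ?c *s ?y"
    using falling_eigenvector[of ?y "of_nat k" k] y by simp
  then have "falling k (x - (1 / ?c) *s ?y) = 0"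
    using c by (simp add: clin_diff[OF falin] clin_scale[OF falin])
  then have "x - (1 / ?c) *s ?y \<in> eigenspaces_span" by (rule Suc.IH)
  moreover have "(1 / ?c) *s ?y \<in> eigenspaces_span"
    unfolding eigenspaces_span_def using y by (intro vec.span_scale vec.span_base) blast
  ultimately have "(x - (1 / ?c) *s ?y) + (1 / ?c) *s ?y \<in> eigenspaces_span"
    unfolding eigenspaces_span_def by (rule vec.span_add)
  then show ?case by simp
qed

text \<open>Repeated splitting \<open>x = a + F b\<close> with \<open>a\<close> in
  \<open>ker E\<close> exhausts \<open>x\<close>, as \<open>F\<close> is nilpotent. The
  \<open>a\<close> are sums of eigenvectors by \<open>falling_kernel\<close>, and \<open>F\<close>
  maps eigenvectors to eigenvectors.\<close>

lemma H_diagonalizable: "eigenspaces_span = UNIV"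
proof -
  let ?S = "{x. \<exists>i::int. H x = of_int i *s x}"
  have Finv: "F x \<in> eigenspaces_span" if "x \<in> eigenspaces_span" for x
    using that unfolding eigenspaces_span_def
  proof (induction rule: vec.span_induct_alt)
    case base
    then show ?case by (simp add: lin vec.span_zero)
  next
    case (step c x y)
    then obtain i :: int where "H x = of_int i *s x" by blast
    then have "H (F x) = of_int (i - 2) *s F x" by (simp add: HF lin)
    then have "F x \<in> ?S" by blast
    then show ?case using step.IH by (simp add: lin vec.span_add vec.span_base vec.span_scale)
  qed
  have Fk: "(F ^^ k) x \<in> eigenspaces_span" if "x \<in> eigenspaces_span" for x k
    by (induction k) (use that Finv in auto)
  obtain N where N: "\<And>x. E x = 0 \<Longrightarrow> falling N x = 0" using falling_kernel by blast
  have "\<exists>s\<in>eigenspaces_span. \<exists>b. x = s + (F ^^ k) b" for k x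
  proof (induction k arbitrary: x)
    case 0
    show ?case by (rule bexI[of _ 0]) (auto simp: eigenspaces_span_def vec.span_zero)
  next
    case (Suc k)
    then obtain s b where sb: "s \<in> eigenspaces_span" "x = s + (F ^^ k) b" by blast
    obtain a b' where ab: "b = a + F b'" "E a = 0" using kernel_E_plus_range_F by blast
    have "x = (s + (F ^^ k) a) + (F ^^ Suc k) b'"
      by (simp only: sb ab clin_add[OF clin_funpow[OF F]] funpow_Suc_right o_apply add.assoc)
    moreover have "s + (F ^^ k) a \<in> eigenspaces_span"
      using sb(1) Fk[OF falling_zero_imp_span[OF N[OF ab(2)]]]
      unfolding eigenspaces_span_def by (rule vec.span_add)
    ultimately show ?case by blast
  qed
  moreover obtain k where "\<And>x. (F ^^ k) x = 0" using F_nilpotent by blast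
  ultimately have "x \<in> eigenspaces_span" for x by (metis add.right_neutral)
  then show ?thesis by blast
qed

end

section \<open>The adjoint action of the triple and the Dynkin grading\<close>

locale simple_sl2 = simple_lie br
  for br :: "complex ^ 'n::finite \<Rightarrow> complex ^ 'n \<Rightarrow> complex ^ 'n" +
  fixes e h f :: "complex ^ 'n"
  assumes triple: "sl2_triple br e h f" and f_nilpotent: "ad_nilpotent br f"
begin

lemma brackets: "br h e = 2 *s e" "br h f = - (2 *s f)" "br e f = h"
  using triple by (simp_all add: sl2_triple_def)

text \<open>\<open>ad e\<close> raises the generalized eigenvalues of \<open>ad h\<close> by 2, and
  only finitely many occur. \<open>N\<close> exceeds the sum of their absolute values, so a shift by
  \<open>2 N\<close> leaves this finite set.\<close>

lemma e_nilpotent: "\<exists>k. \<forall>x. (br e ^^ k) x = 0"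
proof -
  interpret G: direct_decomposition "generalized_eigenspace (br h)"
    by (rule generalized_eigenspace_decomposition[OF linear_right])
  obtain J where J: "finite J" "\<And>i y. i \<notin> J \<Longrightarrow> G.comp i y = 0" using G.finite_degrees by blast
  obtain N :: nat where N: "(\<Sum>c\<in>J. cmod c) < real N" using reals_Archimedean2 by blast
  have e: "e \<in> generalized_eigenspace (br h) 2"
    unfolding generalized_eigenspace_def by (rule CollectI, rule exI[of _ 1]) (simp add: brackets)
  have shift: "(br e ^^ k) y \<in> generalized_eigenspace (br h) (c + 2 * of_nat k)"
    if "y \<in> generalized_eigenspace (br h) c" for k c y
  proof (induction k)
    case (Suc k)
    then show ?case using bracket_generalized_eigenspaces[OF e Suc] by (simp add: algebra_simps)
  qed (use that in simp)
  have bound: "cmod c \<le> (\<Sum>c\<in>J. cmod c)" if "c \<in> J" for c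
    using member_le_sum[of c J cmod] J(1) that by simp
  have "c + 2 * of_nat N \<notin> J" if "c \<in> J" for c
  proof
    assume d: "c + 2 * of_nat N \<in> J"
    have "cmod (2 * of_nat N) \<le> cmod (c + 2 * of_nat N) + cmod c"
      using norm_triangle_ineq4[of "c + 2 * of_nat N" c] by simp
    then have "2 * real N \<le> 2 * (\<Sum>c\<in>J. cmod c)" using bound[OF that] bound[OF d] by (simp add: norm_mult)
    then show False using N by simp
  qed
  then have zero: "(br e ^^ N) (G.comp c y) = 0" if "c \<in> J" for c y
    using J(2)[of "c + 2 * of_nat N" "(br e ^^ N) (G.comp c y)"] that
      G.component_of[OF shift[OF G.component_in], of "c + 2 * of_nat N" N c y] by simp
  have "(br e ^^ N) y = 0" for y
  proof -
    have "(br e ^^ N) (\<Sum>c\<in>J. G.comp c y) = 0"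
      using zero by (simp add: clin_setsum[OF clin_funpow[OF linear_right]])
    then show ?thesis using G.sum_components[OF J(1)] J(2) by simp
  qed
  then show ?thesis by blast
qed

sublocale sl2: sl2_operators "br e" "br h" "br f"
proof
  show "br h (br e x) = br e (br h x) + 2 *s br e x" for x
    by (simp add: jacobi[of h e] brackets)
  show "br h (br f x) = br f (br h x) - 2 *s br f x" for x
    by (simp add: jacobi[of h f] brackets)
  show "br e (br f x) = br f (br e x) + br h x" for x
    by (simp add: jacobi[of e f] brackets)
  show "\<exists>k. \<forall>x. (br f ^^ k) x = 0" using f_nilpotent by (simp add: ad_nilpotent_def)
qed (simp_all add: br_add e_nilpotent)

sublocale opp: sl2_operators "br f" "\<lambda>x. - br h x" "br e" by (rule sl2.opposite)

definition R :: "complex ^ 'n \<Rightarrow> complex ^ 'n" where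
  "R x = (THE u. u \<in> range (br f) \<and> br f (x - br e u) = 0)"

text \<open>The algebra is the direct sum of \<open>ker (ad f)\<close> and
  \<open>[e, [f, g]]\<close>: existence comes from the two sl2 decompositions, uniqueness from the
  two trivial intersections.\<close>

lemma R_ex1: "\<exists>!u. u \<in> range (br f) \<and> br f (x - br e u) = 0"
proof -
  obtain k b where kb: "x = k + br e b" "br f k = 0" using opp.kernel_E_plus_range_F by blast
  obtain a c where ac: "b = a + br f c" "br e a = 0" using sl2.kernel_E_plus_range_F by blast
  show ?thesis
  proof (rule ex1I[of _ "br f c"])
    show "br f c \<in> range (br f) \<and> br f (x - br e (br f c)) = 0"
      using kb ac by (simp add: br_add)
  next
    fix u assume u: "u \<in> range (br f) \<and> br f (x - br e u) = 0"
    then obtain d where d: "u = br f d" by blast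
    have "br f (br e (br f c - u)) = br f (x - br e u) - br f (x - br e (br f c))"
      by (simp add: br_diff)
    also have "\<dots> = 0" using u kb ac by (simp add: br_add)
    finally have "br e (br f c - u) = 0" by (rule sl2.kernel_F_Int_range_E)
    moreover have "br f c - u = br f (c - d)" by (simp add: d br_diff)
    ultimately show "u = br f c" using sl2.kernel_E_Int_range_F by (metis eq_iff_diff_eq_0)
  qed
qed

lemma R_range: "R x \<in> range (br f)" and R_solves: "br f (x - br e (R x)) = 0"
  using theI'[OF R_ex1[of x]] by (simp_all add: R_def)

lemma R_unique: "\<lbrakk>u \<in> range (br f); br f (x - br e u) = 0\<rbrakk> \<Longrightarrow> R x = u"
  using R_ex1[of x] R_range[of x] R_solves[of x] by blast

lemma R_linear: "clin R"
proof (rule clinI)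
  note S = subspace_range[OF linear_right[of f]]
  show "R (x + y) = R x + R y" for x y
    using R_solves[of x] R_solves[of y]
    by (intro R_unique vec.subspace_add[OF S] R_range) (simp add: br_add br_diff algebra_simps)
  show "R (c *s x) = c *s R x" for c x
  proof (intro R_unique vec.subspace_scale[OF S] R_range)
    have "br f (c *s x - br e (c *s R x)) = c *s br f (x - br e (R x))"
      by (simp add: br_diff vec.scale_right_diff_distrib)
    then show "br f (c *s x - br e (c *s R x)) = 0" by (simp add: R_solves)
  qed
qed

lemma R_inverse: "u \<in> range (br f) \<Longrightarrow> R (br e u) = u"
  by (rule R_unique) auto

lemma R_eq_0_iff: "R x = 0 \<longleftrightarrow> br f x = 0"
  using R_solves[of x] R_unique[of 0 x] by (auto intro: range_eqI[of 0 _ 0])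

text \<open>Write \<open>x = a + [f, b]\<close> with \<open>a\<close> in \<open>ker (ad e)\<close>.
  By invariance \<open>a\<close> is orthogonal to \<open>[e, g]\<close> as well as to
  \<open>ker (ad f)\<close>, and these two span the algebra.\<close>

lemma kernel_annihilator:
  assumes "\<And>t. br f t = 0 \<Longrightarrow> K x t = 0" shows "x \<in> range (br f)"
proof -
  obtain a b where ab: "x = a + br f b" "br e a = 0" using sl2.kernel_E_plus_range_F by blast
  have a: "K a t = 0" if "br f t = 0" for t
    using assms[OF that] that by (simp add: ab killing_add killing_invariant')
  have "K a y = 0" for y
  proof -
    obtain k u where "y = k + br e u" "br f k = 0" using opp.kernel_E_plus_range_F by blast
    then show ?thesis using a ab(2) killing_invariant'[of e a u] by (simp add: killing_add)
  qed
  then have "a = 0" by (rule killing_nondegenerate)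
  then show ?thesis using ab by simp
qed

text \<open>Spanning is the diagonalizability of \<open>ad h\<close>; independence is inherited from
  the generalized eigenspaces through the embedding of the integers into the complex
  numbers.\<close>

lemma dynkin_decomposition: "direct_decomposition (dynkin_grading br h)"
proof (rule direct_decompositionI)
  show sub: "vec.subspace (dynkin_grading br h i)" for i
    unfolding dynkin_grading_def vec.subspace_def by (auto simp: br_add vec.scale_right_distrib mult.commute)
  have "(\<Union>i. dynkin_grading br h i) = {x. \<exists>i::int. br h x = of_int i *s x}"
    by (auto simp: dynkin_grading_def)
  then show "vec.span (\<Union>i. dynkin_grading br h i) = UNIV"
    using sl2.H_diagonalizable by (simp add: sl2.eigenspaces_span_def)
  fix J and v :: "int \<Rightarrow> complex ^ 'n"
  assume J: "finite J" "\<And>j. j \<in> J \<Longrightarrow> v j \<in> dynkin_grading br h j" "sum v J = 0"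
  let ?v = "\<lambda>c. v (inv (of_int :: int \<Rightarrow> complex) c)"
  have inj: "inj (of_int :: int \<Rightarrow> complex)" by (simp add: inj_on_def)
  have "sum ?v (of_int ` J) = 0"
    using J(3) inj by (subst sum.reindex) (auto simp: inj_on_def)
  moreover have "?v c \<in> generalized_eigenspace (br h) c" if "c \<in> of_int ` J" for c
    unfolding generalized_eigenspace_def
    using that J(2) inj by (intro CollectI exI[of _ 1]) (auto simp: dynkin_grading_def)
  ultimately have "\<forall>c\<in>of_int ` J. ?v c = 0"
    by (intro generalized_eigenspaces_independent[OF linear_right]) (use J(1) in auto)
  then show "\<forall>j\<in>J. v j = 0" using inj by simp
qed

text \<open>The weights of \<open>ker (ad e)\<close> are nonnegative and those of
  \<open>ker (ad f)\<close> are nonpositive. The former gives surjectivity of \<open>ad f\<close> in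
  degrees at most 1, the latter injectivity in degrees at least 1.\<close>

lemma dynkin_good: "good_grading br f (dynkin_grading br h)"
  and dynkin_compatible: "compatible_grading e h (dynkin_grading br h)"
proof -
  interpret D: direct_decomposition "dynkin_grading br h" by (rule dynkin_decomposition)
  show "compatible_grading e h (dynkin_grading br h)"
    by (simp add: compatible_grading_def dynkin_grading_def brackets)
  have e: "e \<in> dynkin_grading br h 2" and f: "f \<in> dynkin_grading br h (- 2)"
    by (simp_all add: dynkin_grading_def brackets)
  have br: "br x y \<in> dynkin_grading br h (i + j)"
    if "x \<in> dynkin_grading br h i" "y \<in> dynkin_grading br h j" for x y i j
    using that by (simp add: dynkin_grading_def jacobi[of h x y] vec.scale_left_distrib)
  have kerE: "x = 0" if "br e x = 0" "x \<in> dynkin_grading br h i" "i \<le> - 1" for x i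
  proof -
    obtain a b where ab: "x = a + br f b" "br e a = 0" using sl2.kernel_E_plus_range_F by blast
    obtain N where N: "\<And>x. br e x = 0 \<Longrightarrow> sl2.falling N x = 0" using sl2.falling_kernel by blast
    have "(\<Prod>j<N. of_int i - of_nat j) *s x = 0"
      using sl2.falling_eigenvector[of x "of_int i" N] that N[OF that(1)] by (simp add: dynkin_grading_def)
    moreover have "(\<Prod>j<N. of_int i - of_nat j) \<noteq> (0::complex)"
    proof -
      have "of_int i - of_nat j = (of_int (i - int j) :: complex)" for j by simp
      then show ?thesis using that(3) by (simp only: prod_zero_iff finite_lessThan of_int_eq_0_iff) auto
    qed
    ultimately show ?thesis by simp
  qed
  have kerF: "x = 0" if "br f x = 0" "x \<in> dynkin_grading br h i" "i \<ge> 1" for x i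
  proof -
    obtain N where N: "\<And>x. br f x = 0 \<Longrightarrow> opp.falling N x = 0" using opp.falling_kernel by blast
    have "(\<Prod>j<N. of_int (- i) - of_nat j) *s x = 0"
      using opp.falling_eigenvector[of x "of_int (- i)" N] that N[OF that(1)] by (simp add: dynkin_grading_def)
    moreover have "(\<Prod>j<N. of_int (- i) - of_nat j) \<noteq> (0::complex)"
    proof -
      have "of_int (- i) - of_nat j = (of_int (- i - int j) :: complex)" for j by simp
      then show ?thesis using that(3) by (simp only: prod_zero_iff finite_lessThan of_int_eq_0_iff) auto
    qed
    ultimately show ?thesis by simp
  qed
  have surj: "br f ` dynkin_grading br h j = dynkin_grading br h (j - 2)" if "j \<le> 1" for j
  proof
    show "br f ` dynkin_grading br h j \<subseteq> dynkin_grading br h (j - 2)"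
      using br[OF f, of _ j] by (auto simp: add.commute)
    show "dynkin_grading br h (j - 2) \<subseteq> br f ` dynkin_grading br h j"
    proof
      fix x assume x: "x \<in> dynkin_grading br h (j - 2)"
      obtain a b where ab: "x = a + br f b" "br e a = 0" using sl2.kernel_E_plus_range_F by blast
      have "D.comp (j - 2 + 2) (br e a) = br e (D.comp (j - 2) a)" for a
        by (rule D.component_commute[OF linear_right, where s = "\<lambda>i. i + 2"])
           (use br[OF e] in \<open>auto simp: inj_on_def add.commute\<close>)
      then have "br e (D.comp (j - 2) a) = 0"
        using ab(2) by (metis D.component_linear clin_0)
      \<comment> \<open>The degree \<open>j - 2\<close> is negative, and there
        \<open>ker (ad e)\<close> is trivial.\<close>
      then have a0: "D.comp (j - 2) a = 0" using that by (intro kerE[OF _ D.component_in]) auto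
      have "D.comp (j - 2) (br f b) = br f (D.comp j b)"
        by (rule D.component_commute[OF linear_right, where s = "\<lambda>i. i - 2"])
           (use br[OF f] in \<open>auto simp: inj_on_def add.commute\<close>)
      moreover have "D.comp (j - 2) x = x" using D.component_of[OF x] by simp
      ultimately have "x = br f (D.comp j b)"
        using a0 ab(1) clin_add[OF D.component_linear, of "j - 2" a "br f b"] by simp
      then show "x \<in> br f ` dynkin_grading br h j" using D.component_in by blast
    qed
  qed
  show "good_grading br f (dynkin_grading br h)"
    unfolding good_grading_def lie_grading_def
  proof (intro conjI allI ballI impI)
    show "\<exists>!c. (\<forall>i. c i \<in> dynkin_grading br h i) \<and> finite {i. c i \<noteq> 0} \<and> x = (\<Sum>i | c i \<noteq> 0. c i)" for x
      by (rule D.decomposition)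
    show "inj_on (br f) (dynkin_grading br h j)" if "1 \<le> j" for j
    proof (rule inj_onI)
      fix x y assume xy: "x \<in> dynkin_grading br h j" "y \<in> dynkin_grading br h j" "br f x = br f y"
      have "br f (x - y) = 0" using xy(3) by (simp add: br_diff)
      from this have "x - y = 0" by (rule kerF[OF _ vec.subspace_diff[OF D.subspace xy(1,2)] that])
      then show "x = y" by simp
    qed
    show "vec.subspace (dynkin_grading br h i)" for i by (rule D.subspace)
    show "f \<in> dynkin_grading br h (- 2)" by (rule f)
    show "br f ` dynkin_grading br h j = dynkin_grading br h (j - 2)" if "j \<le> 1" for j by (rule surj[OF that])
    show "br x y \<in> dynkin_grading br h (i + j)"
      if "x \<in> dynkin_grading br h i" "y \<in> dynkin_grading br h j" for i j x y by (rule br[OF that])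
  qed
qed

end

section \<open>Good gradings\<close>

text \<open>All that the reduction needs to know about a good grading: the filtration
  \<open>Fil k = \<Oplus>\<^sub>i\<^sub>\<le>\<^sub>k \<Gamma> i\<close> and a partial inverse \<open>R\<close> of \<open>ad e\<close>, with kernel \<open>ker (ad f)\<close>, lowering it by 2.\<close>

locale slice = nondegenerate_lie br
  for br :: "complex ^ 'n::finite \<Rightarrow> complex ^ 'n \<Rightarrow> complex ^ 'n" +
  fixes e f :: "complex ^ 'n" and R :: "complex ^ 'n \<Rightarrow> complex ^ 'n"
    and Fil :: "int \<Rightarrow> (complex ^ 'n) set" and depth :: nat
  assumes R_linear: "clin R"
    and R_inverse: "u \<in> range (br f) \<Longrightarrow> R (br e u) = u"
    and R_range: "R x \<in> range (br f)"
    and R_eq_0_iff: "R x = 0 \<longleftrightarrow> br f x = 0"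
    and kernel_annihilator: "(\<And>t. br f t = 0 \<Longrightarrow> K x t = 0) \<Longrightarrow> x \<in> range (br f)"
    and Fil_subspace: "vec.subspace (Fil k)"
    and Fil_mono: "i \<le> j \<Longrightarrow> Fil i \<subseteq> Fil j"
    and Fil_br: "x \<in> Fil i \<Longrightarrow> y \<in> Fil j \<Longrightarrow> br x y \<in> Fil (i + j)"
    and Fil_top: "Fil (int depth) = UNIV"
    and Fil_bot: "Fil (- int depth) = {0}"
    and e_Fil: "e \<in> Fil 2"
    and kernel_Fil: "br f x = 0 \<Longrightarrow> x \<in> Fil 0"
    and R_Fil: "x \<in> Fil k \<Longrightarrow> R x \<in> Fil (k - 2)"
    and Fil_range: "Fil (- 1) \<subseteq> range (br f)"
    and killing_Fil: "x \<in> Fil 0 \<Longrightarrow> y \<in> Fil (- 1) \<Longrightarrow> K x y = 0"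

text \<open>\<open>M\<close> and \<open>N\<close> are m and n, and the annihilator of
  \<open>N\<close> is b. The last three axioms put b into \<open>Fil 1\<close>,
  \<open>[e, m]\<close> into b and \<open>R b\<close> into m; together they express b as
  \<open>ker (ad f) + [e, m]\<close>, the linear form of transversality of \<open>Q\<close> to the
  orbits in \<open>S\<close>.\<close>

locale slice_isotropic = slice +
  fixes M N :: "(complex ^ 'a) set"
  assumes M_subspace: "vec.subspace M" and N_subspace: "vec.subspace N"
    and Fil_M: "Fil (- 2) \<subseteq> M" and M_N: "M \<subseteq> N" and N_Fil: "N \<subseteq> Fil (- 1)"
    and B_Fil: "(\<And>y. y \<in> N \<Longrightarrow> K x y = 0) \<Longrightarrow> x \<in> Fil 1"
    and e_M: "m \<in> M \<Longrightarrow> y \<in> N \<Longrightarrow> K (br e m) y = 0"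
    and R_B: "(\<And>y. y \<in> N \<Longrightarrow> K x y = 0) \<Longrightarrow> R x \<in> M"

locale good_data = simple_sl2 br e h f
  for br :: "complex ^ 'n::finite \<Rightarrow> complex ^ 'n \<Rightarrow> complex ^ 'n" and e h f :: "complex ^ 'n" +
  fixes \<Gamma> :: "int \<Rightarrow> (complex ^ 'n) set"
  assumes good: "good_grading br f \<Gamma>" and compatible: "compatible_grading e h \<Gamma>"
begin

sublocale grad: direct_decomposition \<Gamma>
  using good by unfold_locales (auto simp: good_grading_def lie_grading_def)

lemma grading_br: "x \<in> \<Gamma> i \<Longrightarrow> y \<in> \<Gamma> j \<Longrightarrow> br x y \<in> \<Gamma> (i + j)"
  and f_degree: "f \<in> \<Gamma> (- 2)" and e_degree: "e \<in> \<Gamma> 2"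
  and f_injective: "j \<ge> 1 \<Longrightarrow> inj_on (br f) (\<Gamma> j)"
  and f_surjective: "j \<le> 1 \<Longrightarrow> br f ` \<Gamma> j = \<Gamma> (j - 2)"
  using good compatible by (auto simp: good_grading_def lie_grading_def compatible_grading_def)

definition Fil :: "int \<Rightarrow> (complex ^ 'n) set" where
  "Fil k = {x. \<forall>i>k. grad.comp i x = 0}"

text \<open>Any strict bound for the absolute values of the occurring degrees serves. Strictness
  makes \<open>Fil (- int depth)\<close> trivial, and this is how all series are seen to
  terminate.\<close>

definition depth :: nat where
  "depth = (SOME d. \<forall>x i. \<bar>i\<bar> \<ge> int d \<longrightarrow> grad.comp i x = 0)"

lemma depth: "\<bar>i\<bar> \<ge> int depth \<Longrightarrow> grad.comp i x = 0"
proof -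
  obtain J where J: "finite J" "\<And>i x. i \<notin> J \<Longrightarrow> grad.comp i x = 0"
    using grad.finite_degrees by blast
  define b where "b = (\<Sum>i\<in>J. \<bar>i\<bar>) + 1"
  have "i \<notin> J" if "\<bar>i\<bar> \<ge> int (nat b)" for i
    using that member_le_sum[of i J abs] J(1) by (auto simp: b_def)
  then have "\<exists>d. \<forall>x i. \<bar>i\<bar> \<ge> int d \<longrightarrow> grad.comp i x = 0" using J(2) by blast
  then have "\<forall>x i. \<bar>i\<bar> \<ge> int depth \<longrightarrow> grad.comp i x = 0" unfolding depth_def by (rule someI_ex)
  then show "\<bar>i\<bar> \<ge> int depth \<Longrightarrow> grad.comp i x = 0" by blast
qed

lemmas comp_linear = clin_0[OF grad.component_linear] clin_add[OF grad.component_linear]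
  clin_diff[OF grad.component_linear] clin_scale[OF grad.component_linear]

lemma component_f: "grad.comp (i - 2) (br f x) = br f (grad.comp i x)"
  by (rule grad.component_commute[OF linear_right, where s = "\<lambda>i. i - 2"])
     (use grading_br[OF f_degree] in \<open>auto simp: inj_on_def\<close>)

lemma component_e: "grad.comp (i + 2) (br e x) = br e (grad.comp i x)"
  by (rule grad.component_commute[OF linear_right, where s = "\<lambda>i. i + 2"])
     (use grading_br[OF e_degree] in \<open>auto simp: inj_on_def add.commute\<close>)

text \<open>Both \<open>ad e\<close> and \<open>ad f\<close> are homogeneous, so a homogeneous
  component of the defining relations of \<open>R x\<close> is again a pair of such relations;
  uniqueness does the rest.\<close>

lemma component_R: "grad.comp (i - 2) (R x) = R (grad.comp i x)"
proof (rule R_unique[symmetric])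
  obtain b where "R x = br f b" using R_range by blast
  then show "grad.comp (i - 2) (R x) \<in> range (br f)" by (simp add: component_f)
  have "br f (grad.comp i x - br e (grad.comp (i - 2) (R x))) = br f (grad.comp i (x - br e (R x)))"
    using component_e[of "i - 2" "R x"] by (simp add: comp_linear)
  also have "\<dots> = grad.comp (i - 2) (br f (x - br e (R x)))" by (rule component_f[symmetric])
  also have "\<dots> = 0" by (simp only: R_solves comp_linear)
  finally show "br f (grad.comp i x - br e (grad.comp (i - 2) (R x))) = 0" .
qed

lemma killing_graded: "x \<in> \<Gamma> i \<Longrightarrow> y \<in> \<Gamma> j \<Longrightarrow> i + j \<noteq> 0 \<Longrightarrow> K x y = 0"
  unfolding killing_trace
proof (rule grad.lin_trace_shift[where s = "\<lambda>k. i + (j + k)"])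
  show "clin (\<lambda>z. br x (br y z))" by (rule clin_compose[OF linear_right linear_right])
qed (use grading_br in auto)

lemma killing_components:
  assumes J: "finite J" "\<And>i. i \<notin> J \<Longrightarrow> grad.comp i y = 0"
  shows "K x y = (\<Sum>i\<in>J. K (grad.comp (- i) x) (grad.comp i y))"
proof -
  have "K x (grad.comp i y) = K (grad.comp (- i) x) (grad.comp i y)" for i
  proof -
    obtain I where I: "finite I" "\<And>i x. i \<notin> I \<Longrightarrow> grad.comp i x = 0" using grad.finite_degrees by blast
    have "K x (grad.comp i y) = K (\<Sum>j\<in>insert (- i) I. grad.comp j x) (grad.comp i y)"
      using I by (subst grad.sum_components) auto
    also have "\<dots> = (\<Sum>j\<in>insert (- i) I. K (grad.comp j x) (grad.comp i y))" by (rule killing_sum)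
    also have "\<dots> = (\<Sum>j\<in>{- i}. K (grad.comp j x) (grad.comp i y))"
      using I(1) killing_graded[OF grad.component_in grad.component_in]
      by (intro sum.mono_neutral_right) (auto simp: add_eq_0_iff)
    finally show ?thesis by simp
  qed
  moreover have "K x y = (\<Sum>i\<in>J. K x (grad.comp i y))"
    using grad.sum_components[OF J] killing_sum(2)[of x "\<lambda>i. grad.comp i y" J] by simp
  ultimately show ?thesis by simp
qed

lemma killing_zeroI:
  assumes "\<And>i. grad.comp (- i) x = 0 \<or> grad.comp i y = 0" shows "K x y = 0"
proof -
  obtain J where J: "finite J" "\<And>i x. i \<notin> J \<Longrightarrow> grad.comp i x = 0" using grad.finite_degrees by blast
  have "K x y = (\<Sum>i\<in>J. K (grad.comp (- i) x) (grad.comp i y))"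
    using J by (rule killing_components)
  also have "\<dots> = 0"
  proof (intro sum.neutral ballI)
    fix i show "K (grad.comp (- i) x) (grad.comp i y) = 0" using assms[of i] by auto
  qed
  finally show ?thesis .
qed
lemma graded_sub_Fil: "i \<le> k \<Longrightarrow> \<Gamma> i \<subseteq> Fil k"
  by (auto simp: Fil_def grad.component_of)

lemma Fil_eq_span: "Fil k = vec.span (\<Union>i\<in>{..k}. \<Gamma> i)"
proof
  show "Fil k \<subseteq> vec.span (\<Union>i\<in>{..k}. \<Gamma> i)"
  proof
    fix x assume x: "x \<in> Fil k"
    obtain J where J: "finite J" "\<And>i x. i \<notin> J \<Longrightarrow> grad.comp i x = 0" using grad.finite_degrees by blast
    have "(\<Sum>i\<in>J. grad.comp i x) \<in> vec.span (\<Union>i\<in>{..k}. \<Gamma> i)"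
    proof (rule vec.span_sum)
      fix i
      show "grad.comp i x \<in> vec.span (\<Union>i\<in>{..k}. \<Gamma> i)"
        using x grad.component_in[of i x]
        by (cases "i \<le> k") (auto simp: Fil_def vec.span_zero intro!: vec.span_base)
    qed
    then show "x \<in> vec.span (\<Union>i\<in>{..k}. \<Gamma> i)" using J by (simp add: grad.sum_components)
  qed
  have "vec.subspace (Fil k)" by (auto simp: vec.subspace_def Fil_def comp_linear)
  then show "vec.span (\<Union>i\<in>{..k}. \<Gamma> i) \<subseteq> Fil k"
    using graded_sub_Fil by (intro vec.span_minimal) auto
qed

sublocale slice br e f R Fil depth
proof unfold_locales
  show "u \<in> range (br f) \<Longrightarrow> R (br e u) = u" "R x \<in> range (br f)" "R x = 0 \<longleftrightarrow> br f x = 0"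
    "R (x + y) = R x + R y" "R (c *s x) = c *s R x" for u x y c
    using R_inverse R_range R_eq_0_iff clin_add[OF R_linear] clin_scale[OF R_linear] by auto
  show "x \<in> range (br f)" if "\<And>t. br f t = 0 \<Longrightarrow> K x t = 0" for x using kernel_annihilator that .
  show sub: "vec.subspace (Fil k)" for k unfolding Fil_eq_span by (rule vec.subspace_span)
  show "i \<le> j \<Longrightarrow> Fil i \<subseteq> Fil j" for i j by (auto simp: Fil_def)
  show "br x y \<in> Fil (i + j)" if "x \<in> Fil i" "y \<in> Fil j" for x y i j
  proof -
    obtain J where J: "finite J" "\<And>i x. i \<notin> J \<Longrightarrow> grad.comp i x = 0" using grad.finite_degrees by blast
    have "br (\<Sum>a\<in>J. grad.comp a x) (\<Sum>b\<in>J. grad.comp b y) \<in> Fil (i + j)"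
      unfolding br_sum_left br_sum_right
    proof (intro vec.subspace_sum[OF sub])
      fix a b
      show "br (grad.comp a x) (grad.comp b y) \<in> Fil (i + j)"
      proof (cases "a \<le> i \<and> b \<le> j")
        case True
        then show ?thesis using grading_br[OF grad.component_in grad.component_in, of a x b y]
            graded_sub_Fil[of "a + b" "i + j"] by auto
      next
        case False
        then have "grad.comp a x = 0 \<or> grad.comp b y = 0" using that by (auto simp: Fil_def)
        then show ?thesis using vec.subspace_0[OF sub] by auto
      qed
    qed
    then show ?thesis using J by (simp add: grad.sum_components)
  qed
  show "Fil (int depth) = UNIV" using depth by (auto simp: Fil_def)
  show "Fil (- int depth) = {0}"
  proof -
    have "x = 0" if "x \<in> Fil (- int depth)" for x
    proof (rule grad.component_eqI)
      fix i show "grad.comp i x = grad.comp i 0"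
        using that depth[of i x] by (cases "i > - int depth") (auto simp: Fil_def comp_linear)
    qed
    then show ?thesis using vec.subspace_0[OF sub] by blast
  qed
  show "e \<in> Fil 2" using graded_sub_Fil[of 2 2] e_degree by auto
  \<comment> \<open>Injectivity of \<open>ad f\<close> in degrees at least 1 excludes positive
    components.\<close>
  show "x \<in> Fil 0" if "br f x = 0" for x
    unfolding Fil_def
  proof (intro CollectI allI impI)
    fix i :: int assume "0 < i"
    have "br f (grad.comp i x) = 0" using component_f[of i x] that by (simp add: comp_linear)
    then show "grad.comp i x = 0"
      using f_injective[of i] \<open>0 < i\<close> grad.component_in[of i x] vec.subspace_0[OF grad.subspace[of i]]
      by (metis (no_types, opaque_lifting) br_linear(1) inj_on_def int_one_le_iff_zero_less)
  qed
  show "R x \<in> Fil (k - 2)" if "x \<in> Fil k" for x k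
    unfolding Fil_def
  proof (intro CollectI allI impI)
    fix i assume "k - 2 < i"
    then show "grad.comp i (R x) = 0"
      using component_R[of "i + 2" x] that clin_0[OF R_linear] by (simp add: Fil_def)
  qed
  \<comment> \<open>Surjectivity of \<open>ad f\<close> from degrees at most 1.\<close>
  show "Fil (- 1) \<subseteq> range (br f)"
    unfolding Fil_eq_span
  proof (rule vec.span_minimal[OF _ subspace_range[OF linear_right]])
    show "(\<Union>i\<in>{..- 1}. \<Gamma> i) \<subseteq> range (br f)"
      using f_surjective[of "i + 2" for i] by force
  qed
  show "K x y = 0" if "x \<in> Fil 0" "y \<in> Fil (- 1)" for x y
  proof (rule killing_zeroI)
    fix i show "grad.comp (- i) x = 0 \<or> grad.comp i y = 0"
      using that by (cases "i < 0") (auto simp: Fil_def)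
  qed
qed

text \<open>The remainder \<open>x - [e, R x]\<close> has degree 1 and lies in
  \<open>ker (ad f)\<close>, which has no positive degrees. Thus the symplectic form represents
  every functional on degree -1.\<close>

lemma e_surjective: assumes "x \<in> \<Gamma> 1" shows "\<exists>y\<in>\<Gamma> (- 1). x = br e y"
proof -
  have "grad.comp (1 - 2) (R x) = R x" using component_R[of 1 x] grad.component_of[OF assms, of 1] by simp
  then have R: "R x \<in> \<Gamma> (- 1)" using grad.component_in[of "- 1" "R x"] by simp
  let ?k = "x - br e (R x)"
  have "?k \<in> \<Gamma> 1" using assms grading_br[OF e_degree R] by (intro vec.subspace_diff grad.subspace) auto
  moreover have "?k \<in> Fil 0" by (rule kernel_Fil[OF R_solves])
  ultimately have "?k = 0" using grad.component_of[of ?k 1 1] by (simp add: Fil_def)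
  then show ?thesis using R by auto
qed

end

section \<open>Isotropic subspaces and the symplectic form on degree -1\<close>

locale isotropic_data = good_data +
  fixes l :: "(complex ^ 'a) set"
  assumes iso: "isotropic br e \<Gamma> l"
begin

lemma l: "vec.subspace l" "l \<subseteq> \<Gamma> (- 1)" "\<And>x y. x \<in> l \<Longrightarrow> y \<in> l \<Longrightarrow> K e (br x y) = 0"
  using iso by (auto simp: isotropic_def)

abbreviation "l' \<equiv> symplectic_complement br e \<Gamma> l"

lemma l'_subspace: "vec.subspace l'"
  using grad.subspace
  by (auto simp: vec.subspace_def symplectic_complement_def br_add killing_add)

text \<open>If \<open>u\<close> were outside \<open>l\<close>, some functional would vanish on
  \<open>l\<close> but not at \<open>u\<close>. Only the degree 1 part \<open>[e, y]\<close> of its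
  Killing representative \<open>b\<close> matters on degree -1, so the functional is symplectic
  pairing with a \<open>y\<close> in \<open>l'\<close>, contrary to the hypothesis on
  \<open>u\<close>.\<close>

lemma double_complement:
  assumes u: "u \<in> \<Gamma> (- 1)" "\<And>y. y \<in> l' \<Longrightarrow> K e (br u y) = 0"
  shows "u \<in> l"
proof (rule ccontr)
  assume "u \<notin> l"
  obtain P where P: "clin P" "\<And>x. P x \<in> l" "\<And>x. x \<in> l \<Longrightarrow> P x = x"
    using clin_projection_exists[OF l(1)] by blast
  let ?v = "u - P u"
  have "?v \<noteq> 0" using P(2)[of u] \<open>u \<notin> l\<close> by auto
  then obtain a where a: "K ?v a \<noteq> 0" using killing_nondegenerate by blast
  have "\<exists>b. \<forall>x. K b x = K a (x - P x)"
    by (rule killing_represents) (auto simp: killing_nondegenerate clin_add[OF P(1)] clin_scale[OF P(1)]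
        killing_add killing_diff algebra_simps)
  then obtain b where b: "\<And>x. K b x = K a (x - P x)" by blast
  obtain y where y: "y \<in> \<Gamma> (- 1)" "grad.comp 1 b = br e y"
    using e_surjective[OF grad.component_in] by blast
  have Ky: "K e (br y x) = K a (x - P x)" if "x \<in> \<Gamma> (- 1)" for x
    using killing_components[of "{- 1}" x b] grad.component_of[OF that] b[of x]
    by (simp add: y killing_invariant)
  have "y \<in> l'" using y(1) Ky l(2) P(3) by (auto simp: symplectic_complement_def)
  then have "K e (br u y) = 0" by (rule u(2))
  then have "K a ?v = 0" using Ky[OF u(1)] br_anticommute[of u y] by simp
  then show False using a by (simp add: killing_sym)
qed

lemma m_space_eq: "m_space \<Gamma> l = {x + y | x y. x \<in> l \<and> y \<in> Fil (- 2)}"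
  and n_space_eq: "n_space br e \<Gamma> l = {x + y | x y. x \<in> l' \<and> y \<in> Fil (- 2)}"
  using l(1) l'_subspace Fil_subspace
  by (simp_all add: m_space_def n_space_def vec.span_Un Fil_eq_span vec.span_eq_iff[THEN iffD2])

lemma l_l': "l \<subseteq> l'"
  using l by (auto simp: symplectic_complement_def)

lemma l'_sub: "l' \<subseteq> \<Gamma> (- 1)"
  by (auto simp: symplectic_complement_def)

sublocale slice_isotropic br e f R Fil depth "m_space \<Gamma> l" "n_space br e \<Gamma> l"
proof unfold_locales
  show "vec.subspace (m_space \<Gamma> l)" "vec.subspace (n_space br e \<Gamma> l)"
    by (simp_all add: m_space_def n_space_def)
  show "Fil (- 2) \<subseteq> m_space \<Gamma> l"
    unfolding m_space_def Fil_eq_span by (rule vec.span_mono) auto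
  show "m_space \<Gamma> l \<subseteq> n_space br e \<Gamma> l"
    unfolding m_space_def n_space_def using l_l' by (intro vec.span_mono) auto
  show "n_space br e \<Gamma> l \<subseteq> Fil (- 1)"
    unfolding n_space_def
  proof (intro vec.span_minimal Fil_subspace Un_least UN_least)
    show "l' \<subseteq> Fil (- 1)" using l'_sub graded_sub_Fil[of "- 1" "- 1"] by simp
    show "\<Gamma> i \<subseteq> Fil (- 1)" if "i \<in> {..- 2}" for i using graded_sub_Fil[of i "- 1"] that by simp
  qed
  have N1: "y \<in> n_space br e \<Gamma> l" if "y \<in> Fil (- 2)" for y
    using that vec.span_mono unfolding n_space_def Fil_eq_span by blast
  have N2: "y \<in> n_space br e \<Gamma> l" if "y \<in> l'" for y
    using that unfolding n_space_def by (intro vec.span_base) auto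
  show B1: "x \<in> Fil 1" if B: "\<And>y. y \<in> n_space br e \<Gamma> l \<Longrightarrow> K x y = 0" for x
    unfolding Fil_def
  proof (intro CollectI allI impI)
    fix i :: int assume "1 < i"
    have "K (grad.comp i x) y = 0" for y
    proof -
      have "grad.comp (- i) y \<in> n_space br e \<Gamma> l"
        using graded_sub_Fil[of "- i" "- 2"] \<open>1 < i\<close> grad.component_in[of "- i" y] by (intro N1) auto
      then have "0 = K x (grad.comp (- i) y)" using B by simp
      also have "\<dots> = K (grad.comp i x) (grad.comp (- i) y)"
        using killing_components[of "{- i}" "grad.comp (- i) y" x] by (simp add: grad.component_of[OF grad.component_in])
      also have "\<dots> = K y (grad.comp i x)"
        using killing_components[of "{i}" "grad.comp i x" y] by (simp add: grad.component_of[OF grad.component_in] killing_sym)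
      finally show ?thesis by (simp add: killing_sym)
    qed
    then show "grad.comp i x = 0" by (rule killing_nondegenerate)
  qed
  \<comment> \<open>For degree reasons only the degree -1 parts \<open>a\<close> of \<open>m\<close>
    and \<open>c\<close> of \<open>y\<close> contribute, and these are symplectically
    orthogonal.\<close>
  show "K (br e m) y = 0" if my: "m \<in> m_space \<Gamma> l" "y \<in> n_space br e \<Gamma> l" for m y
  proof -
    obtain a b where ab: "m = a + b" "a \<in> l" "b \<in> Fil (- 2)" using my(1) by (auto simp: m_space_eq)
    obtain c d where cd: "y = c + d" "c \<in> l'" "d \<in> Fil (- 2)" using my(2) by (auto simp: n_space_eq)
    have y: "y \<in> Fil (- 1)"
      using cd l'_sub graded_sub_Fil[of "- 1" "- 1"] Fil_mono[of "- 2" "- 1"] Fil_subspace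
      by (auto intro!: vec.subspace_add)
    have "br e b \<in> Fil 0" using Fil_br[OF e_Fil ab(3)] by simp
    then have 1: "K (br e b) y = 0" using y by (rule killing_Fil)
    have "a \<in> Fil (- 1)" using ab(2) l(2) graded_sub_Fil[of "- 1" "- 1"] by auto
    then have "br e a \<in> Fil 1" using Fil_br[OF e_Fil, of a "- 1"] by simp
    then have 2: "K (br e a) d = 0"
      using cd(3) by (intro killing_zeroI) (auto simp: Fil_def, smt (verit))
    have "K (br e a) c = K e (br a c)" by (rule killing_invariant)
    also have "\<dots> = 0" using cd(2) ab(2) br_anticommute[of a c] by (auto simp: symplectic_complement_def)
    finally show ?thesis using 1 2 by (simp add: ab cd(1) br_add killing_add)
  qed
  show "R x \<in> m_space \<Gamma> l" if B: "\<And>y. y \<in> n_space br e \<Gamma> l \<Longrightarrow> K x y = 0" for x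
  proof -
    have R1: "R x \<in> Fil (- 1)" using R_Fil[OF B1[OF B]] by simp
    let ?u = "grad.comp (- 1) (R x)"
    have rest: "R x - ?u \<in> Fil (- 2)"
      unfolding Fil_def
    proof (intro CollectI allI impI)
      fix i :: int assume "- 2 < i"
      then show "grad.comp i (R x - ?u) = 0"
        using R1 by (cases "i = - 1") (auto simp: Fil_def comp_linear grad.component_of[OF grad.component_in])
    qed
    \<comment> \<open>Pairing \<open>x\<close> with \<open>y\<close> in \<open>l'\<close> sees
      nothing but \<open>[e, ?u]\<close>, as \<open>x - [e, R x]\<close> and
      \<open>[e, R x - ?u]\<close> lie in \<open>Fil 0\<close>. So \<open>?u\<close> is orthogonal
      to \<open>l'\<close>, and the complement of \<open>l'\<close> is \<open>l\<close>.\<close>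
    have "?u \<in> l"
    proof (rule double_complement[OF grad.component_in])
      fix y assume y: "y \<in> l'"
      then have y1: "y \<in> \<Gamma> (- 1)" using l'_sub by blast
      then have yF: "y \<in> Fil (- 1)" using graded_sub_Fil[of "- 1" "- 1"] by auto
      have "0 = K x y" using B[OF N2[OF y]] by simp
      also have "\<dots> = K (x - br e (R x)) y + K (br e (R x - ?u)) y + K (br e ?u) y"
        by (simp add: killing_diff br_diff)
      also have "K (x - br e (R x)) y = 0" by (rule killing_Fil[OF kernel_Fil[OF R_solves] yF])
      also have "K (br e (R x - ?u)) y = 0"
        using Fil_br[OF e_Fil rest] yF by (intro killing_Fil) simp_all
      finally show "K e (br ?u y) = 0" by (simp add: killing_invariant)
    qed
    then have "?u + (R x - ?u) \<in> m_space \<Gamma> l" using rest unfolding m_space_eq by blast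
    then show ?thesis by simp
  qed
qed

end

section \<open>Loops, differential polynomials and densities\<close>

definition smooth :: "(real \<Rightarrow> 'v::real_normed_vector) \<Rightarrow> bool" where
  "smooth u \<longleftrightarrow> (\<forall>k x. nderiv k u differentiable (at x))"

abbreviation vderiv :: "(real \<Rightarrow> 'v::real_normed_vector) \<Rightarrow> real \<Rightarrow> 'v" where
  "vderiv u \<equiv> (\<lambda>x. vector_derivative u (at x))"

lemma nderiv_0 [simp]: "nderiv 0 u = u"
  and nderiv_Suc: "nderiv (Suc k) u = vderiv (nderiv k u)"
  and nderiv_Suc': "nderiv (Suc k) u = nderiv k (vderiv u)"
  using funpow_swap1[of "\<lambda>w x. vector_derivative w (at x)" k u] by (simp_all add: nderiv_def)

lemma nderiv_1: "nderiv 1 u = vderiv u" "nderiv (Suc 0) u = vderiv u"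
  by (simp_all add: nderiv_Suc)

lemma nderiv_add_index: "nderiv j (nderiv k u) = nderiv (j + k) u"
  by (simp add: nderiv_def funpow_add)

lemma smooth_has_vector_derivative: "smooth u \<Longrightarrow> (u has_vector_derivative vderiv u x) (at x)"
  using smooth_def[of u] nderiv_0[of u] vector_derivative_works[of u "at x"] by metis

lemma smooth_nderiv: "smooth u \<Longrightarrow> smooth (nderiv k u)"
  by (simp add: smooth_def nderiv_add_index)

lemma smooth_vderiv: "smooth u \<Longrightarrow> smooth (vderiv u)"
  using smooth_nderiv[of u 1] by (simp add: nderiv_1)

text \<open>Smoothness of a combination then follows from a class of functions stable under
  differentiation, in place of a formula for all its higher derivatives.\<close>

lemma smooth_coinduct:
  assumes "C u" and step: "\<And>u. C u \<Longrightarrow> (\<forall>x. u differentiable (at x)) \<and> C (vderiv u)"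
  shows "smooth u"
proof -
  have "C (nderiv k u)" for k by (induction k) (use assms in \<open>auto simp: nderiv_Suc\<close>)
  then show ?thesis using step by (auto simp: smooth_def)
qed

lemma smooth_const: "smooth (\<lambda>_. c)"
  by (rule smooth_coinduct[where C = "\<lambda>u. \<exists>c. u = (\<lambda>_. c)"]) auto

lemma vderivI: "(\<And>x. (u has_vector_derivative v x) (at x)) \<Longrightarrow> vderiv u = v"
  by (auto simp: vector_derivative_at)

lemma vderiv_add: "smooth u \<Longrightarrow> smooth v \<Longrightarrow> vderiv (\<lambda>x. u x + v x) = (\<lambda>x. vderiv u x + vderiv v x)"
  by (rule vderivI, rule has_vector_derivative_add; erule smooth_has_vector_derivative)

lemma vderiv_bounded_linear:
  "bounded_linear L \<Longrightarrow> smooth u \<Longrightarrow> vderiv (\<lambda>x. L (u x)) = (\<lambda>x. L (vderiv u x))"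
  by (rule vderivI, erule bounded_linear.has_vector_derivative, erule smooth_has_vector_derivative)

lemma vderiv_bilinear:
  assumes "bounded_bilinear h" "smooth u" "smooth v"
  shows "vderiv (\<lambda>x. h (u x) (v x)) = (\<lambda>x. h (vderiv u x) (v x) + h (u x) (vderiv v x))"
  using bounded_bilinear.has_vector_derivative[OF assms(1) smooth_has_vector_derivative[OF assms(2)]
      smooth_has_vector_derivative[OF assms(3)]]
  by (intro vderivI) (simp add: add.commute)

lemma smooth_add:
  assumes "smooth u" "smooth v" shows "smooth (\<lambda>x. u x + v x)"
proof (rule smooth_coinduct[where C = "\<lambda>w. \<exists>u v. smooth u \<and> smooth v \<and> w = (\<lambda>x. u x + v x)"])
  fix w :: "real \<Rightarrow> 'a" assume "\<exists>u v. smooth u \<and> smooth v \<and> w = (\<lambda>x. u x + v x)"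
  then obtain u v where w: "smooth u" "smooth v" "w = (\<lambda>x. u x + v x)" by blast
  have "w differentiable (at x)" for x
    unfolding w(3) by (rule differentiable_add;
      rule differentiableI_vector; rule smooth_has_vector_derivative; rule w)
  moreover have "vderiv w = (\<lambda>x. vderiv u x + vderiv v x)" unfolding w(3) by (rule vderiv_add[OF w(1,2)])
  ultimately show "(\<forall>x. w differentiable (at x)) \<and> (\<exists>u v. smooth u \<and> smooth v \<and> vderiv w = (\<lambda>x. u x + v x))"
    using smooth_vderiv[OF w(1)] smooth_vderiv[OF w(2)] by blast
qed (use assms in blast)

lemma smooth_bounded_linear:
  assumes L: "bounded_linear L" and "smooth u" shows "smooth (\<lambda>x. L (u x))"
proof (rule smooth_coinduct[where C = "\<lambda>w. \<exists>u. smooth u \<and> w = (\<lambda>x. L (u x))"])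
  fix w assume "\<exists>u. smooth u \<and> w = (\<lambda>x. L (u x))"
  then obtain u where w: "smooth u" "w = (\<lambda>x. L (u x))" by blast
  have "w differentiable (at x)" for x
    unfolding w(2) by (rule differentiableI_vector[OF
      bounded_linear.has_vector_derivative[OF L smooth_has_vector_derivative[OF w(1)]]])
  moreover have "vderiv w = (\<lambda>x. L (vderiv u x))" unfolding w(2) by (rule vderiv_bounded_linear[OF L w(1)])
  ultimately show "(\<forall>x. w differentiable (at x)) \<and> (\<exists>u. smooth u \<and> vderiv w = (\<lambda>x. L (u x)))"
    using smooth_vderiv[OF w(1)] by blast
qed (use assms in blast)

text \<open>The Leibniz rule turns one product into a sum of two; the class stable under
  differentiation consists of sums of products.\<close>

inductive bilinear_sums :: "('a::real_normed_vector \<Rightarrow> 'b::real_normed_vector \<Rightarrow> 'c::real_normed_vector) \<Rightarrow> (real \<Rightarrow> 'c) \<Rightarrow> bool"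
  for h where
  base: "smooth u \<Longrightarrow> smooth v \<Longrightarrow> bilinear_sums h (\<lambda>x. h (u x) (v x))"
| add: "bilinear_sums h a \<Longrightarrow> bilinear_sums h b \<Longrightarrow> bilinear_sums h (\<lambda>x. a x + b x)"

lemma smooth_bilinear:
  assumes h: "bounded_bilinear h" and "smooth u" "smooth v" shows "smooth (\<lambda>x. h (u x) (v x))"
proof (rule smooth_coinduct[where C = "bilinear_sums h"])
  fix w assume "bilinear_sums h w"
  then show "(\<forall>x. w differentiable (at x)) \<and> bilinear_sums h (vderiv w)"
  proof induction
    case (base u v)
    have "(\<lambda>x. h (u x) (v x)) differentiable (at x)" for x
      by (rule differentiableI_vector[OF bounded_bilinear.has_vector_derivative[OF h
            smooth_has_vector_derivative[OF base(1)] smooth_has_vector_derivative[OF base(2)]]])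
    then show ?case
      by (auto simp: vderiv_bilinear[OF h base] intro!: bilinear_sums.intros base smooth_vderiv)
  next
    case (add a b)
    then have "vderiv (\<lambda>x. a x + b x) = (\<lambda>x. vderiv a x + vderiv b x)"
      by (intro vderivI has_vector_derivative_add) (auto simp: vector_derivative_works)
    then show ?case using add by (auto intro: bilinear_sums.add)
  qed
qed (use assms bilinear_sums.base in blast)

lemma loops_iff: "u \<in> loops V \<longleftrightarrow> smooth u \<and> (\<forall>x. u (x + 1) = u x) \<and> (\<forall>x. u x \<in> V)"
  by (simp add: loops_def smooth_def)

lemma loops_UNIV_I: "u \<in> loops V \<Longrightarrow> u \<in> loops UNIV"
  and loops_mono: "V \<subseteq> W \<Longrightarrow> u \<in> loops V \<Longrightarrow> u \<in> loops W"
  and loops_valueI: "u \<in> loops V \<Longrightarrow> (\<And>x. u x \<in> W) \<Longrightarrow> u \<in> loops W"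
  and loops_value: "u \<in> loops V \<Longrightarrow> u x \<in> V"
  and loops_smooth: "u \<in> loops V \<Longrightarrow> smooth u"
  by (auto simp: loops_iff)

lemma loops_const: "(\<lambda>_. c) \<in> loops UNIV"
  by (simp add: loops_iff smooth_const)

lemma loops_add: "u \<in> loops UNIV \<Longrightarrow> v \<in> loops UNIV \<Longrightarrow> (\<lambda>x. u x + v x) \<in> loops UNIV"
  by (simp add: loops_iff smooth_add)

lemma loops_bounded_linear: "bounded_linear L \<Longrightarrow> u \<in> loops UNIV \<Longrightarrow> (\<lambda>x. L (u x)) \<in> loops UNIV"
  by (simp add: loops_iff smooth_bounded_linear)

lemma loops_bilinear:
  "bounded_bilinear h \<Longrightarrow> u \<in> loops UNIV \<Longrightarrow> v \<in> loops UNIV \<Longrightarrow> (\<lambda>x. h (u x) (v x)) \<in> loops UNIV"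
  by (simp add: loops_iff smooth_bilinear)

lemma loops_minus: "u \<in> loops UNIV \<Longrightarrow> (\<lambda>x. - u x) \<in> loops UNIV"
  using loops_bounded_linear[OF bounded_linear_minus[OF bounded_linear_ident]] .

lemma loops_diff: "u \<in> loops UNIV \<Longrightarrow> v \<in> loops UNIV \<Longrightarrow> (\<lambda>x. u x - v x) \<in> loops UNIV"
  using loops_add[OF _ loops_minus, of u v] by simp

lemma loops_sum: "(\<And>i. i \<in> I \<Longrightarrow> u i \<in> loops UNIV) \<Longrightarrow> (\<lambda>x. \<Sum>i\<in>I. u i x) \<in> loops UNIV"
  by (induction I rule: infinite_finite_induct) (auto intro: loops_add loops_const)

lemma loops_scaleR: "u \<in> loops UNIV \<Longrightarrow> (\<lambda>x. c *\<^sub>R u x) \<in> loops UNIV"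
  by (rule loops_bounded_linear[OF bounded_linear_scaleR_right])

lemma loops_mult: "u \<in> loops UNIV \<Longrightarrow> v \<in> loops UNIV \<Longrightarrow> (\<lambda>x. u x * v x :: complex) \<in> loops UNIV"
  by (rule loops_bilinear[OF bounded_bilinear_mult])

lemma loops_vderiv:
  assumes "u \<in> loops UNIV" shows "vderiv u \<in> loops UNIV"
proof -
  have u: "smooth u" "\<And>x. u (x + 1) = u x" using assms by (auto simp: loops_iff)
  have "vderiv u (x + 1) = vderiv u x" for x
  proof -
    have "((\<lambda>x. x + 1) has_vector_derivative 1) (at x)"
      by (auto intro!: derivative_eq_intros)
    from vector_diff_chain_at[OF this, of u "vderiv u (x + 1)"] smooth_has_vector_derivative[OF u(1)]
    have "((\<lambda>x. u (x + 1)) has_vector_derivative vderiv u (x + 1)) (at x)" by (simp add: o_def)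
    then have "(u has_vector_derivative vderiv u (x + 1)) (at x)" using u(2) by simp
    then show ?thesis by (metis vector_derivative_at)
  qed
  then show ?thesis using smooth_vderiv[OF u(1)] by (simp add: loops_iff)
qed

lemma loops_nderiv: "u \<in> loops UNIV \<Longrightarrow> nderiv k u \<in> loops UNIV"
  by (induction k) (auto simp: nderiv_Suc loops_vderiv)

lemma nderiv_add: "smooth u \<Longrightarrow> smooth v \<Longrightarrow> nderiv k (\<lambda>x. u x + v x) = (\<lambda>x. nderiv k u x + nderiv k v x)"
  by (induction k) (simp_all add: nderiv_Suc vderiv_add smooth_nderiv)

lemma nderiv_bounded_linear:
  "bounded_linear L \<Longrightarrow> smooth u \<Longrightarrow> nderiv k (\<lambda>x. L (u x)) = (\<lambda>x. L (nderiv k u x))"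
  by (induction k) (simp_all add: nderiv_Suc vderiv_bounded_linear smooth_nderiv)

lemma nderiv_const: "nderiv k (\<lambda>_. c) = (\<lambda>_. if k = 0 then c else 0)"
  by (induction k) (simp_all add: nderiv_Suc split: if_splits)

lemma smooth_sum: "(\<And>i. i \<in> I \<Longrightarrow> smooth (u i)) \<Longrightarrow> smooth (\<lambda>x. \<Sum>i\<in>I. u i x)"
  by (induction I rule: infinite_finite_induct) (auto intro: smooth_add smooth_const)

lemma nderiv_sum:
  "(\<And>i. i \<in> I \<Longrightarrow> smooth (u i)) \<Longrightarrow> nderiv k (\<lambda>x. \<Sum>i\<in>I. u i x) = (\<lambda>x. \<Sum>i\<in>I. nderiv k (u i) x)"
proof (induction I rule: infinite_finite_induct)
  case (insert i I)
  then show ?case by (simp add: nderiv_add smooth_sum)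
qed (simp_all add: nderiv_const)

lemma loop_continuous_on: "u \<in> loops V \<Longrightarrow> continuous_on S u"
  by (intro continuous_at_imp_continuous_on ballI
      has_vector_derivative_continuous[OF smooth_has_vector_derivative[OF loops_smooth]])

lemma loop_integrable:
  fixes u :: "real \<Rightarrow> 'v::euclidean_space"
  shows "u \<in> loops V \<Longrightarrow> u integrable_on {0..1}"
  by (rule integrable_continuous_real[OF loop_continuous_on])

lemma integral_vderiv:
  fixes u :: "real \<Rightarrow> 'v::euclidean_space"
  assumes "u \<in> loops V" shows "integral {0..1} (vderiv u) = 0"
proof -
  have "((vderiv u) has_integral u 1 - u 0) {0..1}"
    using smooth_has_vector_derivative[OF loops_smooth[OF assms]]
    by (intro fundamental_theorem_of_calculus) (auto intro: has_vector_derivative_at_within)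
  moreover have "u 1 = u 0" using assms[unfolded loops_iff] by (metis add_0)
  ultimately show ?thesis by (simp add: integral_unique)
qed

lemma integral_by_parts_loops:
  fixes h :: "'a::euclidean_space \<Rightarrow> 'b::euclidean_space \<Rightarrow> 'c::euclidean_space"
  assumes h: "bounded_bilinear h" and u: "u \<in> loops UNIV" and v: "v \<in> loops UNIV"
  shows "integral {0..1} (\<lambda>x. h (vderiv u x) (v x)) = - integral {0..1} (\<lambda>x. h (u x) (vderiv v x))"
proof -
  have "0 = integral {0..1} (vderiv (\<lambda>x. h (u x) (v x)))"
    by (rule integral_vderiv[OF loops_bilinear[OF h u v], symmetric])
  also have "\<dots> = integral {0..1} (\<lambda>x. h (vderiv u x) (v x) + h (u x) (vderiv v x))"
    by (simp add: vderiv_bilinear[OF h loops_smooth[OF u] loops_smooth[OF v]])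
  also have "\<dots> = integral {0..1} (\<lambda>x. h (vderiv u x) (v x)) + integral {0..1} (\<lambda>x. h (u x) (vderiv v x))"
    by (intro integral_add loop_integrable[where V = UNIV] loops_bilinear[OF h] loops_vderiv u v)
  finally show ?thesis by (simp add: eq_neg_iff_add_eq_0)
qed

lemma integral_by_parts_nderiv:
  fixes u v :: "real \<Rightarrow> complex"
  assumes u: "u \<in> loops UNIV" and v: "v \<in> loops UNIV"
  shows "integral {0..1} (\<lambda>x. nderiv k u x * v x) = (- 1) ^ k * integral {0..1} (\<lambda>x. u x * nderiv k v x)"
  using v
proof (induction k arbitrary: v)
  case (Suc k)
  have "integral {0..1} (\<lambda>x. nderiv (Suc k) u x * v x) = - integral {0..1} (\<lambda>x. nderiv k u x * vderiv v x)"
    unfolding nderiv_Suc by (rule integral_by_parts_loops[OF bounded_bilinear_mult loops_nderiv[OF u] Suc.prems])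
  also have "\<dots> = (- 1) ^ Suc k * integral {0..1} (\<lambda>x. u x * nderiv (Suc k) v x)"
    using Suc.IH[OF loops_vderiv[OF Suc.prems]] by (simp add: nderiv_Suc')
  finally show ?case .
qed simp

lemma loops_cnj: "u \<in> loops UNIV \<Longrightarrow> (\<lambda>x. cnj (u x)) \<in> loops UNIV"
  by (rule loops_bounded_linear[OF bounded_linear_cnj])

text \<open>The integrand is the continuous function \<open>|c|^2\<close>, nonnegative with zero
  integral over one period; periodicity carries its vanishing to the whole line.\<close>

lemma fundamental_lemma:
  fixes c :: "real \<Rightarrow> complex"
  assumes c: "c \<in> loops UNIV" and zero: "integral {0..1} (\<lambda>x. c x * cnj (c x)) = 0"
  shows "c x = 0"
proof -
  let ?g = "\<lambda>x. (cmod (c x))\<^sup>2"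
  have g: "continuous_on {0..1} ?g" by (intro continuous_intros loop_continuous_on[OF c])
  have "complex_of_real (integral {0..1} ?g) = integral {0..1} (\<lambda>x. c x * cnj (c x))"
    using integral_linear[OF integrable_continuous_real[OF g] bounded_linear_of_real[where 'a = complex]]
    by (simp add: o_def complex_norm_square[symmetric])
  then have "integral {0..1} ?g = 0" using zero by simp
  then have "(?g has_integral 0) (cbox 0 1)"
    using integrable_continuous_real[OF g] by (simp add: has_integral_integral)
  then have "?g y = 0" if "y \<in> {0..1}" for y
    using has_integral_0_cbox_imp_0[of 0 1 ?g y] g that by auto
  then have c0: "c y = 0" if "y \<in> {0..1}" for y using that by simp
  have per: "c (y + of_int n) = c y" for y n
  proof -
    have p: "c (y + of_nat n) = c y" for y and n :: nat
    proof (induction n)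
      case (Suc n)
      have "c ((y + of_nat n) + 1) = c (y + of_nat n)" using c by (simp add: loops_iff)
      then show ?case using Suc by (simp add: algebra_simps)
    qed simp
    show ?thesis
    proof (cases "n \<ge> 0")
      case True
      then show ?thesis using p[of y "nat n"] by simp
    next
      case False
      then show ?thesis using p[of "y + of_int n" "nat (- n)"] by simp
    qed
  qed
  have "c x = c (x + of_int (- floor x))" by (rule per[symmetric])
  also have "\<dots> = 0" by (rule c0) (auto simp: floor_le_iff; linarith)
  finally show ?thesis .
qed

lemma clin_scaleR: "clin T \<Longrightarrow> T (c *\<^sub>R x) = c *\<^sub>R T x"
proof -
  have s: "c *\<^sub>R x = complex_of_real c *s x" for x :: "complex ^ 'm" by (simp add: vec_eq_iff scaleR_conv_of_real[where 'a = complex])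
  assume "clin T" then show ?thesis unfolding s by (rule clin_scale)
qed

lemma scaleR_eq_smult: "c *\<^sub>R x = complex_of_real c *s (x :: complex ^ 'm)"
  by (simp add: vec_eq_iff scaleR_conv_of_real[where 'a = complex])

lemma clin_bounded_linear:
  fixes T :: "complex ^ 'm \<Rightarrow> complex ^ 'n" assumes "clin T" shows "bounded_linear T"
  using assms by (intro linear_conv_bounded_linear[THEN iffD1] linearI) (auto simp: clin_add clin_scaleR)

lemma bilinear_bounded:
  fixes h :: "'a::euclidean_space \<Rightarrow> 'b::euclidean_space \<Rightarrow> 'c::real_normed_vector"
  assumes "\<And>x y z. h (x + y) z = h x z + h y z" "\<And>x y z. h x (y + z) = h x y + h x z"
    "\<And>c x y. h (c *\<^sub>R x) y = c *\<^sub>R h x y" "\<And>c x y. h x (c *\<^sub>R y) = c *\<^sub>R h x y"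
  shows "bounded_bilinear h"
  using assms by (intro bilinear_conv_bounded_bilinear[THEN iffD1]) (simp add: bilinear_def linear_iff)

lemma bounded_bilinear_smult: "bounded_bilinear (\<lambda>(c::complex) (v::complex ^ 'n). c *s v)"
  by (rule bilinear_bounded) (auto simp: vec_eq_iff algebra_simps)

lemma bounded_linear_component: "bounded_linear (\<lambda>x::complex ^ 'n. x $ i)"
  by (rule bounded_linear_vec_nth)

lemma loops_component: "u \<in> loops UNIV \<Longrightarrow> (\<lambda>x. u x $ i :: complex) \<in> loops UNIV"
  by (rule loops_bounded_linear[OF bounded_linear_component])

lemma loops_clin: "clin T \<Longrightarrow> u \<in> loops UNIV \<Longrightarrow> (\<lambda>x. T (u x)) \<in> loops UNIV"
  by (rule loops_bounded_linear[OF clin_bounded_linear])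

lemma vderiv_clin: "clin T \<Longrightarrow> u \<in> loops V \<Longrightarrow> vderiv (\<lambda>x. T (u x)) = (\<lambda>x. T (vderiv u x))"
  by (rule vderiv_bounded_linear[OF clin_bounded_linear loops_smooth])

lemma loops_smult: "c \<in> loops UNIV \<Longrightarrow> u \<in> loops UNIV \<Longrightarrow> (\<lambda>x. c x *s u x :: complex ^ 'n) \<in> loops UNIV"
  by (rule loops_bilinear[OF bounded_bilinear_smult])

lemma loops_vec:
  assumes "\<And>i. (\<lambda>x. u x $ i) \<in> loops UNIV" shows "(u :: real \<Rightarrow> complex ^ 'n) \<in> loops UNIV"
proof -
  have "(\<lambda>x. \<Sum>i\<in>UNIV. u x $ i *s axis i 1) \<in> loops UNIV"
    by (intro loops_sum loops_smult assms loops_const)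
  then show ?thesis by (simp add: basis_expansion)
qed

text \<open>A linear projection onto \<open>V\<close> fixes \<open>u\<close> and commutes with
  differentiation.\<close>

lemma vderiv_in_subspace:
  fixes V :: "(complex ^ 'n) set"
  assumes V: "vec.subspace V" and u: "u \<in> loops V" shows "vderiv u \<in> loops V"
proof -
  obtain P where P: "clin P" "\<And>x. P x \<in> V" "\<And>x. x \<in> V \<Longrightarrow> P x = x"
    using clin_projection_exists[OF V] by blast
  have "(\<lambda>x. P (u x)) = u" using P(3) loops_value[OF u] by auto
  then have "vderiv u = (\<lambda>x. P (vderiv u x))" using vderiv_clin[OF P(1) u] by simp
  then have "vderiv u x \<in> V" for x using P(2) by metis
  then show ?thesis by (rule loops_valueI[OF loops_vderiv[OF loops_UNIV_I[OF u]]])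
qed

section \<open>Curves of loops polynomial in a parameter\<close>

text \<open>Differential polynomials map such curves to such curves, and the parameter derivative
  commutes with \<open>d/dx\<close> and with the integral term by term.\<close>

inductive polycurve :: "(real \<Rightarrow> real \<Rightarrow> 'v::euclidean_space) \<Rightarrow> bool" where
  monomial: "u \<in> loops UNIV \<Longrightarrow> polycurve (\<lambda>t x. t ^ k *\<^sub>R u x)"
| add: "polycurve \<gamma> \<Longrightarrow> polycurve \<delta> \<Longrightarrow> polycurve (\<lambda>t x. \<gamma> t x + \<delta> t x)"

lemma polycurve_const: "u \<in> loops UNIV \<Longrightarrow> polycurve (\<lambda>t. u)"
  using polycurve.monomial[of u 0] by simp

lemma polycurve_line: "u \<in> loops UNIV \<Longrightarrow> w \<in> loops UNIV \<Longrightarrow> polycurve (\<lambda>t x. u x + t *\<^sub>R w x)"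
  using polycurve.add[OF polycurve_const polycurve.monomial[of w 1]] by simp

lemma polycurve_loops: "polycurve \<gamma> \<Longrightarrow> \<gamma> t \<in> loops UNIV"
  by (induction rule: polycurve.induct) (auto intro: loops_add loops_scaleR)

lemma polycurve_bounded_linear:
  fixes L :: "'a::euclidean_space \<Rightarrow> 'b::euclidean_space"
  assumes "bounded_linear L" "polycurve \<gamma>" shows "polycurve (\<lambda>t x. L (\<gamma> t x))"
  using assms(2)
proof induction
  case (monomial u k)
  then show ?case
    using polycurve.monomial[OF loops_bounded_linear[OF assms(1) monomial], of k]
    by (simp add: linear_simps(5)[OF assms(1)])
next
  case (add \<gamma> \<delta>)
  then show ?case using polycurve.add by (simp add: linear_simps(1)[OF assms(1)])
qed

lemma polycurve_bilinear:
  fixes h :: "'a::euclidean_space \<Rightarrow> 'b::euclidean_space \<Rightarrow> 'c::euclidean_space"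
  assumes h: "bounded_bilinear h" and "polycurve \<gamma>" "polycurve \<delta>"
  shows "polycurve (\<lambda>t x. h (\<gamma> t x) (\<delta> t x))"
  using assms(2)
proof induction
  case (monomial u k)
  show ?case using assms(3)
  proof induction
    case (monomial v l)
    have "polycurve (\<lambda>t x. t ^ (k + l) *\<^sub>R h (u x) (v x))"
      by (rule polycurve.monomial[OF loops_bilinear[OF h \<open>u \<in> loops UNIV\<close> monomial]])
    then show ?case
      by (simp add: bounded_bilinear.scaleR_left[OF h] bounded_bilinear.scaleR_right[OF h] power_add mult.commute)
  next
    case (add \<gamma> \<delta>)
    then show ?case using polycurve.add by (simp add: bounded_bilinear.add_right[OF h])
  qed
next
  case (add \<gamma> \<gamma>')
  then show ?case using polycurve.add by (simp add: bounded_bilinear.add_left[OF h])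
qed

lemma polycurve_vderiv:
  assumes "polycurve \<gamma>" shows "polycurve (\<lambda>t. vderiv (\<gamma> t))"
  using assms
proof induction
  case (monomial u k)
  have "vderiv (\<lambda>x. t ^ k *\<^sub>R u x) = (\<lambda>x. t ^ k *\<^sub>R vderiv u x)" for t
    by (rule vderiv_bounded_linear[OF bounded_linear_scaleR_right loops_smooth[OF monomial]])
  then show ?case using polycurve.monomial[OF loops_vderiv[OF monomial]] by simp
next
  case (add \<gamma> \<delta>)
  have "vderiv (\<lambda>x. \<gamma> t x + \<delta> t x) = (\<lambda>x. vderiv (\<gamma> t) x + vderiv (\<delta> t) x)" for t
    by (rule vderiv_add[OF loops_smooth[OF polycurve_loops] loops_smooth[OF polycurve_loops]]; rule add)
  then show ?case using polycurve.add[OF add(3,4)] by simp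
qed

lemma polycurve_nderiv: "polycurve \<gamma> \<Longrightarrow> polycurve (\<lambda>t. nderiv k (\<gamma> t))"
  by (induction k) (simp_all add: nderiv_Suc polycurve_vderiv)

lemma polycurve_sum: "(\<And>i. i \<in> I \<Longrightarrow> polycurve (\<gamma> i)) \<Longrightarrow> polycurve (\<lambda>t x. \<Sum>i\<in>I. \<gamma> i t x)"
  by (induction I rule: infinite_finite_induct) (auto intro: polycurve.add polycurve_const loops_const)

definition tderiv :: "(real \<Rightarrow> real \<Rightarrow> 'v::euclidean_space) \<Rightarrow> real \<Rightarrow> real \<Rightarrow> 'v" where
  "tderiv \<gamma> t x = vector_derivative (\<lambda>s. \<gamma> s x) (at t)"

text \<open>The induction constructs one explicit derivative curve with all the properties; only at
  the end is it identified with the pointwise derivative \<open>tderiv\<close>.\<close>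

lemma polycurve_derivative:
  fixes \<gamma> :: "real \<Rightarrow> real \<Rightarrow> 'v::euclidean_space"
  assumes "polycurve \<gamma>"
  shows polycurve_tderiv: "polycurve (tderiv \<gamma>)"
    and nderiv_tderiv: "((\<lambda>s. nderiv k (\<gamma> s) x) has_vector_derivative nderiv k (tderiv \<gamma> t) x) (at t)"
    and integral_tderiv: "((\<lambda>s. integral {0..1} (\<gamma> s)) has_vector_derivative integral {0..1} (tderiv \<gamma> t)) (at t)"
proof -
  have "\<exists>\<gamma>'. polycurve \<gamma>' \<and>
      (\<forall>t k x. ((\<lambda>s. nderiv k (\<gamma> s) x) has_vector_derivative nderiv k (\<gamma>' t) x) (at t)) \<and>
      (\<forall>t. ((\<lambda>s. integral {0..1} (\<gamma> s)) has_vector_derivative integral {0..1} (\<gamma>' t)) (at t))"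
    using assms
  proof induction
    case (monomial u k)
    let ?\<gamma>' = "\<lambda>t x. t ^ (k - 1) *\<^sub>R (real k *\<^sub>R u x)"
    have n: "nderiv j (\<lambda>x. c *\<^sub>R u x) = (\<lambda>x. c *\<^sub>R nderiv j u x)" for c j
      by (rule nderiv_bounded_linear[OF bounded_linear_scaleR_right loops_smooth[OF monomial]])
    have d: "((\<lambda>s. s ^ k *\<^sub>R v) has_vector_derivative t ^ (k - 1) *\<^sub>R (real k *\<^sub>R v)) (at t)" for t and v :: 'v
    proof -
      have "((\<lambda>s. s ^ k) has_real_derivative real k * t ^ (k - 1)) (at t)"
        by (auto intro!: derivative_eq_intros)
      from has_vector_derivative_scaleR[OF this has_vector_derivative_const[of v]]
      show ?thesis by (simp add: mult.commute)
    qed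
    have n': "nderiv j (?\<gamma>' t) = (\<lambda>x. t ^ (k - 1) *\<^sub>R (real k *\<^sub>R nderiv j u x))" for j t
      using n[of j "t ^ (k - 1) * real k"] by simp
    have i': "integral {0..1} (?\<gamma>' t) = t ^ (k - 1) *\<^sub>R (real k *\<^sub>R integral {0..1} u)" for t
      by (simp only: integral_cmul)
    show ?case
    proof (intro exI[of _ ?\<gamma>'] conjI allI)
      show "polycurve ?\<gamma>'" by (rule polycurve.monomial[OF loops_scaleR[OF monomial]])
      show "((\<lambda>s. nderiv j (\<lambda>x. s ^ k *\<^sub>R u x) x) has_vector_derivative nderiv j (?\<gamma>' t) x) (at t)" for t j x
        unfolding n n' by (rule d)
      show "((\<lambda>s. integral {0..1} (\<lambda>x. s ^ k *\<^sub>R u x)) has_vector_derivative integral {0..1} (?\<gamma>' t)) (at t)" for t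
        unfolding integral_cmul i' by (rule d)
    qed
  next
    case (add \<gamma> \<delta>)
    then obtain \<gamma>' \<delta>' where *: "polycurve \<gamma>'" "polycurve \<delta>'"
      "\<And>t k x. ((\<lambda>s. nderiv k (\<gamma> s) x) has_vector_derivative nderiv k (\<gamma>' t) x) (at t)"
      "\<And>t k x. ((\<lambda>s. nderiv k (\<delta> s) x) has_vector_derivative nderiv k (\<delta>' t) x) (at t)"
      "\<And>t. ((\<lambda>s. integral {0..1} (\<gamma> s)) has_vector_derivative integral {0..1} (\<gamma>' t)) (at t)"
      "\<And>t. ((\<lambda>s. integral {0..1} (\<delta> s)) has_vector_derivative integral {0..1} (\<delta>' t)) (at t)"
      by blast
    have n: "nderiv k (\<lambda>x. \<alpha> s x + \<beta> s x) = (\<lambda>x. nderiv k (\<alpha> s) x + nderiv k (\<beta> s) x)"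
      if "polycurve \<alpha>" "polycurve \<beta>" for k s and \<alpha> \<beta> :: "real \<Rightarrow> real \<Rightarrow> 'v"
      using that by (intro nderiv_add loops_smooth[OF polycurve_loops])
    have i: "integral {0..1} (\<lambda>x. \<alpha> s x + \<beta> s x) = integral {0..1} (\<alpha> s) + integral {0..1} (\<beta> s)"
      if "polycurve \<alpha>" "polycurve \<beta>" for s and \<alpha> \<beta> :: "real \<Rightarrow> real \<Rightarrow> 'v"
      using that by (intro integral_add loop_integrable[OF polycurve_loops])
    show ?case
    proof (intro exI[of _ "\<lambda>t x. \<gamma>' t x + \<delta>' t x"] conjI allI)
      show "polycurve (\<lambda>t x. \<gamma>' t x + \<delta>' t x)" by (rule polycurve.add[OF *(1,2)])
      show "((\<lambda>s. nderiv k (\<lambda>x. \<gamma> s x + \<delta> s x) x) has_vector_derivative nderiv k (\<lambda>x. \<gamma>' t x + \<delta>' t x) x) (at t)" for t k x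
        unfolding n[OF add(1,2)] n[OF *(1,2)] by (rule has_vector_derivative_add[OF *(3,4)])
      show "((\<lambda>s. integral {0..1} (\<lambda>x. \<gamma> s x + \<delta> s x)) has_vector_derivative integral {0..1} (\<lambda>x. \<gamma>' t x + \<delta>' t x)) (at t)" for t
        unfolding i[OF add(1,2)] i[OF *(1,2)] by (rule has_vector_derivative_add[OF *(5,6)])
    qed
  qed
  then obtain \<gamma>' where *: "polycurve \<gamma>'"
      "\<And>t k x. ((\<lambda>s. nderiv k (\<gamma> s) x) has_vector_derivative nderiv k (\<gamma>' t) x) (at t)"
      "\<And>t. ((\<lambda>s. integral {0..1} (\<gamma> s)) has_vector_derivative integral {0..1} (\<gamma>' t)) (at t)"
    by blast
  have "tderiv \<gamma> t x = \<gamma>' t x" for t x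
    using vector_derivative_at[OF *(2)[where k = 0]] by (simp add: tderiv_def)
  then have "tderiv \<gamma> = \<gamma>'" by blast
  with * show "polycurve (tderiv \<gamma>)"
    "((\<lambda>s. nderiv k (\<gamma> s) x) has_vector_derivative nderiv k (tderiv \<gamma> t) x) (at t)"
    "((\<lambda>s. integral {0..1} (\<gamma> s)) has_vector_derivative integral {0..1} (tderiv \<gamma> t)) (at t)"
    by simp_all
qed

lemma has_tderiv: "polycurve \<gamma> \<Longrightarrow> ((\<lambda>s. \<gamma> s x) has_vector_derivative tderiv \<gamma> t x) (at t)"
  using nderiv_tderiv[of \<gamma> 0] by simp

lemma tderiv_line: "tderiv (\<lambda>t x. u x + t *\<^sub>R w x) t = w"
proof
  fix x
  have "((\<lambda>s. u x + s *\<^sub>R w x) has_vector_derivative w x) (at t)"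
    by (auto intro!: derivative_eq_intros)
  then show "tderiv (\<lambda>t x. u x + t *\<^sub>R w x) t x = w x" by (simp add: tderiv_def vector_derivative_at)
qed

lemma polycurve_constant:
  assumes \<gamma>: "polycurve \<gamma>" and zero: "\<And>t x. tderiv \<gamma> t x = 0"
  shows "\<gamma> t = \<gamma> s"
proof
  fix x
  have "((\<lambda>s. \<gamma> s x) has_derivative (\<lambda>h. 0)) (at t within UNIV)" for t
    using has_tderiv[OF \<gamma>, of x t] zero by (simp add: has_vector_derivative_def)
  then show "\<gamma> t x = \<gamma> s x"
    using has_derivative_zero_constant[of UNIV "\<lambda>s. \<gamma> s x"] by (metis convex_UNIV UNIV_I)
qed

lemma tderiv_in_subspace:
  fixes \<gamma> :: "real \<Rightarrow> 'n::finite loop"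
  assumes "vec.subspace V" "polycurve \<gamma>" "\<And>t x. \<gamma> t x \<in> V"
  shows "tderiv \<gamma> t x \<in> V"
proof -
  obtain P where P: "clin P" "\<And>x. P x \<in> V" "\<And>x. x \<in> V \<Longrightarrow> P x = x"
    using clin_projection_exists[OF assms(1)] by blast
  have "((\<lambda>s. P (\<gamma> s x)) has_vector_derivative P (tderiv \<gamma> t x)) (at t)"
    by (rule bounded_linear.has_vector_derivative[OF clin_bounded_linear[OF P(1)] has_tderiv[OF assms(2)]])
  moreover have "(\<lambda>s. P (\<gamma> s x)) = (\<lambda>s. \<gamma> s x)" using P(3)[OF assms(3)] by blast
  ultimately have "((\<lambda>s. \<gamma> s x) has_vector_derivative P (tderiv \<gamma> t x)) (at t)" by simp
  then have "tderiv \<gamma> t x = P (tderiv \<gamma> t x)" unfolding tderiv_def[of \<gamma> t x] by (rule vector_derivative_at)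
  then show ?thesis using P(2)[of "tderiv \<gamma> t x"] by simp
qed

section \<open>Derivatives of densities and local functionals\<close>

lemma density_zero: "(\<lambda>_ _. 0) \<in> densities"
  by (rule densities.coeff[OF loops_const])

lemma diff_poly_density: "p \<in> diff_poly \<Longrightarrow> (\<lambda>_. p) \<in> densities"
proof (induction rule: diff_poly.induct)
  case (const c)
  show ?case by (rule densities.coeff[OF loops_const])
qed (auto intro: densities.intros)

lemma density_loop:
  assumes "p \<in> densities" "q \<in> loops UNIV" shows "(\<lambda>x. p x (jet q x)) \<in> loops UNIV"
  using assms(1)
proof induction
  case (coord k i)
  then show ?case by (simp add: jet_def loops_component[OF loops_nderiv[OF assms(2)]])
qed (auto intro: loops_add loops_mult)

lemma density_polycurve:
  assumes "p \<in> densities" "polycurve \<gamma>" shows "polycurve (\<lambda>t x. p x (jet (\<gamma> t) x))"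
  using assms(1)
proof induction
  case (coeff a)
  then show ?case by (rule polycurve_const)
next
  case (coord k i)
  show ?case unfolding jet_def
    by (rule polycurve_bounded_linear[OF bounded_linear_component polycurve_nderiv[OF assms(2)]])
next
  case (add p p')
  show ?case by (rule polycurve.add[OF add(3,4)])
next
  case (mult p p')
  show ?case by (rule polycurve_bilinear[OF bounded_bilinear_mult mult(3,4)])
qed

text \<open>Partial derivatives \<open>P\<close> with order below \<open>N\<close>, characterized by
  the chain rule. The chain rule along complex curves of jets identifies them with
  \<open>jet_partial\<close>; the one along real curves serves to differentiate functionals.\<close>

definition has_partials ::
    "(real \<Rightarrow> (nat \<Rightarrow> 'n::finite vec) \<Rightarrow> complex) \<Rightarrow> nat \<Rightarrow> (nat \<Rightarrow> 'n \<Rightarrow> real \<Rightarrow> (nat \<Rightarrow> 'n vec) \<Rightarrow> complex) \<Rightarrow> bool"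
  where "has_partials p N P \<longleftrightarrow>
    (\<forall>a i. P a i \<in> densities) \<and> (\<forall>a\<ge>N. \<forall>i. P a i = (\<lambda>_ _. 0)) \<and>
    (\<forall>x (J :: complex \<Rightarrow> nat \<Rightarrow> 'n vec) J' t. (\<forall>a i. ((\<lambda>s. J s a $ i) has_field_derivative J' a i) (at t)) \<longrightarrow>
       ((\<lambda>s. p x (J s)) has_field_derivative (\<Sum>a<N. \<Sum>i\<in>UNIV. P a i x (J t) * J' a i)) (at t)) \<and>
    (\<forall>x (J :: real \<Rightarrow> nat \<Rightarrow> 'n vec) J' t. (\<forall>a i. ((\<lambda>s. J s a $ i) has_vector_derivative J' a i) (at t)) \<longrightarrow>
       ((\<lambda>s. p x (J s)) has_vector_derivative (\<Sum>a<N. \<Sum>i\<in>UNIV. P a i x (J t) * J' a i)) (at t))"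

lemma has_partials_mono:
  assumes "has_partials p N P" "N \<le> N'" shows "has_partials p N' P"
proof -
  have "(\<Sum>a<N. \<Sum>i\<in>UNIV. P a i x j * J' a i) = (\<Sum>a<N'. \<Sum>i\<in>UNIV. P a i x j * J' a i)" for x j J'
    using assms by (intro sum.mono_neutral_left) (auto simp: has_partials_def)
  then show ?thesis using assms by (simp add: has_partials_def)
qed

lemma has_partials_exists: "p \<in> densities \<Longrightarrow> \<exists>N P. has_partials p N P"
proof (induction rule: densities.induct)
  case (coeff a)
  have "has_partials (\<lambda>x _. a x) 0 (\<lambda>_ _ _ _. 0)"
    by (simp add: has_partials_def density_zero)
  then show ?case by blast
next
  case (coord k i)
  let ?P = "\<lambda>a i' (x::real) (j :: nat \<Rightarrow> 'a vec). if a = k \<and> i' = i then 1 else (0::complex)"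
  have "?P a i' \<in> densities" for a i'
    using densities.coeff[OF loops_const[of "if a = k \<and> i' = i then 1 else 0"]] .
  moreover have "(\<Sum>a<Suc k. \<Sum>i'\<in>UNIV. ?P a i' x j * J' a i') = J' k i" for x :: real and j :: "nat \<Rightarrow> 'a vec" and J'
  proof -
    have "(\<Sum>i'\<in>UNIV. ?P a i' x j * J' a i') = (if a = k then J' k i else 0)" for a
      by (simp add: if_distrib[of "\<lambda>c. c * _"] cong: if_cong)
    then show ?thesis by simp
  qed
  ultimately have "has_partials (\<lambda>_ j. j k $ i) (Suc k) ?P"
    by (auto simp: has_partials_def)
  then show ?case by blast
next
  case (add p p')
  then obtain N P N' P' where "has_partials p N P" "has_partials p' N' P'" by blast
  then have P: "has_partials p (max N N') P" "has_partials p' (max N N') P'"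
    by (simp_all add: has_partials_mono)
  have "has_partials (\<lambda>x j. p x j + p' x j) (max N N') (\<lambda>a i x j. P a i x j + P' a i x j)"
    using P unfolding has_partials_def distrib_right sum.distrib
    by (auto intro: densities.add DERIV_add has_vector_derivative_add)
  then show ?case by blast
next
  case (mult p p')
  then obtain N P N' P' where "has_partials p N P" "has_partials p' N' P'" by blast
  then have P: "has_partials p (max N N') P" "has_partials p' (max N N') P'"
    by (simp_all add: has_partials_mono)
  let ?Q = "\<lambda>a i x j. P a i x j * p' x j + p x j * P' a i x j"
  let ?N = "max N N'"
  have s: "(\<Sum>a<?N. \<Sum>i\<in>UNIV. ?Q a i x j * J' a i) =
      p x j * (\<Sum>a<?N. \<Sum>i\<in>UNIV. P' a i x j * J' a i) + (\<Sum>a<?N. \<Sum>i\<in>UNIV. P a i x j * J' a i) * p' x j" for x j J'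
    by (simp add: distrib_right distrib_left sum.distrib sum_distrib_left sum_distrib_right algebra_simps)
  have "has_partials (\<lambda>x j. p x j * p' x j) ?N ?Q"
    unfolding has_partials_def s
  proof (intro conjI allI impI)
    fix x t J' and J :: "complex \<Rightarrow> nat \<Rightarrow> 'a vec"
    assume "\<forall>a i. ((\<lambda>s. J s a $ i) has_field_derivative J' a i) (at t)"
    then have "((\<lambda>s. p x (J s)) has_field_derivative (\<Sum>a<?N. \<Sum>i\<in>UNIV. P a i x (J t) * J' a i)) (at t)"
      "((\<lambda>s. p' x (J s)) has_field_derivative (\<Sum>a<?N. \<Sum>i\<in>UNIV. P' a i x (J t) * J' a i)) (at t)"
      using P by (auto simp: has_partials_def)
    from DERIV_mult[OF this]
    show "((\<lambda>s. p x (J s) * p' x (J s)) has_field_derivative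
        p x (J t) * (\<Sum>a<?N. \<Sum>i\<in>UNIV. P' a i x (J t) * J' a i) +
        (\<Sum>a<?N. \<Sum>i\<in>UNIV. P a i x (J t) * J' a i) * p' x (J t)) (at t)"
      by (simp add: mult.commute add.commute)
  next
    fix x t J' and J :: "real \<Rightarrow> nat \<Rightarrow> 'a vec"
    assume "\<forall>a i. ((\<lambda>s. J s a $ i) has_vector_derivative J' a i) (at t)"
    then have "((\<lambda>s. p x (J s)) has_vector_derivative (\<Sum>a<?N. \<Sum>i\<in>UNIV. P a i x (J t) * J' a i)) (at t)"
      "((\<lambda>s. p' x (J s)) has_vector_derivative (\<Sum>a<?N. \<Sum>i\<in>UNIV. P' a i x (J t) * J' a i)) (at t)"
      using P by (auto simp: has_partials_def)
    from has_vector_derivative_mult[OF this]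
    show "((\<lambda>s. p x (J s) * p' x (J s)) has_vector_derivative
        p x (J t) * (\<Sum>a<?N. \<Sum>i\<in>UNIV. P' a i x (J t) * J' a i) +
        (\<Sum>a<?N. \<Sum>i\<in>UNIV. P a i x (J t) * J' a i) * p' x (J t)) (at t)" .
  qed (use P mult in \<open>auto simp: has_partials_def intro!: densities.add densities.mult\<close>)
  then show ?case by blast
qed

lemma has_partials_real:
  "\<lbrakk>has_partials p N P; \<And>a i. ((\<lambda>s. J s a $ i) has_vector_derivative J' a i) (at t)\<rbrakk> \<Longrightarrow>
    ((\<lambda>s. p x (J s)) has_vector_derivative (\<Sum>a<N. \<Sum>i\<in>UNIV. P a i x (J t) * J' a i)) (at t)"
  by (simp add: has_partials_def)

lemma tderiv_density:
  assumes "has_partials p N P" and \<gamma>: "polycurve \<gamma>"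
  shows "tderiv (\<lambda>t x. p x (jet (\<gamma> t) x)) t x =
    (\<Sum>a<N. \<Sum>i\<in>UNIV. P a i x (jet (\<gamma> t) x) * nderiv a (tderiv \<gamma> t) x $ i)"
proof -
  have "((\<lambda>s. jet (\<gamma> s) x a $ i) has_vector_derivative nderiv a (tderiv \<gamma> t) x $ i) (at t)" for a i
    unfolding jet_def
    by (rule bounded_linear.has_vector_derivative[OF bounded_linear_component nderiv_tderiv[OF \<gamma>]])
  from has_partials_real[OF assms(1) this] show ?thesis
    unfolding tderiv_def by (rule vector_derivative_at)
qed

text \<open>A curve may be replaced by its tangent line when differentiating; gradients are defined
  by lines only.\<close>

lemma tderiv_density_line:
  assumes "p \<in> densities" "polycurve \<gamma>"
  shows "tderiv (\<lambda>t x. p x (jet (\<gamma> t) x)) t x =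
    tderiv (\<lambda>s x. p x (jet (\<lambda>y. \<gamma> t y + s *\<^sub>R tderiv \<gamma> t y) x)) 0 x"
proof -
  obtain N P where P: "has_partials p N P" using has_partials_exists[OF assms(1)] by blast
  have "polycurve (\<lambda>s x. \<gamma> t x + s *\<^sub>R tderiv \<gamma> t x)"
    by (intro polycurve_line polycurve_loops assms polycurve_tderiv)
  from tderiv_density[OF P this, of 0 x] show ?thesis
    unfolding tderiv_density[OF P assms(2)] tderiv_line by simp
qed

definition density_functional :: "(real \<Rightarrow> (nat \<Rightarrow> 'n::finite vec) \<Rightarrow> complex) \<Rightarrow> 'n functional" where
  "density_functional p q = integral {0..1} (\<lambda>x. p x (jet q x))"

lemma density_functional_derivative:
  assumes "p \<in> densities" "polycurve \<gamma>"
  shows "((\<lambda>t. density_functional p (\<gamma> t)) has_vector_derivative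
    integral {0..1} (tderiv (\<lambda>t x. p x (jet (\<gamma> t) x)) t)) (at t)"
  unfolding density_functional_def by (rule integral_tderiv[OF density_polycurve[OF assms]])

text \<open>The Euler-Lagrange derivative of the density whose partials are
  \<open>P\<close>.\<close>

definition variation ::
    "nat \<Rightarrow> (nat \<Rightarrow> 'n \<Rightarrow> real \<Rightarrow> (nat \<Rightarrow> 'n::finite vec) \<Rightarrow> complex) \<Rightarrow> 'n loop \<Rightarrow> 'n \<Rightarrow> real \<Rightarrow> complex"
  where "variation N P q i x = (\<Sum>a<N. (- 1) ^ a * nderiv a (\<lambda>y. P a i y (jet q y)) x)"

lemma variation_loop:
  assumes "has_partials p N P" "q \<in> loops UNIV" shows "variation N P q i \<in> loops UNIV"
proof -
  have "(\<lambda>x. variation N P q i x) \<in> loops UNIV" unfolding variation_def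
    using assms by (intro loops_sum loops_mult loops_const loops_nderiv density_loop) (auto simp: has_partials_def)
  then show ?thesis by simp
qed

lemma variation_derivative:
  assumes p: "p \<in> densities" and P: "has_partials p N P" and q: "q \<in> loops UNIV" and w: "w \<in> loops UNIV"
  shows "((\<lambda>t. density_functional p (\<lambda>x. q x + t *\<^sub>R w x)) has_vector_derivative
    integral {0..1} (\<lambda>x. \<Sum>i\<in>UNIV. variation N P q i x * w x $ i)) (at 0)"
proof -
  note line = polycurve_line[OF q w]
  have P': "P a i \<in> densities" for a i using P by (simp add: has_partials_def)
  have L: "(\<lambda>x. P a i x (jet q x) * nderiv a w x $ i) \<in> loops UNIV"
    "(\<lambda>x. nderiv a (\<lambda>y. P a i y (jet q y)) x * w x $ i) \<in> loops UNIV" for a i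
    using density_loop[OF P' q] loops_component[OF w] loops_component[OF loops_nderiv[OF w]]
    by (auto intro!: loops_mult loops_nderiv)
  have L': "(\<lambda>x. (- 1) ^ a * (nderiv a (\<lambda>y. P a i y (jet q y)) x * w x $ i)) \<in> loops UNIV" for a i
    by (rule loops_mult[OF loops_const L(2)])
  have "integral {0..1} (tderiv (\<lambda>t x. p x (jet (\<lambda>y. q y + t *\<^sub>R w y) x)) 0) =
      integral {0..1} (\<lambda>x. \<Sum>a<N. \<Sum>i\<in>UNIV. P a i x (jet q x) * nderiv a w x $ i)"
    by (rule arg_cong[of _ _ "integral {0..1}"], rule ext) (simp add: tderiv_density[OF P line] tderiv_line)
  also have "\<dots> = (\<Sum>a<N. \<Sum>i\<in>UNIV. integral {0..1} (\<lambda>x. P a i x (jet q x) * nderiv a w x $ i))"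
    by (simp add: integral_sum loop_integrable[OF L(1)] loop_integrable[OF loops_sum[OF L(1)]])
  also have "\<dots> = (\<Sum>a<N. \<Sum>i\<in>UNIV. integral {0..1} (\<lambda>x. (- 1) ^ a * (nderiv a (\<lambda>y. P a i y (jet q y)) x * w x $ i)))"
  proof (intro sum.cong refl)
    fix a i
    have n: "nderiv a (\<lambda>x. w x $ i) = (\<lambda>x. nderiv a w x $ i)"
      by (rule nderiv_bounded_linear[OF bounded_linear_component loops_smooth[OF w]])
    have "integral {0..1} (\<lambda>x. (- 1) ^ a * (nderiv a (\<lambda>y. P a i y (jet q y)) x * w x $ i)) =
        (- 1) ^ a * ((- 1) ^ a * integral {0..1} (\<lambda>x. P a i x (jet q x) * nderiv a w x $ i))"
      using integral_by_parts_nderiv[OF density_loop[OF P' q] loops_component[OF w], of a a i i]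
      by (simp only: integral_mult_right n)
    then show "integral {0..1} (\<lambda>x. P a i x (jet q x) * nderiv a w x $ i) =
        integral {0..1} (\<lambda>x. (- 1) ^ a * (nderiv a (\<lambda>y. P a i y (jet q y)) x * w x $ i))"
      by (simp add: mult.assoc[symmetric] power_mult_distrib[symmetric] del: integral_mult_right)
  qed
  also have "\<dots> = integral {0..1} (\<lambda>x. \<Sum>a<N. \<Sum>i\<in>UNIV. (- 1) ^ a * (nderiv a (\<lambda>y. P a i y (jet q y)) x * w x $ i))"
    by (simp add: integral_sum loop_integrable[OF L'] loop_integrable[OF loops_sum[OF L']] del: integral_mult_right)
  also have "\<dots> = integral {0..1} (\<lambda>x. \<Sum>i\<in>UNIV. variation N P q i x * w x $ i)"
    by (subst sum.swap) (simp add: variation_def sum_distrib_right mult.assoc)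
  finally show ?thesis using density_functional_derivative[OF p line, of 0] by simp
qed

section \<open>Gradients and covector lifts\<close>

context lie
begin

lemma bounded_bilinear_br: "bounded_bilinear br"
  by (rule bilinear_bounded) (simp_all add: br_add scaleR_eq_smult)

lemma bounded_bilinear_killing: "bounded_bilinear K"
  by (rule bilinear_bounded) (simp_all add: killing_add scaleR_eq_smult scaleR_conv_of_real)

lemma loops_br: "u \<in> loops UNIV \<Longrightarrow> v \<in> loops UNIV \<Longrightarrow> (\<lambda>x. br (u x) (v x)) \<in> loops UNIV"
  by (rule loops_bilinear[OF bounded_bilinear_br])

lemma loops_killing: "u \<in> loops UNIV \<Longrightarrow> v \<in> loops UNIV \<Longrightarrow> (\<lambda>x. K (u x) (v x)) \<in> loops UNIV"
  by (rule loops_bilinear[OF bounded_bilinear_killing])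

lemma P2_loops: "q \<in> loops UNIV \<Longrightarrow> v \<in> loops UNIV \<Longrightarrow> P2 br q v \<in> loops UNIV"
  unfolding P2_def by (intro loops_add loops_vderiv loops_br)

lemma P2_add: "\<lbrakk>u \<in> loops UNIV; v \<in> loops UNIV\<rbrakk> \<Longrightarrow>
    P2 br q (\<lambda>x. u x + v x) = (\<lambda>x. P2 br q u x + P2 br q v x)"
  unfolding P2_def by (simp add: fun_cong[OF vderiv_add[OF loops_smooth loops_smooth]] br_add algebra_simps)

lemma pairing_sym: "pairing br u v = pairing br v u"
  by (simp add: pairing_def killing_sym)

lemma pairing_add:
  "\<lbrakk>u \<in> loops UNIV; v \<in> loops UNIV; w \<in> loops UNIV\<rbrakk> \<Longrightarrow>
    pairing br u (\<lambda>x. v x + w x) = pairing br u v + pairing br u w"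
  unfolding pairing_def killing_add
  by (intro integral_add loop_integrable[where V = UNIV] loops_killing)

lemma pairing_diff_left:
  "\<lbrakk>u \<in> loops UNIV; v \<in> loops UNIV; w \<in> loops UNIV\<rbrakk> \<Longrightarrow>
    pairing br (\<lambda>x. v x - w x) u = pairing br v u - pairing br w u"
  unfolding pairing_def killing_diff
  by (intro integral_diff loop_integrable[where V = UNIV] loops_killing)

lemma pairing_P2_skew:
  assumes q: "q \<in> loops UNIV" and u: "u \<in> loops UNIV" and v: "v \<in> loops UNIV"
  shows "pairing br u (P2 br q v) = - pairing br (P2 br q u) v"
proof -
  have i: "integral {0..1} (\<lambda>x. K (u x) (vderiv v x)) = - integral {0..1} (\<lambda>x. K (vderiv u x) (v x))"
    using integral_by_parts_loops[OF bounded_bilinear_killing u v] by simp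
  have "K (u x) (br (q x) (v x)) = - K (br (q x) (u x)) (v x)" for x
    using killing_invariant'[of "q x" "u x" "v x"] by simp
  then have j: "integral {0..1} (\<lambda>x. K (u x) (br (q x) (v x))) = - integral {0..1} (\<lambda>x. K (br (q x) (u x)) (v x))"
    by simp
  have L: "(\<lambda>x. K (u x) (vderiv v x)) \<in> loops UNIV" "(\<lambda>x. K (u x) (br (q x) (v x))) \<in> loops UNIV"
    "(\<lambda>x. K (vderiv u x) (v x)) \<in> loops UNIV" "(\<lambda>x. K (br (q x) (u x)) (v x)) \<in> loops UNIV"
    using assms by (auto intro!: loops_killing loops_br loops_vderiv)
  show ?thesis
    unfolding pairing_def P2_def killing_add
    by (simp add: integral_add L[THEN loop_integrable] i j)
qed

text \<open>Test with \<open>cnj (K (u x) y) *s y\<close>, a loop in \<open>V\<close> because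
  \<open>V\<close> is a complex subspace; this passes from integrated to pointwise
  orthogonality.\<close>

lemma pairing_zero_imp:
  assumes V: "vec.subspace V" and u: "u \<in> loops UNIV"
    and zero: "\<And>w. w \<in> loops V \<Longrightarrow> pairing br u w = 0" and y: "y \<in> V"
  shows "K (u x) y = 0"
proof (rule fundamental_lemma)
  let ?c = "\<lambda>x. K (u x) y"
  show c: "?c \<in> loops UNIV" by (rule loops_killing[OF u loops_const])
  have "(\<lambda>x. cnj (?c x) *s y) \<in> loops V"
    by (rule loops_valueI[OF loops_smult[OF loops_cnj[OF c] loops_const]])
       (rule vec.subspace_scale[OF V y])
  from zero[OF this] show "integral {0..1} (\<lambda>x. ?c x * cnj (?c x)) = 0"
    by (simp add: pairing_def mult.commute)
qed

end

text \<open>Agreement is demanded on smooth loops only. \<open>smeared\<close> functionals are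
  represented in this sense, and gradients at loops cannot tell the difference
  (\<open>gradient_cong\<close>).\<close>

definition represented_by :: "'n::finite functional \<Rightarrow> (real \<Rightarrow> (nat \<Rightarrow> 'n vec) \<Rightarrow> complex) \<Rightarrow> bool" where
  "represented_by F p \<longleftrightarrow> p \<in> densities \<and> (\<forall>q\<in>loops UNIV. F q = density_functional p q)"

lemma local_functional_represented: "F \<in> local_functionals \<Longrightarrow> \<exists>p. represented_by F p"
  by (auto simp: local_functionals_def represented_by_def density_functional_def[abs_def])

context nondegenerate_lie
begin

lemma dual_axis: "\<exists>\<kappa>. \<forall>i y. K (\<kappa> i) y = y $ i"
proof -
  have "\<exists>b. \<forall>y. K b y = y $ i" for i
    by (rule killing_represents[OF killing_nondegenerate]) auto
  then show ?thesis by metis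
qed

lemma has_differential_unique:
  assumes "has_differential br UNIV F q v" "has_differential br UNIV F q v'" shows "v = v'"
proof
  fix x
  have L: "v \<in> loops UNIV" "v' \<in> loops UNIV" using assms by (simp_all add: has_differential_def)
  have "pairing br (\<lambda>x. v x - v' x) w = 0" if "w \<in> loops UNIV" for w
  proof -
    have "pairing br v w = pairing br v' w"
      using assms that vector_derivative_unique_at unfolding has_differential_def by blast
    then show ?thesis using pairing_diff_left[OF that L] by simp
  qed
  then have "K (v x - v' x) y = 0" for y
    using pairing_zero_imp[OF vec.subspace_UNIV loops_diff[OF L]] by blast
  then show "v x = v' x" using killing_nondegenerate by (metis eq_iff_diff_eq_0)
qed

lemma gradient_eqI: "has_differential br UNIV F q v \<Longrightarrow> gradient br F q = v"
  unfolding gradient_def using has_differential_unique by blast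

lemma has_differential_variation:
  assumes F: "represented_by F p" and P: "has_partials p N P" and q: "q \<in> loops UNIV"
    and \<kappa>: "\<And>i y. K (\<kappa> i) y = y $ i"
  shows "has_differential br UNIV F q (\<lambda>x. \<Sum>i\<in>UNIV. variation N P q i x *s \<kappa> i)"
  unfolding has_differential_def
proof (intro conjI ballI)
  show "(\<lambda>x. \<Sum>i\<in>UNIV. variation N P q i x *s \<kappa> i) \<in> loops UNIV"
    by (intro loops_sum loops_smult loops_const variation_loop[OF P q])
  fix w :: "'a loop" assume w: "w \<in> loops UNIV"
  have "F (\<lambda>x. q x + t *\<^sub>R w x) = density_functional p (\<lambda>x. q x + t *\<^sub>R w x)" for t
    using F loops_add[OF q loops_scaleR[OF w]] by (simp add: represented_by_def)
  then show "((\<lambda>t. F (\<lambda>x. q x + t *\<^sub>R w x)) has_vector_derivative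
      pairing br (\<lambda>x. \<Sum>i\<in>UNIV. variation N P q i x *s \<kappa> i) w) (at 0)"
    using variation_derivative[OF _ P q w] F
    by (simp add: pairing_def killing_sum \<kappa> represented_by_def)
qed

lemma has_gradient:
  assumes "represented_by F p" "q \<in> loops UNIV"
  shows "has_differential br UNIV F q (gradient br F q)"
proof -
  obtain N P where "has_partials p N P" using assms(1) has_partials_exists[of p] by (auto simp: represented_by_def)
  moreover obtain \<kappa> where "\<forall>i y. K (\<kappa> i) y = y $ i" using dual_axis by blast
  ultimately have "has_differential br UNIV F q (\<lambda>x. \<Sum>i\<in>UNIV. variation N P q i x *s \<kappa> i)"
    using has_differential_variation[OF assms(1) _ assms(2)] by blast
  from this[folded gradient_eqI[OF this]] show ?thesis .
qed

lemma gradient_loops: "represented_by F p \<Longrightarrow> q \<in> loops UNIV \<Longrightarrow> gradient br F q \<in> loops UNIV"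
  using has_gradient by (auto simp: has_differential_def)

lemma pairing_gradientI:
  assumes "represented_by F p" "q \<in> loops UNIV" "w \<in> loops UNIV"
    and "((\<lambda>t. F (\<lambda>x. q x + t *\<^sub>R w x)) has_vector_derivative d) (at 0)"
  shows "pairing br (gradient br F q) w = d"
  using has_gradient[OF assms(1,2)] assms(3,4) vector_derivative_unique_at
  unfolding has_differential_def by blast

lemma gradient_cong:
  assumes "\<And>q. q \<in> loops UNIV \<Longrightarrow> F q = G q" "q \<in> loops UNIV"
  shows "gradient br F q = gradient br G q"
proof -
  have "has_differential br UNIV F q v = has_differential br UNIV G q v" for v
    using assms(1)[OF loops_add[OF assms(2) loops_scaleR]] by (simp add: has_differential_def)
  then show ?thesis by (simp add: gradient_def)
qed

end

lemma (in slice) kernel_f_subspace: "vec.subspace (ker_ad br f)"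
  unfolding ker_ad_def by (rule subspace_kernel[OF linear_right])

lemma (in slice) range_f_subspace: "vec.subspace (range (br f))"
  by (rule subspace_range[OF linear_right])

lemma affine_loops_iff:
  "vec.subspace V \<Longrightarrow> z \<in> affine_loops e V \<longleftrightarrow> z \<in> loops UNIV \<and> (\<forall>x. z x - e \<in> V)"
proof
  assume "z \<in> affine_loops e V"
  then obtain u where "z = (\<lambda>x. e + u x)" "u \<in> loops V" by (auto simp: affine_loops_def)
  then show "z \<in> loops UNIV \<and> (\<forall>x. z x - e \<in> V)"
    using loops_add[OF loops_const loops_UNIV_I] loops_value by auto
next
  assume z: "z \<in> loops UNIV \<and> (\<forall>x. z x - e \<in> V)"
  then have "(\<lambda>x. z x - e) \<in> loops V"
    using loops_valueI[OF loops_diff[OF _ loops_const[of e]]] by blast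
  then show "z \<in> affine_loops e V" unfolding affine_loops_def by force
qed

section \<open>Covector lifts by a terminating Neumann series\<close>

context slice
begin

lemma Q_iff: "z \<in> Q_space br e f \<longleftrightarrow> z \<in> loops UNIV \<and> (\<forall>x. br f (z x - e) = 0)"
  unfolding Q_space_def affine_loops_iff[OF kernel_f_subspace] by (simp add: ker_ad_def)

text \<open>The operator called \<open>N\<close> in the overview: by \<open>R_P2\<close>,
  \<open>R (P2 z)\<close> is the identity plus this operator on loops in
  \<open>[f, g]\<close>.\<close>

definition perturbation :: "'n loop \<Rightarrow> 'n loop \<Rightarrow> 'n loop" where
  "perturbation z u = (\<lambda>x. R (vderiv u x + br (z x - e) (u x)))"

lemma R_P2: "u x \<in> range (br f) \<Longrightarrow> R (P2 br z u x) = u x + perturbation z u x"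
proof -
  assume u: "u x \<in> range (br f)"
  have "P2 br z u x = br e (u x) + (vderiv u x + br (z x - e) (u x))"
    by (simp add: P2_def br_diff)
  then show ?thesis using R_inverse[OF u] by (simp add: perturbation_def clin_add[OF R_linear])
qed

lemma perturbation_loops: "z \<in> loops UNIV \<Longrightarrow> u \<in> loops UNIV \<Longrightarrow> perturbation z u \<in> loops UNIV"
  unfolding perturbation_def
  by (intro loops_clin[OF R_linear] loops_add loops_vderiv loops_br loops_diff loops_const)

lemma perturbation_add: "u \<in> loops UNIV \<Longrightarrow> v \<in> loops UNIV \<Longrightarrow>
    perturbation z (\<lambda>x. u x + v x) = (\<lambda>x. perturbation z u x + perturbation z v x)"
  by (simp add: perturbation_def fun_cong[OF vderiv_add[OF loops_smooth loops_smooth]] br_add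
      clin_add[OF R_linear] algebra_simps)

lemma perturbation_minus: "u \<in> loops UNIV \<Longrightarrow>
    perturbation z (\<lambda>x. - u x) = (\<lambda>x. - perturbation z u x)"
  by (simp add: perturbation_def clin_neg[OF R_linear, symmetric]
      fun_cong[OF vderiv_bounded_linear[OF bounded_linear_minus[OF bounded_linear_ident] loops_smooth]])

lemma perturbation_Fil:
  assumes "z \<in> loops UNIV" "\<And>x. z x - e \<in> Fil 0" "u \<in> loops (Fil k)"
  shows "perturbation z u \<in> loops (Fil (k - 2))"
proof (rule loops_valueI[OF perturbation_loops])
  fix x
  have "vderiv u x \<in> Fil k" using vderiv_in_subspace[OF Fil_subspace assms(3)] loops_value by blast
  moreover have "br (z x - e) (u x) \<in> Fil k"
    using Fil_br[OF assms(2) loops_value[OF assms(3)]] by simp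
  ultimately show "perturbation z u x \<in> Fil (k - 2)"
    unfolding perturbation_def by (intro R_Fil vec.subspace_add[OF Fil_subspace])
qed (use assms loops_UNIV_I in auto)

text \<open>Each application lowers the filtration by 2, so \<open>depth\<close> applications lead
  from \<open>Fil depth\<close>, which is everything, to \<open>Fil (- depth)\<close>, which is
  zero.\<close>

lemma perturbation_nilpotent:
  assumes z: "z \<in> loops UNIV" "\<And>x. z x - e \<in> Fil 0" and u: "u \<in> loops UNIV"
  shows "(perturbation z ^^ depth) u = (\<lambda>_. 0)"
proof -
  have "(perturbation z ^^ k) u \<in> loops (Fil (int depth - 2 * int k))" for k
  proof (induction k)
    case (Suc k)
    from perturbation_Fil[OF z Suc] show ?case by (simp add: algebra_simps)
  qed (use u Fil_top in simp)
  from this[of depth] have "(perturbation z ^^ depth) u \<in> loops {0}"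
    using Fil_bot by simp
  then show ?thesis using loops_value by fast
qed

text \<open>\<open>(1 + perturbation z)\<^sup>-\<^sup>1\<close> as a terminating geometric series.\<close>

primrec geometric :: "nat \<Rightarrow> 'n loop \<Rightarrow> 'n loop \<Rightarrow> 'n loop" where
  "geometric 0 z y = (\<lambda>_. 0)"
| "geometric (Suc k) z y = (\<lambda>x. y x - perturbation z (geometric k z y) x)"

abbreviation "resolvent \<equiv> geometric depth"

lemma geometric_loops: "z \<in> loops UNIV \<Longrightarrow> y \<in> loops UNIV \<Longrightarrow> geometric k z y \<in> loops UNIV"
  by (induction k) (auto intro: loops_const loops_diff perturbation_loops)

text \<open>The error of a partial sum against a given solution is one more power of
  \<open>- perturbation z\<close> with every term; nilpotency then forces uniqueness.\<close>

lemma geometric_step: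
  assumes z: "z \<in> loops UNIV" and y: "y \<in> loops UNIV" and u: "u \<in> loops UNIV"
    and eq: "\<And>x. u x + perturbation z u x = y x"
  shows "u x - geometric k z y x = (- 1) ^ k *\<^sub>R (perturbation z ^^ k) u x"
proof (induction k arbitrary: x)
  case (Suc k)
  let ?g = "geometric k z y"
  have g: "?g \<in> loops UNIV" by (rule geometric_loops[OF z y])
  have pk: "(perturbation z ^^ k) u \<in> loops UNIV"
    by (induction k) (use u perturbation_loops[OF z] in auto)
  have "u x - geometric (Suc k) z y x = - (perturbation z u x + perturbation z (\<lambda>x. - ?g x) x)"
    using eq[of x] by (simp add: perturbation_minus[OF g] algebra_simps)
  also have "perturbation z u x + perturbation z (\<lambda>x. - ?g x) x = perturbation z (\<lambda>x. u x - ?g x) x"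
    using perturbation_add[OF u loops_minus[OF g], of z] by simp
  also have "\<dots> = perturbation z (\<lambda>x. (- 1) ^ k *\<^sub>R (perturbation z ^^ k) u x) x" by (simp add: Suc)
  also have "\<dots> = (- 1) ^ k *\<^sub>R perturbation z ((perturbation z ^^ k) u) x"
    by (cases "even k") (simp_all add: perturbation_minus[OF pk])
  finally show ?case by simp
qed simp

lemma resolvent_unique:
  assumes z: "z \<in> loops UNIV" "\<And>x. z x - e \<in> Fil 0" and y: "y \<in> loops UNIV" and u: "u \<in> loops UNIV"
    and eq: "\<And>x. u x + perturbation z u x = y x"
  shows "u = resolvent z y"
proof
  fix x show "u x = resolvent z y x"
    using geometric_step[OF z(1) y u eq, of x depth] perturbation_nilpotent[OF z u] by simp
qed

text \<open>Consecutive partial sums differ by a power of \<open>- perturbation z\<close> applied to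
  \<open>y\<close>, so they become stationary at \<open>depth\<close>; being stationary is the
  equation to be solved.\<close>

lemma resolvent_solves:
  assumes z: "z \<in> loops UNIV" "\<And>x. z x - e \<in> Fil 0" and y: "y \<in> loops UNIV"
  shows "resolvent z y x + perturbation z (resolvent z y) x = y x"
proof -
  have step: "geometric (Suc k) z y x - geometric k z y x = (- 1) ^ k *\<^sub>R (perturbation z ^^ k) y x" for k x
  proof (induction k arbitrary: x)
    case 0
    have "perturbation z (\<lambda>_. 0) x = 0"
      by (simp add: perturbation_def clin_0[OF R_linear])
    then show ?case by simp
  next
    case (Suc k)
    let ?g = "geometric k z y" and ?g' = "geometric (Suc k) z y"
    have g: "?g \<in> loops UNIV" "?g' \<in> loops UNIV" by (rule geometric_loops[OF z(1) y])+
    have pk: "(perturbation z ^^ k) y \<in> loops UNIV"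
      by (induction k) (use y perturbation_loops[OF z(1)] in auto)
    have "geometric (Suc (Suc k)) z y x - ?g' x = - (perturbation z ?g' x + perturbation z (\<lambda>x. - ?g x) x)"
      unfolding geometric.simps(2)[of "Suc k"] geometric.simps(2)[of k z y] perturbation_minus[OF g(1)]
      using geometric.simps(2)[of k z y] by simp
    also have "perturbation z ?g' x + perturbation z (\<lambda>x. - ?g x) x = perturbation z (\<lambda>x. ?g' x - ?g x) x"
      using perturbation_add[OF g(2) loops_minus[OF g(1)], of z] by simp
    also have "\<dots> = perturbation z (\<lambda>x. (- 1) ^ k *\<^sub>R (perturbation z ^^ k) y x) x" by (simp only: Suc)
    also have "\<dots> = (- 1) ^ k *\<^sub>R perturbation z ((perturbation z ^^ k) y) x"
      by (cases "even k") (simp_all add: perturbation_minus[OF pk])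
    finally show ?case by simp
  qed
  from step[of depth x] have "geometric (Suc depth) z y x = resolvent z y x"
    using perturbation_nilpotent[OF z y] by simp
  then show ?thesis by (simp add: algebra_simps)
qed

text \<open>Used with \<open>V = [f, g]\<close> for the covector lift, and with \<open>V = m\<close>
  for the correction of a gradient in \<open>bracket2_on_Q\<close>.\<close>

lemma resolvent_in:
  assumes V: "vec.subspace V" and z: "z \<in> loops UNIV" and y: "y \<in> loops V"
    and step: "\<And>u. u \<in> loops V \<Longrightarrow> perturbation z u \<in> loops V"
  shows "geometric k z y \<in> loops V"
proof (induction k)
  case 0
  then show ?case using vec.subspace_0[OF V] loops_valueI[OF loops_const[of 0], of V] by simp
next
  case (Suc k)
  have "(\<lambda>x. y x - perturbation z (geometric k z y) x) \<in> loops UNIV"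
    using loops_UNIV_I[OF y] loops_UNIV_I[OF step[OF Suc]] by (rule loops_diff)
  then have "(\<lambda>x. y x - perturbation z (geometric k z y) x) \<in> loops V"
    by (rule loops_valueI) (intro vec.subspace_diff[OF V] loops_value[OF y] loops_value[OF step[OF Suc]])
  then show ?case by simp
qed

lemma perturbation_range: "z \<in> loops UNIV \<Longrightarrow> u \<in> loops UNIV \<Longrightarrow> perturbation z u \<in> loops (range (br f))"
  by (rule loops_valueI[OF perturbation_loops]) (auto simp: perturbation_def intro: R_range)

lemma Q_Fil: "z \<in> Q_space br e f \<Longrightarrow> z \<in> loops UNIV \<and> (\<forall>x. z x - e \<in> Fil 0)"
  using kernel_Fil by (simp add: Q_iff)

lemma covector_lift_exists_unique:
  assumes z: "z \<in> Q_space br e f" and w: "w \<in> loops UNIV"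
  shows "\<exists>!v. covector_lift br f z w v"
proof -
  have zL: "z \<in> loops UNIV" "\<And>x. z x - e \<in> Fil 0" using Q_Fil[OF z] by auto
  \<comment> \<open>Equality of the two covectors on \<open>Q\<close> says pointwise that
    \<open>v - w\<close> is orthogonal to \<open>ker (ad f)\<close>, that is, lies in
    \<open>[f, g]\<close>. Tangency of \<open>P2 z v\<close> says that \<open>R\<close> kills
    it.\<close>
  have char: "covector_lift br f z w v \<longleftrightarrow> v \<in> loops UNIV \<and> (\<forall>x. v x - w x \<in> range (br f)) \<and>
      (\<forall>x. (v x - w x) + perturbation z (\<lambda>x. v x - w x) x = - R (P2 br z w x))" for v
  proof (cases "v \<in> loops UNIV")
    case v: True
    let ?u = "\<lambda>x. v x - w x"
    have u: "?u \<in> loops UNIV" by (rule loops_diff[OF v w])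
    have "(\<forall>t\<in>loops (ker_ad br f). pairing br v t = pairing br w t) \<longleftrightarrow> (\<forall>x. ?u x \<in> range (br f))"
    proof
      assume *: "\<forall>t\<in>loops (ker_ad br f). pairing br v t = pairing br w t"
      have "pairing br ?u t = 0" if "t \<in> loops (ker_ad br f)" for t
        using * that pairing_diff_left[OF loops_UNIV_I[OF that] v w] by simp
      then have "K (?u x) t = 0" if "br f t = 0" for t x
        using pairing_zero_imp[OF kernel_f_subspace u, of t x] that by (simp add: ker_ad_def)
      then show "\<forall>x. ?u x \<in> range (br f)" using kernel_annihilator by blast
    next
      assume *: "\<forall>x. ?u x \<in> range (br f)"
      show "\<forall>t\<in>loops (ker_ad br f). pairing br v t = pairing br w t"
      proof
        fix t assume t: "t \<in> loops (ker_ad br f)"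
        have "K (?u x) (t x) = 0" for x
        proof -
          obtain b where "?u x = br f b" using * by blast
          then show ?thesis using loops_value[OF t, of x] by (simp add: ker_ad_def killing_invariant')
        qed
        then have "pairing br ?u t = 0" by (simp add: pairing_def)
        then show "pairing br v t = pairing br w t"
          using pairing_diff_left[OF loops_UNIV_I[OF t] v w] by simp
      qed
    qed
    moreover have "P2 br z v \<in> loops (ker_ad br f) \<longleftrightarrow> (\<forall>x. R (P2 br z v x) = 0)"
      using P2_loops[OF zL(1) v] by (auto simp: loops_iff ker_ad_def R_eq_0_iff)
    moreover have "R (P2 br z v x) = R (P2 br z w x) + (?u x + perturbation z ?u x)"
      if "?u x \<in> range (br f)" for x
    proof -
      have "P2 br z v x = P2 br z w x + P2 br z ?u x" using P2_add[OF w u, of z] by (simp add: fun_eq_iff)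
      then show ?thesis using R_P2[of ?u x z] that by (simp add: clin_add[OF R_linear])
    qed
    ultimately show ?thesis
      using v by (auto simp: covector_lift_def eq_neg_iff_add_eq_0 add.commute)
  qed (simp add: covector_lift_def)
  define y where "y = (\<lambda>x. - R (P2 br z w x))"
  have y: "y \<in> loops (range (br f))"
    unfolding y_def
    by (rule loops_valueI[OF loops_minus[OF loops_clin[OF R_linear P2_loops[OF zL(1) w]]]])
       (intro vec.subspace_neg[OF range_f_subspace] R_range)
  have r: "resolvent z y \<in> loops (range (br f))"
    by (rule resolvent_in[OF range_f_subspace zL(1) y perturbation_range[OF zL(1) loops_UNIV_I]])
  show ?thesis
  proof (rule ex1I[of _ "\<lambda>x. w x + resolvent z y x"])
    show "covector_lift br f z w (\<lambda>x. w x + resolvent z y x)"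
      unfolding char using loops_add[OF w loops_UNIV_I[OF r]] loops_value[OF r]
        resolvent_solves[OF zL loops_UNIV_I[OF y]] by (auto simp: y_def)
  next
    fix v assume v: "covector_lift br f z w v"
    then have "v \<in> loops UNIV" by (simp add: char)
    then have "(\<lambda>x. v x - w x) = resolvent z y"
      using v by (intro resolvent_unique zL loops_UNIV_I[OF y] loops_diff w) (auto simp: char y_def)
    then show "v = (\<lambda>x. w x + resolvent z y x)" by (simp add: fun_eq_iff diff_eq_eq add.commute)
  qed
qed

end

section \<open>Differential polynomial maps\<close>

lemma diff_poly_sum: "(\<And>i. i \<in> I \<Longrightarrow> p i \<in> diff_poly) \<Longrightarrow> (\<lambda>j. \<Sum>i\<in>I. p i j) \<in> diff_poly"
  by (induction I rule: infinite_finite_induct) (auto intro: diff_poly.add diff_poly.const)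

lemma diff_poly_total_derivative:
  "p \<in> diff_poly \<Longrightarrow> \<exists>p'\<in>diff_poly. \<forall>c\<in>loops UNIV. \<forall>x.
     ((\<lambda>x. p (jet c x)) has_vector_derivative p' (jet c x)) (at x)"
proof (induction rule: diff_poly.induct)
  case (const c)
  show ?case by (rule bexI[OF _ diff_poly.const[of 0]]) simp
next
  case (coord k i)
  have "((\<lambda>x. jet c x k $ i) has_vector_derivative jet c x (Suc k) $ i) (at x)"
    if "c \<in> loops UNIV" for c :: "'a loop" and x
    unfolding jet_def nderiv_Suc
    by (rule bounded_linear.has_vector_derivative[OF bounded_linear_component
          smooth_has_vector_derivative[OF smooth_nderiv[OF loops_smooth[OF that]]]])
  then show ?case by (intro bexI[OF _ diff_poly.coord[of "Suc k" i]]) blast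
next
  case (add p q)
  then obtain p' q' where *: "p' \<in> diff_poly" "q' \<in> diff_poly"
    "\<And>c x. c \<in> loops UNIV \<Longrightarrow> ((\<lambda>x. p (jet c x)) has_vector_derivative p' (jet c x)) (at x)"
    "\<And>c x. c \<in> loops UNIV \<Longrightarrow> ((\<lambda>x. q (jet c x)) has_vector_derivative q' (jet c x)) (at x)"
    by blast
  show ?case
    by (rule bexI[OF _ diff_poly.add[OF *(1,2)]]) (auto intro!: has_vector_derivative_add *(3,4))
next
  case (mult p q)
  then obtain p' q' where *: "p' \<in> diff_poly" "q' \<in> diff_poly"
    "\<And>c x. c \<in> loops UNIV \<Longrightarrow> ((\<lambda>x. p (jet c x)) has_vector_derivative p' (jet c x)) (at x)"
    "\<And>c x. c \<in> loops UNIV \<Longrightarrow> ((\<lambda>x. q (jet c x)) has_vector_derivative q' (jet c x)) (at x)"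
    by blast
  show ?case
    by (rule bexI[OF _ diff_poly.add[OF diff_poly.mult[OF mult(1) *(2)] diff_poly.mult[OF *(1) mult(2)]]])
       (auto intro!: has_vector_derivative_mult *(3,4))
qed

text \<open>The formula is required on smooth loops only: jets of derivatives are governed by total
  derivatives there.\<close>

definition diff_poly_map :: "('n::finite loop \<Rightarrow> 'n loop) \<Rightarrow> bool" where
  "diff_poly_map \<Psi> \<longleftrightarrow> (\<exists>P. (\<forall>i. P i \<in> diff_poly) \<and> (\<forall>c\<in>loops UNIV. \<forall>x. \<Psi> c x = (\<chi> i. P i (jet c x))))"

lemma diff_poly_mapI:
  "\<lbrakk>\<And>i. P i \<in> diff_poly; \<And>c x i. c \<in> loops UNIV \<Longrightarrow> \<Psi> c x $ i = P i (jet c x)\<rbrakk> \<Longrightarrow> diff_poly_map \<Psi>"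
  unfolding diff_poly_map_def by (rule exI[of _ P]) (auto simp: vec_eq_iff)

lemma diff_poly_mapE:
  assumes "diff_poly_map \<Psi>"
  obtains P where "\<And>i. P i \<in> diff_poly" "\<And>c x i. c \<in> loops UNIV \<Longrightarrow> \<Psi> c x $ i = P i (jet c x)"
  using assms unfolding diff_poly_map_def by (metis vec_lambda_beta)

lemma diff_poly_map_id: "diff_poly_map (\<lambda>c. c)"
  by (rule diff_poly_mapI[OF diff_poly.coord[of 0]]) (simp add: jet_def)

lemma diff_poly_map_const: "diff_poly_map (\<lambda>c x. v)"
  by (rule diff_poly_mapI[OF diff_poly.const, where \<Psi> = "\<lambda>c x. v"]) auto

lemma diff_poly_map_add: "diff_poly_map \<Psi> \<Longrightarrow> diff_poly_map \<Phi> \<Longrightarrow> diff_poly_map (\<lambda>c x. \<Psi> c x + \<Phi> c x)"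
proof (elim diff_poly_mapE)
  fix P P' assume *: "\<And>i. P i \<in> diff_poly" "\<And>i. P' i \<in> diff_poly"
    "\<And>c x i. c \<in> loops UNIV \<Longrightarrow> \<Psi> c x $ i = P i (jet c x)" "\<And>c x i. c \<in> loops UNIV \<Longrightarrow> \<Phi> c x $ i = P' i (jet c x)"
  show ?thesis by (rule diff_poly_mapI[OF diff_poly.add[OF *(1,2)]]) (simp add: *)
qed

lemma diff_poly_map_sum: "(\<And>i. i \<in> I \<Longrightarrow> diff_poly_map (\<Psi> i)) \<Longrightarrow> diff_poly_map (\<lambda>c x. \<Sum>i\<in>I. \<Psi> i c x)"
proof (induction I rule: infinite_finite_induct)
  case (insert i I)
  then show ?case using diff_poly_map_add[of "\<Psi> i" "\<lambda>c x. \<Sum>i\<in>I. \<Psi> i c x"] by simp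
qed (auto intro: diff_poly_map_const)

lemma diff_poly_map_clin:
  assumes T: "clin T" and "diff_poly_map \<Psi>" shows "diff_poly_map (\<lambda>c x. T (\<Psi> c x))"
  using assms(2)
proof (rule diff_poly_mapE)
  fix P assume *: "\<And>i. P i \<in> diff_poly" "\<And>c x i. c \<in> loops UNIV \<Longrightarrow> \<Psi> c x $ i = P i (jet c x)"
  show ?thesis
  proof (rule diff_poly_mapI)
    show "(\<lambda>j. \<Sum>k\<in>UNIV. P k j * T (axis k 1) $ i) \<in> diff_poly" for i
      by (intro diff_poly_sum diff_poly.mult * diff_poly.const)
    show "T (\<Psi> c x) $ i = (\<Sum>k\<in>UNIV. P k (jet c x) * T (axis k 1) $ i)" if "c \<in> loops UNIV" for c x i
      using linear_componentwise[OF T, of "\<Psi> c x" i] *(2)[OF that] by simp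
  qed
qed

lemma diff_poly_map_minus: "diff_poly_map \<Psi> \<Longrightarrow> diff_poly_map \<Phi> \<Longrightarrow> diff_poly_map (\<lambda>c x. \<Psi> c x - \<Phi> c x)"
  using diff_poly_map_add[OF _ diff_poly_map_clin[of "\<lambda>y. - y" \<Phi>], of \<Psi>] by (simp add: clin_iff)

lemma diff_poly_map_scaleR: "diff_poly_map \<Psi> \<Longrightarrow> diff_poly_map (\<lambda>c x. a *\<^sub>R \<Psi> c x)"
  unfolding scaleR_eq_smult by (rule diff_poly_map_clin[OF clin_smult[OF clin_id]])

lemma diff_poly_map_vderiv:
  assumes "diff_poly_map \<Psi>" shows "diff_poly_map (\<lambda>c. vderiv (\<Psi> c))"
  using assms
proof (rule diff_poly_mapE)
  fix P assume *: "\<And>i. P i \<in> diff_poly" "\<And>c x i. c \<in> loops UNIV \<Longrightarrow> \<Psi> c x $ i = P i (jet c x)"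
  have "\<forall>i. \<exists>p'\<in>diff_poly. \<forall>c\<in>loops UNIV. \<forall>x. ((\<lambda>x. P i (jet c x)) has_vector_derivative p' (jet c x)) (at x)"
    using diff_poly_total_derivative[OF *(1)] by blast
  then obtain P' where P': "\<And>i. P' i \<in> diff_poly"
    "\<And>i c x. c \<in> loops UNIV \<Longrightarrow> ((\<lambda>x. P i (jet c x)) has_vector_derivative P' i (jet c x)) (at x)"
    by metis
  show ?thesis
  proof (rule diff_poly_mapI[OF P'(1)])
    fix c :: "'a loop" and x i assume c: "c \<in> loops UNIV"
    have "((\<lambda>x. \<Sum>i\<in>UNIV. P i (jet c x) *s axis i 1) has_vector_derivative
        (\<Sum>i\<in>UNIV. P' i (jet c x) *s axis i (1::complex))) (at x)"
    proof (rule has_vector_derivative_sum)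
      fix i :: 'a
      have "bounded_linear (\<lambda>a. a *s axis i (1::complex))"
        by (rule bounded_bilinear.bounded_linear_left[OF bounded_bilinear_smult])
      from bounded_linear.has_vector_derivative[OF this P'(2)[OF c]]
      show "((\<lambda>x. P i (jet c x) *s axis i 1) has_vector_derivative P' i (jet c x) *s axis i (1::complex)) (at x)" .
    qed
    moreover have "(\<lambda>x. \<Sum>i\<in>UNIV. P i (jet c x) *s axis i 1) = \<Psi> c"
      using *(2)[OF c] basis_expansion[of "\<Psi> c _"] by auto
    ultimately have "vderiv (\<Psi> c) x = (\<Sum>i\<in>UNIV. P' i (jet c x) *s axis i 1)"
      using vector_derivative_at by auto
    then show "vderiv (\<Psi> c) x $ i = P' i (jet c x)"
      by (simp add: axis_def if_distrib cong: if_cong)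
  qed
qed

lemma diff_poly_map_nderiv: "diff_poly_map \<Psi> \<Longrightarrow> diff_poly_map (\<lambda>c. nderiv k (\<Psi> c))"
  by (induction k) (simp_all add: nderiv_Suc diff_poly_map_vderiv)

lemma diff_poly_map_loops: "diff_poly_map \<Psi> \<Longrightarrow> c \<in> loops UNIV \<Longrightarrow> \<Psi> c \<in> loops UNIV"
  by (erule diff_poly_mapE, rule loops_vec) (simp add: density_loop[OF diff_poly_density])

lemma density_compose:
  assumes "p \<in> densities" and \<Psi>: "diff_poly_map \<Psi>"
  shows "\<exists>p'\<in>densities. \<forall>c\<in>loops UNIV. \<forall>x. p x (jet (\<Psi> c) x) = p' x (jet c x)"
  using assms(1)
proof induction
  case (coeff a)
  show ?case by (rule bexI[OF _ densities.coeff[OF coeff]]) simp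
next
  case (coord k i)
  obtain P where P: "\<And>i. P i \<in> diff_poly" "\<And>c x i. c \<in> loops UNIV \<Longrightarrow> nderiv k (\<Psi> c) x $ i = P i (jet c x)"
    using diff_poly_mapE[OF diff_poly_map_nderiv[OF \<Psi>]] by blast
  show ?case
    by (rule bexI[OF _ diff_poly_density[OF P(1)[of i]]]) (simp add: P(2) jet_def[of "\<Psi> _"])
next
  case (add p q)
  then obtain p' q' where *: "p' \<in> densities" "q' \<in> densities"
    "\<forall>c\<in>loops UNIV. \<forall>x. p x (jet (\<Psi> c) x) = p' x (jet c x)" "\<forall>c\<in>loops UNIV. \<forall>x. q x (jet (\<Psi> c) x) = q' x (jet c x)" by blast
  show ?case by (rule bexI[OF _ densities.add[OF *(1,2)]]) (simp add: *)
next
  case (mult p q)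
  then obtain p' q' where *: "p' \<in> densities" "q' \<in> densities"
    "\<forall>c\<in>loops UNIV. \<forall>x. p x (jet (\<Psi> c) x) = p' x (jet c x)" "\<forall>c\<in>loops UNIV. \<forall>x. q x (jet (\<Psi> c) x) = q' x (jet c x)" by blast
  show ?case by (rule bexI[OF _ densities.mult[OF *(1,2)]]) (simp add: *)
qed

lemma diff_poly_compose:
  assumes "p \<in> diff_poly" and \<Psi>: "diff_poly_map \<Psi>"
  shows "\<exists>p'\<in>diff_poly. \<forall>c\<in>loops UNIV. \<forall>x. p (jet (\<Psi> c) x) = p' (jet c x)"
  using assms(1)
proof induction
  case (const a)
  show ?case by (rule bexI[OF _ diff_poly.const[of a]]) simp
next
  case (coord k i)
  obtain P where P: "\<And>i. P i \<in> diff_poly" "\<And>c x i. c \<in> loops UNIV \<Longrightarrow> nderiv k (\<Psi> c) x $ i = P i (jet c x)"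
    using diff_poly_mapE[OF diff_poly_map_nderiv[OF \<Psi>]] by blast
  show ?case
    by (rule bexI[OF _ P(1)[of i]]) (simp add: P(2) jet_def[of "\<Psi> _"])
next
  case (add p q)
  then obtain p' q' where *: "p' \<in> diff_poly" "q' \<in> diff_poly"
    "\<forall>c\<in>loops UNIV. \<forall>x. p (jet (\<Psi> c) x) = p' (jet c x)" "\<forall>c\<in>loops UNIV. \<forall>x. q (jet (\<Psi> c) x) = q' (jet c x)" by blast
  show ?case by (rule bexI[OF _ diff_poly.add[OF *(1,2)]]) (simp add: *)
next
  case (mult p q)
  then obtain p' q' where *: "p' \<in> diff_poly" "q' \<in> diff_poly"
    "\<forall>c\<in>loops UNIV. \<forall>x. p (jet (\<Psi> c) x) = p' (jet c x)" "\<forall>c\<in>loops UNIV. \<forall>x. q (jet (\<Psi> c) x) = q' (jet c x)" by blast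
  show ?case by (rule bexI[OF _ diff_poly.mult[OF *(1,2)]]) (simp add: *)
qed

lemma diff_poly_map_compose:
  assumes "diff_poly_map \<Phi>" "diff_poly_map \<Psi>" shows "diff_poly_map (\<lambda>c. \<Phi> (\<Psi> c))"
proof -
  obtain P where P: "\<And>i. P i \<in> diff_poly" "\<And>c x i. c \<in> loops UNIV \<Longrightarrow> \<Phi> c x $ i = P i (jet c x)"
    using diff_poly_mapE[OF assms(1)] by blast
  have "\<forall>i. \<exists>p'\<in>diff_poly. \<forall>c\<in>loops UNIV. \<forall>x. P i (jet (\<Psi> c) x) = p' (jet c x)"
    using diff_poly_compose[OF P(1) assms(2)] by blast
  then obtain P' where "\<And>i. P' i \<in> diff_poly" "\<And>i c x. c \<in> loops UNIV \<Longrightarrow> P i (jet (\<Psi> c) x) = P' i (jet c x)"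
    by metis
  then show ?thesis
    by (intro diff_poly_mapI[of P']) (simp_all add: P(2)[OF diff_poly_map_loops[OF assms(2)]])
qed

lemma diff_poly_map_bilinear:
  assumes h: "\<And>x. clin (h x)" "\<And>y. clin (\<lambda>x. h x y)" and "diff_poly_map \<Psi>" "diff_poly_map \<Phi>"
  shows "diff_poly_map (\<lambda>c x. h (\<Psi> c x) (\<Phi> c x))"
proof -
  obtain P where P: "\<And>i. P i \<in> diff_poly" "\<And>c x i. c \<in> loops UNIV \<Longrightarrow> \<Psi> c x $ i = P i (jet c x)"
    using diff_poly_mapE[OF assms(3)] by blast
  obtain P' where P': "\<And>i. P' i \<in> diff_poly" "\<And>c x i. c \<in> loops UNIV \<Longrightarrow> \<Phi> c x $ i = P' i (jet c x)"
    using diff_poly_mapE[OF assms(4)] by blast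
  show ?thesis
  proof (rule diff_poly_mapI)
    show "(\<lambda>j. \<Sum>k\<in>UNIV. P k j * (\<Sum>l\<in>UNIV. P' l j * h (axis k 1) (axis l 1) $ i)) \<in> diff_poly" for i
      by (intro diff_poly_sum diff_poly.mult P P' diff_poly.const)
    show "h (\<Psi> c x) (\<Phi> c x) $ i = (\<Sum>k\<in>UNIV. P k (jet c x) * (\<Sum>l\<in>UNIV. P' l (jet c x) * h (axis k 1) (axis l 1) $ i))"
      if "c \<in> loops UNIV" for c x i
      using linear_componentwise[OF h(2), of "\<Psi> c x" "\<Phi> c x" i]
        linear_componentwise[OF h(1), of "axis _ 1" "\<Phi> c x" i] P(2)[OF that] P'(2)[OF that] by simp
  qed
qed

lemma polycurve_vec:
  assumes "\<And>i. polycurve (\<lambda>t x. \<gamma> t x $ i)" shows "polycurve (\<gamma> :: real \<Rightarrow> 'n::finite loop)"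
proof -
  have "polycurve (\<lambda>t x. \<Sum>i\<in>UNIV. \<gamma> t x $ i *s axis i 1)"
    by (intro polycurve_sum polycurve_bilinear[OF bounded_bilinear_smult] assms polycurve_const loops_const)
  then show ?thesis by (simp add: basis_expansion)
qed

lemma diff_poly_map_polycurve:
  assumes \<Psi>: "diff_poly_map \<Psi>" and \<gamma>: "polycurve \<gamma>"
  shows "polycurve (\<lambda>t. \<Psi> (\<gamma> t))"
proof (rule polycurve_vec)
  fix i
  obtain P where P: "\<And>i. P i \<in> diff_poly" "\<And>c x i. c \<in> loops UNIV \<Longrightarrow> \<Psi> c x $ i = P i (jet c x)"
    using diff_poly_mapE[OF \<Psi>] by blast
  show "polycurve (\<lambda>t x. \<Psi> (\<gamma> t) x $ i)"
    using density_polycurve[OF diff_poly_density[OF P(1)] \<gamma>] P(2)[OF polycurve_loops[OF \<gamma>]] by simp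
qed

lemma tderiv_component:
  assumes "polycurve \<gamma>" shows "tderiv \<gamma> t x $ i = tderiv (\<lambda>t x. \<gamma> t x $ i :: complex) t x"
proof -
  have "((\<lambda>s. \<gamma> s x $ i) has_vector_derivative tderiv \<gamma> t x $ i) (at t)"
    by (rule bounded_linear.has_vector_derivative[OF bounded_linear_component has_tderiv[OF assms]])
  then show ?thesis unfolding tderiv_def[of "\<lambda>t x. \<gamma> t x $ i"] by (rule vector_derivative_at[symmetric])
qed

lemma tderiv_diff_poly_map_line:
  assumes \<Psi>: "diff_poly_map \<Psi>" and \<gamma>: "polycurve \<gamma>"
  shows "tderiv (\<lambda>t. \<Psi> (\<gamma> t)) t x = tderiv (\<lambda>s. \<Psi> (\<lambda>y. \<gamma> t y + s *\<^sub>R tderiv \<gamma> t y)) 0 x"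
proof (rule vec_eq_iff[THEN iffD2], rule allI)
  fix i
  obtain P where P: "\<And>i. P i \<in> diff_poly" "\<And>c x i. c \<in> loops UNIV \<Longrightarrow> \<Psi> c x $ i = P i (jet c x)"
    using diff_poly_mapE[OF \<Psi>] by blast
  have line: "polycurve (\<lambda>s y. \<gamma> t y + s *\<^sub>R tderiv \<gamma> t y)"
    by (rule polycurve_line[OF polycurve_loops[OF \<gamma>] polycurve_loops[OF polycurve_tderiv[OF \<gamma>]]])
  show "tderiv (\<lambda>t. \<Psi> (\<gamma> t)) t x $ i = tderiv (\<lambda>s. \<Psi> (\<lambda>y. \<gamma> t y + s *\<^sub>R tderiv \<gamma> t y)) 0 x $ i"
    using tderiv_density_line[OF diff_poly_density[OF P(1)[of i]] \<gamma>, of t x]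
    by (simp add: tderiv_component[OF diff_poly_map_polycurve[OF \<Psi> \<gamma>]]
        tderiv_component[OF diff_poly_map_polycurve[OF \<Psi> line]] P(2)[OF polycurve_loops[OF \<gamma>]]
        P(2)[OF polycurve_loops[OF line]])
qed

section \<open>Gauge transformations and the slice\<close>

context slice
begin

text \<open>The zeroth order part of the \<open>k\<close>-th term of
  \<open>exp (- ad m) (d/dx + q)\<close>. The symbol \<open>d/dx\<close> contributes only to the
  first bracket, where it gives \<open>- m'\<close>; hence the special case
  \<open>k = 0\<close>.\<close>

primrec gauge_term :: "'n loop \<Rightarrow> 'n loop \<Rightarrow> nat \<Rightarrow> 'n loop" where
  "gauge_term m q 0 = q"
| "gauge_term m q (Suc k) = (\<lambda>x. (- 1 / real (Suc k)) *\<^sub>R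
     (br (m x) (gauge_term m q k x) - (if k = 0 then vderiv m x else 0)))"

text \<open>For \<open>m\<close> in \<open>Fil (- 1)\<close> each bracket lowers the filtration by
  1, so \<open>2 * depth\<close> terms suffice to pass from \<open>Fil depth\<close> to zero, for
  arbitrary \<open>q\<close>.\<close>

definition gauge :: "'n loop \<Rightarrow> 'n loop \<Rightarrow> 'n loop" where
  "gauge m q = (\<lambda>x. \<Sum>k<2 * depth. gauge_term m q k x)"

lemma gauge_term_loops: "m \<in> loops UNIV \<Longrightarrow> q \<in> loops UNIV \<Longrightarrow> gauge_term m q k \<in> loops UNIV"
proof (induction k)
  case (Suc k)
  then have "(\<lambda>x. if k = 0 then vderiv m x else 0) \<in> loops UNIV"
    using loops_vderiv loops_const[of 0] by (cases "k = 0") auto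
  with Suc show ?case unfolding gauge_term.simps by (intro loops_scaleR loops_diff loops_br)
qed simp

lemma gauge_loops: "m \<in> loops UNIV \<Longrightarrow> q \<in> loops UNIV \<Longrightarrow> gauge m q \<in> loops UNIV"
  unfolding gauge_def by (intro loops_sum gauge_term_loops)

lemma Fil_scaleR: "x \<in> Fil k \<Longrightarrow> c *\<^sub>R x \<in> Fil k"
  unfolding scaleR_eq_smult by (rule vec.subspace_scale[OF Fil_subspace])

lemma FilD: "x \<in> Fil i \<Longrightarrow> i \<le> j \<Longrightarrow> x \<in> Fil j"
  using Fil_mono by blast

lemma depth_pos: "depth > 0"
proof (rule ccontr)
  assume "\<not> depth > 0"
  then have "(axis undefined 1 :: complex ^ 'n) = 0" using Fil_top Fil_bot by auto
  then have "(axis undefined 1 :: complex ^ 'n) $ undefined = 0" by simp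
  then show False by (simp add: axis_def)
qed

lemma vderiv_Fil: "m \<in> loops (Fil k) \<Longrightarrow> vderiv m x \<in> Fil k"
  using loops_value[OF vderiv_in_subspace[OF Fil_subspace]] .

lemma gauge_term_Fil:
  assumes m: "m \<in> loops (Fil (- 1))" and q: "\<And>x. q x \<in> Fil j" "j \<ge> 0"
  shows "gauge_term m q k x \<in> Fil (j - int k)"
proof (induction k arbitrary: x)
  case (Suc k)
  have "br (m x) (gauge_term m q k x) \<in> Fil (j - int (Suc k))"
    using Fil_br[OF loops_value[OF m] Suc[of x]] by (simp add: algebra_simps)
  \<comment> \<open>Here \<open>j \<ge> 0\<close> enters: \<open>m'\<close> has filtration -1, which
    must not exceed \<open>j - 1\<close>.\<close>
  moreover have "(if k = 0 then vderiv m x else 0) \<in> Fil (j - int (Suc k))"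
    using FilD[OF vderiv_Fil[OF m], of "j - 1"] q(2) vec.subspace_0[OF Fil_subspace] by auto
  ultimately show ?case unfolding gauge_term.simps
    by (intro Fil_scaleR vec.subspace_diff[OF Fil_subspace])
qed (use q in simp)

lemma gauge_term_zero:
  assumes m: "m \<in> loops (Fil (- 1))" and k: "k \<ge> 2 * depth"
  shows "gauge_term m q k x = 0"
proof -
  have "gauge_term m q k x \<in> Fil (int depth - int k)"
    by (rule gauge_term_Fil[OF m]) (auto simp: Fil_top)
  then have "gauge_term m q k x \<in> Fil (- int depth)" by (rule FilD) (use k in linarith)
  then show ?thesis using Fil_bot by simp
qed

lemma gauge_extend:
  assumes "m \<in> loops (Fil (- 1))" "n \<ge> 2 * depth"
  shows "gauge m q x = (\<Sum>k<n. gauge_term m q k x)"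
  unfolding gauge_def using assms gauge_term_zero[OF assms(1)] by (intro sum.mono_neutral_left) auto

lemma gauge_action_eq:
  assumes m: "m \<in> loops (Fil (- 1))" shows "gauge_action br m q = gauge m q"
proof
  fix x
  have fst: "fst ((ad_op br m ^^ k) (1, q)) = (if k = 0 then 1 else 0)" for k
    by (cases k) (simp_all add: ad_op_def split: prod.splits)
  have summand: "gauge_term m q k x = ((- 1) ^ k / fact k) *\<^sub>R snd ((ad_op br m ^^ k) (1, q)) x" for k
  proof (induction k arbitrary: x)
    case (Suc k)
    obtain c y where cy: "(ad_op br m ^^ k) (1, q) = (c, y)" by fastforce
    have c: "c = (if k = 0 then 1 else 0)" using fst[of k] cy by simp
    have y: "gauge_term m q k x = ((- 1) ^ k / fact k) *\<^sub>R y x" using Suc[of x] cy by simp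
    have s: "snd ((ad_op br m ^^ Suc k) (1, q)) x = br (m x) (y x) - c *s vderiv m x"
    proof -
      have "ad_op br m (c, y) = (0, \<lambda>x. br (m x) (y x) - c *s vderiv m x)" by (simp add: ad_op_def)
      then show ?thesis by (simp only: funpow.simps o_apply cy snd_conv)
    qed
    have b: "br (m x) (((- 1) ^ k / fact k) *\<^sub>R y x) = ((- 1) ^ k / fact k) *\<^sub>R br (m x) (y x)"
      by (simp only: scaleR_eq_smult br_linear)
    show ?case
      unfolding gauge_term.simps y b s c
      by (cases "k = 0") (simp_all add: scaleR_diff_right)
  qed simp
  have "gauge_action br m q x = (\<Sum>k. gauge_term m q k x)"
    by (simp only: gauge_action_def summand)
  also have "\<dots> = (\<Sum>k<2 * depth. gauge_term m q k x)"
    by (rule suminf_finite) (use gauge_term_zero[OF m] in auto)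
  finally show "gauge_action br m q x = gauge m q x" by (simp add: gauge_def)
qed

text \<open>Pairs \<open>(V, W)\<close> such that loops in \<open>V\<close> act on \<open>e + W\<close>, with \<open>W = ker (ad f) \<oplus> [e, V]\<close>.\<close>

definition admissible :: "(complex ^ 'n) set \<Rightarrow> (complex ^ 'n) set \<Rightarrow> bool" where
  "admissible V W \<longleftrightarrow> vec.subspace V \<and> vec.subspace W \<and> V \<subseteq> Fil (- 1) \<and> V \<subseteq> W \<and> W \<subseteq> Fil 1 \<and>
     (\<forall>m\<in>V. br m e \<in> W) \<and> (\<forall>m\<in>V. \<forall>w\<in>W. br m w \<in> W) \<and> (\<forall>w\<in>W. R w \<in> V)"

lemma admissible_Fil: "admissible (Fil (- 1)) (Fil 1)"
  unfolding admissible_def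
proof (intro conjI ballI Fil_subspace Fil_mono)
  show "br m e \<in> Fil 1" if "m \<in> Fil (- 1)" for m using Fil_br[OF that e_Fil] by simp
  show "br m w \<in> Fil 1" if "m \<in> Fil (- 1)" "w \<in> Fil 1" for m w using Fil_br[OF that] by (rule FilD) simp
  show "R w \<in> Fil (- 1)" if "w \<in> Fil 1" for w using R_Fil[OF that] by simp
qed auto

lemma gauge_admissible:
  assumes VW: "admissible V W" and m: "m \<in> loops V" and q: "\<And>x. q x - e \<in> W"
  shows "gauge m q x - e \<in> W"
proof -
  note A = VW[unfolded admissible_def]
  have W: "vec.subspace W" using A by blast
  have "gauge_term m q (Suc k) x \<in> W" for k x
  proof (induction k arbitrary: x)
    case 0
    have "br (m x) (q x) = br (m x) e + br (m x) (q x - e)" by (simp add: br_diff)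
    also have "\<dots> \<in> W" using A loops_value[OF m] q by (intro vec.subspace_add[OF W]) auto
    finally have "br (m x) (q x) \<in> W" .
    moreover have "vderiv m x \<in> W" using vderiv_in_subspace[OF _ m] A loops_value by blast
    ultimately show ?case
      by (simp add: scaleR_eq_smult vec.subspace_neg[OF W] vec.subspace_diff[OF W] del: minus_diff_eq)
  next
    case (Suc k)
    have "br (m x) (gauge_term m q (Suc k) x) \<in> W" using A Suc loops_value[OF m] by blast
    then show ?case unfolding gauge_term.simps(2)[of m q "Suc k"] scaleR_eq_smult
      by (intro vec.subspace_scale[OF W] vec.subspace_diff[OF W]) (simp_all add: vec.subspace_0[OF W])
  qed
  then have "(q x - e) + (\<Sum>k<2 * depth - 1. gauge_term m q (Suc k) x) \<in> W"
    using q by (intro vec.subspace_add[OF W] vec.subspace_sum[OF W])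
  also have "(q x - e) + (\<Sum>k<2 * depth - 1. gauge_term m q (Suc k) x) = gauge m q x - e"
  proof -
    obtain n where n: "2 * depth = Suc n" using depth_pos by (cases "2 * depth") auto
    show ?thesis unfolding gauge_def n by (subst sum.lessThan_Suc_shift) simp
  qed
  finally show ?thesis .
qed

section \<open>The gauge parameter leading to the slice as a fixed point\<close>

text \<open>Since \<open>R\<close> vanishes exactly on \<open>ker (ad f)\<close>, a fixed
  \<open>m\<close> is one that moves \<open>q\<close> into \<open>Q\<close>. The step is a Newton
  correction: the leading dependence of \<open>gauge m q\<close> on \<open>m\<close> is
  \<open>[e, m]\<close>, which \<open>R\<close> inverts.\<close>

definition slice_step :: "'n loop \<Rightarrow> 'n loop \<Rightarrow> 'n loop" where
  "slice_step q m = (\<lambda>x. m x - R (gauge m q x - e))"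

lemma slice_step_admissible:
  assumes VW: "admissible V W" and m: "m \<in> loops V" and q: "q \<in> loops UNIV" "\<And>x. q x - e \<in> W"
  shows "slice_step q m \<in> loops V"
proof (rule loops_valueI)
  show "slice_step q m \<in> loops UNIV" unfolding slice_step_def
    by (intro loops_diff loops_clin[OF R_linear] gauge_loops loops_const loops_UNIV_I[OF m] q(1))
  fix x
  have "gauge m q x - e \<in> W" by (rule gauge_admissible[OF VW m q(2)])
  then show "slice_step q m x \<in> V"
    unfolding slice_step_def using VW loops_value[OF m, of x]
    unfolding admissible_def by (intro vec.subspace_diff) auto
qed

text \<open>In the difference of the two gauge transforms, \<open>R\<close> turns the term
  \<open>[e, m - m']\<close> back into \<open>m - m'\<close>, which cancels. All remaining terms lie
  in \<open>Fil (1 - j)\<close>, and \<open>R\<close> brings them to \<open>Fil (- j - 1)\<close>,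
  one step below \<open>m - m'\<close>.\<close>

lemma slice_step_contracts:
  assumes m: "m \<in> loops (Fil (- 1))" and m': "m' \<in> loops (Fil (- 1))"
    and q: "q \<in> loops UNIV" "\<And>x. q x - e \<in> Fil 1"
    and j: "j \<ge> 1" and close: "\<And>x. m x - m' x \<in> Fil (- j)"
  shows "slice_step q m x - slice_step q m' x \<in> Fil (- j - 1)"
proof -
  have mL: "m \<in> loops UNIV" "m' \<in> loops UNIV" using m m' loops_UNIV_I by blast+
  have d: "(\<lambda>x. m x - m' x) \<in> loops (Fil (- j))" by (rule loops_valueI[OF loops_diff[OF mL] close])
  have vd: "vderiv m x - vderiv m' x \<in> Fil (- j)" for x
  proof -
    have "vderiv (\<lambda>x. m x - m' x) x = vderiv m x - vderiv m' x"
      using mL by (intro vector_derivative_at has_vector_derivative_diff smooth_has_vector_derivative loops_smooth)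
    then show ?thesis using vderiv_Fil[OF d, of x] by simp
  qed
  have qF: "q x \<in> Fil 2" for x
    using vec.subspace_add[OF Fil_subspace FilD[OF q(2)[of x], of 2] e_Fil] by simp
  have gF: "gauge_term m q k x \<in> Fil (2 - int k)" for k x by (rule gauge_term_Fil[OF m qF]) simp
  have first: "gauge_term m q 1 x - gauge_term m' q 1 x = br e (m x - m' x)
      + ((vderiv m x - vderiv m' x) - br (m x - m' x) (q x - e))" for x
    using br_anticommute[of e "m x - m' x"] by (simp add: br_diff)
  have firstF: "(vderiv m x - vderiv m' x) - br (m x - m' x) (q x - e) \<in> Fil (1 - j)" for x
  proof (rule vec.subspace_diff[OF Fil_subspace])
    show "vderiv m x - vderiv m' x \<in> Fil (1 - j)" using vd[of x] by (rule FilD) simp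
    show "br (m x - m' x) (q x - e) \<in> Fil (1 - j)" using Fil_br[OF close[of x] q(2)[of x]] by simp
  qed
  have diffF: "gauge_term m q (Suc k) x - gauge_term m' q (Suc k) x \<in> Fil (2 - j - int k)" for k x
  proof (induction k)
    case 0
    have "br e (m x - m' x) \<in> Fil (2 - j)" using Fil_br[OF e_Fil close[of x]] by simp
    then show ?case using first[of x] FilD[OF firstF[of x], of "2 - j"]
      by (simp del: gauge_term.simps add: vec.subspace_add[OF Fil_subspace])
  next
    case (Suc k)
    let ?g = "gauge_term m q (Suc k) x" and ?g' = "gauge_term m' q (Suc k) x"
    have "gauge_term m q (Suc (Suc k)) x - gauge_term m' q (Suc (Suc k)) x
        = (- 1 / real (Suc (Suc k))) *\<^sub>R (br (m x - m' x) ?g + br (m' x) (?g - ?g'))"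
      unfolding gauge_term.simps(2)[of _ _ "Suc k"]
      by (simp add: br_diff scaleR_diff_right del: gauge_term.simps)
    moreover have "br (m x - m' x) ?g \<in> Fil (2 - j - int (Suc k))"
      using Fil_br[OF close[of x] gF[of "Suc k" x]] by (simp add: algebra_simps)
    moreover have "br (m' x) (?g - ?g') \<in> Fil (2 - j - int (Suc k))"
      using Fil_br[OF loops_value[OF m', of x] Suc] by (simp add: algebra_simps)
    ultimately show ?case by (metis Fil_scaleR vec.subspace_add[OF Fil_subspace])
  qed
  obtain n where n: "2 * depth = Suc (Suc n)" using depth_pos by (cases depth) auto
  \<comment> \<open>\<open>X\<close> collects the difference of the two gauge transforms except for
    \<open>[e, m - m']\<close>.\<close>
  define X where "X = ((vderiv m x - vderiv m' x) - br (m x - m' x) (q x - e))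
    + (\<Sum>k<n. gauge_term m q (Suc (Suc k)) x - gauge_term m' q (Suc (Suc k)) x)"
  have XF: "X \<in> Fil (1 - j)" unfolding X_def
  proof (intro vec.subspace_add[OF Fil_subspace] vec.subspace_sum[OF Fil_subspace] firstF)
    fix k show "gauge_term m q (Suc (Suc k)) x - gauge_term m' q (Suc (Suc k)) x \<in> Fil (1 - j)"
      using diffF[of "Suc k" x] by (rule FilD) simp
  qed
  have "gauge m q x - gauge m' q x = (\<Sum>k<Suc (Suc n). gauge_term m q k x - gauge_term m' q k x)"
    by (simp only: gauge_def n sum_subtractf)
  also have "\<dots> = br e (m x - m' x) + X"
    unfolding X_def using first[of x]
    by (simp only: sum.lessThan_Suc_shift o_def gauge_term.simps(1) One_nat_def) (simp del: gauge_term.simps(2))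
  finally have g: "gauge m q x - gauge m' q x = br e (m x - m' x) + X" .
  have "m x - m' x \<in> Fil (- 1)"
    by (rule vec.subspace_diff[OF Fil_subspace loops_value[OF m] loops_value[OF m']])
  then have "m x - m' x \<in> range (br f)" using Fil_range by (rule rev_subsetD)
  then have "R (gauge m q x - gauge m' q x) = (m x - m' x) + R X"
    unfolding g by (simp add: clin_add[OF R_linear] R_inverse)
  then have "slice_step q m x - slice_step q m' x = - R X"
    by (simp add: slice_step_def clin_diff[OF R_linear] algebra_simps)
  moreover have "- R X \<in> Fil (- j - 1)"
    by (rule FilD[OF vec.subspace_neg[OF Fil_subspace R_Fil[OF XF]]]) simp
  ultimately show ?thesis by (simp only:)
qed

primrec slice_iter :: "nat \<Rightarrow> 'n loop \<Rightarrow> 'n loop" where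
  "slice_iter 0 q = (\<lambda>_. 0)"
| "slice_iter (Suc n) q = slice_step q (slice_iter n q)"

abbreviation "slice_gauge \<equiv> slice_iter depth"

lemma slice_iter_admissible:
  assumes "admissible V W" "q \<in> loops UNIV" "\<And>x. q x - e \<in> W"
  shows "slice_iter n q \<in> loops V"
proof (induction n)
  case 0
  have "(0 :: complex ^ 'n) \<in> V" using assms(1) vec.subspace_0 by (auto simp: admissible_def)
  then show ?case using loops_valueI[OF loops_const[of 0], of V] by simp
qed (simp add: slice_step_admissible[OF assms(1) _ assms(2,3)])

lemma gauge_in_Q_iff:
  assumes "m \<in> loops UNIV" "q \<in> loops UNIV"
  shows "gauge m q \<in> Q_space br e f \<longleftrightarrow> slice_step q m = m"
  using gauge_loops[OF assms] by (auto simp: Q_iff slice_step_def R_eq_0_iff[symmetric] fun_eq_iff)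

text \<open>Consecutive iterates agree one filtration step further each time, hence exactly after
  \<open>depth\<close> steps.\<close>

lemma slice_gauge_fixed:
  assumes q: "q \<in> loops UNIV" "\<And>x. q x - e \<in> Fil 1"
  shows "gauge (slice_gauge q) q \<in> Q_space br e f"
proof -
  have it: "slice_iter n q \<in> loops (Fil (- 1))" for n
    by (rule slice_iter_admissible[OF admissible_Fil q])
  have "slice_iter (Suc n) q x - slice_iter n q x \<in> Fil (- int n - 1)" for n x
  proof (induction n arbitrary: x)
    case 0
    have "slice_iter 1 q x \<in> Fil (- 1)" by (rule loops_value[OF it])
    then show ?case by simp
  next
    case (Suc n)
    have "slice_iter (Suc n) q x - slice_iter n q x \<in> Fil (- (int n + 1))" for x
      by (rule FilD[OF Suc]) simp
    from slice_step_contracts[OF it it q _ this, of x]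
    have "slice_iter (Suc (Suc n)) q x - slice_iter (Suc n) q x \<in> Fil (- (int n + 1) - 1)" by simp
    then show ?case by (rule FilD) simp
  qed
  from this[of depth] have "slice_iter (Suc depth) q x - slice_gauge q x \<in> Fil (- int depth)" for x
    by (rule FilD) simp
  then have "slice_step q (slice_gauge q) = slice_gauge q" using Fil_bot by (auto simp: fun_eq_iff)
  then show ?thesis using gauge_in_Q_iff[OF loops_UNIV_I[OF it] q(1)] by simp
qed

text \<open>Two fixed points of a map contracting the filtration differ by an element of every
  \<open>Fil (- n - 1)\<close>.\<close>

lemma slice_gauge_unique:
  assumes q: "q \<in> loops UNIV" "\<And>x. q x - e \<in> Fil 1"
    and m: "m \<in> loops (Fil (- 1))" "gauge m q \<in> Q_space br e f"
  shows "m = slice_gauge q"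
proof
  fix x
  let ?m = "slice_gauge q"
  have m': "?m \<in> loops (Fil (- 1))" by (rule slice_iter_admissible[OF admissible_Fil q])
  have fixed: "slice_step q m = m" "slice_step q ?m = ?m"
    using gauge_in_Q_iff[OF loops_UNIV_I q(1)] m m' slice_gauge_fixed[OF q] by blast+
  have "m x - ?m x \<in> Fil (- int n - 1)" for n x
  proof (induction n arbitrary: x)
    case 0
    then show ?case using vec.subspace_diff[OF Fil_subspace loops_value[OF m(1)] loops_value[OF m']] by simp
  next
    case (Suc n)
    have "m x - ?m x \<in> Fil (- (int n + 1))" for x
      by (rule FilD[OF Suc]) simp
    from slice_step_contracts[OF m(1) m' q _ this, of x]
    have "m x - ?m x \<in> Fil (- (int n + 1) - 1)" by (simp add: fixed)
    then show ?case by (rule FilD) simp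
  qed
  from this[of x depth] have "m x - ?m x \<in> Fil (- int depth)" by (rule FilD) simp
  then show "m x = ?m x" using Fil_bot by simp
qed

definition slice_map :: "'n loop \<Rightarrow> 'n loop" where
  "slice_map q = gauge (slice_gauge q) q"

lemma slice_map_Q: "q \<in> loops UNIV \<Longrightarrow> (\<And>x. q x - e \<in> Fil 1) \<Longrightarrow> slice_map q \<in> Q_space br e f"
  unfolding slice_map_def by (rule slice_gauge_fixed)

lemma gauge_0: "gauge (\<lambda>_. 0) q = q"
proof
  fix x
  obtain n where n: "2 * depth = Suc n" using depth_pos by (cases "2 * depth") auto
  have "gauge_term (\<lambda>_. 0) q (Suc k) x = 0" for k by simp
  then show "gauge (\<lambda>_. 0) q x = q x"
    unfolding gauge_def n by (subst sum.lessThan_Suc_shift) (simp del: gauge_term.simps(2))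
qed

lemma slice_map_id: "q \<in> Q_space br e f \<Longrightarrow> slice_map q = q"
proof -
  assume q: "q \<in> Q_space br e f"
  have "(\<lambda>_. 0) \<in> loops (Fil (- 1))"
    using loops_valueI[OF loops_const[of 0], of "Fil (- 1)"] vec.subspace_0[OF Fil_subspace] by blast
  moreover have "q \<in> loops UNIV" "\<And>x. q x - e \<in> Fil 1" using Q_Fil[OF q] FilD[of _ 0 1] by auto
  ultimately have "(\<lambda>_. 0) = slice_gauge q" using q by (intro slice_gauge_unique) (simp_all add: gauge_0)
  then show "slice_map q = q" unfolding slice_map_def using gauge_0 by metis
qed

lemma diff_poly_map_gauge:
  assumes \<mu>: "diff_poly_map \<mu>" and \<Phi>: "diff_poly_map \<Phi>"
  shows "diff_poly_map (\<lambda>c. gauge (\<mu> c) (\<Phi> c))"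
proof -
  have "diff_poly_map (\<lambda>c. gauge_term (\<mu> c) (\<Phi> c) k)" for k
  proof (induction k)
    case (Suc k)
    have "diff_poly_map (\<lambda>c x. if k = 0 then vderiv (\<mu> c) x else 0)"
      using diff_poly_map_vderiv[OF \<mu>] diff_poly_map_const by (cases "k = 0") simp_all
    then show ?case unfolding gauge_term.simps
      by (rule diff_poly_map_scaleR[OF diff_poly_map_minus[OF
            diff_poly_map_bilinear[OF linear_right linear_left \<mu> Suc]]])
  qed (simp add: \<Phi>)
  then show ?thesis unfolding gauge_def by (rule diff_poly_map_sum)
qed

text \<open>The number of iterations is independent of the loop, so the result is a fixed polynomial
  expression in its jet.\<close>

lemma diff_poly_map_slice_iter:
  assumes \<Phi>: "diff_poly_map \<Phi>" shows "diff_poly_map (\<lambda>c. slice_iter n (\<Phi> c))"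
proof (induction n)
  case (Suc n)
  show ?case unfolding slice_iter.simps slice_step_def
    by (rule diff_poly_map_minus[OF Suc diff_poly_map_clin[OF R_linear
          diff_poly_map_minus[OF diff_poly_map_gauge[OF Suc \<Phi>] diff_poly_map_const]]])
qed (simp add: diff_poly_map_const)

lemma diff_poly_map_slice_map: "diff_poly_map slice_map"
  unfolding slice_map_def[abs_def]
  by (rule diff_poly_map_gauge[OF diff_poly_map_slice_iter diff_poly_map_id]) (rule diff_poly_map_id)

end

section \<open>Independence of the grading and the isotropic subspace\<close>

lemma polycurve_minus: "polycurve \<gamma> \<Longrightarrow> polycurve \<delta> \<Longrightarrow> polycurve (\<lambda>t x. \<gamma> t x - \<delta> t x)"
  using polycurve.add[OF _ polycurve_bounded_linear[OF bounded_linear_minus[OF bounded_linear_ident]], of \<gamma> \<delta>]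
  by simp

text \<open>\<open>a\<close> and \<open>b\<close> are the coefficients of power series
  \<open>A\<close>, \<open>B\<close> with \<open>A' = \<alpha> - [m, A]\<close> and
  \<open>B' = \<beta> - [m, B]\<close>. The identity is the Leibniz rule
  \<open>C' = [\<alpha>, B] + [A, \<beta>] - [m, C]\<close> for \<open>C = [A, B]\<close>, read off
  coefficientwise.\<close>

lemma (in lie) cauchy_bracket:
  assumes a: "\<And>i. real (Suc i) *\<^sub>R a (Suc i) = (if i = 0 then \<alpha> else 0) - br m (a i)"
    and b: "\<And>i. real (Suc i) *\<^sub>R b (Suc i) = (if i = 0 then \<beta> else 0) - br m (b i)"
  shows "real (Suc k) *\<^sub>R (\<Sum>i\<le>Suc k. br (a i) (b (Suc k - i))) =
    br \<alpha> (b k) + br (a k) \<beta> - br m (\<Sum>i\<le>k. br (a i) (b (k - i)))"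
proof -
  note s = bounded_bilinear.scaleR_left[OF bounded_bilinear_br] bounded_bilinear.scaleR_right[OF bounded_bilinear_br]
  have "real (Suc k) *\<^sub>R (\<Sum>i\<le>Suc k. br (a i) (b (Suc k - i))) =
      (\<Sum>i\<le>Suc k. br (real i *\<^sub>R a i) (b (Suc k - i))) + (\<Sum>i\<le>Suc k. br (a i) (real (Suc k - i) *\<^sub>R b (Suc k - i)))"
    unfolding scaleR_sum_right sum.distrib[symmetric]
  proof (rule sum.cong[OF refl])
    fix i assume "i \<in> {..Suc k}"
    then have "real (Suc k) = real i + real (Suc k - i)" by (simp add: of_nat_diff)
    then show "real (Suc k) *\<^sub>R br (a i) (b (Suc k - i)) =
        br (real i *\<^sub>R a i) (b (Suc k - i)) + br (a i) (real (Suc k - i) *\<^sub>R b (Suc k - i))"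
      unfolding s by (simp only: scaleR_left_distrib)
  qed
  also have "(\<Sum>i\<le>Suc k. br (real i *\<^sub>R a i) (b (Suc k - i))) = (\<Sum>i\<le>k. br ((if i = 0 then \<alpha> else 0) - br m (a i)) (b (k - i)))"
    by (subst sum.atMost_Suc_shift) (simp add: a del: of_nat_Suc)
  also have "\<dots> = (\<Sum>i\<le>k. (if i = 0 then br \<alpha> (b k) else 0) - br (br m (a i)) (b (k - i)))"
    by (intro sum.cong refl) (simp add: br_diff)
  also have "(\<Sum>i\<le>Suc k. br (a i) (real (Suc k - i) *\<^sub>R b (Suc k - i))) =
      (\<Sum>i\<le>k. br (a i) (real (Suc (k - i)) *\<^sub>R b (Suc (k - i))))"
    by (simp only: sum.atMost_Suc diff_self_eq_0 of_nat_0 scaleR_zero_left br_linear add_0_right)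
       (rule sum.cong[OF refl], simp only: atMost_iff Suc_diff_le)
  also have "\<dots> = (\<Sum>i\<le>k. (if i = k then br (a k) \<beta> else 0) - br (a i) (br m (b (k - i))))"
    unfolding b by (intro sum.cong refl) (auto simp: br_diff)
  finally show ?thesis
    by (simp add: sum_subtractf br_sum_right jacobi[of m] sum.distrib)
qed

section \<open>Zero curvature and invariance of the projection to the slice\<close>

context slice
begin

text \<open>The coefficients of the power series in \<open>r\<close> solving
  \<open>dW/dr = m' - [m, W]\<close>, \<open>W = v\<close> at \<open>r = 0\<close>. Its value at
  \<open>r = 1\<close> is the infinitesimal parameter that moves the gauge transformed loop.\<close>

primrec gauge_tangent :: "'n loop \<Rightarrow> 'n loop \<Rightarrow> 'n loop \<Rightarrow> nat \<Rightarrow> 'n loop" where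
  "gauge_tangent m m' v 0 = v"
| "gauge_tangent m m' v (Suc k) = (\<lambda>x. (- 1 / real (Suc k)) *\<^sub>R
     (br (m x) (gauge_tangent m m' v k x) - (if k = 0 then m' x else 0)))"

lemma gauge_tangent_properties:
  assumes m: "m \<in> loops (Fil (- 1))" and m': "m' \<in> loops (Fil (- 1))" and v: "v \<in> loops (Fil (- 1))"
  shows "gauge_tangent m m' v k \<in> loops (Fil (- 1)) \<and> (\<forall>x. gauge_tangent m m' v k x \<in> Fil (- int k))"
proof (induction k)
  case 0
  then show ?case using v FilD[OF loops_value[OF v], of 0] by simp
next
  case (Suc k)
  let ?w = "gauge_tangent m m' v k"
  have d: "(\<lambda>x. if k = 0 then m' x else 0) \<in> loops UNIV"
    using loops_UNIV_I[OF m'] loops_const[of 0] by (cases "k = 0") auto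
  have L: "gauge_tangent m m' v (Suc k) \<in> loops UNIV"
    unfolding gauge_tangent.simps using Suc m d by (intro loops_scaleR loops_diff loops_br) (auto intro: loops_UNIV_I)
  have F: "gauge_tangent m m' v (Suc k) x \<in> Fil (- int (Suc k))" for x
  proof -
    have "br (m x) (?w x) \<in> Fil (- 1 + - int k)" using Suc by (intro Fil_br loops_value[OF m]) auto
    moreover have "(if k = 0 then m' x else 0) \<in> Fil (- 1 + - int k)"
      using loops_value[OF m', of x] vec.subspace_0[OF Fil_subspace] by auto
    ultimately show ?thesis unfolding gauge_tangent.simps
      using FilD[of _ "- 1 + - int k" "- int (Suc k)"] by (intro Fil_scaleR vec.subspace_diff[OF Fil_subspace]) auto
  qed
  show ?case
  proof (intro conjI allI F loops_valueI[OF L])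
    show "gauge_tangent m m' v (Suc k) x \<in> Fil (- 1)" for x using F[of x] by (rule FilD) simp
  qed
qed

lemma gauge_tangent_zero:
  assumes "m \<in> loops (Fil (- 1))" "m' \<in> loops (Fil (- 1))" "v \<in> loops (Fil (- 1))" "k \<ge> 2 * depth"
  shows "gauge_tangent m m' v k = (\<lambda>_. 0)"
proof
  fix x
  have "gauge_tangent m m' v k x \<in> Fil (- int depth)"
    by (rule FilD[of _ "- int k"]) (use gauge_tangent_properties[OF assms(1-3)] assms(4) in auto)
  then show "gauge_tangent m m' v k x = 0" using Fil_bot by simp
qed

text \<open>Zero curvature: a variation \<open>m'\<close> of the gauge parameter together with an infinitesimal gauge
  transformation \<open>v\<close> of \<open>s\<close> moves \<open>gauge m s\<close> by an infinitesimal gauge transformation.\<close>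

lemma gauge_derivative:
  assumes m: "polycurve m" "\<And>t. m t \<in> loops (Fil (- 1))" and s: "polycurve s"
    and v: "v \<in> loops (Fil (- 1))" and sv: "\<And>x. tderiv s t x = P2 br (s t) v x"
  shows "\<exists>W\<in>loops (Fil (- 1)). \<forall>x. tderiv (\<lambda>t. gauge (m t) (s t)) t x = P2 br (gauge (m t) (s t)) W x"
proof -
  define x where "x = (\<lambda>k t. gauge_term (m t) (s t) k)"
  define md where "md = tderiv m t"
  define w where "w = gauge_tangent (m t) md v"
  have mdL: "md \<in> loops (Fil (- 1))"
    unfolding md_def using tderiv_in_subspace[OF Fil_subspace m(1) loops_value[OF m(2)]]
    by (intro loops_valueI[OF polycurve_loops[OF polycurve_tderiv[OF m(1)]]])
  note wp = gauge_tangent_properties[OF m(2)[of t] mdL v, folded w_def]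
  note w0 = gauge_tangent_zero[OF m(2)[of t] mdL v, folded w_def]
  have wL: "w k \<in> loops UNIV" for k using wp loops_UNIV_I by blast
  have vm: "polycurve (\<lambda>t y. if k = 0 then vderiv (m t) y else 0)" for k :: nat
    using polycurve_vderiv[OF m(1)] polycurve_const[OF loops_const[of 0]] by (cases "k = 0") auto
  have xP: "polycurve (x k)" for k
  proof (induction k)
    case 0
    show ?case using s by (simp add: x_def)
  next
    case (Suc k)
    have "polycurve (\<lambda>t y. (- 1 / real (Suc k)) *\<^sub>R (br (m t y) (x k t y) - (if k = 0 then vderiv (m t) y else 0)))"
      by (rule polycurve_bounded_linear[OF bounded_linear_scaleR_right
            polycurve_minus[OF polycurve_bilinear[OF bounded_bilinear_br m(1) Suc] vm]])
    then show ?case by (simp add: x_def)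
  qed
  have xd: "real (Suc k) *\<^sub>R tderiv (x (Suc k)) t y =
      (if k = 0 then vderiv md y else 0) - (br (m t y) (tderiv (x k) t y) + br (md y) (x k t y))" for k y
  proof -
    have 1: "((\<lambda>\<tau>. br (m \<tau> y) (x k \<tau> y)) has_vector_derivative
        br (m t y) (tderiv (x k) t y) + br (md y) (x k t y)) (at t)"
      unfolding md_def
      by (rule bounded_bilinear.has_vector_derivative[OF bounded_bilinear_br has_tderiv[OF m(1)] has_tderiv[OF xP]])
    have 2: "((\<lambda>\<tau>. if k = 0 then vderiv (m \<tau>) y else 0) has_vector_derivative (if k = 0 then vderiv md y else 0)) (at t)"
      using nderiv_tderiv[OF m(1), of 1 y t] by (cases "k = 0") (simp_all add: nderiv_1 md_def)
    have "((\<lambda>\<tau>. x (Suc k) \<tau> y) has_vector_derivative (- 1 / real (Suc k)) *\<^sub>R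
        ((br (m t y) (tderiv (x k) t y) + br (md y) (x k t y)) - (if k = 0 then vderiv md y else 0))) (at t)"
      using bounded_linear.has_vector_derivative[OF bounded_linear_scaleR_right
          has_vector_derivative_diff[OF 1 2], of "- 1 / real (Suc k)"]
      by (simp add: x_def)
    then have "tderiv (x (Suc k)) t y = (- 1 / real (Suc k)) *\<^sub>R
        ((br (m t y) (tderiv (x k) t y) + br (md y) (x k t y)) - (if k = 0 then vderiv md y else 0))"
      unfolding tderiv_def[of "x (Suc k)"] by (rule vector_derivative_at)
    then show ?thesis by (simp del: of_nat_Suc)
  qed
  have xr: "real (Suc i) *\<^sub>R x (Suc i) t y = (if i = 0 then vderiv (m t) y else 0) - br (m t y) (x i t y)" for i y
    by (simp add: x_def del: of_nat_Suc)
  have wr: "real (Suc i) *\<^sub>R w (Suc i) y = (if i = 0 then md y else 0) - br (m t y) (w i y)" for i y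
    by (simp add: w_def del: of_nat_Suc)
  have dw: "real (Suc k) *\<^sub>R vderiv (w (Suc k)) y = (if k = 0 then vderiv md y else 0)
      - (br (m t y) (vderiv (w k) y) + br (vderiv (m t) y) (w k y))" for k y
  proof -
    have 1: "((\<lambda>y. br (m t y) (w k y)) has_vector_derivative
        br (m t y) (vderiv (w k) y) + br (vderiv (m t) y) (w k y)) (at y)"
      by (rule bounded_bilinear.has_vector_derivative[OF bounded_bilinear_br
            smooth_has_vector_derivative[OF loops_smooth[OF m(2)]] smooth_has_vector_derivative[OF loops_smooth[OF wL]]])
    have 2: "((\<lambda>y. if k = 0 then md y else 0) has_vector_derivative (if k = 0 then vderiv md y else 0)) (at y)"
      using smooth_has_vector_derivative[OF loops_smooth[OF mdL]] by (cases "k = 0") simp_all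
    have "(w (Suc k) has_vector_derivative (- 1 / real (Suc k)) *\<^sub>R
        ((br (m t y) (vderiv (w k) y) + br (vderiv (m t) y) (w k y)) - (if k = 0 then vderiv md y else 0))) (at y)"
      using bounded_linear.has_vector_derivative[OF bounded_linear_scaleR_right
          has_vector_derivative_diff[OF 1 2], of "- 1 / real (Suc k)"]
      by (simp add: w_def)
    then have "vderiv (w (Suc k)) y = (- 1 / real (Suc k)) *\<^sub>R
        ((br (m t y) (vderiv (w k) y) + br (vderiv (m t) y) (w k y)) - (if k = 0 then vderiv md y else 0))"
      by (rule vector_derivative_at)
    then show ?thesis by (simp del: of_nat_Suc)
  qed
  \<comment> \<open>The zero curvature identity, coefficient by coefficient. By \<open>xd\<close>,
    \<open>dw\<close> and \<open>cauchy_bracket\<close> both sides obey the same recursion, and at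
    \<open>k = 0\<close> it is the hypothesis \<open>sv\<close>.\<close>
  have main: "tderiv (x k) t y = vderiv (w k) y + (\<Sum>i\<le>k. br (x i t y) (w (k - i) y))" for k y
  proof (induction k)
    case 0
    have "x 0 = s" by (auto simp: x_def)
    then show ?case using sv[of y] by (simp add: P2_def w_def)
  next
    case (Suc k)
    have "real (Suc k) *\<^sub>R (vderiv (w (Suc k)) y + (\<Sum>i\<le>Suc k. br (x i t y) (w (Suc k - i) y)))
        = real (Suc k) *\<^sub>R tderiv (x (Suc k)) t y"
      unfolding scaleR_add_right xd dw cauchy_bracket[of "\<lambda>i. x i t y" _ _ "\<lambda>i. w i y", OF xr wr]
      using br_anticommute[of "x k t y" "md y"] by (simp add: Suc br_add)
    then show ?case by (simp del: of_nat_Suc sum.atMost_Suc)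
  qed
  \<comment> \<open>Both series end before index \<open>?d\<close>. Summing to twice that bound
    makes the triangle \<open>i + j < ?n\<close> contain the whole square of possibly nonzero
    terms.\<close>
  let ?d = "2 * depth" and ?n = "4 * depth"
  define W where "W = (\<lambda>y. \<Sum>k<?d. w k y)"
  have WU: "W \<in> loops UNIV" unfolding W_def by (intro loops_sum wL)
  have "W y \<in> Fil (- 1)" for y
    unfolding W_def by (rule vec.subspace_sum[OF Fil_subspace], rule loops_value, rule wp[THEN conjunct1])
  then have WL: "W \<in> loops (Fil (- 1))" by (rule loops_valueI[OF WU])
  have x0: "x i t y = 0" if "i \<ge> ?d" for i y unfolding x_def by (rule gauge_term_zero[OF m(2) that])
  have "tderiv (\<lambda>t. gauge (m t) (s t)) t y = P2 br (gauge (m t) (s t)) W y" for y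
  proof -
    have "(\<lambda>t. gauge (m t) (s t)) = (\<lambda>t y. \<Sum>k<?n. x k t y)"
    proof (intro ext)
      fix \<tau> y
      show "gauge (m \<tau>) (s \<tau>) y = (\<Sum>k<?n. x k \<tau> y)"
        using gauge_extend[OF m(2)[of \<tau>], of ?n "s \<tau>" y] by (simp add: x_def)
    qed
    then have "((\<lambda>\<tau>. gauge (m \<tau>) (s \<tau>) y) has_vector_derivative (\<Sum>k<?n. tderiv (x k) t y)) (at t)"
      using has_vector_derivative_sum[of "{..<?n}" "\<lambda>k \<tau>. x k \<tau> y" "\<lambda>k. tderiv (x k) t y" "at t"] has_tderiv[OF xP]
      by (simp add: fun_eq_iff)
    then have "tderiv (\<lambda>t. gauge (m t) (s t)) t y = (\<Sum>k<?n. tderiv (x k) t y)"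
      unfolding tderiv_def[of "\<lambda>t. gauge (m t) (s t)"] by (rule vector_derivative_at)
    also have "\<dots> = (\<Sum>k<?n. vderiv (w k) y) + (\<Sum>k<?n. \<Sum>i\<le>k. br (x i t y) (w (k - i) y))"
      by (simp only: main sum.distrib)
    also have "(\<Sum>k<?n. vderiv (w k) y) = (\<Sum>k<?d. vderiv (w k) y)"
      using w0 by (intro sum.mono_neutral_right) auto
    also have "\<dots> = vderiv W y"
      using nderiv_sum[of "{..<?d}" w 1] loops_smooth[OF wL] by (simp add: nderiv_1 W_def fun_eq_iff)
    also have "(\<Sum>k<?n. \<Sum>i\<le>k. br (x i t y) (w (k - i) y)) = (\<Sum>(i, j)\<in>{(i, j). i + j < ?n}. br (x i t y) (w j y))"
      by (rule sum.triangle_reindex[symmetric])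
    also have "\<dots> = (\<Sum>(i, j)\<in>{..<?d} \<times> {..<?d}. br (x i t y) (w j y))"
    proof (rule sum.mono_neutral_right)
      show "finite {(i, j). i + j < ?n}"
        by (rule finite_subset[of _ "{..<?n} \<times> {..<?n}"]) auto
      show "\<forall>p\<in>{(i, j). i + j < ?n} - {..<?d} \<times> {..<?d}. (case p of (i, j) \<Rightarrow> br (x i t y) (w j y)) = 0"
      proof
        fix p assume p: "p \<in> {(i, j). i + j < ?n} - {..<?d} \<times> {..<?d}"
        obtain i j where ij: "p = (i, j)" by (cases p)
        with p have "i \<ge> ?d \<or> j \<ge> ?d" by auto
        then show "(case p of (i, j) \<Rightarrow> br (x i t y) (w j y)) = 0"
          using x0[of i y] w0[of j] ij by auto
      qed
    qed auto
    also have "\<dots> = br (gauge (m t) (s t) y) (W y)"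
      by (simp add: sum.cartesian_product[symmetric] br_sum_left br_sum_right gauge_def W_def x_def)
         (rule sum.swap)
    finally show ?thesis by (simp add: P2_def)
  qed
  then show ?thesis using WL by blast
qed

lemma P2_Fil:
  assumes "\<And>x. s x - e \<in> Fil 1" "v \<in> loops (Fil (- 1))" shows "P2 br s v x \<in> Fil 1"
proof -
  have "br e (v x) \<in> Fil 1" using Fil_br[OF e_Fil loops_value[OF assms(2)]] by simp
  moreover have "br (s x - e) (v x) \<in> Fil 1" using Fil_br[OF assms(1) loops_value[OF assms(2)]] by (rule FilD) simp
  moreover have "vderiv v x \<in> Fil 1" using vderiv_Fil[OF assms(2)] by (rule FilD) simp
  ultimately have "vderiv v x + (br e (v x) + br (s x - e) (v x)) \<in> Fil 1"
    by (intro vec.subspace_add[OF Fil_subspace])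
  then show ?thesis by (simp add: P2_def br_diff)
qed

lemma line_Fil:
  assumes "\<And>x. s x - e \<in> Fil 1" "\<And>x. u x \<in> Fil 1" shows "s x + t *\<^sub>R u x - e \<in> Fil 1"
  using vec.subspace_add[OF Fil_subspace assms(1)[of x] Fil_scaleR[OF assms(2), of t x]] by (simp add: algebra_simps)

text \<open>Infinitesimal transversality: a gauge direction tangent to \<open>Q\<close> satisfies
  \<open>W + perturbation z W = 0\<close>, and the perturbation is nilpotent.\<close>

lemma P2_kernel_imp_zero:
  assumes z: "z \<in> Q_space br e f" and W: "W \<in> loops (Fil (- 1))" and "\<And>x. br f (P2 br z W x) = 0"
  shows "W = (\<lambda>_. 0)"
proof -
  have zL: "z \<in> loops UNIV" "\<And>x. z x - e \<in> Fil 0" using Q_Fil[OF z] by auto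
  have "W x + perturbation z W x = 0" for x
  proof -
    have "W x \<in> range (br f)" using Fil_range loops_value[OF W] by blast
    moreover have "R (P2 br z W x) = 0" using assms(3) R_eq_0_iff by blast
    ultimately show ?thesis using R_P2[of W x z] by simp
  qed
  then have "W = resolvent z (\<lambda>_. 0)"
    by (intro resolvent_unique zL loops_const loops_UNIV_I[OF W])
  moreover have "(\<lambda>_. 0) = resolvent z (\<lambda>_. 0)"
    by (intro resolvent_unique zL loops_const) (simp add: perturbation_def clin_0[OF R_linear])
  ultimately show ?thesis by simp
qed

lemma slice_map_polycurve: "polycurve s \<Longrightarrow> polycurve (\<lambda>t. slice_map (s t))"
  by (rule diff_poly_map_polycurve[OF diff_poly_map_slice_map])

text \<open>The projected curve stays in \<open>Q\<close>, so its velocity is tangent to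
  \<open>Q\<close>; by \<open>gauge_derivative\<close> the velocity is also a gauge direction. By
  transversality it vanishes.\<close>

lemma slice_map_tangent:
  assumes s: "s \<in> loops UNIV" "\<And>x. s x - e \<in> Fil 1" and v: "v \<in> loops (Fil (- 1))"
  shows "tderiv (\<lambda>t. slice_map (\<lambda>x. s x + t *\<^sub>R P2 br s v x)) 0 x = 0"
proof -
  define \<sigma> where "\<sigma> = (\<lambda>t x. s x + t *\<^sub>R P2 br s v x)"
  define z where "z = (\<lambda>t. slice_map (\<sigma> t))"
  have \<sigma>: "polycurve \<sigma>" unfolding \<sigma>_def
    by (rule polycurve_line[OF s(1) P2_loops[OF s(1) loops_UNIV_I[OF v]]])
  have \<sigma>F: "\<sigma> t x - e \<in> Fil 1" for t x
    unfolding \<sigma>_def by (rule line_Fil[OF s(2) P2_Fil[OF s(2) v]])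
  have mP: "polycurve (\<lambda>t. slice_gauge (\<sigma> t))"
    by (rule diff_poly_map_polycurve[OF diff_poly_map_slice_iter[OF diff_poly_map_id] \<sigma>])
  have mF: "slice_gauge (\<sigma> t) \<in> loops (Fil (- 1))" for t
    by (rule slice_iter_admissible[OF admissible_Fil polycurve_loops[OF \<sigma>] \<sigma>F])
  have "\<sigma> 0 = s" by (simp add: \<sigma>_def)
  then have sv: "tderiv \<sigma> 0 x = P2 br (\<sigma> 0) v x" for x
    unfolding \<sigma>_def by (simp only: tderiv_line)
  obtain W where W: "W \<in> loops (Fil (- 1))" "\<And>x. tderiv z 0 x = P2 br (z 0) W x"
    using gauge_derivative[OF mP mF \<sigma> v sv] unfolding z_def slice_map_def by blast
  have zQ: "z t \<in> Q_space br e f" for t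
    unfolding z_def by (rule slice_map_Q[OF polycurve_loops[OF \<sigma>] \<sigma>F])
  have zP: "polycurve z" unfolding z_def by (rule slice_map_polycurve[OF \<sigma>])
  have "br f (tderiv z 0 x) = 0" for x
  proof -
    have "((\<lambda>t. br f (z t x)) has_vector_derivative br f (tderiv z 0 x)) (at 0)"
      by (rule bounded_linear.has_vector_derivative[OF clin_bounded_linear[OF linear_right] has_tderiv[OF zP]])
    moreover have "(\<lambda>t. br f (z t x)) = (\<lambda>t. br f e)" using zQ by (simp add: Q_iff br_diff)
    ultimately have "((\<lambda>t::real. br f e) has_vector_derivative br f (tderiv z 0 x)) (at 0)" by simp
    from vector_derivative_unique_at[OF this has_vector_derivative_const] show ?thesis .
  qed
  then have "W = (\<lambda>_. 0)" using W by (intro P2_kernel_imp_zero[OF zQ]) auto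
  then show ?thesis using W(2)[of x] by (simp add: P2_def z_def \<sigma>_def)
qed

lemma gauge_term_scale: "m \<in> loops UNIV \<Longrightarrow> gauge_term (\<lambda>x. t *\<^sub>R m x) s k x = t ^ k *\<^sub>R gauge_term m s k x"
proof (induction k arbitrary: x)
  case (Suc k)
  have "vderiv (\<lambda>x. t *\<^sub>R m x) x = t *\<^sub>R vderiv m x"
    using fun_cong[OF vderiv_bounded_linear[OF bounded_linear_scaleR_right loops_smooth[OF Suc.prems]]] .
  then show ?case using Suc
    by (simp add: bounded_bilinear.scaleR_left[OF bounded_bilinear_br]
        bounded_bilinear.scaleR_right[OF bounded_bilinear_br] scaleR_diff_right mult.commute)
qed simp

text \<open>The curve of gauge transforms by \<open>t m\<close> joins \<open>s\<close> to
  \<open>gauge m s\<close> with velocity \<open>P2 (\<gamma> t) m\<close>. By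
  \<open>slice_map_tangent\<close> its image under \<open>slice_map\<close> has zero velocity at
  every \<open>t\<close>.\<close>

lemma slice_map_gauge:
  assumes s: "s \<in> loops UNIV" "\<And>x. s x - e \<in> Fil 1" and m: "m \<in> loops (Fil (- 1))"
  shows "slice_map (gauge m s) = slice_map s"
proof -
  define \<gamma> where "\<gamma> = (\<lambda>t. gauge (\<lambda>x. t *\<^sub>R m x) s)"
  let ?d = "2 * depth"
  note mL = loops_UNIV_I[OF m]
  have \<gamma>eq: "\<gamma> t x = (\<Sum>k<?d. t ^ k *\<^sub>R gauge_term m s k x)" for t x
    by (simp only: \<gamma>_def gauge_def gauge_term_scale[OF mL])
  have "polycurve (\<lambda>t x. \<Sum>k<?d. t ^ k *\<^sub>R gauge_term m s k x)"
    by (intro polycurve_sum polycurve.monomial gauge_term_loops mL s)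
  then have \<gamma>P: "polycurve \<gamma>" using \<gamma>eq by presburger
  have tm: "(\<lambda>x. t *\<^sub>R m x) \<in> loops (Fil (- 1))" for t
    by (rule loops_valueI[OF loops_scaleR[OF mL]]) (rule Fil_scaleR[OF loops_value[OF m]])
  have \<gamma>F: "\<gamma> t x - e \<in> Fil 1" for t x
    unfolding \<gamma>_def by (rule gauge_admissible[OF admissible_Fil tm s(2)])
  have d\<gamma>: "tderiv \<gamma> t x = P2 br (\<gamma> t) m x" for t x
  proof -
    obtain n where n: "?d = Suc n" using depth_pos by (cases "?d") auto
    have gr: "real (Suc k) *\<^sub>R gauge_term m s (Suc k) x = (if k = 0 then vderiv m x else 0) - br (m x) (gauge_term m s k x)" for k
      by (simp del: of_nat_Suc)
    have "((\<lambda>t. t ^ k *\<^sub>R gauge_term m s k x) has_vector_derivative (real k * t ^ (k - 1)) *\<^sub>R gauge_term m s k x) (at t)" for k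
    proof -
      have "((\<lambda>t. t ^ k) has_real_derivative real k * t ^ (k - 1)) (at t)"
        by (auto intro!: derivative_eq_intros)
      from has_vector_derivative_scaleR[OF this has_vector_derivative_const[of "gauge_term m s k x"]]
      show ?thesis by simp
    qed
    then have "((\<lambda>t. \<gamma> t x) has_vector_derivative (\<Sum>k<?d. (real k * t ^ (k - 1)) *\<^sub>R gauge_term m s k x)) (at t)"
      unfolding \<gamma>eq by (intro has_vector_derivative_sum)
    then have "tderiv \<gamma> t x = (\<Sum>k<?d. (real k * t ^ (k - 1)) *\<^sub>R gauge_term m s k x)"
      unfolding tderiv_def by (rule vector_derivative_at)
    \<comment> \<open>The vanishing term of index \<open>?d\<close> is added, so that after the
      index shift \<open>?d\<close> terms remain.\<close>
    also have "\<dots> = (\<Sum>k<Suc ?d. (real k * t ^ (k - 1)) *\<^sub>R gauge_term m s k x)"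
      using gauge_term_zero[OF m, of ?d s x] by simp
    also have "\<dots> = (\<Sum>k<?d. t ^ k *\<^sub>R (real (Suc k) *\<^sub>R gauge_term m s (Suc k) x))"
      by (subst sum.lessThan_Suc_shift) (simp add: mult.commute del: of_nat_Suc gauge_term.simps)
    also have "\<dots> = (\<Sum>k<?d. (if k = 0 then vderiv m x else 0)) - (\<Sum>k<?d. br (m x) (t ^ k *\<^sub>R gauge_term m s k x))"
      unfolding gr sum_subtractf[symmetric]
      by (intro sum.cong refl) (simp add: bounded_bilinear.scaleR_right[OF bounded_bilinear_br] scaleR_diff_right)
    also have "(\<Sum>k<?d. (if k = 0 then vderiv m x else 0)) = vderiv m x" by (simp add: n)
    also have "vderiv m x - (\<Sum>k<?d. br (m x) (t ^ k *\<^sub>R gauge_term m s k x)) = vderiv m x - br (m x) (\<gamma> t x)"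
      by (simp only: \<gamma>eq br_sum_right)
    also have "\<dots> = P2 br (\<gamma> t) m x"
      by (simp add: P2_def br_anticommute[of "\<gamma> t x"])
    finally show ?thesis .
  qed
  have zero: "tderiv (\<lambda>t. slice_map (\<gamma> t)) t x = 0" for t x
  proof -
    have "tderiv \<gamma> t = P2 br (\<gamma> t) m" using d\<gamma> by blast
    then show ?thesis
      using tderiv_diff_poly_map_line[OF diff_poly_map_slice_map \<gamma>P, of t x]
        slice_map_tangent[OF polycurve_loops[OF \<gamma>P, of t] \<gamma>F m, of x] by simp
  qed
  have "slice_map (\<gamma> 1) = slice_map (\<gamma> 0)"
    by (rule polycurve_constant[OF slice_map_polycurve[OF \<gamma>P] zero])
  then show ?thesis by (simp add: \<gamma>_def gauge_0)
qed

text \<open>The line through \<open>s\<close> in the direction \<open>P2 s v\<close> stays in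
  \<open>e + Fil 1\<close>, where \<open>F\<close> factors through \<open>slice_map\<close>, and
  \<open>slice_map\<close> has zero derivative along it.\<close>

lemma constant_along_orbits:
  assumes F0: "represented_by F0 p0" and F: "represented_by F p"
    and eq: "\<And>q. q \<in> loops UNIV \<Longrightarrow> (\<And>x. q x - e \<in> Fil 1) \<Longrightarrow> F q = F0 (slice_map q)"
    and s: "s \<in> loops UNIV" "\<And>x. s x - e \<in> Fil 1" and v: "v \<in> loops (Fil (- 1))"
  shows "pairing br (gradient br F s) (P2 br s v) = 0"
proof (rule pairing_gradientI[OF F s(1) P2_loops[OF s(1) loops_UNIV_I[OF v]]])
  let ?\<sigma> = "\<lambda>t x. s x + t *\<^sub>R P2 br s v x"
  let ?z = "\<lambda>t. slice_map (?\<sigma> t)"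
  have \<sigma>: "polycurve ?\<sigma>" by (rule polycurve_line[OF s(1) P2_loops[OF s(1) loops_UNIV_I[OF v]]])
  note zP = slice_map_polycurve[OF \<sigma>]
  have p0: "p0 \<in> densities" using F0 by (simp add: represented_by_def)
  obtain N P where P: "has_partials p0 N P" using has_partials_exists[OF p0] by blast
  have "tderiv ?z 0 = (\<lambda>_. 0)" using slice_map_tangent[OF s v] by blast
  then have "tderiv (\<lambda>t x. p0 x (jet (?z t) x)) 0 = (\<lambda>_. 0)"
    by (intro ext) (simp add: tderiv_density[OF P zP] nderiv_const)
  then have "((\<lambda>t. density_functional p0 (?z t)) has_vector_derivative 0) (at 0)"
    using density_functional_derivative[OF p0 zP, of 0] by simp
  moreover have \<sigma>F: "?\<sigma> t x - e \<in> Fil 1" for t x by (rule line_Fil[OF s(2) P2_Fil[OF s(2) v]])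
  moreover have "F (?\<sigma> t) = density_functional p0 (?z t)" for t
    using eq[OF polycurve_loops[OF \<sigma>] \<sigma>F] F0 polycurve_loops[OF zP]
    by (simp add: represented_by_def)
  ultimately show "((\<lambda>t. F (\<lambda>x. s x + t *\<^sub>R P2 br s v x)) has_vector_derivative 0) (at 0)" by simp
qed

text \<open>An affine retraction of the whole space onto \<open>e + Fil 1\<close>. Composed with
  \<open>slice_map\<close> it is a differential polynomial map on all loops that lands in
  \<open>Q\<close>.\<close>

lemma slice_projection:
  obtains \<Phi> where "diff_poly_map \<Phi>" "\<And>q x. \<Phi> q x - e \<in> Fil 1"
    "\<And>q. (\<And>x. q x - e \<in> Fil 1) \<Longrightarrow> \<Phi> q = q"
proof -
  obtain P where P: "clin P" "\<And>x. P x \<in> Fil 1" "\<And>x. x \<in> Fil 1 \<Longrightarrow> P x = x"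
    using clin_projection_exists[OF Fil_subspace] by blast
  have "diff_poly_map (\<lambda>q x. e + P (q x - e))"
    by (rule diff_poly_map_add[OF diff_poly_map_const diff_poly_map_clin[OF P(1)
          diff_poly_map_minus[OF diff_poly_map_id diff_poly_map_const]]])
  then show thesis by (rule that) (use P in auto)
qed

lemma invariant_extension_exists:
  assumes "\<phi> \<in> local_functionals_on (Q_space br e f)"
  shows "\<exists>F\<in>local_functionals. (\<forall>z\<in>Q_space br e f. F z = \<phi> z) \<and>
    (\<forall>s\<in>loops UNIV. (\<forall>x. s x - e \<in> Fil 1) \<longrightarrow>
      (\<forall>v\<in>loops (Fil (- 1)). pairing br (gradient br F s) (P2 br s v) = 0))"
proof -
  obtain F0 where F0: "F0 \<in> local_functionals" "\<And>z. z \<in> Q_space br e f \<Longrightarrow> \<phi> z = F0 z"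
    using assms by (auto simp: local_functionals_on_def)
  obtain p where p: "represented_by F0 p" using local_functional_represented[OF F0(1)] by blast
  obtain \<Phi> where \<Phi>: "diff_poly_map \<Phi>" "\<And>q x. \<Phi> q x - e \<in> Fil 1"
    "\<And>q. (\<And>x. q x - e \<in> Fil 1) \<Longrightarrow> \<Phi> q = q" using slice_projection by blast
  have D: "diff_poly_map (\<lambda>q. slice_map (\<Phi> q))"
    by (rule diff_poly_map_compose[OF diff_poly_map_slice_map \<Phi>(1)])
  obtain p' where p': "p' \<in> densities" "\<And>c x. c \<in> loops UNIV \<Longrightarrow> p x (jet (slice_map (\<Phi> c)) x) = p' x (jet c x)"
    using density_compose[OF _ D] p by (metis represented_by_def)
  define F where "F = (\<lambda>q. integral {0..1} (\<lambda>x. p' x (jet q x)))"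
  have F: "F \<in> local_functionals" using p'(1) by (auto simp: F_def local_functionals_def)
  have Fp: "represented_by F p'" using p'(1) by (simp add: represented_by_def F_def density_functional_def)
  have eq: "F q = F0 (slice_map q)" if "q \<in> loops UNIV" "\<And>x. q x - e \<in> Fil 1" for q
    using p p'(2)[OF that(1)] diff_poly_map_loops[OF D that(1)] \<Phi>(3)[OF that(2)]
    by (simp add: F_def represented_by_def density_functional_def)
  show ?thesis
  proof (intro bexI[OF _ F] conjI ballI impI allI)
    fix z assume z: "z \<in> Q_space br e f"
    then have "z \<in> loops UNIV" "\<And>x. z x - e \<in> Fil 1" using Q_Fil FilD[of _ 0 1] by auto
    then show "F z = \<phi> z" using eq slice_map_id[OF z] F0(2)[OF z] by simp
  next
    fix s v assume "s \<in> loops UNIV" "\<forall>x. s x - e \<in> Fil 1" "v \<in> loops (Fil (- 1))"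
    then show "pairing br (gradient br F s) (P2 br s v) = 0"
      using constant_along_orbits[OF p Fp eq] by blast
  qed
qed

lemma Q_line: "z \<in> Q_space br e f \<Longrightarrow> t \<in> loops (ker_ad br f) \<Longrightarrow> (\<lambda>x. z x + a *\<^sub>R t x) \<in> Q_space br e f"
  using loops_value[of t "ker_ad br f"] loops_add[OF _ loops_scaleR[OF loops_UNIV_I[of t "ker_ad br f"]], of z a]
  by (auto simp: Q_iff ker_ad_def br_diff br_add scaleR_eq_smult)

lemma differential_on_Q:
  assumes F: "represented_by F p" "\<And>z. z \<in> Q_space br e f \<Longrightarrow> F z = \<phi> z" and z: "z \<in> Q_space br e f"
  shows "has_differential br (ker_ad br f) \<phi> z (gradient br F z)"
proof -
  have g: "has_differential br UNIV F z (gradient br F z)"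
    by (rule has_gradient[OF F(1)]) (use z Q_iff in blast)
  have "F (\<lambda>x. z x + s *\<^sub>R t x) = \<phi> (\<lambda>x. z x + s *\<^sub>R t x)" if "t \<in> loops (ker_ad br f)" for s t
    by (rule F(2)[OF Q_line[OF z that]])
  then show ?thesis using g loops_UNIV_I unfolding has_differential_def by fastforce
qed

lemma differential_pairing_eq:
  "\<lbrakk>has_differential br V \<phi> z w; has_differential br V \<phi> z w'; t \<in> loops V\<rbrakk> \<Longrightarrow> pairing br w t = pairing br w' t"
  unfolding has_differential_def using vector_derivative_unique_at by blast

end

section \<open>Evaluation of the reduced bracket by the covector lift\<close>

context slice_isotropic
begin

definition B where "B = {x. \<forall>y\<in>N. K x y = 0}"

lemma B_subspace: "vec.subspace B"
  by (auto simp: B_def vec.subspace_def killing_add)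

lemma Fil_B: "Fil 0 \<subseteq> B"
  using killing_Fil N_Fil by (auto simp: B_def)

lemma B_Fil1: "B \<subseteq> Fil 1" and R_B_M: "x \<in> B \<Longrightarrow> R x \<in> M"
  using B_Fil R_B by (auto simp: B_def)

lemma M_Fil: "M \<subseteq> Fil (- 1)"
  using M_N N_Fil by blast

text \<open>By this pair the iteration that solves the slice problem in \<open>Fil (- 1)\<close>
  stays in m when started on \<open>S\<close>, so one construction serves all isotropic
  subspaces.\<close>

lemma admissible_M: "admissible M B"
  unfolding admissible_def
proof (intro conjI ballI M_subspace B_subspace M_Fil B_Fil1)
  show "M \<subseteq> B" using M_Fil Fil_B FilD[of _ "- 1" 0] by auto
  show "br m e \<in> B" if "m \<in> M" for m
    using e_M[OF that] br_anticommute[of m e] by (simp add: B_def)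
  show "br m w \<in> B" if "m \<in> M" "w \<in> B" for m w
  proof -
    have "br m w \<in> Fil (- 1 + 1)" using that M_Fil B_Fil1 by (intro Fil_br) auto
    then show ?thesis using Fil_B by auto
  qed
qed (rule R_B_M)

lemma bracket2_on_Q:
  assumes z: "z \<in> Q_space br e f"
    and F: "represented_by F p" "\<And>z. z \<in> Q_space br e f \<Longrightarrow> F z = \<phi> z"
      "\<And>v. v \<in> loops N \<Longrightarrow> pairing br (gradient br F z) (P2 br z v) = 0"
    and G: "represented_by G p'" "\<And>z. z \<in> Q_space br e f \<Longrightarrow> G z = \<psi> z"
      "\<And>v. v \<in> loops N \<Longrightarrow> pairing br (gradient br G z) (P2 br z v) = 0"
    and w: "has_differential br (ker_ad br f) \<phi> z w" and w': "has_differential br (ker_ad br f) \<psi> z w'"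
    and v: "covector_lift br f z w' v"
  shows "bracket2 br F G z = pairing br w (P2 br z v)"
proof -
  have zL: "z \<in> loops UNIV" "\<And>x. z x - e \<in> Fil 0" using Q_Fil[OF z] by auto
  let ?F = "gradient br F z" and ?G = "gradient br G z"
  have FL: "?F \<in> loops UNIV" and GL: "?G \<in> loops UNIV" using gradient_loops F(1) G(1) zL(1) by blast+
  note PG = P2_loops[OF zL(1) GL]
  \<comment> \<open>Skew symmetry of \<open>P2\<close> converts constancy of \<open>G\<close> along
    \<open>D\<close> into orthogonality of \<open>P2 z (grad G)\<close> to n.\<close>
  have "pairing br (P2 br z ?G) n = 0" if "n \<in> loops N" for n
    using pairing_P2_skew[OF zL(1) GL loops_UNIV_I[OF that]] G(3)[OF that] by simp
  then have PB: "P2 br z ?G x \<in> B" for x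
    using pairing_zero_imp[OF N_subspace PG] by (auto simp: B_def)
  define y where "y = (\<lambda>x. - R (P2 br z ?G x))"
  have "y \<in> loops UNIV" unfolding y_def by (intro loops_minus loops_clin[OF R_linear] PG)
  then have y: "y \<in> loops M"
    by (rule loops_valueI) (auto simp: y_def intro!: vec.subspace_neg[OF M_subspace] R_B_M PB)
  \<comment> \<open>On \<open>Q\<close>, both \<open>u'\<close> and \<open>[z - e, u]\<close> lie in
    \<open>Fil 0\<close>, hence in b, and \<open>R\<close> maps b into m.\<close>
  have pM: "perturbation z u \<in> loops M" if u: "u \<in> loops M" for u
  proof (rule loops_valueI[OF perturbation_loops[OF zL(1) loops_UNIV_I[OF u]]])
    fix x
    have uF: "u \<in> loops (Fil (- 1))" by (rule loops_mono[OF M_Fil u])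
    have "vderiv u x \<in> Fil 0" using vderiv_Fil[OF uF] by (rule FilD) simp
    moreover have "br (z x - e) (u x) \<in> Fil 0"
      using Fil_br[OF zL(2) loops_value[OF uF]] by (rule FilD) simp
    ultimately have "vderiv u x + br (z x - e) (u x) \<in> B" using Fil_B vec.subspace_add[OF Fil_subspace] by blast
    then show "perturbation z u x \<in> M" unfolding perturbation_def by (rule R_B_M)
  qed
  define n where "n = resolvent z y"
  have n: "n \<in> loops M" unfolding n_def by (rule resolvent_in[OF M_subspace zL(1) y pM])
  note nL = loops_UNIV_I[OF n]
  have R0: "R (P2 br z (\<lambda>x. ?G x + n x) x) = 0" for x
  proof -
    have "n x \<in> range (br f)" using Fil_range M_Fil loops_value[OF n] by blast
    then have "R (P2 br z (\<lambda>x. ?G x + n x) x) = R (P2 br z ?G x) + (n x + perturbation z n x)"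
      unfolding P2_add[OF GL nL] by (simp add: clin_add[OF R_linear] R_P2)
    then show ?thesis
      unfolding n_def resolvent_solves[OF zL loops_UNIV_I[OF y]] by (simp add: y_def)
  qed
  \<comment> \<open>Adding \<open>n\<close> does not change the covector on \<open>Q\<close>:
    \<open>Fil (- 1)\<close> is orthogonal to \<open>Fil 0\<close>, which contains
    \<open>ker (ad f)\<close>.\<close>
  have vn: "pairing br n t = 0" if "t \<in> loops (ker_ad br f)" for t
  proof -
    have "K (n x) (t x) = 0" for x
    proof -
      have "n x \<in> Fil (- 1)" using loops_value[OF n, of x] M_Fil by blast
      moreover have "t x \<in> Fil 0" using loops_value[OF that, of x] by (simp add: ker_ad_def kernel_Fil)
      ultimately show ?thesis using killing_Fil by (simp add: killing_sym[of "n x"])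
    qed
    then show ?thesis by (simp add: pairing_def)
  qed
  have "covector_lift br f z w' (\<lambda>x. ?G x + n x)"
    unfolding covector_lift_def
  proof (intro conjI ballI)
    show "(\<lambda>x. ?G x + n x) \<in> loops UNIV" by (rule loops_add[OF GL nL])
    show "P2 br z (\<lambda>x. ?G x + n x) \<in> loops (ker_ad br f)"
      by (rule loops_valueI[OF P2_loops[OF zL(1) loops_add[OF GL nL]]]) (use R0 R_eq_0_iff in \<open>auto simp: ker_ad_def\<close>)
    fix t assume t: "t \<in> loops (ker_ad br f)"
    have "pairing br (\<lambda>x. ?G x + n x) t = pairing br ?G t + pairing br n t"
      using pairing_add[OF loops_UNIV_I[OF t] GL nL] by (simp add: pairing_sym)
    then show "pairing br (\<lambda>x. ?G x + n x) t = pairing br w' t"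
      using vn[OF t] differential_pairing_eq[OF differential_on_Q[OF G(1,2) z] w' t] by simp
  qed
  moreover have "w' \<in> loops UNIV" using w' by (simp add: has_differential_def)
  ultimately have v_eq: "v = (\<lambda>x. ?G x + n x)" using covector_lift_exists_unique[OF z] v by blast
  \<comment> \<open>The contribution of \<open>n\<close> vanishes since
    \<open>m \<subseteq> n\<close> and \<open>F\<close> is constant along \<open>D\<close>. As
    \<open>P2 z v\<close> is tangent to \<open>Q\<close>, the gradient of \<open>F\<close> may then
    be replaced by any covector \<open>w\<close> representing the differential of
    \<open>\<phi>\<close>.\<close>
  have "pairing br ?F (P2 br z v) = pairing br ?F (P2 br z ?G) + pairing br ?F (P2 br z n)"
    unfolding v_eq P2_add[OF GL nL] by (rule pairing_add[OF FL PG P2_loops[OF zL(1) nL]])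
  then have "bracket2 br F G z = pairing br ?F (P2 br z v)"
    using F(3)[OF loops_mono[OF M_N n]] by (simp add: bracket2_def)
  also have "\<dots> = pairing br w (P2 br z v)"
    using v by (intro differential_pairing_eq[OF differential_on_Q[OF F(1,2) z] w]) (auto simp: covector_lift_def)
  finally show ?thesis .
qed

end

context isotropic_data
begin

lemma b_space_eq: "b_space br e \<Gamma> l = B"
  by (simp add: b_space_def B_def)

lemma S_iff: "s \<in> S_space br e \<Gamma> l \<longleftrightarrow> s \<in> loops UNIV \<and> (\<forall>x. s x - e \<in> B)"
  unfolding S_space_def b_space_eq by (rule affine_loops_iff[OF B_subspace])

lemma Q_S: "z \<in> Q_space br e f \<Longrightarrow> z \<in> S_space br e \<Gamma> l"
  using Q_Fil[of z] Fil_B by (auto simp: S_iff)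

lemma S_Fil: "s \<in> S_space br e \<Gamma> l \<Longrightarrow> s \<in> loops UNIV \<and> (\<forall>x. s x - e \<in> Fil 1)"
  using B_Fil1 by (auto simp: S_iff)

lemma extension_exists:
  assumes "\<phi> \<in> local_functionals_on (Q_space br e f)"
  shows "\<exists>F. reduction_extension br e f \<Gamma> l \<phi> F"
proof -
  obtain F where F: "F \<in> local_functionals" "\<forall>z\<in>Q_space br e f. F z = \<phi> z"
    "\<forall>s\<in>loops UNIV. (\<forall>x. s x - e \<in> Fil 1) \<longrightarrow>
      (\<forall>v\<in>loops (Fil (- 1)). pairing br (gradient br F s) (P2 br s v) = 0)"
    using invariant_extension_exists[OF assms] by blast
  have "constant_along_D br e \<Gamma> l F"
    unfolding constant_along_D_def
  proof (intro ballI)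
    fix s v assume s: "s \<in> S_space br e \<Gamma> l" and v: "v \<in> loops (n_space br e \<Gamma> l)"
    show "pairing br (gradient br F s) (P2 br s v) = 0"
      using F(3) S_Fil[OF s] loops_mono[OF N_Fil v] by blast
  qed
  then show ?thesis using F(1,2) unfolding reduction_extension_def by blast
qed

lemma bracket2_extensions:
  assumes "reduction_extension br e f \<Gamma> l \<phi> F" "reduction_extension br e f \<Gamma> l \<psi> G" "z \<in> Q_space br e f"
    "has_differential br (ker_ad br f) \<phi> z w" "has_differential br (ker_ad br f) \<psi> z w'"
    "covector_lift br f z w' v"
  shows "bracket2 br F G z = pairing br w (P2 br z v)"
proof -
  obtain p p' where "represented_by F p" "represented_by G p'"
    using assms(1,2) local_functional_represented unfolding reduction_extension_def by blast
  then show ?thesis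
    using assms Q_S[OF assms(3)] by (intro bracket2_on_Q) (auto simp: reduction_extension_def constant_along_D_def)
qed

lemma differential_exists:
  assumes "\<phi> \<in> local_functionals_on (Q_space br e f)" "z \<in> Q_space br e f"
  shows "\<exists>w. has_differential br (ker_ad br f) \<phi> z w"
proof -
  obtain F where "F \<in> local_functionals" "\<And>z. z \<in> Q_space br e f \<Longrightarrow> F z = \<phi> z"
    using assms(1) by (auto simp: local_functionals_on_def)
  then show ?thesis using local_functional_represented differential_on_Q[OF _ _ assms(2)] by blast
qed

text \<open>The value on the right involves neither \<open>\<Gamma>\<close> nor \<open>l\<close>;
  the independence theorem is read off from this equation.\<close>

lemma reduced_bracket_eq:
  assumes "\<phi> \<in> local_functionals_on (Q_space br e f)" "\<psi> \<in> local_functionals_on (Q_space br e f)"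
    "z \<in> Q_space br e f" "has_differential br (ker_ad br f) \<phi> z w"
    "has_differential br (ker_ad br f) \<psi> z w'" "covector_lift br f z w' v"
  shows "reduced_bracket br e f \<Gamma> l \<phi> \<psi> z = pairing br w (P2 br z v)"
  unfolding reduced_bracket_def
proof (rule the_equality)
  obtain F G where FG: "reduction_extension br e f \<Gamma> l \<phi> F" "reduction_extension br e f \<Gamma> l \<psi> G"
    using extension_exists assms(1,2) by blast
  note eq = bracket2_extensions[OF FG assms(3-), symmetric]
  show "\<exists>F G. reduction_extension br e f \<Gamma> l \<phi> F \<and> reduction_extension br e f \<Gamma> l \<psi> G \<and>
      pairing br w (P2 br z v) = bracket2 br F G z"
    by (rule exI[of _ F], rule exI[of _ G]) (intro conjI FG eq)
qed (use bracket2_extensions[OF _ _ assms(3-)] in auto)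

lemma reduced_bracket_extensions:
  assumes "\<phi> \<in> local_functionals_on (Q_space br e f)" "\<psi> \<in> local_functionals_on (Q_space br e f)"
    "z \<in> Q_space br e f" "reduction_extension br e f \<Gamma> l \<phi> F" "reduction_extension br e f \<Gamma> l \<psi> G"
  shows "reduced_bracket br e f \<Gamma> l \<phi> \<psi> z = bracket2 br F G z"
proof -
  obtain w w' where w: "has_differential br (ker_ad br f) \<phi> z w" "has_differential br (ker_ad br f) \<psi> z w'"
    using differential_exists assms(1-3) by blast
  then have "w' \<in> loops UNIV" by (simp add: has_differential_def)
  then obtain v where v: "covector_lift br f z w' v" using covector_lift_exists_unique[OF assms(3)] by blast
  show ?thesis
    using reduced_bracket_eq[OF assms(1-3) w v] bracket2_extensions[OF assms(4,5,3) w v] by simp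
qed

lemma reduction_well_defined: "reduction_well_defined br e f \<Gamma> l"
  unfolding reduction_well_defined_def using extension_exists reduced_bracket_extensions by blast

end

section \<open>Drinfeld-Sokolov method\<close>

lemma deriv_x_funpow: "(deriv_x ^^ a) T \<alpha> \<beta> = (- 1) ^ a * T (nderiv a \<alpha>) \<beta>"
  by (induction a arbitrary: \<alpha>) (simp_all add: deriv_x_def nderiv_add_index)

lemma deriv_y_funpow: "(deriv_y ^^ b) T \<alpha> \<beta> = (- 1) ^ b * T \<alpha> (nderiv b \<beta>)"
  by (induction b arbitrary: \<beta>) (simp_all add: deriv_y_def nderiv_add_index)

lemma has_partials_smear:
  assumes \<alpha>: "\<alpha> \<in> test_functions" and P: "has_partials p N P"
  shows "has_partials (\<lambda>x j. \<alpha> x * p x j) N (\<lambda>a i x j. \<alpha> x * P a i x j)"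
proof -
  have s: "(\<Sum>a<N. \<Sum>i\<in>UNIV. \<alpha> x * P a i x j * J' a i) = \<alpha> x * (\<Sum>a<N. \<Sum>i\<in>UNIV. P a i x j * J' a i)" for x j J'
    by (simp add: sum_distrib_left mult.assoc)
  show ?thesis
    unfolding has_partials_def s
    using P by (auto simp: has_partials_def intro!: densities.mult densities.coeff[OF \<alpha>] DERIV_cmult
        has_vector_derivative_mult_right)
qed

lemma has_partials_complex:
  fixes J :: "complex \<Rightarrow> nat \<Rightarrow> 'n::finite vec"
  shows "\<lbrakk>has_partials p N P; \<And>a i. ((\<lambda>s. J s a $ i) has_field_derivative J' a i) (at t)\<rbrakk> \<Longrightarrow>
    ((\<lambda>s. p x (J s)) has_field_derivative (\<Sum>a<N. \<Sum>i\<in>UNIV. P a i x (J t) * J' a i)) (at t)"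
  by (simp add: has_partials_def)

text \<open>Varying a single complex jet coordinate makes the chain rule pick out one partial. The
  order bound for \<open>jet_orders\<close> follows from this.\<close>

lemma jet_partial_eq:
  assumes "has_partials (\<lambda>_. u) N P" shows "jet_partial a i u j = P a i x j"
proof -
  let ?J = "\<lambda>s. j(a := (\<chi> k. if k = i then s else j a $ k))"
  have "((\<lambda>s. ?J s a' $ i') has_field_derivative (if a' = a \<and> i' = i then 1 else 0)) (at t)" for a' i' t
    by (cases "a' = a"; cases "i' = i") auto
  then have "((\<lambda>s. u (?J s)) has_field_derivative
      (\<Sum>a'<N. \<Sum>i'\<in>UNIV. P a' i' x (?J (j a $ i)) * (if a' = a \<and> i' = i then 1 else 0))) (at (j a $ i))"
    by (rule has_partials_complex[OF assms])
  moreover have "?J (j a $ i) = j" by (auto simp: fun_eq_iff vec_eq_iff)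
  moreover have "(\<Sum>a'<N. \<Sum>i'\<in>UNIV. P a' i' x j * (if a' = a \<and> i' = i then 1 else 0)) = P a i x j"
  proof -
    have "(\<Sum>i'\<in>UNIV. P a' i' x j * (if a' = a \<and> i' = i then 1 else 0)) = (if a' = a then P a i x j else 0)" for a'
      by (simp add: if_distrib cong: if_cong)
    moreover have "P a i x j = 0" if "\<not> a < N" using assms that by (simp add: has_partials_def)
    ultimately show ?thesis by simp
  qed
  ultimately have "((\<lambda>s. u (?J s)) has_field_derivative P a i x j) (at (j a $ i))" by simp
  then show ?thesis unfolding jet_partial_def by (rule DERIV_imp_deriv)
qed

lemma jet_orders_bound:
  assumes "has_partials (\<lambda>_. u) N P" shows "jet_orders u \<subseteq> {..<N}"
proof
  fix a assume "a \<in> jet_orders u"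
  then obtain i j where "jet_partial a i u j \<noteq> 0" by (auto simp: jet_orders_def)
  then have "P a i 0 j \<noteq> 0" by (simp add: jet_partial_eq[OF assms, where x = 0])
  then show "a \<in> {..<N}" using assms by (cases "a < N") (auto simp: has_partials_def)
qed

lemma (in lie) pairing_sum:
  assumes "\<And>i. i \<in> I \<Longrightarrow> v i \<in> loops UNIV" "u \<in> loops UNIV"
  shows "pairing br u (\<lambda>x. \<Sum>i\<in>I. v i x) = (\<Sum>i\<in>I. pairing br u (v i))"
  using assms(1)
proof (induction I rule: infinite_finite_induct)
  case (insert i I)
  then show ?case using pairing_add[OF assms(2), of "v i" "\<lambda>x. \<Sum>i\<in>I. v i x"] by (simp add: loops_sum)
qed (simp_all add: pairing_def)

lemma (in lie) P2_sum:
  assumes "\<And>i. i \<in> I \<Longrightarrow> v i \<in> loops UNIV"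
  shows "P2 br q (\<lambda>x. \<Sum>i\<in>I. v i x) = (\<lambda>x. \<Sum>i\<in>I. P2 br q (v i) x)"
  using assms
proof (induction I rule: infinite_finite_induct)
  case (insert i I)
  then show ?case using P2_add[of "v i" "\<lambda>x. \<Sum>i\<in>I. v i x" q] by (simp add: loops_sum)
qed (simp_all add: P2_def)

locale adapted_slice = slice +
  fixes \<xi> \<eta> Iq
  assumes adapted: "adapted_basis br f \<xi> \<eta> Iq"
begin

lemma basis: "inj \<xi>" "vec.span (range \<xi>) = UNIV" "vec.span (\<xi> ` Iq) = ker_ad br f"
  "K (\<xi> i) (\<eta> j) = (if i = j then 1 else 0)"
  using adapted by (auto simp: adapted_basis_def)

lemma expand: "(\<Sum>i\<in>UNIV. K x (\<eta> i) *s \<xi> i) = x"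
proof -
  have "x \<in> vec.span (range \<xi>)" by (simp add: basis)
  then show ?thesis
  proof (induction rule: vec.span_induct_alt)
    case (step c y z)
    then obtain j where "y = \<xi> j" by blast
    have "(\<Sum>i\<in>UNIV. K (c *s \<xi> j + z) (\<eta> i) *s \<xi> i) =
        (\<Sum>i\<in>UNIV. (if i = j then c *s \<xi> j else 0)) + (\<Sum>i\<in>UNIV. K z (\<eta> i) *s \<xi> i)"
      unfolding sum.distrib[symmetric]
      by (intro sum.cong refl) (auto simp: killing_add basis vec.scale_left_distrib)
    then show ?case using step.IH \<open>y = \<xi> j\<close> by simp
  qed simp
qed

lemma killing_eqI: "(\<And>i. K (\<xi> i) x = K (\<xi> i) y) \<Longrightarrow> x = y"
proof -
  assume *: "\<And>i. K (\<xi> i) x = K (\<xi> i) y"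
  have "K z x = K z y" for z
    using * by (subst (1 2) expand[of z, symmetric]) (simp add: killing_sum)
  then have "K (x - y) z = 0" for z by (simp add: killing_diff killing_sym[of _ z])
  then show "x = y" using killing_nondegenerate by (metis eq_iff_diff_eq_0)
qed

lemma expand_dual: "(\<Sum>i\<in>UNIV. K (\<xi> i) x *s \<eta> i) = x"
proof (rule killing_eqI)
  fix j
  have "K (\<xi> j) (\<Sum>i\<in>UNIV. K (\<xi> i) x *s \<eta> i) = (\<Sum>i\<in>UNIV. if i = j then K (\<xi> j) x else 0)"
    unfolding killing_sum by (intro sum.cong refl) (auto simp: basis)
  then show "K (\<xi> j) (\<Sum>i\<in>UNIV. K (\<xi> i) x *s \<eta> i) = K (\<xi> j) x" by simp
qed

lemma span_subset_iff: "x \<in> vec.span (\<xi> ` I) \<longleftrightarrow> (\<forall>i. i \<notin> I \<longrightarrow> K x (\<eta> i) = 0)"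
proof
  assume "x \<in> vec.span (\<xi> ` I)"
  then show "\<forall>i. i \<notin> I \<longrightarrow> K x (\<eta> i) = 0"
    by (induction rule: vec.span_induct_alt) (auto simp: killing_add basis split: if_splits)
next
  assume *: "\<forall>i. i \<notin> I \<longrightarrow> K x (\<eta> i) = 0"
  have "(\<Sum>i\<in>UNIV. K x (\<eta> i) *s \<xi> i) \<in> vec.span (\<xi> ` I)"
  proof (rule vec.span_sum)
    fix i show "K x (\<eta> i) *s \<xi> i \<in> vec.span (\<xi> ` I)"
      using * by (cases "i \<in> I") (auto simp: vec.span_zero intro: vec.span_scale vec.span_base)
  qed
  then show "x \<in> vec.span (\<xi> ` I)" by (simp only: expand)
qed

lemma kernel_iff: "br f x = 0 \<longleftrightarrow> (\<forall>i. i \<notin> Iq \<longrightarrow> K x (\<eta> i) = 0)"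
  using span_subset_iff[of x Iq] by (simp add: basis ker_ad_def)

definition coordinate_vector :: "complex ^ 'a \<Rightarrow> complex ^ 'a" where
  "coordinate_vector y = (\<chi> i. K y (\<eta> i))"

lemma coordinate_vector_linear: "clin coordinate_vector"
  by (rule clinI) (auto simp: coordinate_vector_def vec_eq_iff killing_add)

abbreviation "co \<equiv> coords br e \<eta>"

lemma coords_eq: "co z = (\<lambda>x. coordinate_vector (z x - e))"
  by (simp add: coords_def coordinate_vector_def)

lemma coords_loops: "z \<in> loops UNIV \<Longrightarrow> co z \<in> loops UNIV"
  unfolding coords_eq by (intro loops_clin[OF coordinate_vector_linear] loops_diff loops_const)

lemma diff_poly_map_coords: "diff_poly_map co"
  unfolding coords_eq
  by (rule diff_poly_map_clin[OF coordinate_vector_linear diff_poly_map_minus[OF diff_poly_map_id diff_poly_map_const]])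

definition decode :: "'a loop \<Rightarrow> 'a loop" where
  "decode c = (\<lambda>x. e + (\<Sum>i\<in>UNIV. c x $ i *s \<xi> i))"

lemma diff_poly_map_decode: "diff_poly_map decode"
proof -
  have "clin (\<lambda>y. \<Sum>i\<in>UNIV. y $ i *s \<xi> i)"
    by (rule clinI) (simp_all add: vec.scale_left_distrib sum.distrib vec.scale_sum_right)
  then show ?thesis unfolding decode_def[abs_def]
    by (rule diff_poly_map_add[OF diff_poly_map_const diff_poly_map_clin[OF _ diff_poly_map_id]])
qed

lemma decode_coords: "decode (co z) = z"
  by (simp add: decode_def coords_def expand)

lemma smeared_represented:
  assumes "u \<in> diff_poly" "\<alpha> \<in> test_functions" shows "\<exists>p. represented_by (smeared br e \<eta> u \<alpha>) p"
proof -
  have "(\<lambda>x j. \<alpha> x * u j) \<in> densities"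
    by (rule densities.mult[OF densities.coeff[OF assms(2)] diff_poly_density[OF assms(1)]])
  from density_compose[OF this diff_poly_map_coords] obtain p where "p \<in> densities"
    "\<forall>c\<in>loops UNIV. \<forall>x. \<alpha> x * u (jet (co c) x) = p x (jet c x)" by blast
  then show ?thesis
    by (intro exI[of _ p]) (simp add: represented_by_def smeared_def density_functional_def)
qed

lemma gradient_smeared:
  assumes u: "has_partials (\<lambda>_. u) N P" "u \<in> diff_poly" and \<alpha>: "\<alpha> \<in> test_functions" and z: "z \<in> loops UNIV"
  shows "gradient br (smeared br e \<eta> u \<alpha>) z =
    (\<lambda>x. \<Sum>i\<in>UNIV. variation N (\<lambda>a i x j. \<alpha> x * P a i x j) (co z) i x *s \<eta> i)"
proof (rule gradient_eqI)
  let ?P = "\<lambda>a i x j. \<alpha> x * P a i x j"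
  note P = has_partials_smear[OF \<alpha> u(1)]
  note c = coords_loops[OF z]
  show "has_differential br UNIV (smeared br e \<eta> u \<alpha>) z (\<lambda>x. \<Sum>i\<in>UNIV. variation N ?P (co z) i x *s \<eta> i)"
    unfolding has_differential_def
  proof (intro conjI ballI)
    show "(\<lambda>x. \<Sum>i\<in>UNIV. variation N ?P (co z) i x *s \<eta> i) \<in> loops UNIV"
      by (intro loops_sum loops_smult loops_const variation_loop[OF P c])
    fix w :: "'a loop" assume w: "w \<in> loops UNIV"
    let ?w = "\<lambda>x. coordinate_vector (w x)"
    have "co (\<lambda>x. z x + t *\<^sub>R w x) = (\<lambda>x. co z x + t *\<^sub>R ?w x)" for t
      unfolding coords_eq
      by (simp add: clin_add[OF coordinate_vector_linear] clin_diff[OF coordinate_vector_linear]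
          clin_scaleR[OF coordinate_vector_linear] algebra_simps)
    then have "smeared br e \<eta> u \<alpha> (\<lambda>x. z x + t *\<^sub>R w x) =
        density_functional (\<lambda>x j. \<alpha> x * u j) (\<lambda>x. co z x + t *\<^sub>R ?w x)" for t
      by (simp add: smeared_def density_functional_def)
    moreover have "(\<lambda>x j. \<alpha> x * u j) \<in> densities"
      by (rule densities.mult[OF densities.coeff[OF \<alpha>] diff_poly_density[OF u(2)]])
    moreover have "pairing br (\<lambda>x. \<Sum>i\<in>UNIV. variation N ?P (co z) i x *s \<eta> i) w =
        integral {0..1} (\<lambda>x. \<Sum>i\<in>UNIV. variation N ?P (co z) i x * ?w x $ i)"
      by (simp add: pairing_def killing_sum coordinate_vector_def killing_sym[of "\<eta> _"])
    ultimately show "((\<lambda>t. smeared br e \<eta> u \<alpha> (\<lambda>x. z x + t *\<^sub>R w x)) has_vector_derivative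
        pairing br (\<lambda>x. \<Sum>i\<in>UNIV. variation N ?P (co z) i x *s \<eta> i) w) (at 0)"
      using variation_derivative[OF _ P c loops_clin[OF coordinate_vector_linear w]] by simp
  qed
qed

lemma gradient_coordinate:
  assumes \<alpha>: "\<alpha> \<in> test_functions" and z: "z \<in> loops UNIV"
  shows "gradient br (smeared br e \<eta> (coordinate i) \<alpha>) z = (\<lambda>x. \<alpha> x *s \<eta> i)"
proof (rule gradient_eqI)
  have L: "(\<lambda>x. \<alpha> x *s \<eta> i) \<in> loops UNIV" by (rule loops_smult[OF \<alpha> loops_const])
  show "has_differential br UNIV (smeared br e \<eta> (coordinate i) \<alpha>) z (\<lambda>x. \<alpha> x *s \<eta> i)"
    unfolding has_differential_def
  proof (intro conjI ballI L)
    fix w :: "'a loop" assume w: "w \<in> loops UNIV"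
    let ?I = "\<lambda>w. integral {0..1} (\<lambda>x. \<alpha> x * K (w x) (\<eta> i))"
    have lK: "(\<lambda>x. \<alpha> x * K (u x) (\<eta> i)) \<in> loops UNIV" if "u \<in> loops UNIV" for u
      by (rule loops_mult[OF \<alpha> loops_killing[OF that loops_const]])
    have "smeared br e \<eta> (coordinate i) \<alpha> (\<lambda>x. z x + t *\<^sub>R w x) = ?I (\<lambda>x. z x - e) + t *\<^sub>R ?I w" for t
    proof -
      have "smeared br e \<eta> (coordinate i) \<alpha> (\<lambda>x. z x + t *\<^sub>R w x) =
          integral {0..1} (\<lambda>x. \<alpha> x * K (z x - e) (\<eta> i) + t *\<^sub>R (\<alpha> x * K (w x) (\<eta> i)))"
        by (simp add: smeared_def coordinate_def jet_def coords_def killing_add killing_diff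
            scaleR_eq_smult scaleR_conv_of_real algebra_simps)
      also have "\<dots> = ?I (\<lambda>x. z x - e) + integral {0..1} (\<lambda>x. t *\<^sub>R (\<alpha> x * K (w x) (\<eta> i)))"
        by (intro integral_add loop_integrable[where V = UNIV] lK loops_scaleR loops_diff z w loops_const)
      finally show ?thesis by (simp only: integral_cmul)
    qed
    moreover have "pairing br (\<lambda>x. \<alpha> x *s \<eta> i) w = ?I w"
      by (simp add: pairing_def killing_sym[of "\<eta> i"])
    ultimately show "((\<lambda>t. smeared br e \<eta> (coordinate i) \<alpha> (\<lambda>x. z x + t *\<^sub>R w x)) has_vector_derivative
        pairing br (\<lambda>x. \<alpha> x *s \<eta> i) w) (at 0)"
      by (auto intro!: derivative_eq_intros)
  qed
qed

lemma density_bracket2_coordinates: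
  assumes "\<alpha> \<in> test_functions" "\<beta> \<in> test_functions" "z \<in> loops UNIV"
  shows "density_bracket br e \<eta> (bracket2 br) z (coordinate i) (coordinate j) \<alpha> \<beta> =
    pairing br (\<lambda>x. \<alpha> x *s \<eta> i) (P2 br z (\<lambda>x. \<beta> x *s \<eta> j))"
  by (simp add: density_bracket_def bracket2_def gradient_coordinate[OF assms(1,3)] gradient_coordinate[OF assms(2,3)])

text \<open>Rewrites the Euler-Lagrange sum over the orders that actually occur, which is the index
  set in \<open>leibniz_bracket\<close>; in the other orders all partials vanish
  identically.\<close>

lemma gradient_smeared_orders:
  assumes u: "u \<in> diff_poly" and \<alpha>: "\<alpha> \<in> test_functions" and z: "z \<in> loops UNIV"
  defines "A \<equiv> (\<lambda>a i x. ((- 1) ^ a * nderiv a (\<lambda>x. jet_partial a i u (jet (co z) x) * \<alpha> x) x) *s \<eta> i)"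
  shows "finite (jet_orders u)"
    and "(\<lambda>x. jet_partial a i u (jet (co z) x) * \<alpha> x) \<in> test_functions"
    and "gradient br (smeared br e \<eta> u \<alpha>) z = (\<lambda>x. \<Sum>a\<in>jet_orders u. \<Sum>i\<in>UNIV. A a i x)"
proof -
  obtain N P where P: "has_partials (\<lambda>_. u) N P" using has_partials_exists[OF diff_poly_density[OF u]] by blast
  have jp: "jet_partial a i u (jet (co z) x) * \<alpha> x = \<alpha> x * P a i x (jet (co z) x)" for a i x
    using jet_partial_eq[OF P, of a i "jet (co z) x" x] by simp
  have Pd: "P a i \<in> densities" for a i using P by (simp add: has_partials_def)
  show test: "(\<lambda>x. jet_partial a i u (jet (co z) x) * \<alpha> x) \<in> test_functions" for a i
    unfolding jp by (rule loops_mult[OF \<alpha> density_loop[OF Pd coords_loops[OF z]]])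
  show "finite (jet_orders u)" using jet_orders_bound[OF P] finite_subset by blast
  have "gradient br (smeared br e \<eta> u \<alpha>) z = (\<lambda>x. \<Sum>i\<in>UNIV. \<Sum>a<N. A a i x)"
    unfolding gradient_smeared[OF P u \<alpha> z] variation_def A_def jp by (simp add: vec.scale_sum_left)
  also have "\<dots> = (\<lambda>x. \<Sum>a<N. \<Sum>i\<in>UNIV. A a i x)" by (rule ext, rule sum.swap)
  also have "\<dots> = (\<lambda>x. \<Sum>a\<in>jet_orders u. \<Sum>i\<in>UNIV. A a i x)"
  proof (intro ext sum.mono_neutral_right)
    fix x
    show "\<forall>a\<in>{..<N} - jet_orders u. (\<Sum>i\<in>UNIV. A a i x) = 0"
    proof
      fix a assume "a \<in> {..<N} - jet_orders u"
      then have "jet_partial a i u j = 0" for i j by (auto simp: jet_orders_def)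
      then show "(\<Sum>i\<in>UNIV. A a i x) = 0" by (simp add: A_def nderiv_const)
    qed
  qed (use jet_orders_bound[OF P] in auto)
  finally show "gradient br (smeared br e \<eta> u \<alpha>) z = (\<lambda>x. \<Sum>a\<in>jet_orders u. \<Sum>i\<in>UNIV. A a i x)" .
qed

text \<open>Both gradients are expanded in the vectors \<open>\<eta> i\<close>. Multiplication and
  differentiation of the distribution act by duality on the test functions and reproduce exactly the
  Euler-Lagrange coefficients of these expansions.\<close>

lemma leibniz_bracket_eq:
  assumes u: "u \<in> diff_poly" and v: "v \<in> diff_poly" and \<alpha>: "\<alpha> \<in> test_functions" and \<beta>: "\<beta> \<in> test_functions"
    and z: "z \<in> loops UNIV"
  shows "leibniz_bracket br e \<eta> z u v \<alpha> \<beta> = bracket2 br (smeared br e \<eta> u \<alpha>) (smeared br e \<eta> v \<beta>) z"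
proof -
  note gu = gradient_smeared_orders[OF u \<alpha> z] and gv = gradient_smeared_orders[OF v \<beta> z]
  define A where "A = (\<lambda>a i x. ((- 1) ^ a * nderiv a (\<lambda>x. jet_partial a i u (jet (co z) x) * \<alpha> x) x) *s \<eta> i)"
  define B where "B = (\<lambda>a i x. ((- 1) ^ a * nderiv a (\<lambda>x. jet_partial a i v (jet (co z) x) * \<beta> x) x) *s \<eta> i)"
  have AL: "A a i \<in> loops UNIV" and BL: "B a i \<in> loops UNIV" for a i
    unfolding A_def B_def
    by (intro loops_smult loops_mult loops_const loops_nderiv gu(2) gv(2))+
  \<comment> \<open>Homogeneity is what allows the signs \<open>(- 1) ^ a\<close> and
    \<open>(- 1) ^ b\<close> to be pulled out.\<close>
  have T: "density_bracket br e \<eta> (bracket2 br) z (coordinate i) (coordinate j)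
      (\<lambda>x. c * \<alpha>' x) (\<lambda>x. d * \<beta>' x) = c * d * density_bracket br e \<eta> (bracket2 br) z (coordinate i) (coordinate j) \<alpha>' \<beta>'"
    if "\<alpha>' \<in> test_functions" "\<beta>' \<in> test_functions" for c d \<alpha>' \<beta>' i j
  proof -
    have L: "(\<lambda>x. c * \<alpha>' x) \<in> test_functions" "(\<lambda>x. d * \<beta>' x) \<in> test_functions"
      using that by (auto intro: loops_mult loops_const)
    have vd: "vderiv (\<lambda>x. (d * \<beta>' x) *s \<eta> j) x = d *s vderiv (\<lambda>x. \<beta>' x *s \<eta> j) x" for x
      using fun_cong[OF vderiv_clin[OF clin_smult[OF clin_id] loops_smult[OF that(2) loops_const]], of d "\<eta> j" x] by simp
    have "P2 br z (\<lambda>x. (d * \<beta>' x) *s \<eta> j) = (\<lambda>x. d *s P2 br z (\<lambda>x. \<beta>' x *s \<eta> j) x)"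
      unfolding P2_def vd by (simp add: vec.scale_right_distrib)
    then show ?thesis
      unfolding density_bracket2_coordinates[OF L z] density_bracket2_coordinates[OF that z]
      by (simp add: pairing_def mult.assoc mult.left_commute)
  qed
  have "mult_x (\<lambda>x. jet_partial a i u (jet (co z) x))
          ((deriv_x ^^ a) (mult_y (\<lambda>y. jet_partial b j v (jet (co z) y))
              ((deriv_y ^^ b) (density_bracket br e \<eta> (bracket2 br) z (coordinate i) (coordinate j))))) \<alpha> \<beta>
      = pairing br (A a i) (P2 br z (B b j))" for a i b j
  proof -
    let ?\<alpha> = "nderiv a (\<lambda>x. jet_partial a i u (jet (co z) x) * \<alpha> x)"
    let ?\<beta> = "nderiv b (\<lambda>x. jet_partial b j v (jet (co z) x) * \<beta> x)"
    have t: "?\<alpha> \<in> test_functions" "?\<beta> \<in> test_functions" by (rule loops_nderiv, rule gu(2) gv(2))+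
    have L: "(\<lambda>x. (- 1) ^ a * ?\<alpha> x) \<in> test_functions" "(\<lambda>x. (- 1) ^ b * ?\<beta> x) \<in> test_functions"
      using t by (auto intro: loops_mult loops_const)
    have "pairing br (A a i) (P2 br z (B b j)) = density_bracket br e \<eta> (bracket2 br) z (coordinate i) (coordinate j)
        (\<lambda>x. (- 1) ^ a * ?\<alpha> x) (\<lambda>x. (- 1) ^ b * ?\<beta> x)"
      unfolding A_def B_def by (rule density_bracket2_coordinates[OF L z, symmetric])
    also have "\<dots> = (- 1) ^ a * (- 1) ^ b * density_bracket br e \<eta> (bracket2 br) z (coordinate i) (coordinate j) ?\<alpha> ?\<beta>"
      by (rule T[OF t])
    finally show ?thesis by (simp add: mult_x_def mult_y_def deriv_x_funpow deriv_y_funpow)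
  qed
  then have "leibniz_bracket br e \<eta> z u v \<alpha> \<beta> =
      (\<Sum>a\<in>jet_orders u. \<Sum>i\<in>UNIV. \<Sum>b\<in>jet_orders v. \<Sum>j\<in>UNIV. pairing br (A a i) (P2 br z (B b j)))"
    unfolding leibniz_bracket_def by simp
  also have "\<dots> = (\<Sum>a\<in>jet_orders u. \<Sum>i\<in>UNIV.
      pairing br (A a i) (P2 br z (\<lambda>x. \<Sum>b\<in>jet_orders v. \<Sum>j\<in>UNIV. B b j x)))"
    by (simp add: P2_sum pairing_sum loops_sum AL BL P2_loops[OF z])
  also have "\<dots> = pairing br (\<lambda>x. \<Sum>a\<in>jet_orders u. \<Sum>i\<in>UNIV. A a i x) (P2 br z (\<lambda>x. \<Sum>b\<in>jet_orders v. \<Sum>j\<in>UNIV. B b j x))"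
    by (simp add: pairing_sym[of _ "P2 br z _"] pairing_sum loops_sum AL BL P2_loops[OF z])
  finally show ?thesis using gu(3) gv(3) by (simp add: bracket2_def A_def B_def)
qed

end

lemma diff_poly_mask:
  "p \<in> diff_poly \<Longrightarrow> (\<lambda>j. p (\<lambda>k. \<chi> i. if i \<in> I then j k $ i else 0)) \<in> diff_poly"
proof (induction rule: diff_poly.induct)
  case (coord k i)
  then show ?case using diff_poly.coord[of k i] diff_poly.const[of 0] by (cases "i \<in> I") simp_all
qed (auto intro: diff_poly.intros)

lemma coordinate_diff_poly: "coordinate i \<in> diff_poly"
  unfolding coordinate_def[abs_def] by (rule diff_poly.coord)

lemma coordinate_jet: "coordinate i (jet c x) = c x $ i"
  by (simp add: coordinate_def jet_def)

context isotropic_data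
begin

lemma gauge_S:
  assumes "s \<in> S_space br e \<Gamma> l" "m \<in> loops (m_space \<Gamma> l)"
  shows "gauge m s \<in> S_space br e \<Gamma> l"
  using assms gauge_loops[OF loops_UNIV_I[OF assms(2)]] gauge_admissible[OF admissible_M assms(2)]
  by (auto simp: S_iff)

lemma gauge_action_M: "m \<in> loops (m_space \<Gamma> l) \<Longrightarrow> gauge_action br m q = gauge m q"
  by (rule gauge_action_eq[OF loops_mono[OF M_Fil]])

lemma slice_gauge_M: "s \<in> S_space br e \<Gamma> l \<Longrightarrow> slice_gauge s \<in> loops (m_space \<Gamma> l)"
  by (rule slice_iter_admissible[OF admissible_M]) (auto simp: S_iff)

lemma slice_gauge_M_unique:
  assumes "s \<in> S_space br e \<Gamma> l" "m \<in> loops (m_space \<Gamma> l)" "gauge m s \<in> Q_space br e f"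
  shows "m = slice_gauge s"
  using S_Fil[OF assms(1)] assms(3) by (intro slice_gauge_unique loops_mono[OF M_Fil assms(2)]) auto

text \<open>\<open>Bk\<close> need only agree with the reduced bracket on local functionals on
  \<open>Q\<close>, so that the classical bracket can be put in its place.\<close>

lemma drinfeld_sokolov:
  assumes Bk: "\<And>\<phi> \<psi> z. \<phi> \<in> local_functionals_on (Q_space br e f) \<Longrightarrow> \<psi> \<in> local_functionals_on (Q_space br e f) \<Longrightarrow>
      z \<in> Q_space br e f \<Longrightarrow> Bk \<phi> \<psi> z = reduced_bracket br e f \<Gamma> l \<phi> \<psi> z"
  shows "drinfeld_sokolov_computes br e f \<Gamma> l Bk"
  unfolding drinfeld_sokolov_computes_def
proof (intro conjI ballI allI impI)
  fix s assume s: "s \<in> S_space br e \<Gamma> l"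
  show "\<exists>!m. m \<in> loops (m_space \<Gamma> l) \<and> gauge_action br m s \<in> Q_space br e f"
  proof (rule ex1I[of _ "slice_gauge s"])
    show "slice_gauge s \<in> loops (m_space \<Gamma> l) \<and> gauge_action br (slice_gauge s) s \<in> Q_space br e f"
      using slice_gauge_M[OF s] S_Fil[OF s] slice_gauge_fixed[of s] by (simp add: gauge_action_M)
    fix m assume "m \<in> loops (m_space \<Gamma> l) \<and> gauge_action br m s \<in> Q_space br e f"
    then have "m \<in> loops (m_space \<Gamma> l)" "gauge m s \<in> Q_space br e f" by (auto simp: gauge_action_M)
    then show "m = slice_gauge s" by (rule slice_gauge_M_unique[OF s])
  qed
next
  fix \<xi> \<eta> Iq Ib
  assume "adapted_basis br f \<xi> \<eta> Iq \<and> Iq \<subseteq> Ib \<and> vec.span (\<xi> ` Ib) = b_space br e \<Gamma> l"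
  then have adapted: "adapted_basis br f \<xi> \<eta> Iq" and Iq: "Iq \<subseteq> Ib" and Ib: "vec.span (\<xi> ` Ib) = B"
    by (auto simp: b_space_eq)
  interpret A: adapted_slice br e f R Fil depth \<xi> \<eta> Iq by unfold_locales (rule adapted)
  obtain \<Phi> where \<Phi>: "diff_poly_map \<Phi>" "\<And>q x. \<Phi> q x - e \<in> Fil 1"
    "\<And>q. (\<And>x. q x - e \<in> Fil 1) \<Longrightarrow> \<Phi> q = q" using slice_projection by blast
  have "diff_poly_map (\<lambda>c. A.co (slice_map (\<Phi> (A.decode c))))"
    by (rule diff_poly_map_compose[OF A.diff_poly_map_coords diff_poly_map_compose[OF diff_poly_map_slice_map
          diff_poly_map_compose[OF \<Phi>(1) A.diff_poly_map_decode]]])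
  then obtain P where P: "\<And>i. P i \<in> diff_poly"
    "\<And>c x i. c \<in> loops UNIV \<Longrightarrow> A.co (slice_map (\<Phi> (A.decode c))) x $ i = P i (jet c x)"
    using diff_poly_mapE by blast
  have P_eq: "P i (jet (A.co q) x) = A.co (slice_map q) x $ i"
    if "q \<in> loops UNIV" "\<And>x. q x - e \<in> Fil 1" for q i x
    using P(2)[OF A.coords_loops[OF that(1)], of x i] \<Phi>(3)[OF that(2)] by (simp add: A.decode_coords)
  \<comment> \<open>Erasing the coordinates outside \<open>Ib\<close> makes \<open>U i\<close> a
    polynomial in the coordinates of \<open>S\<close> alone. On \<open>S\<close> those coordinates
    vanish with all derivatives, so \<open>U i\<close> and \<open>P i\<close> agree there, but in
    general not nearby.\<close>
  define mask :: "(nat \<Rightarrow> complex ^ 'a) \<Rightarrow> nat \<Rightarrow> complex ^ 'a"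
    where "mask = (\<lambda>j k. \<chi> i. if i \<in> Ib then j k $ i else 0)"
  define U where "U = (\<lambda>i j. P i (mask j))"
  have mask_S: "mask (jet (A.co s) x) = jet (A.co s) x" if s: "s \<in> S_space br e \<Gamma> l" for s x
  proof (intro ext, rule vec_eq_iff[THEN iffD2], rule allI)
    fix k i
    have "jet (A.co s) x k $ i = 0" if "i \<notin> Ib"
    proof -
      have c: "A.co s \<in> loops UNIV" using A.coords_loops s S_iff by blast
      have "A.co s y $ i = 0" for y
        using s that A.span_subset_iff[of "s y - e" Ib] by (auto simp: Ib S_iff coords_def)
      then have "nderiv k (\<lambda>y. A.co s y $ i) x = 0" by (simp add: nderiv_const)
      then show ?thesis
        using fun_cong[OF nderiv_bounded_linear[OF bounded_linear_component loops_smooth[OF c]], of k i x]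
        by (simp add: jet_def)
    qed
    then show "mask (jet (A.co s) x) k $ i = jet (A.co s) x k $ i" by (simp add: mask_def)
  qed
  have U_eq: "U i (jet (A.co s) x) = A.co (slice_map s) x $ i" if "s \<in> S_space br e \<Gamma> l" for s i x
    unfolding U_def mask_S[OF that] using S_Fil[OF that] by (intro P_eq) auto
  have U_P: "U i (jet (A.co s) x) = P i (jet (A.co s) x)" if "s \<in> S_space br e \<Gamma> l" for s i x
    unfolding U_def mask_S[OF that] by (rule refl)
  have U_poly: "U i \<in> diff_poly" for i
    unfolding U_def mask_def by (rule diff_poly_mask[OF P(1)])
  have smeared_Q: "smeared br e \<eta> v \<alpha> z = smeared br e \<eta> (coordinate i) \<alpha> z"
    if "z \<in> Q_space br e f" "\<forall>s\<in>S_space br e \<Gamma> l. \<forall>x. v (jet (A.co s) x) = U i (jet (A.co s) x)" for v \<alpha> z i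
    using that(2) Q_S[OF that(1)] U_eq[OF Q_S[OF that(1)]] slice_map_id[OF that(1)]
    by (simp add: smeared_def coordinate_jet)
  have co_local: "smeared br e \<eta> (coordinate i) \<alpha> \<in> local_functionals_on (Q_space br e f)"
    if \<alpha>: "\<alpha> \<in> test_functions" for i \<alpha>
  proof -
    obtain p where p: "represented_by (smeared br e \<eta> (coordinate i) \<alpha>) p"
      using A.smeared_represented[OF coordinate_diff_poly \<alpha>] by blast
    then have "(\<lambda>q. integral {0..1} (\<lambda>x. p x (jet q x))) \<in> local_functionals"
      by (auto simp: represented_by_def local_functionals_def)
    moreover have "smeared br e \<eta> (coordinate i) \<alpha> z = integral {0..1} (\<lambda>x. p x (jet z x))" if "z \<in> Q_space br e f" for z
      using p that by (auto simp: represented_by_def density_functional_def Q_iff)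
    ultimately show ?thesis by (auto simp: local_functionals_on_def)
  qed
  \<comment> \<open>A smeared density agrees with an integral of a density in the loop itself only
    on smooth loops. It is replaced by that local functional \<open>F\<close>, which has the same
    gradients at loops.\<close>
  have extension: "\<exists>F. reduction_extension br e f \<Gamma> l (smeared br e \<eta> (coordinate i) \<alpha>) F \<and>
      (\<forall>z\<in>loops UNIV. gradient br F z = gradient br (smeared br e \<eta> v \<alpha>) z)"
    if v: "density_extension_constant_along_D br e \<Gamma> l \<eta> (U i) v" and \<alpha>: "\<alpha> \<in> test_functions" for i v \<alpha>
  proof -
    have v1: "v \<in> diff_poly" "\<forall>s\<in>S_space br e \<Gamma> l. \<forall>x. v (jet (A.co s) x) = U i (jet (A.co s) x)"
      "constant_along_D br e \<Gamma> l (smeared br e \<eta> v \<alpha>)"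
      using v \<alpha> by (auto simp: density_extension_constant_along_D_def)
    obtain p where p: "represented_by (smeared br e \<eta> v \<alpha>) p" using A.smeared_represented[OF v1(1) \<alpha>] by blast
    define F where "F = (\<lambda>q. integral {0..1} (\<lambda>x. p x (jet q x)))"
    have F: "F \<in> local_functionals" using p by (auto simp: F_def represented_by_def local_functionals_def)
    have Feq: "F q = smeared br e \<eta> v \<alpha> q" if "q \<in> loops UNIV" for q
      using p that by (simp add: F_def represented_by_def density_functional_def)
    have g: "gradient br F z = gradient br (smeared br e \<eta> v \<alpha>) z" if "z \<in> loops UNIV" for z
      by (rule gradient_cong[OF Feq that])
    have "constant_along_D br e \<Gamma> l F"
      using v1(3) g unfolding constant_along_D_def by (auto simp: S_iff)
    moreover have "F z = smeared br e \<eta> (coordinate i) \<alpha> z" if "z \<in> Q_space br e f" for z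
      using Feq[of z] smeared_Q[OF that v1(2)] that by (simp add: Q_iff)
    ultimately show ?thesis using F g unfolding reduction_extension_def by blast
  qed
  have compute: "density_bracket br e \<eta> Bk z (coordinate i) (coordinate j) \<alpha> \<beta> = leibniz_bracket br e \<eta> z v w \<alpha> \<beta>"
    if v: "density_extension_constant_along_D br e \<Gamma> l \<eta> (U i) v"
      and w: "density_extension_constant_along_D br e \<Gamma> l \<eta> (U j) w"
      and z: "z \<in> Q_space br e f" and \<alpha>: "\<alpha> \<in> test_functions" and \<beta>: "\<beta> \<in> test_functions" for i j v w z \<alpha> \<beta>
  proof -
    have zL: "z \<in> loops UNIV" using z by (simp add: Q_iff)
    obtain F G where F: "reduction_extension br e f \<Gamma> l (smeared br e \<eta> (coordinate i) \<alpha>) F"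
        "gradient br F z = gradient br (smeared br e \<eta> v \<alpha>) z"
      and G: "reduction_extension br e f \<Gamma> l (smeared br e \<eta> (coordinate j) \<beta>) G"
        "gradient br G z = gradient br (smeared br e \<eta> w \<beta>) z"
      using extension[OF v \<alpha>] extension[OF w \<beta>] zL by blast
    have "density_bracket br e \<eta> Bk z (coordinate i) (coordinate j) \<alpha> \<beta> = bracket2 br F G z"
      unfolding density_bracket_def Bk[OF co_local[OF \<alpha>] co_local[OF \<beta>] z]
      by (rule reduced_bracket_extensions[OF co_local[OF \<alpha>] co_local[OF \<beta>] z F(1) G(1)])
    also have "\<dots> = bracket2 br (smeared br e \<eta> v \<alpha>) (smeared br e \<eta> w \<beta>) z"
      by (simp add: bracket2_def F(2) G(2))
    also have "\<dots> = leibniz_bracket br e \<eta> z v w \<alpha> \<beta>"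
      using v w by (intro A.leibniz_bracket_eq[symmetric] \<alpha> \<beta> zL) (auto simp: density_extension_constant_along_D_def)
    finally show ?thesis .
  qed
  have P_const: "pairing br (gradient br (smeared br e \<eta> (P i) \<alpha>) s) (P2 br s v) = 0"
    if \<alpha>: "\<alpha> \<in> test_functions" and s: "s \<in> S_space br e \<Gamma> l" and v: "v \<in> loops (n_space br e \<Gamma> l)" for i \<alpha> s v
  proof -
    obtain p p0 where p: "represented_by (smeared br e \<eta> (P i) \<alpha>) p" "represented_by (smeared br e \<eta> (coordinate i) \<alpha>) p0"
      using A.smeared_represented[OF P(1) \<alpha>] A.smeared_represented[OF coordinate_diff_poly \<alpha>] by blast
    show ?thesis
    proof (rule constant_along_orbits[OF p(2,1)])
      show "smeared br e \<eta> (P i) \<alpha> q = smeared br e \<eta> (coordinate i) \<alpha> (slice_map q)"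
        if "q \<in> loops UNIV" "\<And>x. q x - e \<in> Fil 1" for q
        unfolding smeared_def P_eq[OF that] by (simp add: coordinate_jet)
    qed (use S_Fil[OF s] loops_mono[OF N_Fil v] in auto)
  qed
  \<comment> \<open>The unmasked \<open>P i\<close> factors through the projection to
    \<open>Q\<close> on all of \<open>e + Fil 1\<close>, not merely on \<open>S\<close>; this makes
    it an extension constant along \<open>D\<close> for every isotropic \<open>l\<close>.\<close>
  have P_ext: "density_extension_constant_along_D br e \<Gamma> l \<eta> (U i) (P i)" for i
    unfolding density_extension_constant_along_D_def constant_along_D_def
    using P(1) U_P P_const by simp
  \<comment> \<open>For Lagrangian \<open>l\<close> one has \<open>n = m\<close>, so
    \<open>P2 s v\<close> is tangent to \<open>S\<close>, and along \<open>S\<close> the masked and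
    unmasked densities have the same derivative.\<close>
  have U_ext: "density_extension_constant_along_D br e \<Gamma> l \<eta> (U i) (U i)" if lag: "lagrangian br e \<Gamma> l" for i
    unfolding density_extension_constant_along_D_def constant_along_D_def
  proof (intro conjI ballI allI refl U_poly)
    fix \<alpha> s v assume \<alpha>: "\<alpha> \<in> test_functions" and s: "s \<in> S_space br e \<Gamma> l" and v: "v \<in> loops (n_space br e \<Gamma> l)"
    have "n_space br e \<Gamma> l = m_space \<Gamma> l" using lag by (simp add: lagrangian_def n_space_def m_space_def)
    then have vM: "v \<in> loops (m_space \<Gamma> l)" using v by simp
    obtain p where p: "represented_by (smeared br e \<eta> (P i) \<alpha>) p" using A.smeared_represented[OF P(1) \<alpha>] by blast
    obtain p' where p': "represented_by (smeared br e \<eta> (U i) \<alpha>) p'" using A.smeared_represented[OF U_poly \<alpha>] by blast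
    have sL: "s \<in> loops UNIV" using s by (simp add: S_iff)
    have PL: "P2 br s v \<in> loops UNIV" by (rule P2_loops[OF sL loops_UNIV_I[OF v]])
    have "P2 br s v x \<in> B" for x
    proof -
      note adm = admissible_M[unfolded admissible_def]
      have vx: "v x \<in> m_space \<Gamma> l" by (rule loops_value[OF vM])
      have "vderiv v x \<in> B" using loops_value[OF vderiv_in_subspace[OF M_subspace vM], of x] adm by blast
      moreover have "br (v x) e \<in> B" "br (v x) (s x - e) \<in> B" using adm vx s by (auto simp: S_iff)
      ultimately have "vderiv v x - (br (v x) e + br (v x) (s x - e)) \<in> B"
        by (intro vec.subspace_diff[OF B_subspace] vec.subspace_add[OF B_subspace])
      then show ?thesis using br_anticommute[of "s x" "v x"] by (simp add: P2_def br_diff)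
    qed
    then have "(s x - e) + complex_of_real t *s P2 br s v x \<in> B" for t x
      using s by (intro vec.subspace_add[OF B_subspace] vec.subspace_scale[OF B_subspace]) (simp_all add: S_iff)
    then have line: "(\<lambda>x. s x + t *\<^sub>R P2 br s v x) \<in> S_space br e \<Gamma> l" for t
      using loops_add[OF sL loops_scaleR[OF PL]] by (simp add: S_iff scaleR_eq_smult algebra_simps)
    have "smeared br e \<eta> (U i) \<alpha> (\<lambda>x. s x + t *\<^sub>R P2 br s v x) = smeared br e \<eta> (P i) \<alpha> (\<lambda>x. s x + t *\<^sub>R P2 br s v x)" for t
      unfolding smeared_def U_P[OF line] by (rule refl)
    moreover have "((\<lambda>t. smeared br e \<eta> (P i) \<alpha> (\<lambda>x. s x + t *\<^sub>R P2 br s v x)) has_vector_derivative 0) (at 0)"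
      using has_gradient[OF p sL] PL P_const[OF \<alpha> s v, of i] unfolding has_differential_def by fastforce
    ultimately show "pairing br (gradient br (smeared br e \<eta> (U i) \<alpha>) s) (P2 br s v) = 0"
      by (intro pairing_gradientI[OF p' sL PL]) simp
  qed
  show "\<exists>U. (\<forall>i\<in>Iq. U i \<in> invariant_ring br e \<Gamma> l \<eta> Ib) \<and>
      (\<forall>s\<in>S_space br e \<Gamma> l. \<forall>m\<in>loops (m_space \<Gamma> l). gauge_action br m s \<in> Q_space br e f \<longrightarrow>
         (\<forall>i\<in>Iq. \<forall>x. A.co (gauge_action br m s) x $ i = U i (jet (A.co s) x))) \<and>
      (\<forall>u\<in>invariant_ring br e \<Gamma> l \<eta> Ib. \<exists>p\<in>diff_poly. \<forall>s\<in>S_space br e \<Gamma> l. \<forall>x.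
         u (jet (A.co s) x) = p (jet (\<lambda>y. \<chi> i. if i \<in> Iq then U i (jet (A.co s) y) else 0) x)) \<and>
      (lagrangian br e \<Gamma> l \<longrightarrow>
         (\<forall>i\<in>Iq. \<forall>j\<in>Iq. \<forall>z\<in>Q_space br e f. \<forall>\<alpha>\<in>test_functions. \<forall>\<beta>\<in>test_functions.
            density_bracket br e \<eta> Bk z (coordinate i) (coordinate j) \<alpha> \<beta> =
            leibniz_bracket br e \<eta> z (U i) (U j) \<alpha> \<beta>)) \<and>
      (\<forall>i\<in>Iq. \<exists>v. density_extension_constant_along_D br e \<Gamma> l \<eta> (U i) v) \<and>
      (\<forall>i\<in>Iq. \<forall>j\<in>Iq. \<forall>v w.
         density_extension_constant_along_D br e \<Gamma> l \<eta> (U i) v \<longrightarrow>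
         density_extension_constant_along_D br e \<Gamma> l \<eta> (U j) w \<longrightarrow>
         (\<forall>z\<in>Q_space br e f. \<forall>\<alpha>\<in>test_functions. \<forall>\<beta>\<in>test_functions.
            density_bracket br e \<eta> Bk z (coordinate i) (coordinate j) \<alpha> \<beta> =
            leibniz_bracket br e \<eta> z v w \<alpha> \<beta>))"
  proof (intro exI[of _ U] conjI ballI allI impI)
    fix i show "U i \<in> invariant_ring br e \<Gamma> l \<eta> Ib"
      unfolding invariant_ring_def
    proof (intro CollectI conjI U_poly ballI allI)
      show "depends_only_on Ib (U i)"
        unfolding depends_only_on_def
      proof (intro allI impI)
        fix j j' :: "nat \<Rightarrow> complex ^ 'a"
        assume "\<forall>k. \<forall>i\<in>Ib. j k $ i = j' k $ i"
        then have "mask j = mask j'" by (auto simp: mask_def fun_eq_iff vec_eq_iff)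
        then show "U i j = U i j'" by (simp add: U_def)
      qed
      fix s m x assume s: "s \<in> S_space br e \<Gamma> l" and m: "m \<in> loops (m_space \<Gamma> l)"
      have "slice_map (gauge m s) = slice_map s"
        using S_Fil[OF s] by (intro slice_map_gauge loops_mono[OF M_Fil m]) auto
      then show "U i (jet (A.co (gauge_action br m s)) x) = U i (jet (A.co s) x)"
        by (simp add: gauge_action_M[OF m] U_eq[OF s] U_eq[OF gauge_S[OF s m]])
    qed
  next
    fix s m i x assume s: "s \<in> S_space br e \<Gamma> l" and m: "m \<in> loops (m_space \<Gamma> l)"
      and Q: "gauge_action br m s \<in> Q_space br e f"
    have "m = slice_gauge s" using slice_gauge_M_unique[OF s m] Q by (simp add: gauge_action_M[OF m])
    then have "gauge_action br m s = slice_map s" unfolding gauge_action_M[OF m] slice_map_def by simp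
    then show "A.co (gauge_action br m s) x $ i = U i (jet (A.co s) x)" by (simp add: U_eq[OF s])
  next
    fix u assume u: "u \<in> invariant_ring br e \<Gamma> l \<eta> Ib"
    show "\<exists>p\<in>diff_poly. \<forall>s\<in>S_space br e \<Gamma> l. \<forall>x.
         u (jet (A.co s) x) = p (jet (\<lambda>y. \<chi> i. if i \<in> Iq then U i (jet (A.co s) y) else 0) x)"
    \<comment> \<open>An invariant takes the same value at \<open>s\<close> and at its
      representative in \<open>Q\<close>, whose coordinates are the \<open>U i\<close> and zeros; so
      the polynomial sought is \<open>u\<close> itself.\<close>
    proof (intro bexI[of _ u] ballI allI)
      show "u \<in> diff_poly" using u by (simp add: invariant_ring_def)
      fix s x assume s: "s \<in> S_space br e \<Gamma> l"
      have zQ: "slice_map s \<in> Q_space br e f" using S_Fil[OF s] by (intro slice_map_Q) auto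
      have "(\<lambda>y. \<chi> i. if i \<in> Iq then U i (jet (A.co s) y) else 0) = A.co (slice_map s)"
      proof (intro ext, rule vec_eq_iff[THEN iffD2], rule allI)
        fix y i
        have "A.co (slice_map s) y $ i = 0" if "i \<notin> Iq"
          using zQ that A.kernel_iff[of "slice_map s y - e"] by (simp add: Q_iff coords_def)
        then show "(\<chi> i. if i \<in> Iq then U i (jet (A.co s) y) else 0) $ i = A.co (slice_map s) y $ i"
          by (simp add: U_eq[OF s])
      qed
      moreover have "u (jet (A.co (gauge_action br (slice_gauge s) s)) x) = u (jet (A.co s) x)"
        using u s slice_gauge_M[OF s] by (simp add: invariant_ring_def)
      ultimately show "u (jet (A.co s) x) = u (jet (\<lambda>y. \<chi> i. if i \<in> Iq then U i (jet (A.co s) y) else 0) x)"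
        by (simp add: gauge_action_M[OF slice_gauge_M[OF s]] slice_map_def)
    qed
  qed (use compute U_ext P_ext in blast)+
qed

end

section \<open>Dirac formula\<close>

lemma diff_op_sum_bound:
  "\<lbrakk>A \<in> diff_ops; \<And>k. k \<ge> N \<Longrightarrow> A k = (\<lambda>_. 0)\<rbrakk> \<Longrightarrow> op_fun A c w x = (\<Sum>k<N. A k (jet c x) * nderiv k w x)"
  unfolding op_fun_def by (rule sum.mono_neutral_left) (auto simp: not_less[symmetric])

lemma op_fun_loops:
  assumes "A \<in> diff_ops" "c \<in> loops UNIV" "w \<in> test_functions" shows "op_fun A c w \<in> test_functions"
proof -
  have "(\<lambda>x. op_fun A c w x) \<in> test_functions"
    unfolding op_fun_def using assms
    by (intro loops_sum loops_mult loops_nderiv density_loop[OF diff_poly_density]) (auto simp: diff_ops_def)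
  then show ?thesis by simp
qed

text \<open>The signs from the dual derivative and from integration by parts cancel.
  \<open>T\<close> is tested against one fixed \<open>\<beta>\<close> only, so the lemma can be
  iterated along a composition of operators.\<close>

lemma op_dist_eq:
  assumes A: "A \<in> diff_ops" and c: "c \<in> loops UNIV" and g: "g \<in> test_functions" and \<alpha>: "\<alpha> \<in> test_functions"
    and T: "\<And>\<alpha>. \<alpha> \<in> test_functions \<Longrightarrow> T \<alpha> \<beta> = integral {0..1} (\<lambda>x. \<alpha> x * g x)"
  shows "op_dist A c T \<alpha> \<beta> = integral {0..1} (\<lambda>x. \<alpha> x * op_fun A c g x)"
proof -
  let ?K = "{k. A k \<noteq> (\<lambda>_. 0)}"
  have a: "(\<lambda>x. A k (jet c x) * \<alpha> x) \<in> test_functions" for k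
    using A by (intro loops_mult \<alpha> density_loop[OF diff_poly_density c]) (simp add: diff_ops_def)
  have b: "(\<lambda>x. \<alpha> x * (A k (jet c x) * nderiv k g x)) \<in> test_functions" for k
    using A by (intro loops_mult \<alpha> density_loop[OF diff_poly_density c] loops_nderiv g) (simp add: diff_ops_def)
  have m: "(- 1) ^ k * ((- 1) ^ k * y) = (y :: complex)" for k y
    by (simp add: mult.assoc[symmetric] power_mult_distrib[symmetric])
  have "op_dist A c T \<alpha> \<beta> = (\<Sum>k\<in>?K. (- 1) ^ k * integral {0..1} (\<lambda>x. nderiv k (\<lambda>x. A k (jet c x) * \<alpha> x) x * g x))"
    by (simp add: op_dist_def mult_x_def deriv_x_funpow T[OF loops_nderiv[OF a]])
  also have "\<dots> = (\<Sum>k\<in>?K. integral {0..1} (\<lambda>x. \<alpha> x * (A k (jet c x) * nderiv k g x)))"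
    unfolding integral_by_parts_nderiv[OF a g] m by (simp add: mult_ac)
  also have "\<dots> = integral {0..1} (\<lambda>x. \<Sum>k\<in>?K. \<alpha> x * (A k (jet c x) * nderiv k g x))"
    using A by (intro integral_sum[symmetric] loop_integrable[OF b]) (simp add: diff_ops_def)
  finally show ?thesis by (simp add: op_fun_def sum_distrib_left)
qed

lemma fundamental_lemma_test:
  assumes "g \<in> test_functions" "g' \<in> test_functions"
    and "\<And>\<alpha>. \<alpha> \<in> test_functions \<Longrightarrow> integral {0..1} (\<lambda>x. \<alpha> x * g x) = integral {0..1} (\<lambda>x. \<alpha> x * g' x)"
  shows "g x = g' x"
proof -
  have d: "(\<lambda>x. g x - g' x) \<in> test_functions" by (rule loops_diff[OF assms(1,2)])
  let ?\<alpha> = "\<lambda>x. cnj (g x - g' x)"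
  have \<alpha>: "?\<alpha> \<in> test_functions" by (rule loops_cnj[OF d])
  have "integral {0..1} (\<lambda>x. (g x - g' x) * ?\<alpha> x) = integral {0..1} (\<lambda>x. ?\<alpha> x * g x - ?\<alpha> x * g' x)"
    by (simp add: algebra_simps)
  also have "\<dots> = integral {0..1} (\<lambda>x. ?\<alpha> x * g x) - integral {0..1} (\<lambda>x. ?\<alpha> x * g' x)"
    by (intro integral_diff loop_integrable[where V = UNIV] loops_mult \<alpha> assms)
  also have "\<dots> = 0" using assms(3)[OF \<alpha>] by simp
  finally show ?thesis using fundamental_lemma[OF d, of x] by simp
qed

section \<open>Vector valued differential operators\<close>

text \<open>Operators linear in the scalar function \<open>w\<close>, with differential polynomials
  in the coordinate loop \<open>c\<close> as coefficients. Finite order and polynomial coefficients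
  of the inverse minor are obtained from closure of this class under the steps of the Neumann
  series.\<close>

definition vector_diff_op :: "('n::finite loop \<Rightarrow> (real \<Rightarrow> complex) \<Rightarrow> 'n loop) \<Rightarrow> bool" where
  "vector_diff_op \<O> \<longleftrightarrow> (\<exists>N \<Psi>. (\<forall>k. diff_poly_map (\<Psi> k)) \<and>
     (\<forall>c\<in>loops UNIV. \<forall>w\<in>test_functions. \<O> c w = (\<lambda>x. \<Sum>k<N. nderiv k w x *s \<Psi> k c x)))"

text \<open>A form padded with zero coefficients, so that two operators can be summed up to a common
  order.\<close>

lemma vector_diff_opE:
  assumes "vector_diff_op \<O>"
  shows "\<exists>N \<Psi>. (\<forall>k. diff_poly_map (\<Psi> k)) \<and> (\<forall>k\<ge>N. \<Psi> k = (\<lambda>c x. 0)) \<and>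
    (\<forall>M\<ge>N. \<forall>c\<in>loops UNIV. \<forall>w\<in>test_functions. \<forall>x. \<O> c w x = (\<Sum>k<M. nderiv k w x *s \<Psi> k c x))"
proof -
  obtain N \<Psi> where *: "\<And>k. diff_poly_map (\<Psi> k)"
    "\<And>c w. c \<in> loops UNIV \<Longrightarrow> w \<in> test_functions \<Longrightarrow> \<O> c w = (\<lambda>x. \<Sum>k<N. nderiv k w x *s \<Psi> k c x)"
    using assms unfolding vector_diff_op_def by blast
  let ?\<Psi> = "\<lambda>k. if k < N then \<Psi> k else (\<lambda>c x. 0)"
  show ?thesis
  proof (rule exI[of _ N], rule exI[of _ ?\<Psi>], intro conjI allI ballI impI)
    show "diff_poly_map (?\<Psi> k)" for k by (simp add: *(1) diff_poly_map_const)
    show "?\<Psi> k = (\<lambda>c x. 0)" if "N \<le> k" for k using that by simp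
    fix M w x and c :: "'a loop" assume "N \<le> M" "c \<in> loops UNIV" "w \<in> test_functions"
    then have "\<O> c w x = (\<Sum>k<N. nderiv k w x *s ?\<Psi> k c x)" by (simp add: *)
    also have "\<dots> = (\<Sum>k<M. nderiv k w x *s ?\<Psi> k c x)"
      using \<open>N \<le> M\<close> by (intro sum.mono_neutral_left) auto
    finally show "\<O> c w x = (\<Sum>k<M. nderiv k w x *s ?\<Psi> k c x)" .
  qed
qed

lemma vector_diff_opI:
  "\<lbrakk>\<And>k. diff_poly_map (\<Psi> k); \<And>c w x. c \<in> loops UNIV \<Longrightarrow> w \<in> test_functions \<Longrightarrow>
    \<O> c w x = (\<Sum>k<N. nderiv k w x *s \<Psi> k c x)\<rbrakk> \<Longrightarrow> vector_diff_op \<O>"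
  unfolding vector_diff_op_def by (intro exI[of _ N] exI[of _ \<Psi>]) (auto simp: fun_eq_iff)

lemma vector_diff_op_scalar: "vector_diff_op (\<lambda>c w x. w x *s v)"
  by (rule vector_diff_opI[of "\<lambda>k c x. v" _ 1]) (auto simp: diff_poly_map_const)

lemma vector_diff_op_zero: "vector_diff_op (\<lambda>c w x. 0)"
  using vector_diff_op_scalar[of 0] by simp

lemma vector_diff_op_add:
  assumes "vector_diff_op \<O>" "vector_diff_op \<P>" shows "vector_diff_op (\<lambda>c w x. \<O> c w x + \<P> c w x)"
proof -
  obtain N \<Psi> where 1: "\<And>k. diff_poly_map (\<Psi> k)" "\<And>k. k \<ge> N \<Longrightarrow> \<Psi> k = (\<lambda>c x. 0)"
    "\<And>M c w x. M \<ge> N \<Longrightarrow> c \<in> loops UNIV \<Longrightarrow> w \<in> test_functions \<Longrightarrow> \<O> c w x = (\<Sum>k<M. nderiv k w x *s \<Psi> k c x)"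
    using vector_diff_opE[OF assms(1)] by blast
  obtain N' \<Phi> where 2: "\<And>k. diff_poly_map (\<Phi> k)" "\<And>k. k \<ge> N' \<Longrightarrow> \<Phi> k = (\<lambda>c x. 0)"
    "\<And>M c w x. M \<ge> N' \<Longrightarrow> c \<in> loops UNIV \<Longrightarrow> w \<in> test_functions \<Longrightarrow> \<P> c w x = (\<Sum>k<M. nderiv k w x *s \<Phi> k c x)"
    using vector_diff_opE[OF assms(2)] by blast
  show ?thesis
    by (rule vector_diff_opI[of "\<lambda>k c x. \<Psi> k c x + \<Phi> k c x" _ "max N N'"])
       (simp_all add: diff_poly_map_add 1(1) 2(1) 1(3)[of "max N N'"] 2(3)[of "max N N'"]
         vec.scale_right_distrib sum.distrib)
qed

lemma vector_diff_op_clin: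
  assumes T: "clin T" and "vector_diff_op \<O>" shows "vector_diff_op (\<lambda>c w x. T (\<O> c w x))"
proof -
  obtain N \<Psi> where 1: "\<And>k. diff_poly_map (\<Psi> k)" "\<And>k. k \<ge> N \<Longrightarrow> \<Psi> k = (\<lambda>c x. 0)"
    "\<And>M c w x. M \<ge> N \<Longrightarrow> c \<in> loops UNIV \<Longrightarrow> w \<in> test_functions \<Longrightarrow> \<O> c w x = (\<Sum>k<M. nderiv k w x *s \<Psi> k c x)"
    using vector_diff_opE[OF assms(2)] by blast
  show ?thesis
    by (rule vector_diff_opI[of "\<lambda>k c x. T (\<Psi> k c x)" _ N])
       (simp_all add: diff_poly_map_clin[OF T 1(1)] 1(3)[OF order_refl] clin_setsum[OF T] clin_scale[OF T])
qed

lemma vector_diff_op_bracket: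
  assumes h: "\<And>x. clin (h x)" "\<And>y. clin (\<lambda>x. h x y)" and \<Phi>: "diff_poly_map \<Phi>" and "vector_diff_op \<O>"
  shows "vector_diff_op (\<lambda>c w x. h (\<Phi> c x) (\<O> c w x))"
proof -
  obtain N \<Psi> where 1: "\<And>k. diff_poly_map (\<Psi> k)" "\<And>k. k \<ge> N \<Longrightarrow> \<Psi> k = (\<lambda>c x. 0)"
    "\<And>M c w x. M \<ge> N \<Longrightarrow> c \<in> loops UNIV \<Longrightarrow> w \<in> test_functions \<Longrightarrow> \<O> c w x = (\<Sum>k<M. nderiv k w x *s \<Psi> k c x)"
    using vector_diff_opE[OF assms(4)] by blast
  show ?thesis
    by (rule vector_diff_opI[of "\<lambda>k c x. h (\<Phi> c x) (\<Psi> k c x)" _ N])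
       (simp_all add: diff_poly_map_bilinear[OF h \<Phi> 1(1)] 1(3)[OF order_refl] clin_setsum[OF h(1)] clin_scale[OF h(1)])
qed

lemma vector_diff_op_vderiv:
  assumes "vector_diff_op \<O>" shows "vector_diff_op (\<lambda>c w. vderiv (\<O> c w))"
proof -
  obtain N \<Psi> where \<Psi>: "\<And>k. diff_poly_map (\<Psi> k)" "\<And>k. k \<ge> N \<Longrightarrow> \<Psi> k = (\<lambda>c x. 0)"
    "\<And>M c w x. M \<ge> N \<Longrightarrow> c \<in> loops UNIV \<Longrightarrow> w \<in> test_functions \<Longrightarrow> \<O> c w x = (\<Sum>k<M. nderiv k w x *s \<Psi> k c x)"
    using vector_diff_opE[OF assms] by blast
  let ?\<Phi> = "\<lambda>k c x. (case k of 0 \<Rightarrow> 0 | Suc j \<Rightarrow> \<Psi> j c x) + vderiv (\<Psi> k c) x"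
  show ?thesis
  proof (rule vector_diff_opI[of ?\<Phi> _ "Suc N"])
    show "diff_poly_map (?\<Phi> k)" for k
    proof (rule diff_poly_map_add[OF _ diff_poly_map_vderiv[OF \<Psi>(1)]])
      show "diff_poly_map (\<lambda>c x. case k of 0 \<Rightarrow> 0 | Suc j \<Rightarrow> \<Psi> j c x)"
        by (cases k) (simp_all add: diff_poly_map_const \<Psi>(1))
    qed
    fix c :: "'a loop" and w x assume c: "c \<in> loops UNIV" and w: "w \<in> test_functions"
    have "((\<lambda>x. \<Sum>k<N. nderiv k w x *s \<Psi> k c x) has_vector_derivative
        (\<Sum>k<N. nderiv k w x *s vderiv (\<Psi> k c) x + nderiv (Suc k) w x *s \<Psi> k c x)) (at x)"
      unfolding nderiv_Suc
      by (intro has_vector_derivative_sum bounded_bilinear.has_vector_derivative[OF bounded_bilinear_smult]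
          smooth_has_vector_derivative smooth_nderiv loops_smooth[OF w] loops_smooth[OF diff_poly_map_loops[OF \<Psi>(1) c]])
    moreover have "\<O> c w = (\<lambda>x. \<Sum>k<N. nderiv k w x *s \<Psi> k c x)" using \<Psi>(3)[OF order_refl c w] by blast
    ultimately have "vderiv (\<O> c w) x = (\<Sum>k<N. nderiv k w x *s vderiv (\<Psi> k c) x + nderiv (Suc k) w x *s \<Psi> k c x)"
      by (simp add: vector_derivative_at)
    also have "\<dots> = (\<Sum>k<N. nderiv k w x *s vderiv (\<Psi> k c) x) + (\<Sum>k<N. nderiv (Suc k) w x *s \<Psi> k c x)"
      by (rule sum.distrib)
    also have "(\<Sum>k<N. nderiv k w x *s vderiv (\<Psi> k c) x) = (\<Sum>k<Suc N. nderiv k w x *s vderiv (\<Psi> k c) x)"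
      using \<Psi>(2)[of N] by simp
    also have "(\<Sum>k<N. nderiv (Suc k) w x *s \<Psi> k c x) =
        (\<Sum>k<Suc N. nderiv k w x *s (case k of 0 \<Rightarrow> 0 | Suc j \<Rightarrow> \<Psi> j c x))"
      by (subst sum.lessThan_Suc_shift) simp
    finally show "vderiv (\<O> c w) x = (\<Sum>k<Suc N. nderiv k w x *s ?\<Phi> k c x)"
      by (simp only: vec.scale_right_distrib sum.distrib add.commute)
  qed
qed

lemma vector_diff_op_functional:
  fixes T :: "complex ^ 'n::finite \<Rightarrow> complex ^ 'n"
  assumes T: "clin T" and "vector_diff_op \<O>"
  shows "\<exists>A\<in>diff_ops. \<forall>c\<in>loops UNIV. \<forall>w\<in>test_functions. \<forall>x. op_fun A c w x = T (\<O> c w x) $ i"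
proof -
  obtain N \<Psi> where 1: "\<And>k. diff_poly_map (\<Psi> k)" "\<And>k. k \<ge> N \<Longrightarrow> \<Psi> k = (\<lambda>c x. 0)"
    "\<And>M c w x. M \<ge> N \<Longrightarrow> c \<in> loops UNIV \<Longrightarrow> w \<in> test_functions \<Longrightarrow> T (\<O> c w x) = (\<Sum>k<M. nderiv k w x *s \<Psi> k c x)"
    using vector_diff_opE[OF vector_diff_op_clin[OF assms]] by blast
  have "\<exists>P. P \<in> diff_poly \<and> (\<forall>c\<in>loops UNIV. \<forall>x. \<Psi> k c x $ i = P (jet c x)) \<and> (k \<ge> N \<longrightarrow> P = (\<lambda>_. 0))" for k
  proof (cases "k \<ge> N")
    case True
    then show ?thesis using 1(2)[of k] diff_poly.const[of 0] by auto
  next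
    case False
    obtain P where "\<And>i. P i \<in> diff_poly" "\<And>c x i. c \<in> loops UNIV \<Longrightarrow> \<Psi> k c x $ i = P i (jet c x)"
      using diff_poly_mapE[OF 1(1)[of k]] by blast
    then show ?thesis using False by (intro exI[of _ "P i"]) auto
  qed
  then obtain P where P: "\<And>k. P k \<in> diff_poly" "\<And>k c x. c \<in> loops UNIV \<Longrightarrow> \<Psi> k c x $ i = P k (jet c x)"
    "\<And>k. k \<ge> N \<Longrightarrow> P k = (\<lambda>_. 0)" by metis
  have "finite {k. P k \<noteq> (\<lambda>_. 0)}"
    by (rule finite_subset[of _ "{..<N}"]) (use P(3) in \<open>auto simp: not_le[symmetric]\<close>)
  then have D: "P \<in> diff_ops" using P(1) by (simp add: diff_ops_def)
  show ?thesis
    by (rule bexI[OF _ D]) (auto simp: diff_op_sum_bound[OF D P(3)] 1(3)[OF order_refl] P(2) mult.commute)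
qed

section \<open>The inverse minor and the Dirac correction\<close>

context adapted_slice
begin

lemma coordinates_range:
  assumes u: "u \<in> range (br f)" shows "u = (\<Sum>b\<in>- Iq. K (\<xi> b) u *s \<eta> b)"
proof -
  have "K (\<xi> i) u = 0" if "i \<in> Iq" for i
  proof -
    have "br f (\<xi> i) = 0" using that vec.span_base[of "\<xi> i" "\<xi> ` Iq"] by (auto simp: basis ker_ad_def)
    then show ?thesis using u killing_invariant'[of f _ "\<xi> i"] by (auto simp: killing_sym[of "\<xi> i"])
  qed
  then have "(\<Sum>i\<in>UNIV. K (\<xi> i) u *s \<eta> i) = (\<Sum>b\<in>- Iq. K (\<xi> b) u *s \<eta> b)"
    by (intro sum.mono_neutral_right) auto
  then show ?thesis by (simp only: expand_dual)
qed

lemma dual_range: "b \<notin> Iq \<Longrightarrow> \<eta> b \<in> range (br f)"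
  by (rule kernel_annihilator) (auto simp: kernel_iff killing_sym[of "\<eta> b"])

text \<open>The action on functions of the entry \<open>(i, j)\<close> of the operator matrix of the
  second bracket.\<close>

definition Fop :: "'a loop \<Rightarrow> 'a \<Rightarrow> 'a \<Rightarrow> (real \<Rightarrow> complex) \<Rightarrow> real \<Rightarrow> complex" where
  "Fop z i j \<beta> x = K (\<eta> i) (P2 br z (\<lambda>x. \<beta> x *s \<eta> j) x)"

lemma Fop_loops: "z \<in> loops UNIV \<Longrightarrow> \<beta> \<in> test_functions \<Longrightarrow> Fop z i j \<beta> \<in> test_functions"
  using loops_killing[OF loops_const P2_loops[OF _ loops_smult[OF _ loops_const]], of z \<beta> "\<eta> i" "\<eta> j"]
  by (simp add: Fop_def[abs_def])

lemma density_bracket2_Fop: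
  assumes "\<alpha> \<in> test_functions" "\<beta> \<in> test_functions" "z \<in> loops UNIV"
  shows "density_bracket br e \<eta> (bracket2 br) z (coordinate i) (coordinate j) \<alpha> \<beta> =
    integral {0..1} (\<lambda>x. \<alpha> x * Fop z i j \<beta> x)"
  by (simp add: density_bracket2_coordinates[OF assms] pairing_def Fop_def)

lemma P2_vector_diff_op: "vector_diff_op (\<lambda>c w. P2 br (decode c) (\<lambda>x. w x *s v))"
  unfolding P2_def
  by (rule vector_diff_op_add[OF vector_diff_op_vderiv[OF vector_diff_op_scalar]
        vector_diff_op_bracket[OF linear_right linear_left diff_poly_map_decode vector_diff_op_scalar]])

lemma killing_functional_component: "clin (\<lambda>y. axis i (K v y))"
  by (rule clinI) (auto simp: killing_add axis_def vec_eq_iff)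

lemma represents_exists: "\<exists>FF. represents_bracket2 br e \<eta> FF"
proof -
  have "\<exists>A\<in>diff_ops. \<forall>c\<in>loops UNIV. \<forall>w\<in>test_functions. \<forall>x. op_fun A c w x = Fop (decode c) i j w x" for i j
    using vector_diff_op_functional[OF killing_functional_component[of i "\<eta> i"] P2_vector_diff_op[of "\<eta> j"], of i]
    by (simp add: Fop_def axis_def)
  then obtain FF where FF: "\<And>i j. FF i j \<in> diff_ops"
    "\<And>i j c w x. c \<in> loops UNIV \<Longrightarrow> w \<in> test_functions \<Longrightarrow> op_fun (FF i j) c w x = Fop (decode c) i j w x"
    by metis
  have "represents_bracket2 br e \<eta> FF"
    unfolding represents_bracket2_def
  proof (intro conjI allI ballI FF(1))
    fix i j and z :: "'a loop" and \<alpha> \<beta>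
    assume z: "z \<in> loops UNIV" and \<alpha>: "\<alpha> \<in> test_functions" and \<beta>: "\<beta> \<in> test_functions"
    have "op_dist (FF i j) (co z) delta \<alpha> \<beta> = integral {0..1} (\<lambda>x. \<alpha> x * op_fun (FF i j) (co z) \<beta> x)"
      by (rule op_dist_eq[OF FF(1) coords_loops[OF z] \<beta> \<alpha>]) (simp add: delta_def)
    then show "density_bracket br e \<eta> (bracket2 br) z (coordinate i) (coordinate j) \<alpha> \<beta> = op_dist (FF i j) (co z) delta \<alpha> \<beta>"
      by (simp add: density_bracket2_Fop[OF \<alpha> \<beta> z] FF(2)[OF coords_loops[OF z] \<beta>] decode_coords)
  qed
  then show ?thesis by blast
qed

text \<open>By the fundamental lemma the action on functions is determined by the distribution.
  Hence what is shown for \<open>Fop\<close> holds for every matrix \<open>FF\<close> representing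
  the bracket.\<close>

lemma represents_op_fun:
  assumes FF: "represents_bracket2 br e \<eta> FF" and z: "z \<in> loops UNIV" and \<beta>: "\<beta> \<in> test_functions"
  shows "op_fun (FF i j) (co z) \<beta> = Fop z i j \<beta>"
proof
  fix x
  have D: "FF i j \<in> diff_ops" using FF by (simp add: represents_bracket2_def)
  show "op_fun (FF i j) (co z) \<beta> x = Fop z i j \<beta> x"
  proof (rule fundamental_lemma_test[OF op_fun_loops[OF D coords_loops[OF z] \<beta>] Fop_loops[OF z \<beta>]])
    fix \<alpha> assume \<alpha>: "\<alpha> \<in> test_functions"
    have "integral {0..1} (\<lambda>x. \<alpha> x * op_fun (FF i j) (co z) \<beta> x) = op_dist (FF i j) (co z) delta \<alpha> \<beta>"
      by (rule op_dist_eq[OF D coords_loops[OF z] \<beta> \<alpha>, symmetric]) (simp add: delta_def)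
    also have "\<dots> = integral {0..1} (\<lambda>x. \<alpha> x * Fop z i j \<beta> x)"
      using FF \<alpha> \<beta> z by (simp add: represents_bracket2_def density_bracket2_Fop[symmetric])
    finally show "integral {0..1} (\<lambda>x. \<alpha> x * op_fun (FF i j) (co z) \<beta> x) = integral {0..1} (\<lambda>x. \<alpha> x * Fop z i j \<beta> x)" .
  qed
qed

lemma perturbation_zero: "perturbation z (\<lambda>_. 0) = (\<lambda>_. 0)"
  by (simp add: perturbation_def clin_0[OF R_linear])

lemma vector_diff_op_geometric:
  assumes "vector_diff_op \<O>" shows "vector_diff_op (\<lambda>c w. geometric k (decode c) (\<O> c w))"
proof (induction k)
  case (Suc k)
  have "diff_poly_map (\<lambda>c x. decode c x - e)" by (rule diff_poly_map_minus[OF diff_poly_map_decode diff_poly_map_const])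
  from vector_diff_op_clin[OF R_linear vector_diff_op_add[OF vector_diff_op_vderiv[OF Suc]
        vector_diff_op_bracket[OF linear_right linear_left this Suc]]]
  have "vector_diff_op (\<lambda>c w x. - perturbation (decode c) (geometric k (decode c) (\<O> c w)) x)"
    unfolding perturbation_def by (rule vector_diff_op_clin[of "\<lambda>y. - y", rotated]) (simp add: clin_iff)
  from vector_diff_op_add[OF assms this] show ?case by simp
qed (simp add: vector_diff_op_zero)

lemma Fop_sum:
  assumes "\<And>b. b \<in> I \<Longrightarrow> \<beta> b \<in> test_functions"
  shows "(\<Sum>b\<in>I. Fop z a b (\<beta> b) x) = K (\<eta> a) (P2 br z (\<lambda>x. \<Sum>b\<in>I. \<beta> b x *s \<eta> b) x)"
proof -
  have "(\<lambda>x. \<beta> b x *s \<eta> b) \<in> loops UNIV" if "b \<in> I" for b by (rule loops_smult[OF assms[OF that] loops_const])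
  from fun_cong[OF P2_sum[of I "\<lambda>b x. \<beta> b x *s \<eta> b" z, OF this], of x]
  show ?thesis by (simp add: Fop_def killing_sum)
qed

text \<open>The entry of \<open>(1 + perturbation z)^(-1) R\<close> that maps the multiple
  \<open>w\<close> of \<open>\<xi> c\<close> to the coefficient of \<open>\<eta> b\<close>.\<close>

definition Sop :: "'a loop \<Rightarrow> 'a \<Rightarrow> 'a \<Rightarrow> (real \<Rightarrow> complex) \<Rightarrow> real \<Rightarrow> complex" where
  "Sop z b c w x = K (\<xi> b) (resolvent z (\<lambda>x. w x *s R (\<xi> c)) x)"

lemma Sop_solution:
  assumes z: "z \<in> Q_space br e f" and w: "w \<in> test_functions"
  shows "(\<lambda>x. \<Sum>b\<in>- Iq. Sop z b c w x *s \<eta> b) = resolvent z (\<lambda>x. w x *s R (\<xi> c))"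
    and "resolvent z (\<lambda>x. w x *s R (\<xi> c)) \<in> loops (range (br f))"
proof -
  have zL: "z \<in> loops UNIV" using z by (simp add: Q_iff)
  have "(\<lambda>x. w x *s R (\<xi> c)) \<in> loops (range (br f))"
    by (rule loops_valueI[OF loops_smult[OF w loops_const]]) (rule vec.subspace_scale[OF range_f_subspace R_range])
  then show r: "resolvent z (\<lambda>x. w x *s R (\<xi> c)) \<in> loops (range (br f))"
    by (rule resolvent_in[OF range_f_subspace zL _ perturbation_range[OF zL loops_UNIV_I]])
  show "(\<lambda>x. \<Sum>b\<in>- Iq. Sop z b c w x *s \<eta> b) = resolvent z (\<lambda>x. w x *s R (\<xi> c))"
    unfolding Sop_def using coordinates_range[OF loops_value[OF r]] by simp
qed

lemma Sop_loops: "z \<in> Q_space br e f \<Longrightarrow> w \<in> test_functions \<Longrightarrow> Sop z b c w \<in> test_functions"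
  using loops_killing[OF loops_const loops_UNIV_I[OF Sop_solution(2)], of z w "\<xi> b" c]
  by (simp add: Sop_def[abs_def])

text \<open>For the resolvent \<open>?u\<close> of \<open>w R (\<xi> c)\<close>, the vectors
  \<open>P2 z ?u\<close> and \<open>w \<xi> c\<close> have the same image under \<open>R\<close>.
  Their difference lies in \<open>ker (ad f)\<close> and has no coordinates outside
  \<open>Iq\<close>.\<close>

lemma Fop_Sop:
  assumes z: "z \<in> Q_space br e f" and w: "w \<in> test_functions" and a: "a \<notin> Iq"
  shows "(\<Sum>b\<in>- Iq. Fop z a b (Sop z b c w) x) = (if a = c then w x else 0)"
proof -
  have zL: "z \<in> loops UNIV" "\<And>x. z x - e \<in> Fil 0" using Q_Fil[OF z] by auto
  let ?y = "\<lambda>x. w x *s R (\<xi> c)"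
  let ?u = "resolvent z ?y"
  note u = Sop_solution[OF z w, of c]
  have yL: "?y \<in> loops UNIV" by (rule loops_smult[OF w loops_const])
  have "R (P2 br z ?u x) = ?u x + perturbation z ?u x" by (rule R_P2[OF loops_value[OF u(2)]])
  also have "\<dots> = ?y x" by (rule resolvent_solves[OF zL yL])
  finally have "R (P2 br z ?u x - w x *s \<xi> c) = 0"
    by (simp add: clin_diff[OF R_linear] clin_scale[OF R_linear])
  then have "K (P2 br z ?u x - w x *s \<xi> c) (\<eta> a) = 0" using a R_eq_0_iff kernel_iff by blast
  then have "K (\<eta> a) (P2 br z ?u x) = w x * K (\<xi> c) (\<eta> a)"
    by (simp add: killing_diff killing_sym[of "\<eta> a"])
  also have "\<dots> = (if a = c then w x else 0)" by (simp add: basis)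
  finally show ?thesis using Fop_sum[of "- Iq" "\<lambda>b. Sop z b c w" z a x] Sop_loops[OF z w] by (simp add: u(1))
qed

lemma resolvent_sum:
  assumes z: "z \<in> loops UNIV" "\<And>x. z x - e \<in> Fil 0" and y: "\<And>i. i \<in> I \<Longrightarrow> y i \<in> loops UNIV"
  shows "resolvent z (\<lambda>x. \<Sum>i\<in>I. y i x) = (\<lambda>x. \<Sum>i\<in>I. resolvent z (y i) x)"
proof (rule resolvent_unique[OF z loops_sum[OF y], symmetric])
  have L: "resolvent z (y i) \<in> loops UNIV" if "i \<in> I" for i by (rule geometric_loops[OF z(1) y[OF that]])
  then show "(\<lambda>x. \<Sum>i\<in>I. resolvent z (y i) x) \<in> loops UNIV" by (rule loops_sum)
  have "perturbation z (\<lambda>x. \<Sum>i\<in>I. resolvent z (y i) x) x = (\<Sum>i\<in>I. perturbation z (resolvent z (y i)) x)" for x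
    using L
  proof (induction I rule: infinite_finite_induct)
    case (insert i I)
    then show ?case using perturbation_add[of "resolvent z (y i)" "\<lambda>x. \<Sum>i\<in>I. resolvent z (y i) x" z]
      by (simp add: loops_sum)
  qed (simp_all add: perturbation_zero)
  then show "(\<Sum>i\<in>I. resolvent z (y i) x) + perturbation z (\<lambda>x. \<Sum>i\<in>I. resolvent z (y i) x) x = (\<Sum>i\<in>I. y i x)" for x
    using resolvent_solves[OF z y] by (simp add: sum.distrib[symmetric])
qed

text \<open>\<open>w \<eta> c\<close> takes values in \<open>[f, g]\<close>, so it is the resolvent
  of \<open>R (P2 z (w \<eta> c))\<close>. In the expansion of the latter \<open>R\<close> kills the
  basis vectors in \<open>Iq\<close>.\<close>

lemma Sop_Fop:
  assumes z: "z \<in> Q_space br e f" and w: "w \<in> test_functions" and a: "a \<notin> Iq" and c: "c \<notin> Iq"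
  shows "(\<Sum>b\<in>- Iq. Sop z a b (Fop z b c w) x) = (if a = c then w x else 0)"
proof -
  have zL: "z \<in> loops UNIV" "\<And>x. z x - e \<in> Fil 0" using Q_Fil[OF z] by auto
  let ?u = "\<lambda>x. w x *s \<eta> c"
  let ?y = "\<lambda>b x. Fop z b c w x *s R (\<xi> b)"
  have uL: "?u \<in> loops UNIV" by (rule loops_smult[OF w loops_const])
  have uR: "?u x \<in> range (br f)" for x by (rule vec.subspace_scale[OF range_f_subspace dual_range[OF c]])
  have yL: "?y b \<in> loops UNIV" for b by (rule loops_smult[OF Fop_loops[OF zL(1) w] loops_const])
  have "?u = resolvent z (\<lambda>x. \<Sum>b\<in>- Iq. ?y b x)"
  proof (rule resolvent_unique[OF zL loops_sum[OF yL] uL])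
    fix x
    have "(\<Sum>b\<in>- Iq. ?y b x) = R (\<Sum>b\<in>- Iq. K (P2 br z ?u x) (\<eta> b) *s \<xi> b)"
      by (simp add: clin_setsum[OF R_linear] clin_scale[OF R_linear] Fop_def killing_sym[of "\<eta> _"])
    also have "\<dots> = R (\<Sum>b\<in>UNIV. K (P2 br z ?u x) (\<eta> b) *s \<xi> b)"
    proof -
      have "R (\<xi> b) = 0" if "b \<in> Iq" for b
        using that vec.span_base[of "\<xi> b" "\<xi> ` Iq"] by (auto simp: basis ker_ad_def R_eq_0_iff)
      then show ?thesis
        unfolding clin_setsum[OF R_linear] clin_scale[OF R_linear] by (intro sum.mono_neutral_left) auto
    qed
    also have "\<dots> = ?u x + perturbation z ?u x" unfolding expand by (rule R_P2[OF uR])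
    finally show "?u x + perturbation z ?u x = (\<Sum>b\<in>- Iq. ?y b x)" by simp
  qed
  then have "K (\<xi> a) (w x *s \<eta> c) = K (\<xi> a) (\<Sum>b\<in>- Iq. resolvent z (?y b) x)"
    unfolding resolvent_sum[OF zL yL] by (simp add: fun_eq_iff)
  then have "(\<Sum>b\<in>- Iq. Sop z a b (Fop z b c w) x) = w x * (if a = c then 1 else 0)"
    by (simp only: killing_sum Sop_def killing_scale basis)
  then show ?thesis by simp
qed

lemma inverse_minor_exists:
  assumes FF: "represents_bracket2 br e \<eta> FF" shows "\<exists>SS. inverse_minor br e f \<eta> Iq FF SS"
proof -
  have "\<exists>A\<in>diff_ops. \<forall>c'\<in>loops UNIV. \<forall>w\<in>test_functions. \<forall>x. op_fun A c' w x = Sop (decode c') b c w x" for b c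
    using vector_diff_op_functional[OF killing_functional_component[of b "\<xi> b"]
        vector_diff_op_geometric[where k = depth, OF vector_diff_op_scalar[of "R (\<xi> c)"]], where i = b]
    by (simp add: Sop_def axis_def)
  then obtain SS where SS: "\<And>b c. SS b c \<in> diff_ops"
    "\<And>b c c' w x. c' \<in> loops UNIV \<Longrightarrow> w \<in> test_functions \<Longrightarrow> op_fun (SS b c) c' w x = Sop (decode c') b c w x"
    by metis
  have SS': "op_fun (SS b c) (co z) w = Sop z b c w" if "z \<in> loops UNIV" "w \<in> test_functions" for b c z w
    using SS(2)[OF coords_loops[OF that(1)] that(2)] by (auto simp: decode_coords)
  have "inverse_minor br e f \<eta> Iq FF SS"
    unfolding inverse_minor_def
  proof (intro conjI ballI allI SS(1))
    fix z a c w x assume z: "z \<in> Q_space br e f" and a: "a \<in> - Iq" and c: "c \<in> - Iq" and w: "w \<in> test_functions"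
    have zL: "z \<in> loops UNIV" using z by (simp add: Q_iff)
    show "(\<Sum>b\<in>- Iq. op_fun (FF a b) (co z) (op_fun (SS b c) (co z) w) x) = (if a = c then w x else 0)"
      using Fop_Sop[OF z w, of a c x] a by (simp add: SS'[OF zL w] represents_op_fun[OF FF zL Sop_loops[OF z w]])
    show "(\<Sum>b\<in>- Iq. op_fun (SS a b) (co z) (op_fun (FF b c) (co z) w) x) = (if a = c then w x else 0)"
      using Sop_Fop[OF z w, of a c x] a c by (simp add: represents_op_fun[OF FF zL w] SS'[OF zL Fop_loops[OF zL w]])
  qed
  then show ?thesis by blast
qed

text \<open>Adding multiples of \<open>\<eta> a\<close> with \<open>a\<close> outside
  \<open>Iq\<close> leaves the covector on \<open>Q\<close> unchanged, since these annihilate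
  \<open>ker (ad f)\<close>. The coefficients \<open>- u\<close> cancel the components of the
  Poisson vector transverse to \<open>Q\<close>, because \<open>SS\<close> is a right inverse of the
  minor.\<close>

lemma dirac_lift:
  fixes j
  assumes FF: "represents_bracket2 br e \<eta> FF" and SS: "inverse_minor br e f \<eta> Iq FF SS"
    and z: "z \<in> Q_space br e f" and \<beta>: "\<beta> \<in> test_functions"
  defines "u \<equiv> (\<lambda>a x. \<Sum>b\<in>- Iq. op_fun (SS a b) (co z) (op_fun (FF b j) (co z) \<beta>) x)"
  shows "covector_lift br f z (\<lambda>x. \<beta> x *s \<eta> j) (\<lambda>x. \<beta> x *s \<eta> j + (\<Sum>a\<in>- Iq. (- u a x) *s \<eta> a))"
    and "a \<in> - Iq \<Longrightarrow> u a \<in> test_functions"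
proof -
  have zL: "z \<in> loops UNIV" using z by (simp add: Q_iff)
  note cL = coords_loops[OF zL]
  have FD: "FF i j \<in> diff_ops" for i j using FF by (simp add: represents_bracket2_def)
  have SD: "SS a b \<in> diff_ops" if "a \<in> - Iq" "b \<in> - Iq" for a b using SS that by (simp add: inverse_minor_def)
  note FL = op_fun_loops[OF FD cL \<beta>]
  have SL: "op_fun (SS a b) (co z) (op_fun (FF b j) (co z) \<beta>) \<in> test_functions" if "a \<in> - Iq" "b \<in> - Iq" for a b
    by (rule op_fun_loops[OF SD[OF that] cL FL])
  show uL: "u a \<in> test_functions" if "a \<in> - Iq" for a
    unfolding u_def using SL[OF that] by (rule loops_sum)
  let ?b = "\<lambda>x. \<beta> x *s \<eta> j" and ?n = "\<lambda>x. \<Sum>a\<in>- Iq. (- u a x) *s \<eta> a"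
  have bL: "?b \<in> loops UNIV" by (rule loops_smult[OF \<beta> loops_const])
  have nL: "?n \<in> loops UNIV" by (intro loops_sum loops_smult loops_minus uL loops_const)
  have nK: "K (?n x) t = 0" if "br f t = 0" for x t
    using that unfolding killing_sum kernel_iff by (intro sum.neutral) (simp add: killing_sym[of "\<eta> _"])
  have op_sum: "op_fun A (co z) (\<lambda>x. \<Sum>b\<in>I. g b x) x = (\<Sum>b\<in>I. op_fun A (co z) (g b) x)"
    if "\<And>b. b \<in> I \<Longrightarrow> g b \<in> test_functions" for A I g x
  proof -
    have "nderiv k (\<lambda>x. \<Sum>b\<in>I. g b x) = (\<lambda>x. \<Sum>b\<in>I. nderiv k (g b) x)" for k
      by (rule nderiv_sum) (rule loops_smooth[OF that])
    then show ?thesis unfolding op_fun_def by (simp only: sum_distrib_left) (rule sum.swap)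
  qed
  have cancel: "(\<Sum>a\<in>- Iq. Fop z c a (u a) x) = Fop z c j \<beta> x" if c: "c \<in> - Iq" for c x
  proof -
    have "(\<Sum>a\<in>- Iq. Fop z c a (u a) x) = (\<Sum>a\<in>- Iq. op_fun (FF c a) (co z) (u a) x)"
      using uL by (intro sum.cong refl) (simp add: represents_op_fun[OF FF zL])
    also have "\<dots> = (\<Sum>a\<in>- Iq. \<Sum>b\<in>- Iq. op_fun (FF c a) (co z) (op_fun (SS a b) (co z) (op_fun (FF b j) (co z) \<beta>)) x)"
      unfolding u_def using SL by (intro sum.cong refl op_sum)
    also have "\<dots> = (\<Sum>b\<in>- Iq. \<Sum>a\<in>- Iq. op_fun (FF c a) (co z) (op_fun (SS a b) (co z) (op_fun (FF b j) (co z) \<beta>)) x)"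
      by (rule sum.swap)
    also have "\<dots> = (\<Sum>b\<in>- Iq. if c = b then op_fun (FF b j) (co z) \<beta> x else 0)"
      using SS z c FL by (intro sum.cong refl) (auto simp: inverse_minor_def)
    also have "\<dots> = op_fun (FF c j) (co z) \<beta> x" using c by simp
    finally show ?thesis by (simp add: represents_op_fun[OF FF zL \<beta>])
  qed
  show "covector_lift br f z ?b (\<lambda>x. ?b x + ?n x)"
    unfolding covector_lift_def
  proof (intro conjI ballI)
    show vL: "(\<lambda>x. ?b x + ?n x) \<in> loops UNIV" by (rule loops_add[OF bL nL])
    fix t assume t: "t \<in> loops (ker_ad br f)"
    have "pairing br ?n t = 0" using nK loops_value[OF t] by (simp add: pairing_def ker_ad_def)
    then show "pairing br (\<lambda>x. ?b x + ?n x) t = pairing br ?b t"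
      using pairing_add[OF loops_UNIV_I[OF t] bL nL] by (simp add: pairing_sym)
  next
    show "P2 br z (\<lambda>x. ?b x + ?n x) \<in> loops (ker_ad br f)"
    proof (rule loops_valueI[OF P2_loops[OF zL loops_add[OF bL nL]]])
      fix x
      have "K (P2 br z (\<lambda>x. ?b x + ?n x) x) (\<eta> c) = 0" if c: "c \<notin> Iq" for c
      proof -
        have neg: "Fop z c a (\<lambda>x. - u a x) x = - Fop z c a (u a) x" if "a \<in> - Iq" for a
        proof -
          have "vderiv (\<lambda>x. (- u a x) *s \<eta> a) x = - vderiv (\<lambda>x. u a x *s \<eta> a) x"
            using fun_cong[OF vderiv_clin[OF _ loops_smult[OF uL[OF that] loops_const], of "\<lambda>y. - y"], of "\<eta> a" x]
            by (simp add: clin_iff)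
          then show ?thesis by (simp add: Fop_def P2_def killing_add killing_diff killing_neg)
        qed
        have "K (\<eta> c) (P2 br z ?n x) = (\<Sum>a\<in>- Iq. Fop z c a (\<lambda>x. - u a x) x)"
          using uL by (intro Fop_sum[symmetric] loops_minus)
        also have "\<dots> = - Fop z c j \<beta> x" using cancel[of c x] c neg by (simp add: sum_negf)
        finally show ?thesis
          using P2_add[OF bL nL, of z] by (simp add: killing_add Fop_def killing_sym[of _ "\<eta> c"])
      qed
      then show "P2 br z (\<lambda>x. ?b x + ?n x) x \<in> ker_ad br f" by (simp add: ker_ad_def kernel_iff)
    qed
  qed
qed

lemma smeared_coordinate_local:
  assumes \<alpha>: "\<alpha> \<in> test_functions"
  shows "smeared br e \<eta> (coordinate i) \<alpha> \<in> local_functionals_on (Q_space br e f)"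
    and "z \<in> Q_space br e f \<Longrightarrow> has_differential br (ker_ad br f) (smeared br e \<eta> (coordinate i) \<alpha>) z (\<lambda>x. \<alpha> x *s \<eta> i)"
proof -
  obtain p where p: "represented_by (smeared br e \<eta> (coordinate i) \<alpha>) p"
    using smeared_represented[OF coordinate_diff_poly \<alpha>] by blast
  then have "(\<lambda>q. integral {0..1} (\<lambda>x. p x (jet q x))) \<in> local_functionals"
    by (auto simp: represented_by_def local_functionals_def)
  moreover have "smeared br e \<eta> (coordinate i) \<alpha> z = integral {0..1} (\<lambda>x. p x (jet z x))" if "z \<in> Q_space br e f" for z
    using p that by (auto simp: represented_by_def density_functional_def Q_iff)
  ultimately show "smeared br e \<eta> (coordinate i) \<alpha> \<in> local_functionals_on (Q_space br e f)"
    by (auto simp: local_functionals_on_def)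
  show "has_differential br (ker_ad br f) (smeared br e \<eta> (coordinate i) \<alpha>) z (\<lambda>x. \<alpha> x *s \<eta> i)"
    if z: "z \<in> Q_space br e f"
    using differential_on_Q[OF p refl z] gradient_coordinate[OF \<alpha>, of z i] z by (simp add: Q_iff)
qed

text \<open>\<open>Bk\<close> enters only through the Poisson tensor formula for the two smeared
  coordinates; evaluated on the lift of \<open>dirac_lift\<close>, this formula is the Dirac
  formula, for any inverse of the minor.\<close>

lemma dirac_formula:
  assumes FF: "represents_bracket2 br e \<eta> FF" and SS: "inverse_minor br e f \<eta> Iq FF SS"
    and z: "z \<in> Q_space br e f" and \<alpha>: "\<alpha> \<in> test_functions" and \<beta>: "\<beta> \<in> test_functions"
    and Bk: "\<And>w w' v. has_differential br (ker_ad br f) (smeared br e \<eta> (coordinate i) \<alpha>) z w \<Longrightarrow>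
      has_differential br (ker_ad br f) (smeared br e \<eta> (coordinate j) \<beta>) z w' \<Longrightarrow> covector_lift br f z w' v \<Longrightarrow>
      Bk (smeared br e \<eta> (coordinate i) \<alpha>) (smeared br e \<eta> (coordinate j) \<beta>) z = pairing br w (P2 br z v)"
  shows "density_bracket br e \<eta> Bk z (coordinate i) (coordinate j) \<alpha> \<beta> =
    op_dist (FF i j) (co z) delta \<alpha> \<beta> -
    (\<Sum>a\<in>- Iq. \<Sum>b\<in>- Iq. op_dist (FF i a) (co z) (op_dist (SS a b) (co z) (op_dist (FF b j) (co z) delta)) \<alpha> \<beta>)"
proof -
  have zL: "z \<in> loops UNIV" using z by (simp add: Q_iff)
  note cL = coords_loops[OF zL]
  have FD: "FF i j \<in> diff_ops" for i j using FF by (simp add: represents_bracket2_def)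
  have SD: "SS a b \<in> diff_ops" if "a \<in> - Iq" "b \<in> - Iq" for a b using SS that by (simp add: inverse_minor_def)
  define u where "u = (\<lambda>a x. \<Sum>b\<in>- Iq. op_fun (SS a b) (co z) (op_fun (FF b j) (co z) \<beta>) x)"
  have lift: "covector_lift br f z (\<lambda>x. \<beta> x *s \<eta> j) (\<lambda>x. \<beta> x *s \<eta> j + (\<Sum>a\<in>- Iq. (- u a x) *s \<eta> a))"
    unfolding u_def by (rule dirac_lift(1)[OF FF SS z \<beta>])
  have uL: "u a \<in> test_functions" if "a \<in> - Iq" for a
    unfolding u_def by (rule dirac_lift(2)[OF FF SS z \<beta> that])
  have d: "op_dist (FF b j) (co z) delta \<alpha> \<beta> = integral {0..1} (\<lambda>x. \<alpha> x * op_fun (FF b j) (co z) \<beta> x)"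
    if "\<alpha> \<in> test_functions" for b \<alpha>
    by (rule op_dist_eq[OF FD cL \<beta> that]) (simp add: delta_def)
  have d2: "op_dist (SS a b) (co z) (op_dist (FF b j) (co z) delta) \<alpha> \<beta> =
      integral {0..1} (\<lambda>x. \<alpha> x * op_fun (SS a b) (co z) (op_fun (FF b j) (co z) \<beta>) x)"
    if "a \<in> - Iq" "b \<in> - Iq" "\<alpha> \<in> test_functions" for a b \<alpha>
  proof (rule op_dist_eq[OF SD[OF that(1,2)] cL op_fun_loops[OF FD cL \<beta>] that(3)])
    show "op_dist (FF b j) (co z) delta \<gamma> \<beta> = integral {0..1} (\<lambda>x. \<gamma> x * op_fun (FF b j) (co z) \<beta> x)"
      if "\<gamma> \<in> test_functions" for \<gamma> using that by (rule d)
  qed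
  have SL: "op_fun (SS a b) (co z) (op_fun (FF b j) (co z) \<beta>) \<in> test_functions" if "a \<in> - Iq" "b \<in> - Iq" for a b
    by (rule op_fun_loops[OF SD[OF that] cL op_fun_loops[OF FD cL \<beta>]])
  have d3: "op_dist (FF i a) (co z) (op_dist (SS a b) (co z) (op_dist (FF b j) (co z) delta)) \<alpha> \<beta> =
      integral {0..1} (\<lambda>x. \<alpha> x * Fop z i a (op_fun (SS a b) (co z) (op_fun (FF b j) (co z) \<beta>)) x)"
    if "a \<in> - Iq" "b \<in> - Iq" for a b
    unfolding represents_op_fun[OF FF zL SL[OF that], symmetric]
  proof (rule op_dist_eq[OF FD cL SL[OF that] \<alpha>])
    note ab = that
    show "op_dist (SS a b) (co z) (op_dist (FF b j) (co z) delta) \<gamma> \<beta> =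
        integral {0..1} (\<lambda>x. \<gamma> x * op_fun (SS a b) (co z) (op_fun (FF b j) (co z) \<beta>) x)"
      if "\<gamma> \<in> test_functions" for \<gamma> by (rule d2[OF ab that])
  qed
  let ?g = "\<lambda>a b. op_fun (SS a b) (co z) (op_fun (FF b j) (co z) \<beta>)"
  have GL: "(\<lambda>x. \<alpha> x * Fop z i a (?g a b) x) \<in> test_functions" if "a \<in> - Iq" "b \<in> - Iq" for a b
    by (rule loops_mult[OF \<alpha> Fop_loops[OF zL SL[OF that]]])
  have Fs: "(\<Sum>b\<in>- Iq. Fop z i a (?g a b) x) = Fop z i a (u a) x" if a: "a \<in> - Iq" for a x
  proof -
    have "(\<lambda>x. u a x *s \<eta> a) = (\<lambda>x. \<Sum>b\<in>- Iq. ?g a b x *s \<eta> a)" by (simp add: u_def vec.scale_sum_left)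
    then show ?thesis
      using fun_cong[OF P2_sum[of "- Iq" "\<lambda>b x. ?g a b x *s \<eta> a" z, OF loops_smult[OF SL[OF a] loops_const]], of x]
      by (simp add: Fop_def killing_sum)
  qed
  have AL: "(\<lambda>x. \<alpha> x * Fop z i a (u a) x) \<in> test_functions" if "a \<in> - Iq" for a
    by (rule loops_mult[OF \<alpha> Fop_loops[OF zL uL[OF that]]])
  have second: "(\<Sum>a\<in>- Iq. \<Sum>b\<in>- Iq. op_dist (FF i a) (co z) (op_dist (SS a b) (co z) (op_dist (FF b j) (co z) delta)) \<alpha> \<beta>)
      = integral {0..1} (\<lambda>x. \<Sum>a\<in>- Iq. \<alpha> x * Fop z i a (u a) x)"
  proof -
    have "(\<Sum>b\<in>- Iq. op_dist (FF i a) (co z) (op_dist (SS a b) (co z) (op_dist (FF b j) (co z) delta)) \<alpha> \<beta>)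
        = integral {0..1} (\<lambda>x. \<alpha> x * Fop z i a (u a) x)" if a: "a \<in> - Iq" for a
    proof -
      have "(\<Sum>b\<in>- Iq. op_dist (FF i a) (co z) (op_dist (SS a b) (co z) (op_dist (FF b j) (co z) delta)) \<alpha> \<beta>)
          = (\<Sum>b\<in>- Iq. integral {0..1} (\<lambda>x. \<alpha> x * Fop z i a (?g a b) x))"
        by (intro sum.cong refl d3 a)
      also have "\<dots> = integral {0..1} (\<lambda>x. \<Sum>b\<in>- Iq. \<alpha> x * Fop z i a (?g a b) x)"
        by (intro integral_sum[symmetric] loop_integrable[OF GL[OF a]]) simp
      finally show ?thesis by (simp only: sum_distrib_left[symmetric] Fs[OF a])
    qed
    then have "(\<Sum>a\<in>- Iq. \<Sum>b\<in>- Iq. op_dist (FF i a) (co z) (op_dist (SS a b) (co z) (op_dist (FF b j) (co z) delta)) \<alpha> \<beta>)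
        = (\<Sum>a\<in>- Iq. integral {0..1} (\<lambda>x. \<alpha> x * Fop z i a (u a) x))"
      by (intro sum.cong refl)
    also have "\<dots> = integral {0..1} (\<lambda>x. \<Sum>a\<in>- Iq. \<alpha> x * Fop z i a (u a) x)"
      by (intro integral_sum[symmetric] loop_integrable[OF AL]) simp
    finally show ?thesis .
  qed
  let ?b = "\<lambda>x. \<beta> x *s \<eta> j" and ?n = "\<lambda>x. \<Sum>a\<in>- Iq. u a x *s \<eta> a"
  have bL: "?b \<in> loops UNIV" by (rule loops_smult[OF \<beta> loops_const])
  have nL: "?n \<in> loops UNIV" by (intro loops_sum loops_smult uL loops_const)
  have b': "?b = (\<lambda>x. (?b x + (\<Sum>a\<in>- Iq. (- u a x) *s \<eta> a)) + ?n x)"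
    by (simp add: sum_negf)
  have vL: "(\<lambda>x. ?b x + (\<Sum>a\<in>- Iq. (- u a x) *s \<eta> a)) \<in> loops UNIV"
    using lift by (simp add: covector_lift_def)
  have P: "P2 br z ?b x = P2 br z (\<lambda>x. ?b x + (\<Sum>a\<in>- Iq. (- u a x) *s \<eta> a)) x + P2 br z ?n x" for x
    using fun_cong[OF P2_add[OF vL nL, of z], of x] by (simp add: sum_negf)
  have K': "K (\<eta> i) (P2 br z (\<lambda>x. ?b x + (\<Sum>a\<in>- Iq. (- u a x) *s \<eta> a)) x) =
      Fop z i j \<beta> x - (\<Sum>a\<in>- Iq. Fop z i a (u a) x)" for x
    using P[of x] Fop_sum[of "- Iq" u z i x] uL by (simp add: Fop_def killing_add)
  have "density_bracket br e \<eta> Bk z (coordinate i) (coordinate j) \<alpha> \<beta> =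
      pairing br (\<lambda>x. \<alpha> x *s \<eta> i) (P2 br z (\<lambda>x. ?b x + (\<Sum>a\<in>- Iq. (- u a x) *s \<eta> a)))"
    unfolding density_bracket_def
    by (rule Bk[OF smeared_coordinate_local(2)[OF \<alpha> z] smeared_coordinate_local(2)[OF \<beta> z] lift])
  also have "\<dots> = integral {0..1} (\<lambda>x. \<alpha> x * Fop z i j \<beta> x - (\<Sum>a\<in>- Iq. \<alpha> x * Fop z i a (u a) x))"
    by (simp only: pairing_def killing_scale K' right_diff_distrib sum_distrib_left)
  also have "\<dots> = integral {0..1} (\<lambda>x. \<alpha> x * Fop z i j \<beta> x) - integral {0..1} (\<lambda>x. \<Sum>a\<in>- Iq. \<alpha> x * Fop z i a (u a) x)"
    by (intro integral_diff loop_integrable[where V = UNIV] loops_sum AL loops_mult[OF \<alpha> Fop_loops[OF zL \<beta>]])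
  finally show ?thesis
    unfolding second d[OF \<alpha>] by (simp only: represents_op_fun[OF FF zL \<beta>])
qed

end

section \<open>Lagrangian subspaces and assembly of the results\<close>

context good_data
begin

text \<open>An isotropic subspace of maximal dimension. A vector \<open>y\<close> of the complement
  outside \<open>l\<close> could be adjoined: its pairings with \<open>l\<close> vanish, and the
  pairing with itself vanishes because the bracket is alternating.\<close>

lemma lagrangian_exists: "\<exists>l. lagrangian br e \<Gamma> l"
proof -
  define I where "I = (\<lambda>l. isotropic br e \<Gamma> l)"
  have "I {0}" using vec.subspace_0[OF grad.subspace] by (auto simp: I_def isotropic_def)
  moreover have "\<forall>l. I l \<longrightarrow> vec.dim l < Suc CARD('n)" by (simp add: less_Suc_eq_le dim_subset_UNIV_cart_gen)
  ultimately have "\<exists>l. I l \<and> (\<forall>l'. I l' \<longrightarrow> vec.dim l' \<le> vec.dim l)" by (rule ex_has_greatest_nat)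
  then obtain l where max: "I l" "\<And>l'. I l' \<Longrightarrow> vec.dim l' \<le> vec.dim l" by blast
  interpret isotropic_data br e h f \<Gamma> l using max(1) by unfold_locales (simp add: I_def)
  have "y \<in> l" if y: "y \<in> l'" for y
  proof (rule ccontr)
    assume "y \<notin> l"
    define L where "L = {a + c *s y | a c. a \<in> l}"
    have "vec.subspace L"
      using vec.subspace_sums[OF max(1)[unfolded I_def isotropic_def, THEN conjunct1] vec.subspace_span[of "{y}"]]
      by (simp add: L_def vec.span_singleton) (smt (verit) Collect_cong UNIV_I image_iff)
    moreover have "L \<subseteq> \<Gamma> (- 1)"
      using isotropic_data.l(2)[OF isotropic_data_axioms] y l'_sub grad.subspace
      by (auto simp: L_def intro!: vec.subspace_add vec.subspace_scale)
    moreover have "K e (br u v) = 0" if uv: "u \<in> L" "v \<in> L" for u v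
    proof -
      obtain a c b d where *: "u = a + c *s y" "v = b + d *s y" "a \<in> l" "b \<in> l" using uv by (auto simp: L_def)
      have "K e (br a b) = 0" using * isotropic_data.l(3)[OF isotropic_data_axioms] by blast
      moreover have "K e (br y a) = 0" "K e (br y b) = 0" using y * by (auto simp: symplectic_complement_def)
      ultimately show ?thesis using br_anticommute[of a y] by (simp add: * br_add killing_add killing_diff)
    qed
    ultimately have "I L" by (simp add: I_def isotropic_def)
    then have "vec.dim L \<le> vec.dim l" by (rule max(2))
    moreover have "l \<subset> L"
    proof
      show "l \<subseteq> L" unfolding L_def by (force intro: exI[of _ 0])
      have "y \<in> L" unfolding L_def
        using vec.subspace_0[OF isotropic_data.l(1)[OF isotropic_data_axioms]] by (force intro: exI[of _ 1])
      then show "l \<noteq> L" using \<open>y \<notin> l\<close> by blast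
    qed
    ultimately show False
      using vec.dim_psubset[of l L] \<open>vec.subspace L\<close> isotropic_data.l(1)[OF isotropic_data_axioms]
      by (simp add: vec.span_eq_iff[THEN iffD2])
  qed
  then have "l' = l" using l_l' by blast
  then show ?thesis using iso unfolding lagrangian_def by blast
qed

end

context simple_sl2
begin

lemma lagrangian_isotropic_data:
  assumes "lagrangian br e (dynkin_grading br h) l"
  shows "isotropic_data br e h f (dynkin_grading br h) l"
  by (intro isotropic_data.intro good_data.intro simple_sl2_axioms good_data_axioms.intro
      isotropic_data_axioms.intro dynkin_good dynkin_compatible) (use assms in \<open>simp add: lagrangian_def\<close>)

text \<open>Existence makes the subspace chosen by \<open>SOME\<close> a genuine Lagrangian one;
  which one it is does not affect the values computed by \<open>reduced_bracket_eq\<close>.\<close>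

lemma classical_isotropic_data:
  "isotropic_data br e h f (dynkin_grading br h) (SOME l. lagrangian br e (dynkin_grading br h) l)"
proof -
  interpret good_data br e h f "dynkin_grading br h"
    by unfold_locales (rule dynkin_good, rule dynkin_compatible)
  show ?thesis by (rule lagrangian_isotropic_data[OF someI_ex[OF lagrangian_exists]])
qed

lemmas classical_W_bracket_eq =
  isotropic_data.reduced_bracket_eq[OF classical_isotropic_data, folded classical_W_bracket_def]

end

context isotropic_data
begin

text \<open>One covector lift evaluates both brackets, once with the data \<open>\<Gamma>\<close>,
  \<open>l\<close> and once with the Dynkin grading and the chosen Lagrangian subspace.\<close>

lemma reduced_bracket_independent:
  assumes \<phi>: "\<phi> \<in> local_functionals_on (Q_space br e f)" and \<psi>: "\<psi> \<in> local_functionals_on (Q_space br e f)"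
    and z: "z \<in> Q_space br e f"
  shows "reduced_bracket br e f \<Gamma> l \<phi> \<psi> z = classical_W_bracket br e h f \<phi> \<psi> z"
proof -
  obtain w w' where w: "has_differential br (ker_ad br f) \<phi> z w" "has_differential br (ker_ad br f) \<psi> z w'"
    using differential_exists[OF \<phi> z] differential_exists[OF \<psi> z] by blast
  then have "w' \<in> loops UNIV" by (simp add: has_differential_def)
  then obtain v where v: "covector_lift br f z w' v" using covector_lift_exists_unique[OF z] by blast
  show ?thesis unfolding reduced_bracket_eq[OF \<phi> \<psi> z w v] by (rule classical_W_bracket_eq[OF \<phi> \<psi> z w v, symmetric])
qed

lemma poisson_tensor_procedure:
  "poisson_tensor_procedure_computes br e f (reduced_bracket br e f \<Gamma> l)"
  unfolding poisson_tensor_procedure_computes_def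
proof (intro conjI ballI allI impI)
  fix \<phi> \<psi> z w w' v
  assume "\<phi> \<in> local_functionals_on (Q_space br e f)" "\<psi> \<in> local_functionals_on (Q_space br e f)" "z \<in> Q_space br e f"
    "has_differential br (ker_ad br f) \<phi> z w" "has_differential br (ker_ad br f) \<psi> z w'" "covector_lift br f z w' v"
  then show "reduced_bracket br e f \<Gamma> l \<phi> \<psi> z = pairing br w (P2 br z v)" by (rule reduced_bracket_eq)
qed (rule covector_lift_exists_unique differential_exists, assumption+)+

lemma dirac_formula_classical: "dirac_formula_computes br e f \<Gamma> (classical_W_bracket br e h f)"
  unfolding dirac_formula_computes_def
proof (intro allI impI, elim conjE)
  fix \<xi> \<eta> :: "'a \<Rightarrow> complex ^ 'a" and Iq assume adapted: "adapted_basis br f \<xi> \<eta> Iq"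
  interpret A: adapted_slice br e f R Fil depth \<xi> \<eta> Iq by unfold_locales (rule adapted)
  have "density_bracket br e \<eta> (classical_W_bracket br e h f) z (coordinate i) (coordinate j) \<alpha> \<beta> =
      op_dist (FF i j) (A.co z) delta \<alpha> \<beta> -
      (\<Sum>a\<in>- Iq. \<Sum>b\<in>- Iq. op_dist (FF i a) (A.co z) (op_dist (SS a b) (A.co z) (op_dist (FF b j) (A.co z) delta)) \<alpha> \<beta>)"
    if FF: "represents_bracket2 br e \<eta> FF" and SS: "inverse_minor br e f \<eta> Iq FF SS" and z: "z \<in> Q_space br e f"
      and \<alpha>: "\<alpha> \<in> test_functions" and \<beta>: "\<beta> \<in> test_functions" for FF SS i j z \<alpha> \<beta>
  proof (rule A.dirac_formula[OF FF SS z \<alpha> \<beta>])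
    fix w w' v assume "has_differential br (ker_ad br f) (smeared br e \<eta> (coordinate i) \<alpha>) z w"
      "has_differential br (ker_ad br f) (smeared br e \<eta> (coordinate j) \<beta>) z w'" "covector_lift br f z w' v"
    from classical_W_bracket_eq[OF A.smeared_coordinate_local(1)[OF \<alpha>] A.smeared_coordinate_local(1)[OF \<beta>] z this]
    show "classical_W_bracket br e h f (smeared br e \<eta> (coordinate i) \<alpha>) (smeared br e \<eta> (coordinate j) \<beta>) z =
      pairing br w (P2 br z v)" .
  qed
  then show "(\<exists>FF. represents_bracket2 br e \<eta> FF) \<and>
      (\<forall>FF. represents_bracket2 br e \<eta> FF \<longrightarrow>
         (\<exists>SS. inverse_minor br e f \<eta> Iq FF SS) \<and>
         (\<forall>SS. inverse_minor br e f \<eta> Iq FF SS \<longrightarrow>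
            (\<forall>i\<in>Iq. \<forall>j\<in>Iq. \<forall>z\<in>Q_space br e f. \<forall>\<alpha>\<in>test_functions. \<forall>\<beta>\<in>test_functions.
               density_bracket br e \<eta> (classical_W_bracket br e h f) z (coordinate i) (coordinate j) \<alpha> \<beta> =
               op_dist (FF i j) (A.co z) delta \<alpha> \<beta> -
               (\<Sum>a\<in>- Iq. \<Sum>b\<in>- Iq.
                  op_dist (FF i a) (A.co z) (op_dist (SS a b) (A.co z) (op_dist (FF b j) (A.co z) delta)) \<alpha> \<beta>))))"
    using A.represents_exists A.inverse_minor_exists by (intro conjI allI impI ballI) blast+
qed

end

theorem theorem3p11:
  fixes br :: "complex ^ 'n::finite \<Rightarrow> complex ^ 'n \<Rightarrow> complex ^ 'n"
    and e h f :: "complex ^ 'n"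
  assumes "simple_lie_algebra br"
    and "ad_nilpotent br f"
    and "sl2_triple br e h f"
  shows "(\<forall>\<Gamma> l. good_grading br f \<Gamma> \<and> compatible_grading e h \<Gamma> \<and> isotropic br e \<Gamma> l \<longrightarrow>
            reduction_well_defined br e f \<Gamma> l \<and>
            (\<forall>\<phi>\<in>local_functionals_on (Q_space br e f). \<forall>\<psi>\<in>local_functionals_on (Q_space br e f).
               \<forall>z\<in>Q_space br e f.
                 reduced_bracket br e f \<Gamma> l \<phi> \<psi> z = classical_W_bracket br e h f \<phi> \<psi> z) \<and>
            drinfeld_sokolov_computes br e f \<Gamma> l (classical_W_bracket br e h f) \<and>
            dirac_formula_computes br e f \<Gamma> (classical_W_bracket br e h f)) \<and>
         poisson_tensor_procedure_computes br e f (classical_W_bracket br e h f)"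
proof (intro conjI allI impI ballI)
  interpret simple_sl2 br e h f
    using assms by unfold_locales (auto simp: simple_lie_algebra_def)
  show "poisson_tensor_procedure_computes br e f (classical_W_bracket br e h f)"
    unfolding classical_W_bracket_def by (rule isotropic_data.poisson_tensor_procedure[OF classical_isotropic_data])
  fix \<Gamma> l assume data: "good_grading br f \<Gamma> \<and> compatible_grading e h \<Gamma> \<and> isotropic br e \<Gamma> l"
  interpret isotropic_data br e h f \<Gamma> l using data by unfold_locales auto
  show "reduction_well_defined br e f \<Gamma> l" by (rule reduction_well_defined)
  show "drinfeld_sokolov_computes br e f \<Gamma> l (classical_W_bracket br e h f)"
    by (rule drinfeld_sokolov) (rule reduced_bracket_independent[symmetric])
  show "dirac_formula_computes br e f \<Gamma> (classical_W_bracket br e h f)" by (rule dirac_formula_classical)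
  show "reduced_bracket br e f \<Gamma> l \<phi> \<psi> z = classical_W_bracket br e h f \<phi> \<psi> z"
    if "\<phi> \<in> local_functionals_on (Q_space br e f)" "\<psi> \<in> local_functionals_on (Q_space br e f)"
      "z \<in> Q_space br e f" for \<phi> \<psi> z using that by (rule reduced_bracket_independent)
qed

end
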